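(* Let $\sigma_0:\mathbb R\times\mathcal P_2(\mathbb R)\to\mathbb R$ satisfy the regularity assumption (R) of the context. Consider the two problems for an unknown $\psi:\mathbb R\times\mathcal P_2(\mathbb R)\times\mathbb R\to\mathbb R$: $$\text{(1)}\quad\partial_m\psi(x,\mu,m)=\partial_x\psi(x,\mu,m)\sigma_0(x,\mu)+\int_{\mathbb R}D_\mu\psi(x,\mu,m)(y)\sigma_0(y,\mu)\mu(dy),\qquad\psi(x,\mu,0)=x,$$ $$\text{(2)}\quad\partial_m\psi(x,\mu,m)=\sigma_0(\psi(x,\mu,m),\mu_m),\qquad\mu_m=\psi(\cdot,\mu,m)_\sharp\mu,\qquad\psi(x,\mu,0)=x.$$ Then both problems have unique solutions, and the solution $\psi$ is the same for (1) and (2).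
   Context: **Notation.** $\mathcal P_2(\mathbb R)$ is the set of Borel probability measures on $\mathbb R$ with finite second moment. $\lambda$ is a fixed exponent, large enough that the following is finite ($\lambda>1/2$): $|\mu-\nu|_{-\lambda}^2:=\int_{\mathbb R}\frac{|F_\xi(\mu-\nu)|^2}{(1+|\xi|^2)^\lambda}d\xi$, $F_\xi(\eta):=(2\pi)^{-1/2}\int e^{i\xi x}\eta(dx)$. $\sharp$ denotes pushforward. For a function $u$ on $\mathcal P_2(\mathbb R)$, $\delta_\mu u(\mu,\cdot)$ is its linear functional derivative: it is continuous in $(\mu,y)$, of at most quadratic growth in $y$, and satisfies $u(m_1)-u(m_2)=\int_0^1\int\delta_\mu u(sm_1+(1-s)m_2,y)(m_1-m_2)(dy)ds$; $D_\mu u(\mu)(y):=\partial_y\delta_\mu u(\mu,y)$ is the Lions derivative and $D_{y\mu}u(\mu)(y):=\partial_yD_\mu u(\mu)(y)$. For functions of further variables these are taken in $\mu$ with the other variables fixed; $\partial_x^i$ acts on the first (spatial) argument. **Assumption (R) on $\sigma_0$** (for some integer $k$). (a) $\sigma_0$ and $D_\mu\sigma_0$ are bounded, Borel measurable, and there is $L>0$ such that for all $x_1,x_2,y_1,y_2\in\mathbb R$, $\mu,\nu\in\mathcal P_2(\mathbb R)$: $|\sigma_0(x_1,\mu)-\sigma_0(x_2,\nu)|\le L|x_1-x_2|+L|\mu-\nu|_{-\lambda}$, and both $|D_\mu\sigma_0(x_1,\mu)(y_1)-D_\mu\sigma_0(x_2,\nu)(y_2)|$ and $|D_{y\mu}\sigma_0(x_1,\mu)(y_1)-D_{y\mu}\sigma_0(x_2,\nu)(y_2)|$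 are at most $L|x_1-x_2|+L|y_1-y_2|+L|\mu-\nu|_{-\lambda}$. (b) $\sigma_0(\cdot,\mu)\in W^{k+2,\infty}(\mathbb R)$ uniformly in $\mu$, $D_\mu\sigma_0(\cdot,\mu)(y)$ exists and lies in $W^{k+1,\infty}(\mathbb R)$ uniformly in $(y,\mu)$, and $\sup_{\mu,y}\big(\sum_{i=0}^{k+2}\|\partial_x^i\sigma_0(\cdot,\mu)\|_{L^\infty}+\sum_{i=0}^{k}(\|\partial_x^iD_\mu\sigma_0(\cdot,\mu)(y)\|_{L^\infty}+\|\partial_x^iD_{y\mu}\sigma_0(\cdot,\mu)(y)\|_{L^\infty})\big)\le C_k$. *)

theory Defs
  imports "HOL-Probability.Probability"
begin

section \<open>The space of measures with finite second moment\<close>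

definition P2 :: "real measure set" where
  "P2 = {\<mu>. prob_space \<mu> \<and> sets \<mu> = sets borel \<and> integrable \<mu> (\<lambda>x. x\<^sup>2)}"

definition second_moment :: "real measure \<Rightarrow> real" where
  "second_moment \<mu> = (\<integral>x. x\<^sup>2 \<partial>\<mu>)"

definition couplings :: "real measure \<Rightarrow> real measure \<Rightarrow> (real \<times> real) measure set" where
  "couplings \<mu> \<nu> = {\<pi>. sets \<pi> = sets (borel \<Otimes>\<^sub>M borel)
      \<and> distr \<pi> borel fst = \<mu> \<and> distr \<pi> borel snd = \<nu>}"

text \<open>The quadratic Wasserstein distance. The topological notions on \<open>P2\<close> below (continuity, Borel
  sets, bounded sets) are the ones of this metric.\<close>

definition W2 :: "real measure \<Rightarrow> real measure \<Rightarrow> real" where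
  "W2 \<mu> \<nu> = sqrt (Inf ((\<lambda>\<pi>. \<integral>z. (fst z - snd z)\<^sup>2 \<partial>\<pi>) ` couplings \<mu> \<nu>))"

definition W2_open :: "real measure set \<Rightarrow> bool" where
  "W2_open U \<longleftrightarrow> U \<subseteq> P2 \<and> (\<forall>\<mu>\<in>U. \<exists>e>0. \<forall>\<nu>\<in>P2. W2 \<mu> \<nu> < e \<longrightarrow> \<nu> \<in> U)"

definition P2_borel :: "real measure measure" where
  "P2_borel = sigma P2 {U. W2_open U}"

text \<open>Joint continuity on the product of \<open>P2\<close> and a metric space; as everything is metric, it is
  sequential continuity. Several real arguments are passed as a tuple \<open>z\<close>.\<close>

definition continuous_P2 :: "(real measure \<Rightarrow> 'a::metric_space \<Rightarrow> real) \<Rightarrow> bool" where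
  "continuous_P2 f \<longleftrightarrow>
    (\<forall>M \<mu> Z z. (\<forall>n. M n \<in> P2) \<longrightarrow> \<mu> \<in> P2 \<longrightarrow> (\<lambda>n. W2 (M n) \<mu>) \<longlonglongrightarrow> 0 \<longrightarrow> Z \<longlonglongrightarrow> z
       \<longrightarrow> (\<lambda>n. f (M n) (Z n)) \<longlonglongrightarrow> f \<mu> z)"

text \<open>The distance \<open>|\<mu> - \<nu>|\<close> of index \<open>-\<lambda>\<close>. The library's \<open>char \<mu> \<xi>\<close> is the integral of \<open>exp (i \<xi> x)\<close>
  without the normalising factor.\<close>

definition fourier_transform_diff :: "real measure \<Rightarrow> real measure \<Rightarrow> real \<Rightarrow> complex" where
  "fourier_transform_diff \<mu> \<nu> \<xi> = (char \<mu> \<xi> - char \<nu> \<xi>) / complex_of_real (sqrt (2 * pi))"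

definition fourier_dist :: "real \<Rightarrow> real measure \<Rightarrow> real measure \<Rightarrow> real" where
  "fourier_dist lam \<mu> \<nu> =
    sqrt (\<integral>\<xi>. (cmod (fourier_transform_diff \<mu> \<nu> \<xi>))\<^sup>2 / (1 + \<xi>\<^sup>2) powr lam \<partial>lborel)"


section \<open>Derivatives on the space of measures\<close>

text \<open>The measure \<open>s m1 + (1 - s) m2\<close>, for \<open>s\<close> in the unit interval.\<close>

definition mixture :: "real \<Rightarrow> real measure \<Rightarrow> real measure \<Rightarrow> real measure" where
  "mixture s m1 m2 = measure_of UNIV (sets borel)
     (\<lambda>A. ennreal s * emeasure m1 A + ennreal (1 - s) * emeasure m2 A)"

text \<open>\<open>d\<close> is a linear functional derivative of \<open>u\<close>. It is determined by \<open>u\<close> only up to adding a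
  function of \<open>\<mu>\<close>. The quadratic growth in \<open>y\<close> is uniform on bounded subsets of \<open>P2\<close>.\<close>

definition is_linear_deriv :: "(real measure \<Rightarrow> real) \<Rightarrow> (real measure \<Rightarrow> real \<Rightarrow> real) \<Rightarrow> bool" where
  "is_linear_deriv u d \<longleftrightarrow>
     continuous_P2 d \<and>
     (\<forall>R. \<exists>C. \<forall>\<mu>\<in>P2. second_moment \<mu> \<le> R \<longrightarrow> (\<forall>y. \<bar>d \<mu> y\<bar> \<le> C * (1 + y\<^sup>2))) \<and>
     (\<forall>m1\<in>P2. \<forall>m2\<in>P2. u m1 - u m2 =
        (LINT s:{0..1}|lborel. (\<integral>y. d (mixture s m1 m2) y \<partial>m1) - (\<integral>y. d (mixture s m1 m2) y \<partial>m2)))"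

text \<open>\<open>D\<close> is the Lions derivative of \<open>u\<close>; on \<open>P2\<close> it is determined by \<open>u\<close>.\<close>

definition is_Lions_deriv :: "(real measure \<Rightarrow> real) \<Rightarrow> (real measure \<Rightarrow> real \<Rightarrow> real) \<Rightarrow> bool" where
  "is_Lions_deriv u D \<longleftrightarrow>
     (\<exists>d. is_linear_deriv u d \<and> (\<forall>\<mu>\<in>P2. \<forall>y. (d \<mu> has_real_derivative D \<mu> y) (at y)))"


section \<open>Sobolev spaces on the line\<close>

definition test_functions :: "(real \<Rightarrow> real) set" where
  "test_functions = {\<phi>. (\<forall>n. (deriv ^^ n) \<phi> differentiable_on UNIV) \<and> (\<exists>R. \<forall>x. \<bar>x\<bar> > R \<longrightarrow> \<phi> x = 0)}"

definition locally_integrable :: "(real \<Rightarrow> real) \<Rightarrow> bool" where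
  "locally_integrable f \<longleftrightarrow> (\<forall>a b. set_integrable lborel {a..b} f)"

definition is_weak_deriv :: "nat \<Rightarrow> (real \<Rightarrow> real) \<Rightarrow> (real \<Rightarrow> real) \<Rightarrow> bool" where
  "is_weak_deriv i f g \<longleftrightarrow> locally_integrable f \<and> locally_integrable g \<and>
     (\<forall>\<phi>\<in>test_functions.
        (\<integral>x. f x * (deriv ^^ i) \<phi> x \<partial>lborel) = (-1) ^ i * (\<integral>x. g x * \<phi> x \<partial>lborel))"

text \<open>A representative; weak derivatives are unique up to null sets.\<close>

definition weak_deriv :: "nat \<Rightarrow> (real \<Rightarrow> real) \<Rightarrow> real \<Rightarrow> real" where
  "weak_deriv i f = (SOME g. is_weak_deriv i f g)"

definition Linf_norm :: "(real \<Rightarrow> real) \<Rightarrow> ereal" where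
  "Linf_norm f = esssup lborel (\<lambda>x. ereal \<bar>f x\<bar>)"

definition Linf :: "(real \<Rightarrow> real) set" where
  "Linf = {f \<in> borel_measurable lborel. Linf_norm f < \<infinity>}"

definition sobolev_inf :: "nat \<Rightarrow> (real \<Rightarrow> real) set" where
  "sobolev_inf n = {f. \<forall>i\<le>n. \<exists>g\<in>Linf. is_weak_deriv i f g}"

definition sobolev_inf_norm :: "nat \<Rightarrow> (real \<Rightarrow> real) \<Rightarrow> ereal" where
  "sobolev_inf_norm n f = (\<Sum>i\<le>n. Linf_norm (weak_deriv i f))"


section \<open>The regularity assumption\<close>

text \<open>\<open>D x \<mu> y\<close> and \<open>E x \<mu> y\<close> stand for the Lions derivative of \<open>\<sigma> x\<close> at \<open>\<mu>\<close> and its derivative in \<open>y\<close>;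
  they are tied to \<open>\<sigma>\<close> in \<open>assumption_R\<close>.\<close>

definition assumption_R_a ::
  "real \<Rightarrow> (real \<Rightarrow> real measure \<Rightarrow> real) \<Rightarrow> (real \<Rightarrow> real measure \<Rightarrow> real \<Rightarrow> real)
    \<Rightarrow> (real \<Rightarrow> real measure \<Rightarrow> real \<Rightarrow> real) \<Rightarrow> bool" where
  "assumption_R_a lam \<sigma> D E \<longleftrightarrow>
     (\<exists>B. \<forall>x. \<forall>\<mu>\<in>P2. \<bar>\<sigma> x \<mu>\<bar> \<le> B) \<and>
     (\<exists>B. \<forall>x. \<forall>\<mu>\<in>P2. \<forall>y. \<bar>D x \<mu> y\<bar> \<le> B) \<and>
     (\<lambda>(x, \<mu>). \<sigma> x \<mu>) \<in> borel_measurable (borel \<Otimes>\<^sub>M P2_borel) \<and>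
     (\<lambda>(x, \<mu>, y). D x \<mu> y) \<in> borel_measurable (borel \<Otimes>\<^sub>M P2_borel \<Otimes>\<^sub>M borel) \<and>
     (\<exists>L>0. \<forall>x1 x2 y1 y2. \<forall>\<mu>\<in>P2. \<forall>\<nu>\<in>P2.
        \<bar>\<sigma> x1 \<mu> - \<sigma> x2 \<nu>\<bar> \<le> L * \<bar>x1 - x2\<bar> + L * fourier_dist lam \<mu> \<nu> \<and>
        \<bar>D x1 \<mu> y1 - D x2 \<nu> y2\<bar>
          \<le> L * \<bar>x1 - x2\<bar> + L * \<bar>y1 - y2\<bar> + L * fourier_dist lam \<mu> \<nu> \<and>
        \<bar>E x1 \<mu> y1 - E x2 \<nu> y2\<bar>
          \<le> L * \<bar>x1 - x2\<bar> + L * \<bar>y1 - y2\<bar> + L * fourier_dist lam \<mu> \<nu>)"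

definition assumption_R_b ::
  "nat \<Rightarrow> (real \<Rightarrow> real measure \<Rightarrow> real) \<Rightarrow> (real \<Rightarrow> real measure \<Rightarrow> real \<Rightarrow> real)
    \<Rightarrow> (real \<Rightarrow> real measure \<Rightarrow> real \<Rightarrow> real) \<Rightarrow> bool" where
  "assumption_R_b k \<sigma> D E \<longleftrightarrow>
     (\<exists>C::real. \<forall>\<mu>\<in>P2. (\<lambda>x. \<sigma> x \<mu>) \<in> sobolev_inf (k + 2)
        \<and> sobolev_inf_norm (k + 2) (\<lambda>x. \<sigma> x \<mu>) \<le> ereal C) \<and>
     (\<exists>C::real. \<forall>\<mu>\<in>P2. \<forall>y. (\<lambda>x. D x \<mu> y) \<in> sobolev_inf (k + 1)
        \<and> sobolev_inf_norm (k + 1) (\<lambda>x. D x \<mu> y) \<le> ereal C) \<and>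
     (\<forall>\<mu>\<in>P2. \<forall>y. (\<lambda>x. E x \<mu> y) \<in> sobolev_inf k) \<and>
     (\<exists>C::real. \<forall>\<mu>\<in>P2. \<forall>y.
        (\<Sum>i\<le>k + 2. Linf_norm (weak_deriv i (\<lambda>x. \<sigma> x \<mu>))) +
        (\<Sum>i\<le>k. Linf_norm (weak_deriv i (\<lambda>x. D x \<mu> y)) + Linf_norm (weak_deriv i (\<lambda>x. E x \<mu> y)))
          \<le> ereal C)"

definition assumption_R :: "real \<Rightarrow> nat \<Rightarrow> (real \<Rightarrow> real measure \<Rightarrow> real) \<Rightarrow> bool" where
  "assumption_R lam k \<sigma> \<longleftrightarrow>
     (\<exists>D E. (\<forall>x. is_Lions_deriv (\<sigma> x) (D x)) \<and>
            (\<forall>x. \<forall>\<mu>\<in>P2. \<forall>y. (D x \<mu> has_real_derivative E x \<mu> y) (at y)) \<and>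
            assumption_R_a lam \<sigma> D E \<and> assumption_R_b k \<sigma> D E)"


section \<open>The two problems\<close>

text \<open>Classical solutions of the transport equation: the derivatives in \<open>x\<close>, \<open>m\<close> and \<open>\<mu>\<close> exist and
  are jointly continuous, and the Lions derivative grows at most quadratically in \<open>y\<close>, locally
  uniformly in the other arguments (so that it is integrable against every \<open>\<mu>\<close> in \<open>P2\<close>).\<close>

definition solves_transport ::
  "(real \<Rightarrow> real measure \<Rightarrow> real) \<Rightarrow> (real \<Rightarrow> real measure \<Rightarrow> real \<Rightarrow> real) \<Rightarrow> bool" where
  "solves_transport \<sigma> \<psi> \<longleftrightarrow>
     (\<exists>\<psi>x \<psi>m D.
        (\<forall>x m. \<forall>\<mu>\<in>P2. ((\<lambda>x. \<psi> x \<mu> m) has_real_derivative \<psi>x x \<mu> m) (at x)) \<and>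
        (\<forall>x m. \<forall>\<mu>\<in>P2. ((\<lambda>m. \<psi> x \<mu> m) has_real_derivative \<psi>m x \<mu> m) (at m)) \<and>
        (\<forall>x m. is_Lions_deriv (\<lambda>\<mu>. \<psi> x \<mu> m) (\<lambda>\<mu> y. D x \<mu> m y)) \<and>
        continuous_P2 (\<lambda>\<mu> (x, m). \<psi>x x \<mu> m) \<and>
        continuous_P2 (\<lambda>\<mu> (x, m). \<psi>m x \<mu> m) \<and>
        continuous_P2 (\<lambda>\<mu> (x, m, y). D x \<mu> m y) \<and>
        (\<forall>R. \<exists>C. \<forall>x m y. \<forall>\<mu>\<in>P2. \<bar>x\<bar> \<le> R \<longrightarrow> \<bar>m\<bar> \<le> R \<longrightarrow> second_moment \<mu> \<le> R
             \<longrightarrow> \<bar>D x \<mu> m y\<bar> \<le> C * (1 + y\<^sup>2)) \<and>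
        (\<forall>x m. \<forall>\<mu>\<in>P2. \<psi>m x \<mu> m = \<psi>x x \<mu> m * \<sigma> x \<mu> + (\<integral>y. D x \<mu> m y * \<sigma> y \<mu> \<partial>\<mu>)) \<and>
        (\<forall>x. \<forall>\<mu>\<in>P2. \<psi> x \<mu> 0 = x))"

definition flow_measure ::
  "(real \<Rightarrow> real measure \<Rightarrow> real \<Rightarrow> real) \<Rightarrow> real measure \<Rightarrow> real \<Rightarrow> real measure" where
  "flow_measure \<psi> \<mu> m = distr \<mu> borel (\<lambda>x. \<psi> x \<mu> m)"

text \<open>Measurability is what makes the pushforward meaningful, and the pushforward has to lie in the
  domain of \<open>\<sigma>\<close>.\<close>

definition solves_flow ::
  "(real \<Rightarrow> real measure \<Rightarrow> real) \<Rightarrow> (real \<Rightarrow> real measure \<Rightarrow> real \<Rightarrow> real) \<Rightarrow> bool" where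
  "solves_flow \<sigma> \<psi> \<longleftrightarrow>
     (\<forall>\<mu>\<in>P2. \<forall>m. (\<lambda>x. \<psi> x \<mu> m) \<in> borel_measurable borel \<and> flow_measure \<psi> \<mu> m \<in> P2) \<and>
     (\<forall>x m. \<forall>\<mu>\<in>P2.
        ((\<lambda>m. \<psi> x \<mu> m) has_real_derivative \<sigma> (\<psi> x \<mu> m) (flow_measure \<psi> \<mu> m)) (at m)) \<and>
     (\<forall>x. \<forall>\<mu>\<in>P2. \<psi> x \<mu> 0 = x)"

text \<open>A function on \<open>P2\<close> is represented by one on all measures; equality of functions is therefore
  equality on \<open>P2\<close>.\<close>

definition agree_P2 ::
  "(real \<Rightarrow> real measure \<Rightarrow> real \<Rightarrow> real) \<Rightarrow> (real \<Rightarrow> real measure \<Rightarrow> real \<Rightarrow> real) \<Rightarrow> bool" where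
  "agree_P2 \<psi> \<phi> \<longleftrightarrow> (\<forall>x m. \<forall>\<mu>\<in>P2. \<psi> x \<mu> m = \<phi> x \<mu> m)"

end

theory Submission
  imports Defs
begin

text \<open>A solution of the transport equation is constant along the characteristics of the mean-field
  flow, so it has to be the flow. That the flow exists and is unique follows from a Volterra fixed
  point and a Gronwall estimate in a supremum norm weighted in time. The flow solves the transport
  equation because it is a semigroup and is differentiable: its derivative in \<open>\<mu>\<close> solves the equation
  linearized along the flow, and stability of that linear equation makes the derivative continuous.

  Two properties of the coefficient are not literally among the hypotheses. For small \<open>\<lambda>\<close> the
  distance of index \<open>-\<lambda>\<close> is only Hoelder continuous in the first Wasserstein distance, but the bound
  on the Lions derivative makes the coefficient Lipschitz in that distance. A Lipschitz function with
  a bounded weak second derivative is continuously differentiable, and interpolating between this and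
  the Lipschitz bound in \<open>\<mu>\<close> gives a modulus of continuity in \<open>\<mu>\<close> for the spatial derivative.\<close>

section \<open>Measures with finite second moment\<close>

text \<open>Two distances are kept apart. The definitions speak of \<open>W2\<close>, but the
  Gronwall estimates close in the first Wasserstein distance, which controls integrals of Lipschitz
  functions; \<open>kr_le_W2\<close> passes from one to the other. Direct \<open>W2\<close> bounds
  are needed only for the curve of laws and for the segments joining it to the initial measure.
  Boundedness of the coefficient makes every displacement at most \<open>K * \<bar>m\<bar>\<close>,
  so all estimates can be uniform in the position although positions are unbounded. In the measure
  variable the coefficient is differentiable only up to a modulus, so remainders are of size
  \<omega>(w) * w and not quadratic. This suffices for a derivative along segments of measures,
  which the fundamental theorem of calculus turns into the formula defining the linear derivative.
  One chain rule at time 0 serves twice: the semigroup property carries it to every time for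
  uniqueness, and for the flow itself, where the differentiated function is constant, it is the
  transport equation.\<close>

lemma P2_prob_space: "\<mu> \<in> P2 \<Longrightarrow> prob_space \<mu>"
  by (simp add: P2_def)

lemma P2_sets: "\<mu> \<in> P2 \<Longrightarrow> sets \<mu> = sets borel"
  by (simp add: P2_def)

lemma P2_space: "\<mu> \<in> P2 \<Longrightarrow> space \<mu> = UNIV"
  using sets_eq_imp_space_eq[OF P2_sets] by simp

lemma P2_measurable: "\<mu> \<in> P2 \<Longrightarrow> f \<in> borel_measurable borel \<Longrightarrow> f \<in> borel_measurable \<mu>"
  by (simp add: measurable_cong_sets[OF P2_sets refl])

lemma integrable_P2:
  fixes f :: "real \<Rightarrow> real"
  assumes \<mu>: "\<mu> \<in> P2" and f: "f \<in> borel_measurable borel" and bd: "\<And>x. \<bar>f x\<bar> \<le> C * (1 + x\<^sup>2)"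
  shows "integrable \<mu> f"
proof -
  interpret prob_space \<mu> using \<mu> by (rule P2_prob_space)
  have "integrable \<mu> (\<lambda>x. C * (1 + x\<^sup>2))"
    using \<mu> by (auto simp: P2_def)
  then show ?thesis
  proof (rule Bochner_Integration.integrable_bound)
    show "AE x in \<mu>. norm (f x) \<le> norm (C * (1 + x\<^sup>2))"
      using order_trans[OF bd abs_ge_self] by (intro AE_I2) simp
  qed (use P2_measurable[OF \<mu> f] in simp)
qed

lemma abs_le_one_plus_square: "\<bar>x\<bar> \<le> 1 + x\<^sup>2" for x :: real
proof (cases "\<bar>x\<bar> \<le> 1")
  case True then show ?thesis using zero_le_power2[of x] by linarith
next
  case False
  then have "\<bar>x\<bar> * 1 \<le> \<bar>x\<bar> * \<bar>x\<bar>" by (intro mult_left_mono) auto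
  then show ?thesis by (simp add: power2_eq_square)
qed

lemma lipschitz_growth:
  fixes g :: "real \<Rightarrow> real"
  assumes "\<And>x y. \<bar>g x - g y\<bar> \<le> C * \<bar>x - y\<bar>"
  shows "\<bar>g x\<bar> \<le> (\<bar>g 0\<bar> + C) * (1 + x\<^sup>2)"
proof -
  have "0 \<le> C" using assms[of 1 0] by simp
  have "\<bar>g x\<bar> \<le> \<bar>g 0\<bar> + C * \<bar>x\<bar>" using assms[of x 0] by simp
  also have "\<dots> \<le> \<bar>g 0\<bar> * (1 + x\<^sup>2) + C * (1 + x\<^sup>2)"
    using \<open>0 \<le> C\<close> abs_le_one_plus_square[of x]
    by (intro add_mono mult_left_mono) (auto simp: algebra_simps)
  finally show ?thesis by (simp add: algebra_simps)
qed

lemma lipschitz_continuous: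
  fixes g :: "real \<Rightarrow> real"
  assumes "\<And>x y. \<bar>g x - g y\<bar> \<le> C * \<bar>x - y\<bar>"
  shows "continuous_on UNIV g"
proof -
  have "0 \<le> C" using assms[of 1 0] by simp
  then have "C-lipschitz_on UNIV g"
    using assms by (intro lipschitz_onI) (auto simp: dist_real_def)
  then show ?thesis by (rule lipschitz_on_continuous_on)
qed

lemma lipschitz_measurable:
  fixes g :: "real \<Rightarrow> real"
  assumes "\<And>x y. \<bar>g x - g y\<bar> \<le> C * \<bar>x - y\<bar>"
  shows "g \<in> borel_measurable borel"
  using lipschitz_continuous[OF assms] by (rule borel_measurable_continuous_onI)

lemma integrable_lipschitz:
  fixes g :: "real \<Rightarrow> real"
  assumes "\<mu> \<in> P2" "\<And>x y. \<bar>g x - g y\<bar> \<le> C * \<bar>x - y\<bar>"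
  shows "integrable \<mu> g"
  using integrable_P2[OF assms(1) lipschitz_measurable[OF assms(2)] lipschitz_growth[OF assms(2)]] .

text \<open>\<open>\<sigma>\<close> is bounded, so every map pushed along later moves points by a
  bounded amount; this alone keeps the image in \<open>P2\<close>. The explicit second moment allows
  growth bounds that are uniform on bounded sets to be applied to the measures met along the
  flow.\<close>

lemma distr_P2:
  assumes \<mu>: "\<mu> \<in> P2" and f: "f \<in> borel_measurable borel" and bd: "\<And>x. \<bar>f x - x\<bar> \<le> c"
  shows "distr \<mu> borel f \<in> P2"
    and "second_moment (distr \<mu> borel f) \<le> 2 * second_moment \<mu> + 2 * c\<^sup>2"
proof -
  note [measurable] = P2_measurable[OF \<mu> f] f
  interpret prob_space \<mu> using \<mu> by (rule P2_prob_space)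
  have "0 \<le> c" using bd[of 0] by simp
  have sq: "(f x)\<^sup>2 \<le> 2 * x\<^sup>2 + 2 * c\<^sup>2" for x
  proof -
    have "(f x)\<^sup>2 = (x + (f x - x))\<^sup>2" by simp
    also have "\<dots> \<le> 2 * x\<^sup>2 + 2 * (f x - x)\<^sup>2"
      using zero_le_power2[of "x - (f x - x)"] by (simp add: power2_eq_square algebra_simps)
    also have "(f x - x)\<^sup>2 \<le> c\<^sup>2" using bd[of x] by (intro abs_le_square_iff[THEN iffD1]) simp
    finally show ?thesis by simp
  qed
  have le: "2 * x\<^sup>2 + 2 * c\<^sup>2 \<le> (2 + 2 * c\<^sup>2) * (1 + x\<^sup>2)" for x
    by (simp add: algebra_simps)
  have "integrable \<mu> (\<lambda>x. (f x)\<^sup>2)"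
    by (rule integrable_P2[OF \<mu>, where C="2 + 2 * c\<^sup>2"])
      (use f order_trans[OF sq le] in auto)
  moreover have "integrable \<mu> (\<lambda>x. 2 * x\<^sup>2 + 2 * c\<^sup>2)"
    using \<mu> by (auto simp: P2_def)
  ultimately have "(\<integral>x. (f x)\<^sup>2 \<partial>\<mu>) \<le> (\<integral>x. 2 * x\<^sup>2 + 2 * c\<^sup>2 \<partial>\<mu>)"
    using sq by (intro integral_mono) auto
  also have "\<dots> = 2 * second_moment \<mu> + 2 * c\<^sup>2"
    using \<mu> by (subst Bochner_Integration.integral_add) (auto simp: P2_def second_moment_def prob_space)
  finally show "second_moment (distr \<mu> borel f) \<le> 2 * second_moment \<mu> + 2 * c\<^sup>2"
    by (simp add: second_moment_def integral_distr)
  show "distr \<mu> borel f \<in> P2"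
    using \<open>integrable \<mu> (\<lambda>x. (f x)\<^sup>2)\<close>
    by (auto simp: P2_def integrable_distr_eq intro!: prob_space_distr)
qed

lemma second_moment_nonneg: "0 \<le> second_moment \<mu>"
  by (simp add: second_moment_def)

text \<open>By Kantorovich duality, \<open>kr_le \<mu> \<nu> w\<close> says that the first Wasserstein distance is at most \<open>w\<close>.\<close>

definition kr_le :: "real measure \<Rightarrow> real measure \<Rightarrow> real \<Rightarrow> bool" where
  "kr_le \<mu> \<nu> w \<longleftrightarrow> 0 \<le> w \<and>
     (\<forall>g. (\<forall>x y. \<bar>g x - g y\<bar> \<le> \<bar>x - y\<bar>) \<longrightarrow> \<bar>(\<integral>x. g x \<partial>\<mu>) - (\<integral>x. g x \<partial>\<nu>)\<bar> \<le> w)"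

lemma kr_le_nonneg: "kr_le \<mu> \<nu> w \<Longrightarrow> 0 \<le> w"
  by (simp add: kr_le_def)

lemma kr_leI:
  assumes "0 \<le> w"
    and "\<And>g. (\<And>x y. \<bar>g x - g y\<bar> \<le> \<bar>x - y\<bar>) \<Longrightarrow> \<bar>(\<integral>x. g x \<partial>\<mu>) - (\<integral>x. g x \<partial>\<nu>)\<bar> \<le> w"
  shows "kr_le \<mu> \<nu> w"
  using assms by (simp add: kr_le_def)

lemma kr_leD1:
  assumes "kr_le \<mu> \<nu> w" "\<And>x y. \<bar>g x - g y\<bar> \<le> \<bar>x - y\<bar>"
  shows "\<bar>(\<integral>x. g x \<partial>\<mu>) - (\<integral>x. g x \<partial>\<nu>)\<bar> \<le> w"
proof -
  have "\<forall>x y. \<bar>g x - g y\<bar> \<le> \<bar>x - y\<bar>" using assms(2) by blast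
  with assms(1) show ?thesis unfolding kr_le_def by (elim conjE allE[of _ g]) (rule mp)
qed

lemma kr_leD:
  assumes "kr_le \<mu> \<nu> w" "\<mu> \<in> P2" "\<nu> \<in> P2" and g: "\<And>x y. \<bar>g x - g y\<bar> \<le> C * \<bar>x - y\<bar>"
  shows "\<bar>(\<integral>x. g x \<partial>\<mu>) - (\<integral>x. g x \<partial>\<nu>)\<bar> \<le> C * w"
\<comment> \<open>The function is rescaled by 1 / C. For C = 0 it is constant, and both integrals
  agree because the measures have mass 1.\<close>
proof (cases "C = 0")
  case True
  interpret m: prob_space \<mu> using assms by (auto intro: P2_prob_space)
  interpret n: prob_space \<nu> using assms by (auto intro: P2_prob_space)
  have "g = (\<lambda>x. g 0)" using g[of _ 0] True by auto
  then obtain c where "g = (\<lambda>x. c)" by blast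
  then show ?thesis using True by (simp add: m.prob_space n.prob_space)
next
  case False
  moreover have "0 \<le> C" using g[of 1 0] by simp
  ultimately have C: "0 < C" by simp
  have "\<bar>g x / C - g y / C\<bar> \<le> \<bar>x - y\<bar>" for x y
    using g[of x y] C by (simp add: abs_divide pos_divide_le_eq mult.commute flip: diff_divide_distrib)
  then have "\<bar>(\<integral>x. g x / C \<partial>\<mu>) - (\<integral>x. g x / C \<partial>\<nu>)\<bar> \<le> w"
    by (rule kr_leD1[OF assms(1)])
  then have "\<bar>(\<integral>x. g x \<partial>\<mu>) - (\<integral>x. g x \<partial>\<nu>)\<bar> / C \<le> w"
    using C by (simp add: abs_divide flip: diff_divide_distrib)
  then show ?thesis using C by (simp add: pos_divide_le_eq mult.commute)
qed

lemma kr_le_mono: "kr_le \<mu> \<nu> w \<Longrightarrow> w \<le> w' \<Longrightarrow> kr_le \<mu> \<nu> w'"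
  by (rule kr_leI) (auto dest: kr_le_nonneg intro: order_trans[OF kr_leD1])

lemma kr_le_refl: "kr_le \<mu> \<mu> 0"
  by (simp add: kr_le_def)

lemma kr_le_trans:
  assumes "kr_le \<mu> \<nu> v" "kr_le \<nu> \<rho> w"
  shows "kr_le \<mu> \<rho> (v + w)"
proof (rule kr_leI)
  fix g :: "real \<Rightarrow> real" assume "\<bar>g x - g y\<bar> \<le> \<bar>x - y\<bar>" for x y
  then have "\<bar>(\<integral>x. g x \<partial>\<mu>) - (\<integral>x. g x \<partial>\<nu>)\<bar> \<le> v" "\<bar>(\<integral>x. g x \<partial>\<nu>) - (\<integral>x. g x \<partial>\<rho>)\<bar> \<le> w"
    using assms by (auto simp: kr_le_def)
  then show "\<bar>(\<integral>x. g x \<partial>\<mu>) - (\<integral>x. g x \<partial>\<rho>)\<bar> \<le> v + w" by linarith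
qed (use assms[THEN kr_le_nonneg] in simp)

text \<open>The image of \<open>\<mu>\<close> under x \<mapsto> (f x, g x) couples the two measures.
  The mean displacement is kept instead of its supremum because in \<open>flow_exists\<close> the
  maps converge only pointwise, and dominated convergence has to be applied to this mean.\<close>

lemma kr_le_distr:
  assumes \<mu>: "\<mu> \<in> P2" and f: "f \<in> borel_measurable borel" and bdf: "\<And>x. \<bar>f x - x\<bar> \<le> b"
    and g: "g \<in> borel_measurable borel" and bdg: "\<And>x. \<bar>g x - x\<bar> \<le> c"
  shows "kr_le (distr \<mu> borel f) (distr \<mu> borel g) (\<integral>x. \<bar>f x - g x\<bar> \<partial>\<mu>)"
proof (rule kr_leI)
  fix h :: "real \<Rightarrow> real" assume h: "\<bar>h x - h y\<bar> \<le> \<bar>x - y\<bar>" for x y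
  interpret prob_space \<mu> using \<mu> by (rule P2_prob_space)
  have hm[measurable]: "h \<in> borel_measurable borel" using lipschitz_measurable[of h 1] h by simp
  note [measurable] = P2_measurable[OF \<mu> f] P2_measurable[OF \<mu> g] f g
  have ih: "integrable (distr \<mu> borel f) h" "integrable (distr \<mu> borel g) h"
    using integrable_lipschitz[OF distr_P2(1)[OF \<mu> f bdf], of h 1]
      integrable_lipschitz[OF distr_P2(1)[OF \<mu> g bdg], of h 1] h by auto
  then have int: "integrable \<mu> (\<lambda>x. h (f x))" "integrable \<mu> (\<lambda>x. h (g x))"
    by (auto simp: integrable_distr_eq)
  have "integrable \<mu> (\<lambda>x. \<bar>f x - g x\<bar>)"
  proof (rule integrable_P2[OF \<mu>, where C="b + c"])
    fix x
    have "\<bar>f x - g x\<bar> \<le> b + c" using bdf[of x] bdg[of x] by linarith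
    moreover have "0 \<le> (b + c) * x\<^sup>2" using bdf[of x] bdg[of x] by (intro mult_nonneg_nonneg) auto
    ultimately show "\<bar>\<bar>f x - g x\<bar>\<bar> \<le> (b + c) * (1 + x\<^sup>2)" by (simp add: algebra_simps)
  qed simp
  have "\<bar>\<integral>x. h (f x) - h (g x) \<partial>\<mu>\<bar> \<le> (\<integral>x. \<bar>h (f x) - h (g x)\<bar> \<partial>\<mu>)"
    by (rule integral_abs_bound)
  also have "\<dots> \<le> (\<integral>x. \<bar>f x - g x\<bar> \<partial>\<mu>)"
    using int h \<open>integrable \<mu> (\<lambda>x. \<bar>f x - g x\<bar>)\<close> by (intro integral_mono) auto
  finally show "\<bar>(\<integral>x. h x \<partial>distr \<mu> borel f) - (\<integral>x. h x \<partial>distr \<mu> borel g)\<bar> \<le> (\<integral>x. \<bar>f x - g x\<bar> \<partial>\<mu>)"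
    using int by (simp add: integral_distr)
qed simp

lemma kr_le_distr_uniform:
  assumes \<mu>: "\<mu> \<in> P2" and f: "f \<in> borel_measurable borel" and bdf: "\<And>x. \<bar>f x - x\<bar> \<le> b"
    and g: "g \<in> borel_measurable borel" and bdg: "\<And>x. \<bar>g x - x\<bar> \<le> c"
    and d: "\<And>x. \<bar>f x - g x\<bar> \<le> d"
  shows "kr_le (distr \<mu> borel f) (distr \<mu> borel g) d"
proof (rule kr_le_mono[OF kr_le_distr[OF assms(1-5)]])
  interpret prob_space \<mu> using \<mu> by (rule P2_prob_space)
  have "0 \<le> d" using d[of 0] by simp
  have "(\<integral>x. \<bar>f x - g x\<bar> \<partial>\<mu>) \<le> (\<integral>x. d \<partial>\<mu>)"
    using d \<open>0 \<le> d\<close> by (intro integral_mono') auto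
  then show "(\<integral>x. \<bar>f x - g x\<bar> \<partial>\<mu>) \<le> d" by (simp add: prob_space)
qed

lemma kr_le_push:
  assumes "kr_le \<mu> \<nu> w" "\<mu> \<in> P2" "\<nu> \<in> P2"
    and f: "\<And>x y. \<bar>f x - f y\<bar> \<le> C * \<bar>x - y\<bar>"
  shows "kr_le (distr \<mu> borel f) (distr \<nu> borel f) (C * w)"
proof (rule kr_leI)
  have "0 \<le> C" using f[of 1 0] by simp
  then show "0 \<le> C * w" using kr_le_nonneg[OF assms(1)] by simp
  fix h :: "real \<Rightarrow> real" assume h: "\<bar>h x - h y\<bar> \<le> \<bar>x - y\<bar>" for x y
  have hm[measurable]: "h \<in> borel_measurable borel" using lipschitz_measurable[of h 1] h by simp
  have fm: "f \<in> borel_measurable borel" using f by (rule lipschitz_measurable)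
  note [measurable] = P2_measurable[OF assms(2) fm] P2_measurable[OF assms(3) fm]
  have "\<bar>h (f x) - h (f y)\<bar> \<le> C * \<bar>x - y\<bar>" for x y using order_trans[OF h f] .
  from kr_leD[OF assms(1-3) this]
  show "\<bar>(\<integral>x. h x \<partial>distr \<mu> borel f) - (\<integral>x. h x \<partial>distr \<nu> borel f)\<bar> \<le> C * w"
    by (simp add: integral_distr)
qed

text \<open>Both measures are compared with the point mass at 0. A finite bound is needed to measure
  steps along the segment between two arbitrary measures.\<close>

lemma kr_le_exists:
  assumes "\<mu> \<in> P2" "\<nu> \<in> P2"
  obtains w where "kr_le \<mu> \<nu> w"
proof
  show "kr_le \<mu> \<nu> ((\<integral>x. \<bar>x\<bar> \<partial>\<mu>) + (\<integral>x. \<bar>x\<bar> \<partial>\<nu>))"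
  proof (rule kr_leI)
    fix h :: "real \<Rightarrow> real" assume h: "\<bar>h x - h y\<bar> \<le> \<bar>x - y\<bar>" for x y
    have *: "\<bar>(\<integral>x. h x \<partial>\<rho>) - h 0\<bar> \<le> (\<integral>x. \<bar>x\<bar> \<partial>\<rho>)" if \<rho>: "\<rho> \<in> P2" for \<rho>
    proof -
      interpret prob_space \<rho> using \<rho> by (rule P2_prob_space)
      have i: "integrable \<rho> h" "integrable \<rho> (\<lambda>x. \<bar>x\<bar>)"
        using h by (auto intro!: integrable_lipschitz[OF \<rho>, where C=1])
      have "(\<integral>x. h x \<partial>\<rho>) - h 0 = (\<integral>x. h x - h 0 \<partial>\<rho>)"
        using i by (simp add: prob_space)
      also have "\<bar>\<dots>\<bar> \<le> (\<integral>x. \<bar>h x - h 0\<bar> \<partial>\<rho>)" by (rule integral_abs_bound)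
      also have "\<dots> \<le> (\<integral>x. \<bar>x\<bar> \<partial>\<rho>)"
        using i h[of _ 0] by (intro integral_mono) auto
      finally show ?thesis .
    qed
    from *[OF assms(1)] *[OF assms(2)]
    show "\<bar>(\<integral>x. h x \<partial>\<mu>) - (\<integral>x. h x \<partial>\<nu>)\<bar> \<le> (\<integral>x. \<bar>x\<bar> \<partial>\<mu>) + (\<integral>x. \<bar>x\<bar> \<partial>\<nu>)"
      by linarith
  qed simp
qed

section \<open>Convex combinations of two measures\<close>

text \<open>\<open>measure_of\<close> takes the prescribed values only if they are countably
  additive. Tossing a biased coin and then sampling from \<open>m1\<close> or \<open>m2\<close>
  produces a measure with these values, and its integrals come from the Giry monad.\<close>

lemma mixture_eq_bind:
  assumes "m1 \<in> P2" "m2 \<in> P2" "0 \<le> s" "s \<le> 1"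
  shows "mixture s m1 m2 = measure_pmf (bernoulli_pmf s) \<bind> (\<lambda>b. if b then m1 else m2)"
proof -
  let ?N = "\<lambda>b. if b then m1 else m2"
  let ?M = "measure_pmf (bernoulli_pmf s) \<bind> ?N"
  have N: "?N \<in> measure_pmf (bernoulli_pmf s) \<rightarrow>\<^sub>M subprob_algebra borel"
    using assms P2_sets P2_prob_space
    by (auto simp: space_subprob_algebra prob_space_imp_subprob_space)
  have sets: "sets ?M = sets borel"
    by (rule sets_bind[OF sets_kernel[OF N]]) simp_all
  have "?M = measure_of (space ?M) (sets ?M) (emeasure ?M)"
    by (simp add: measure_of_of_measure)
  also have "\<dots> = measure_of UNIV (sets borel) (emeasure ?M)"
    using sets sets_eq_imp_space_eq[OF sets] by simp
  also have "\<dots> = mixture s m1 m2"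
    unfolding mixture_def
  proof (rule measure_of_eq)
    fix A :: "real set" assume "A \<in> sigma_sets UNIV (sets borel)"
    then have A: "A \<in> sets borel" by (metis sets.sigma_sets_eq space_borel)
    have "emeasure ?M A = (\<integral>\<^sup>+b. emeasure (?N b) A \<partial>bernoulli_pmf s)"
      by (rule emeasure_bind[OF _ N A]) simp
    also have "\<dots> = ennreal s * emeasure m1 A + ennreal (1 - s) * emeasure m2 A"
      using assms by (simp add: nn_integral_bernoulli_pmf mult.commute)
    finally show "emeasure ?M A = ennreal s * emeasure m1 A + ennreal (1 - s) * emeasure m2 A" .
  qed simp
  finally show ?thesis by simp
qed

context
  fixes m1 m2 :: "real measure" and s :: real
  assumes m: "m1 \<in> P2" "m2 \<in> P2" and s: "0 \<le> s" "s \<le> 1"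
begin

lemma mixture_kernel:
  "(\<lambda>b. if b then m1 else m2) \<in> measure_pmf (bernoulli_pmf s) \<rightarrow>\<^sub>M subprob_algebra borel"
  using m P2_sets P2_prob_space by (auto simp: space_subprob_algebra prob_space_imp_subprob_space)

lemma sets_mixture: "sets (mixture s m1 m2) = sets borel"
  unfolding mixture_eq_bind[OF m s] by (rule sets_bind[OF sets_kernel[OF mixture_kernel]]) simp_all

lemma nn_integral_mixture:
  "f \<in> borel_measurable borel \<Longrightarrow>
    (\<integral>\<^sup>+x. f x \<partial>mixture s m1 m2) = ennreal s * (\<integral>\<^sup>+x. f x \<partial>m1) + ennreal (1 - s) * (\<integral>\<^sup>+x. f x \<partial>m2)"
  unfolding mixture_eq_bind[OF m s] using s
  by (subst nn_integral_bind[OF _ mixture_kernel]) (auto simp: nn_integral_bernoulli_pmf mult.commute)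

lemma emeasure_mixture:
  "A \<in> sets borel \<Longrightarrow>
    emeasure (mixture s m1 m2) A = ennreal s * emeasure m1 A + ennreal (1 - s) * emeasure m2 A"
  using nn_integral_mixture[of "indicator A"] m by (simp add: sets_mixture P2_sets)

lemma integrable_mixture:
  fixes f :: "real \<Rightarrow> real"
  assumes i: "integrable m1 f" "integrable m2 f" and f: "f \<in> borel_measurable borel"
  shows "integrable (mixture s m1 m2) f"
    and "(\<integral>x. f x \<partial>mixture s m1 m2) = s * (\<integral>x. f x \<partial>m1) + (1 - s) * (\<integral>x. f x \<partial>m2)"
proof -
  have fm: "f \<in> borel_measurable (mixture s m1 m2)"
    using f by (simp add: measurable_cong_sets[OF sets_mixture refl])
  have fin: "(\<integral>\<^sup>+x. ennreal (norm (f x)) \<partial>m1) < \<infinity>" "(\<integral>\<^sup>+x. ennreal (norm (f x)) \<partial>m2) < \<infinity>"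
    using i by (auto simp: integrable_iff_bounded)
  show int: "integrable (mixture s m1 m2) f"
    unfolding integrable_iff_bounded using fm f fin
    by (auto simp: nn_integral_mixture ennreal_mult_less_top)
  have fin': "(\<integral>\<^sup>+x. ennreal (f x) \<partial>M) < \<infinity>" "(\<integral>\<^sup>+x. ennreal (- f x) \<partial>M) < \<infinity>"
    if "(\<integral>\<^sup>+x. ennreal (norm (f x)) \<partial>M) < \<infinity>" for M :: "real measure"
    by (rule le_less_trans[OF nn_integral_mono that]; simp add: ennreal_leI)+
  show "(\<integral>x. f x \<partial>mixture s m1 m2) = s * (\<integral>x. f x \<partial>m1) + (1 - s) * (\<integral>x. f x \<partial>m2)"
    using i int f s fin'[OF fin(1)] fin'[OF fin(2)]
    by (simp add: real_lebesgue_integral_def nn_integral_mixture enn2real_plus enn2real_mult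
        ennreal_mult_less_top algebra_simps)
qed

lemma mixture_P2: "mixture s m1 m2 \<in> P2"
  and second_moment_mixture:
    "second_moment (mixture s m1 m2) = s * second_moment m1 + (1 - s) * second_moment m2"
proof -
  have "emeasure (mixture s m1 m2) UNIV = 1"
    using m[THEN P2_prob_space, THEN prob_space.emeasure_space_1] m[THEN P2_space] s
    by (simp add: emeasure_mixture flip: ennreal_plus)
  then have "prob_space (mixture s m1 m2)"
    using sets_eq_imp_space_eq[OF sets_mixture] by (intro prob_spaceI) simp
  then show "mixture s m1 m2 \<in> P2"
    using m by (auto simp: P2_def sets_mixture intro!: integrable_mixture)
  show "second_moment (mixture s m1 m2) = s * second_moment m1 + (1 - s) * second_moment m2"
    unfolding second_moment_def using m by (intro integrable_mixture) (auto simp: P2_def)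
qed

lemma integral_mixture_lipschitz:
  assumes "\<And>x y. \<bar>g x - g y\<bar> \<le> C * \<bar>x - y\<bar>"
  shows "(\<integral>x. g x \<partial>mixture s m1 m2) = s * (\<integral>x. g x \<partial>m1) + (1 - s) * (\<integral>x. g x \<partial>m2)"
  by (intro integrable_mixture integrable_lipschitz[OF _ assms] lipschitz_measurable[OF assms] m)

end

lemma mixture_0: "m1 \<in> P2 \<Longrightarrow> m2 \<in> P2 \<Longrightarrow> mixture 0 m1 m2 = m2"
  by (intro measure_eqI) (auto simp: sets_mixture emeasure_mixture P2_sets)

lemma mixture_1: "m1 \<in> P2 \<Longrightarrow> m2 \<in> P2 \<Longrightarrow> mixture 1 m1 m2 = m1"
  by (intro measure_eqI) (auto simp: sets_mixture emeasure_mixture P2_sets)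

text \<open>All integrals are affine along the segment, with slope the difference of the integrals
  against its two ends.\<close>

lemma kr_le_mixture:
  assumes m: "m1 \<in> P2" "m2 \<in> P2" and w: "kr_le m1 m2 w" and s: "s \<in> {0..1}" and t: "t \<in> {0..1}"
  shows "kr_le (mixture s m1 m2) (mixture t m1 m2) (\<bar>s - t\<bar> * w)"
proof (rule kr_leI)
  show "0 \<le> \<bar>s - t\<bar> * w" using kr_le_nonneg[OF w] by simp
  fix g :: "real \<Rightarrow> real" assume g: "\<bar>g x - g y\<bar> \<le> \<bar>x - y\<bar>" for x y
  then have g1: "\<bar>g x - g y\<bar> \<le> 1 * \<bar>x - y\<bar>" for x y by simp
  have "(\<integral>x. g x \<partial>mixture s m1 m2) - (\<integral>x. g x \<partial>mixture t m1 m2)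
      = (s - t) * ((\<integral>x. g x \<partial>m1) - (\<integral>x. g x \<partial>m2))"
    using s t by (simp add: integral_mixture_lipschitz[OF m _ _ g1] algebra_simps)
  then show "\<bar>(\<integral>x. g x \<partial>mixture s m1 m2) - (\<integral>x. g x \<partial>mixture t m1 m2)\<bar> \<le> \<bar>s - t\<bar> * w"
    using w g by (simp add: abs_mult kr_le_def mult_left_mono)
qed

section \<open>Couplings and the quadratic Wasserstein distance\<close>

text \<open>The joint law of \<open>f\<close> and \<open>g\<close> is a coupling. \<open>P\<close>
  is left free because \<open>W2_mixture_le\<close> realises two mixtures on a product with the unit
  interval.\<close>

lemma W2_distr_le:
  assumes P: "prob_space P" and f[measurable]: "f \<in> borel_measurable P" and g[measurable]: "g \<in> borel_measurable P"
  shows "W2 (distr P borel f) (distr P borel g) \<le> sqrt (\<integral>p. (f p - g p)\<^sup>2 \<partial>P)"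
proof -
  let ?\<pi> = "distr P (borel \<Otimes>\<^sub>M borel) (\<lambda>p. (f p, g p))"
  have "?\<pi> \<in> couplings (distr P borel f) (distr P borel g)"
    by (auto simp: couplings_def distr_distr comp_def)
  moreover have "(\<integral>z. (fst z - snd z)\<^sup>2 \<partial>?\<pi>) = (\<integral>p. (f p - g p)\<^sup>2 \<partial>P)"
    by (subst integral_distr) auto
  ultimately have "Inf ((\<lambda>\<pi>. \<integral>z. (fst z - snd z)\<^sup>2 \<partial>\<pi>) ` couplings (distr P borel f) (distr P borel g))
      \<le> (\<integral>p. (f p - g p)\<^sup>2 \<partial>P)"
    by (intro cInf_lower) (auto intro!: bdd_belowI[where m=0] image_eqI[where x="?\<pi>"])
  then show ?thesis by (simp add: W2_def)
qed

text \<open>Makes the infimum in \<open>W2\<close> run over a nonempty set; the infimum of the empty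
  set of reals has no useful value.\<close>

lemma product_coupling:
  assumes m: "\<mu> \<in> P2" "\<nu> \<in> P2"
  shows "\<mu> \<Otimes>\<^sub>M \<nu> \<in> couplings \<mu> \<nu>"
proof -
  interpret m: prob_space \<mu> using m by (auto intro: P2_prob_space)
  interpret n: prob_space \<nu> using m by (auto intro: P2_prob_space)
  have "distr (\<mu> \<Otimes>\<^sub>M \<nu>) borel fst = distr (\<mu> \<Otimes>\<^sub>M \<nu>) \<mu> fst"
    using m by (intro distr_cong) (auto simp: P2_sets)
  moreover have "distr (\<mu> \<Otimes>\<^sub>M \<nu>) borel snd = distr (\<mu> \<Otimes>\<^sub>M \<nu>) \<nu> snd"
    using m by (intro distr_cong) (auto simp: P2_sets)
  moreover have "distr (\<mu> \<Otimes>\<^sub>M \<nu>) \<nu> snd = \<nu>"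
  proof (rule measure_eqI)
    fix A assume A: "A \<in> sets (distr (\<mu> \<Otimes>\<^sub>M \<nu>) \<nu> snd)"
    then have "snd -` A \<inter> space (\<mu> \<Otimes>\<^sub>M \<nu>) = space \<mu> \<times> A"
      by (auto simp: space_pair_measure dest: sets.sets_into_space)
    with A show "emeasure (distr (\<mu> \<Otimes>\<^sub>M \<nu>) \<nu> snd) A = emeasure \<nu> A"
      by (simp add: emeasure_distr n.emeasure_pair_measure_Times m.emeasure_space_1)
  qed simp
  ultimately show ?thesis
    using m by (auto simp: couplings_def P2_sets n.distr_pair_fst intro!: sets_pair_measure_cong)
qed

text \<open>Cauchy-Schwarz, in the form that the variance of h(x) - h(y) under the coupling is
  nonnegative.\<close>

lemma coupling_integral_le:
  assumes m: "\<mu> \<in> P2" "\<nu> \<in> P2" and \<pi>: "\<pi> \<in> couplings \<mu> \<nu>"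
    and h: "\<And>x y. \<bar>h x - h y\<bar> \<le> \<bar>x - y\<bar>"
  shows "((\<integral>x. h x \<partial>\<mu>) - (\<integral>x. h x \<partial>\<nu>))\<^sup>2 \<le> (\<integral>z. (fst z - snd z)\<^sup>2 \<partial>\<pi>)"
proof -
  have s[measurable_cong]: "sets \<pi> = sets (borel \<Otimes>\<^sub>M borel)"
    and d: "distr \<pi> borel fst = \<mu>" "distr \<pi> borel snd = \<nu>"
    using \<pi> by (auto simp: couplings_def)
  have "prob_space (distr \<pi> borel fst)" using d m P2_prob_space by simp
  then interpret p: prob_space \<pi> by (rule prob_space_distrD[rotated]) measurable
  have hm[measurable]: "h \<in> borel_measurable borel" using lipschitz_measurable[of h 1] h by simp
  have i: "integrable \<mu> h" "integrable \<nu> h"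
    using integrable_lipschitz[OF m(1), of h 1] integrable_lipschitz[OF m(2), of h 1] h by auto
  then have ih: "integrable \<pi> (\<lambda>z. h (fst z))" "integrable \<pi> (\<lambda>z. h (snd z))"
    unfolding d[symmetric] by (auto simp: integrable_distr_eq)
  have "integrable \<mu> (\<lambda>x. x\<^sup>2)" "integrable \<nu> (\<lambda>x. x\<^sup>2)" using m by (auto simp: P2_def)
  then have "integrable \<pi> (\<lambda>z. (fst z)\<^sup>2)" "integrable \<pi> (\<lambda>z. (snd z)\<^sup>2)"
    unfolding d[symmetric] by (auto simp: integrable_distr_eq)
  then have "integrable \<pi> (\<lambda>z. 2 * (fst z)\<^sup>2 + 2 * (snd z)\<^sup>2)" by simp
  \<comment> \<open>Without integrability the Bochner integral of the cost would take its default
    value 0.\<close>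
  then have sq: "integrable \<pi> (\<lambda>z. (fst z - snd z)\<^sup>2)"
  proof (rule Bochner_Integration.integrable_bound)
    have "norm ((a - b)\<^sup>2) \<le> norm (2 * a\<^sup>2 + 2 * b\<^sup>2)" for a b :: real
      using zero_le_power2[of "a + b", unfolded power2_sum]
      by (simp add: abs_of_nonneg[OF zero_le_power2]) (simp add: power2_diff)
    then show "AE z in \<pi>. norm ((fst z - snd z)\<^sup>2) \<le> norm (2 * (fst z)\<^sup>2 + 2 * (snd z)\<^sup>2)" by simp
  qed measurable
  let ?Z = "\<lambda>z. h (fst z) - h (snd z)"
  have Zle: "(?Z z)\<^sup>2 \<le> (fst z - snd z)\<^sup>2" for z
    using h[of "fst z" "snd z"] by (simp add: abs_le_square_iff)
  have iZ: "integrable \<pi> ?Z" using ih by auto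
  have iZ2: "integrable \<pi> (\<lambda>z. (?Z z)\<^sup>2)"
    by (rule Bochner_Integration.integrable_bound[OF sq]) (use Zle in auto)
  have "(\<integral>x. h x \<partial>\<mu>) - (\<integral>x. h x \<partial>\<nu>) = (\<integral>z. ?Z z \<partial>\<pi>)"
    unfolding d[symmetric] using ih by (simp add: integral_distr)
  moreover have "(\<integral>z. ?Z z \<partial>\<pi>)\<^sup>2 \<le> (\<integral>z. (?Z z)\<^sup>2 \<partial>\<pi>)"
    using p.variance_eq[OF iZ iZ2] p.variance_positive[of ?Z] by simp
  moreover have "\<dots> \<le> (\<integral>z. (fst z - snd z)\<^sup>2 \<partial>\<pi>)"
    using iZ2 sq Zle by (intro integral_mono) auto
  ultimately show ?thesis by simp
qed

text \<open>The first Wasserstein distance is dominated by the second. This is how convergence in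
  \<open>W2\<close>, which the definitions speak of, enters estimates proved for
  \<open>kr_le\<close>.\<close>

lemma kr_le_W2:
  assumes m: "\<mu> \<in> P2" "\<nu> \<in> P2"
  shows "kr_le \<mu> \<nu> (W2 \<mu> \<nu>)"
proof (rule kr_leI)
  have ne: "couplings \<mu> \<nu> \<noteq> {}" using product_coupling[OF m] by auto
  show "0 \<le> W2 \<mu> \<nu>" unfolding W2_def using ne by (auto intro!: cInf_greatest)
  fix h :: "real \<Rightarrow> real" assume h: "\<bar>h x - h y\<bar> \<le> \<bar>x - y\<bar>" for x y
  have "((\<integral>x. h x \<partial>\<mu>) - (\<integral>x. h x \<partial>\<nu>))\<^sup>2
      \<le> Inf ((\<lambda>\<pi>. \<integral>z. (fst z - snd z)\<^sup>2 \<partial>\<pi>) ` couplings \<mu> \<nu>)"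
    using ne coupling_integral_le[OF m _ h] by (intro cInf_greatest) auto
  then show "\<bar>(\<integral>x. h x \<partial>\<mu>) - (\<integral>x. h x \<partial>\<nu>)\<bar> \<le> W2 \<mu> \<nu>"
    unfolding W2_def by (metis real_sqrt_abs real_sqrt_le_iff)
qed

section \<open>Gronwall and Volterra\<close>

text \<open>The right-hand side, as a function of m, has the bound on \<open>f'\<close> as its
  derivative, so adding it to f or to -f gives a nondecreasing function. Monotonicity replaces
  integration of \<open>f'\<close>, which need not be continuous.\<close>

lemma deriv_exp_bound_nonneg:
  fixes f f' :: "real \<Rightarrow> real"
  assumes \<kappa>: "0 < \<kappa>" and m: "0 \<le> m"
    and d: "\<And>r. 0 \<le> r \<Longrightarrow> r \<le> m \<Longrightarrow> (f has_real_derivative f' r) (at r)"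
    and bd: "\<And>r. 0 \<le> r \<Longrightarrow> r \<le> m \<Longrightarrow> \<bar>f' r\<bar> \<le> \<beta> * exp (\<kappa> * r) + \<epsilon>"
  shows "\<bar>f m - f 0\<bar> \<le> \<beta> * (exp (\<kappa> * m) - 1) / \<kappa> + \<epsilon> * m"
proof -
  have "c * f 0 \<le> c * f m + (\<beta> * (exp (\<kappa> * m) - 1) / \<kappa> + \<epsilon> * m)" if c: "\<bar>c\<bar> = 1" for c
  proof -
    let ?g = "\<lambda>r. c * f r + (\<beta> * (exp (\<kappa> * r) - 1) / \<kappa> + \<epsilon> * r)"
    have "?g 0 \<le> ?g m"
    proof (rule DERIV_nonneg_imp_nondecreasing[OF m])
      fix r assume r: "0 \<le> r" "r \<le> m"
      have "(?g has_real_derivative c * f' r + (\<beta> * exp (\<kappa> * r) + \<epsilon>)) (at r)"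
        using \<kappa> by (auto intro!: derivative_eq_intros d[OF r])
      moreover have "\<bar>c * f' r\<bar> = \<bar>f' r\<bar>" using c by (simp add: abs_mult)
      then have "0 \<le> c * f' r + (\<beta> * exp (\<kappa> * r) + \<epsilon>)" using bd[OF r] by linarith
      ultimately show "\<exists>y. (?g has_real_derivative y) (at r) \<and> 0 \<le> y" by blast
    qed
    then show ?thesis by simp
  qed
  from this[of 1] this[of "-1"] show ?thesis by simp
qed

lemma deriv_exp_bound:
  fixes f f' :: "real \<Rightarrow> real"
  assumes \<kappa>: "0 < \<kappa>"
    and d: "\<And>r. \<bar>r\<bar> \<le> \<bar>m\<bar> \<Longrightarrow> (f has_real_derivative f' r) (at r)"
    and bd: "\<And>r. \<bar>r\<bar> \<le> \<bar>m\<bar> \<Longrightarrow> \<bar>f' r\<bar> \<le> \<beta> * exp (\<kappa> * \<bar>r\<bar>) + \<epsilon>"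
  shows "\<bar>f m - f 0\<bar> \<le> \<beta> * (exp (\<kappa> * \<bar>m\<bar>) - 1) / \<kappa> + \<epsilon> * \<bar>m\<bar>"
proof (cases "0 \<le> m")
  case True
  have "\<bar>f' r\<bar> \<le> \<beta> * exp (\<kappa> * r) + \<epsilon>" if "0 \<le> r" "r \<le> m" for r using bd[of r] that by simp
  then show ?thesis using deriv_exp_bound_nonneg[OF \<kappa> True, of f f' \<beta> \<epsilon>] d True by simp
next
  case False
  have "((\<lambda>r. f (- r)) has_real_derivative - f' (- r)) (at r)" if "0 \<le> r" "r \<le> - m" for r
    using DERIV_mirror[of f "f' (- r)" r] d[of "- r"] that by simp
  moreover have "\<bar>- f' (- r)\<bar> \<le> \<beta> * exp (\<kappa> * r) + \<epsilon>" if "0 \<le> r" "r \<le> - m" for r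
    using bd[of "- r"] that by simp
  ultimately show ?thesis
    using deriv_exp_bound_nonneg[OF \<kappa>, of "- m" "\<lambda>r. f (- r)" "\<lambda>r. - f' (- r)" \<beta> \<epsilon>] False by simp
qed

text \<open>The supremum over the family need not be measurable in time, so it is not integrated but
  weighted with \<open>exp (- 2 K \<bar>m\<bar>)\<close>.\<close>

lemma gronwall_sup:
  fixes w w' :: "real \<Rightarrow> 'i \<Rightarrow> real"
  assumes K: "0 < K" and T: "\<bar>m\<bar> \<le> T" and \<epsilon>: "0 \<le> \<epsilon>"
    and d: "\<And>m i. ((\<lambda>m. w m i) has_real_derivative w' m i) (at m)"
    and bdd: "\<And>m i. \<bar>m\<bar> \<le> T \<Longrightarrow> \<bar>w m i\<bar> \<le> M"
    and init: "\<And>i. \<bar>w 0 i\<bar> \<le> \<epsilon>0"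
    and step: "\<And>m i c. \<bar>m\<bar> \<le> T \<Longrightarrow> (\<And>j. \<bar>w m j\<bar> \<le> c) \<Longrightarrow> \<bar>w' m i\<bar> \<le> K * c + \<epsilon>"
  shows "\<bar>w m i\<bar> \<le> 2 * (\<epsilon>0 + T * \<epsilon>) * exp (2 * K * T)"
proof -
  let ?h = "\<lambda>(m, i). exp (- (2 * K * \<bar>m\<bar>)) * \<bar>w m i\<bar>"
  let ?S = "?h ` ({- T..T} \<times> UNIV)"
  define N where "N = Sup ?S"
  have T0: "0 \<le> T" using T by linarith
  have "?h p \<le> M" if pin: "p \<in> {- T..T} \<times> UNIV" for p
  proof -
    obtain r j where p: "p = (r, j)" "\<bar>r\<bar> \<le> T" using pin by (cases p) auto
    have "exp (- (2 * K * \<bar>r\<bar>)) * \<bar>w r j\<bar> \<le> 1 * \<bar>w r j\<bar>"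
      using K by (intro mult_right_mono) auto
    then show ?thesis using bdd[OF p(2), of j] p by simp
  qed
  then have bS: "bdd_above ?S" by (intro bdd_aboveI[where M=M]) auto
  have leN: "\<bar>w r j\<bar> \<le> N * exp (2 * K * \<bar>r\<bar>)" if "\<bar>r\<bar> \<le> T" for r j
  proof -
    have "?h (r, j) \<le> N" unfolding N_def using that by (intro cSup_upper[OF _ bS] imageI) auto
    then show ?thesis by (simp add: exp_minus field_simps)
  qed
  \<comment> \<open>The weight grows at twice the rate \<open>K\<close>, so integrating
    \<open>K * N * exp (2 * K * \<bar>t\<bar>)\<close> returns only half of \<open>N\<close>. In the
    inequality for the supremum this half is absorbed by the left-hand side.\<close>
  have est: "\<bar>w r j\<bar> \<le> \<epsilon>0 + N * (exp (2 * K * \<bar>r\<bar>) - 1) / 2 + \<epsilon> * T" if r: "\<bar>r\<bar> \<le> T" for r j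
  proof -
    have "\<bar>w' t j\<bar> \<le> (K * N) * exp (2 * K * \<bar>t\<bar>) + \<epsilon>" if "\<bar>t\<bar> \<le> \<bar>r\<bar>" for t
      using step[of t "N * exp (2 * K * \<bar>t\<bar>)" j] leN[of t] that r by (simp add: mult.assoc)
    from deriv_exp_bound[of "2 * K" r "\<lambda>m. w m j" "\<lambda>m. w' m j", OF _ d this]
    have "\<bar>w r j - w 0 j\<bar> \<le> N * (exp (2 * K * \<bar>r\<bar>) - 1) / 2 + \<epsilon> * \<bar>r\<bar>"
      using K by simp
    moreover have "\<epsilon> * \<bar>r\<bar> \<le> \<epsilon> * T" using r \<epsilon> by (intro mult_left_mono) auto
    ultimately show ?thesis using init[of j] by linarith
  qed
  have "N \<le> N / 2 + (\<epsilon>0 + T * \<epsilon>)"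
  proof -
    have e0: "0 \<le> \<epsilon>0" using init[of i] by linarith
    have N0: "0 \<le> N" using leN[of 0 i] T0 by simp
    have "?h p \<le> N / 2 + (\<epsilon>0 + T * \<epsilon>)" if pin: "p \<in> {- T..T} \<times> UNIV" for p
    proof -
      obtain r j where p: "p = (r, j)" "\<bar>r\<bar> \<le> T" using pin by (cases p) auto
      have "0 \<le> 2 * K * \<bar>r\<bar>" using K by simp
      then have e1: "1 \<le> exp (2 * K * \<bar>r\<bar>)" by simp
      have "\<epsilon>0 + T * \<epsilon> \<le> (\<epsilon>0 + T * \<epsilon>) * exp (2 * K * \<bar>r\<bar>)"
        using mult_left_mono[OF e1, of "\<epsilon>0 + T * \<epsilon>"] e0 T0 \<epsilon> by simp
      then have "\<bar>w r j\<bar> \<le> (N / 2 + (\<epsilon>0 + T * \<epsilon>)) * exp (2 * K * \<bar>r\<bar>)"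
        using est[OF p(2), of j] N0 by (simp add: algebra_simps diff_divide_distrib)
      then show ?thesis using p by (simp add: exp_minus field_simps)
    qed
    then show ?thesis unfolding N_def using T0 by (intro cSup_least) (force, blast)
  qed
  then have N2: "N \<le> 2 * (\<epsilon>0 + T * \<epsilon>)" by simp
  have "\<bar>w m i\<bar> \<le> N * exp (2 * K * \<bar>m\<bar>)" by (rule leN[OF T])
  also have "\<dots> \<le> N * exp (2 * K * T)"
    using leN[of 0 i] T0 K T by (intro mult_left_mono) auto
  also have "\<dots> \<le> 2 * (\<epsilon>0 + T * \<epsilon>) * exp (2 * K * T)"
    using N2 by (intro mult_right_mono) auto
  finally show ?thesis .
qed

section \<open>Volterra equations and integrals depending on a parameter\<close>

text \<open>Rescaling to the fixed interval \<open>{0..1}\<close> treats both signs of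
  \<open>m\<close> at once and lets continuity in further parameters be read off from an integral
  over a compact set.\<close>

lemma continuous_antiderivative:
  fixes g :: "real \<Rightarrow> real"
  assumes "continuous_on UNIV g"
  shows "((\<lambda>m. m * integral {0..1} (\<lambda>t. g (m * t))) has_real_derivative g m) (at m)"
proof -
  have "isCont g x" for x using assms by (simp add: continuous_on_eq_continuous_at)
  then obtain P where P: "\<And>x. (P has_real_derivative g x) (at x)"
    using einterval_antiderivative[of "-\<infinity>" "\<infinity>" g]
    by (auto simp: has_real_derivative_iff_has_vector_derivative)
  have "m * integral {0..1} (\<lambda>t. g (m * t)) = P m - P 0" for m
  proof -
    have "((\<lambda>t. P (m * t)) has_real_derivative m * g (m * t)) (at t within {0..1})" for t
    proof (rule DERIV_subset[of _ _ _ UNIV])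
      have "((\<lambda>t. P (m * t)) has_real_derivative g (m * t) * m) (at t)"
        by (rule DERIV_chain2[OF P]) (auto intro!: derivative_eq_intros)
      then show "((\<lambda>t. P (m * t)) has_real_derivative m * g (m * t)) (at t)"
        by (simp add: mult.commute)
    qed simp
    then have "((\<lambda>t. m * g (m * t)) has_integral P (m * 1) - P (m * 0)) {0..1}"
      by (intro fundamental_theorem_of_calculus)
        (auto simp: has_real_derivative_iff_has_vector_derivative)
    then show ?thesis by (simp add: integral_unique flip: integral_mult_right)
  qed
  then show ?thesis by (auto intro!: derivative_eq_intros P)
qed

text \<open>Banach's fixed point theorem for bounded continuous functions on the whole plane, after
  division by the weight \<open>exp (\<kappa> * \<bar>r\<bar>)\<close>: a rate of at least
  \<open>2 * K\<close> makes the integral operator a contraction with factor 1 / 2, globally in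
  time. \<open>G\<close> receives the entire section at time r because the equations are nonlocal in
  the position, and it has to be Lipschitz only on bounded continuous sections.\<close>

lemma volterra_exists:
  fixes G :: "real \<Rightarrow> (real \<Rightarrow> real) \<Rightarrow> real \<Rightarrow> real"
  assumes \<kappa>: "0 < \<kappa>" "2 * K \<le> \<kappa>"
    and lip: "\<And>r x u v c. continuous_on UNIV u \<Longrightarrow> continuous_on UNIV v \<Longrightarrow> bounded (range u) \<Longrightarrow>
       bounded (range v) \<Longrightarrow> (\<And>z. \<bar>u z - v z\<bar> \<le> c) \<Longrightarrow> \<bar>G r u x - G r v x\<bar> \<le> K * c"
    and cont: "\<And>u. continuous_on UNIV (\<lambda>p. u (fst p) (snd p)) \<Longrightarrow>
       (\<And>T. \<exists>B. \<forall>r z. \<bar>r\<bar> \<le> T \<longrightarrow> \<bar>u r z\<bar> \<le> B) \<Longrightarrow>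
       continuous_on UNIV (\<lambda>p. G (fst p) (u (fst p)) (snd p))"
    and zero: "\<And>r x. \<bar>G r (\<lambda>_. 0) x\<bar> \<le> C * exp (\<kappa> * \<bar>r\<bar>)"
  obtains u where "continuous_on UNIV (\<lambda>p. u (fst p) (snd p))"
    and "\<And>T. \<exists>B. \<forall>r z. \<bar>r\<bar> \<le> T \<longrightarrow> \<bar>u r z\<bar> \<le> B"
    and "\<And>m x. ((\<lambda>m. u m x) has_real_derivative G m (u m) x) (at m)"
    and "\<And>x. u 0 x = 0"
proof -
  define U where "U \<phi> r z = exp (\<kappa> * \<bar>r\<bar>) * apply_bcontfun \<phi> (r, z)" for \<phi> :: "(real \<times> real) \<Rightarrow>\<^sub>C real" and r z
  define g where "g \<phi> r x = G r (U \<phi> r) x" for \<phi> r x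
  define I where "I \<phi> m x = m * integral {0..1} (\<lambda>t. g \<phi> (m * t) x)" for \<phi> m x
  have Ucont: "continuous_on UNIV (\<lambda>p. U \<phi> (fst p) (snd p))" for \<phi>
    unfolding U_def by (auto intro!: continuous_intros)
  have Ubd: "\<bar>U \<phi> r z\<bar> \<le> exp (\<kappa> * \<bar>r\<bar>) * norm \<phi>" for \<phi> r z
    using norm_bounded[of \<phi> "(r, z)"] by (simp add: U_def abs_mult)
  have Ustrip: "\<exists>B. \<forall>r z. \<bar>r\<bar> \<le> T \<longrightarrow> \<bar>U \<phi> r z\<bar> \<le> B" for \<phi> T
  proof (intro exI allI impI)
    fix r z :: real assume "\<bar>r\<bar> \<le> T"
    then have "exp (\<kappa> * \<bar>r\<bar>) * norm \<phi> \<le> exp (\<kappa> * T) * norm \<phi>"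
      using \<kappa> by (intro mult_right_mono) auto
    with Ubd[of \<phi> r z] show "\<bar>U \<phi> r z\<bar> \<le> exp (\<kappa> * T) * norm \<phi>" by linarith
  qed
  have Usec: "continuous_on UNIV (U \<phi> r)" "bounded (range (U \<phi> r))" for \<phi> r
  proof -
    have "continuous_on UNIV (\<lambda>z. (r, z))" by (intro continuous_intros)
    from continuous_on_compose2[OF Ucont[of \<phi>] this]
    show "continuous_on UNIV (U \<phi> r)" by simp
    show "bounded (range (U \<phi> r))" using Ubd[of \<phi> r] by (auto simp: bounded_iff)
  qed
  have gcont: "continuous_on UNIV (\<lambda>p. g \<phi> (fst p) (snd p))" for \<phi>
    unfolding g_def by (rule cont[OF Ucont Ustrip])
  have gsec: "continuous_on UNIV (\<lambda>r. g \<phi> r x)" for \<phi> x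
  proof -
    have "continuous_on UNIV (\<lambda>r. (r, x))" by (intro continuous_intros)
    from continuous_on_compose2[OF gcont[of \<phi>] this] show ?thesis by simp
  qed
  have gbd: "\<bar>g \<phi> r x\<bar> \<le> (K * norm \<phi> + C) * exp (\<kappa> * \<bar>r\<bar>)" for \<phi> r x
  proof -
    have "\<bar>g \<phi> r x - G r (\<lambda>_. 0) x\<bar> \<le> K * (exp (\<kappa> * \<bar>r\<bar>) * norm \<phi>)"
      unfolding g_def using Ubd[of \<phi> r] by (intro lip Usec) auto
    then show ?thesis using zero[of r x] by (simp add: algebra_simps)
  qed
  have gdiff: "\<bar>g \<phi> r x - g \<theta> r x\<bar> \<le> K * dist \<phi> \<theta> * exp (\<kappa> * \<bar>r\<bar>)" for \<phi> \<theta> r x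
  proof -
    have "\<bar>U \<phi> r z - U \<theta> r z\<bar> \<le> exp (\<kappa> * \<bar>r\<bar>) * dist \<phi> \<theta>" for z
      using dist_bounded[of \<phi> "(r, z)" \<theta>]
      by (simp add: U_def dist_real_def abs_mult flip: right_diff_distrib)
    from lip[OF Usec(1) Usec(1) Usec(2) Usec(2) this]
    show ?thesis unfolding g_def by (simp add: mult_ac)
  qed
  have Ider: "((\<lambda>m. I \<phi> m x) has_real_derivative g \<phi> m x) (at m)" for \<phi> m x
    unfolding I_def using gsec by (rule continuous_antiderivative)
  have I0: "I \<phi> 0 x = 0" for \<phi> x by (simp add: I_def)
  have Icont: "continuous_on UNIV (\<lambda>p. I \<phi> (fst p) (snd p))" for \<phi>
  proof -
    have "continuous_on (UNIV \<times> cbox 0 1) (\<lambda>(p, t). g \<phi> (fst p * t) (snd p))"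
    proof -
      have "continuous_on (UNIV \<times> cbox 0 1) (\<lambda>q :: (real \<times> real) \<times> real. (fst (fst q) * snd q, snd (fst q)))"
        by (intro continuous_intros)
      from continuous_on_compose2[OF gcont[of \<phi>] this]
      show ?thesis by (simp add: case_prod_unfold)
    qed
    from integral_continuous_on_param[OF this]
    show ?thesis unfolding I_def by (auto intro!: continuous_intros)
  qed
  \<comment> \<open>Integrating the weight in time gains a factor 1 / \<kappa>. This gives both the
    boundedness of the image and the contraction.\<close>
  have Ibound: "exp (- (\<kappa> * \<bar>m\<bar>)) * \<bar>h m\<bar> \<le> \<beta> / \<kappa>"
    if h: "\<And>m. (h has_real_derivative h' m) (at m)" "h 0 = 0" "\<And>m. \<bar>h' m\<bar> \<le> \<beta> * exp (\<kappa> * \<bar>m\<bar>)"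
    for h h' :: "real \<Rightarrow> real" and \<beta> m
  proof -
    have \<beta>: "0 \<le> \<beta>" using h(3)[of 0] by simp
    have "\<bar>h m\<bar> \<le> \<beta> * (exp (\<kappa> * \<bar>m\<bar>) - 1) / \<kappa>"
      using deriv_exp_bound[OF \<kappa>(1), of m h h' \<beta> 0] h by simp
    also have "\<dots> \<le> \<beta> / \<kappa> * exp (\<kappa> * \<bar>m\<bar>)"
      using \<beta> \<kappa> by (simp add: divide_right_mono mult_left_mono)
    finally show ?thesis by (simp add: exp_minus field_simps)
  qed
  define J where "J \<phi> p = exp (- (\<kappa> * \<bar>fst p\<bar>)) * I \<phi> (fst p) (snd p)" for \<phi> p
  have Jbc: "J \<phi> \<in> bcontfun" for \<phi>
  proof -
    have "\<bar>J \<phi> p\<bar> \<le> (K * norm \<phi> + C) / \<kappa>" for p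
      using Ibound[where h="\<lambda>m. I \<phi> m (snd p)" and m="fst p", OF Ider I0 gbd] by (simp add: J_def abs_mult)
    then have "bounded (range (J \<phi>))" by (auto simp: bounded_iff)
    moreover have "continuous_on UNIV (J \<phi>)"
      unfolding J_def by (intro continuous_intros Icont)
    ultimately show ?thesis by (simp add: bcontfun_def)
  qed
  have contr: "dist (Bcontfun (J \<phi>)) (Bcontfun (J \<theta>)) \<le> (1 / 2) * dist \<phi> \<theta>" for \<phi> \<theta>
  proof (rule dist_bound)
    fix p
    have "exp (- (\<kappa> * \<bar>fst p\<bar>)) * \<bar>I \<phi> (fst p) (snd p) - I \<theta> (fst p) (snd p)\<bar> \<le> K * dist \<phi> \<theta> / \<kappa>"
      by (rule Ibound[where h'="\<lambda>m. g \<phi> m (snd p) - g \<theta> m (snd p)"])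
        (auto intro!: derivative_eq_intros Ider gdiff simp: I0)
    also have "\<dots> \<le> (1 / 2) * dist \<phi> \<theta>"
      using \<kappa> mult_right_mono[OF \<kappa>(2), of "dist \<phi> \<theta>"] by (simp add: field_simps)
    finally show "dist (apply_bcontfun (Bcontfun (J \<phi>)) p) (apply_bcontfun (Bcontfun (J \<theta>)) p) \<le> (1 / 2) * dist \<phi> \<theta>"
      by (simp add: Bcontfun_inverse[OF Jbc] dist_real_def J_def abs_mult flip: right_diff_distrib)
  qed
  obtain \<phi> where \<phi>: "Bcontfun (J \<phi>) = \<phi>"
    using banach_fix_type[of "1 / 2" "\<lambda>\<phi>. Bcontfun (J \<phi>)"] contr by auto
  have fixp: "U \<phi> m x = I \<phi> m x" for m x
  proof -
    have "apply_bcontfun \<phi> (m, x) = J \<phi> (m, x)"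
      using Bcontfun_inverse[OF Jbc[of \<phi>]] \<phi> by metis
    then show ?thesis by (simp add: U_def J_def exp_minus)
  qed
  show thesis
  proof
    show "continuous_on UNIV (\<lambda>p. U \<phi> (fst p) (snd p))" by (rule Ucont)
    show "\<exists>B. \<forall>r z. \<bar>r\<bar> \<le> T \<longrightarrow> \<bar>U \<phi> r z\<bar> \<le> B" for T by (rule Ustrip)
    show "((\<lambda>m. U \<phi> m x) has_real_derivative G m (U \<phi> m) x) (at m)" for m x
      using Ider[of \<phi> x m] by (simp add: fixp g_def[symmetric])
    show "U \<phi> 0 x = 0" for x by (simp add: fixp I0)
  qed
qed

text \<open>Dominated convergence for difference quotients, which the mean value inequality bounds
  by \<open>g\<close>. Domination is asked for only at distance less than 1 from \<open>m0\<close>,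
  because the bounds it is applied with are local in time.\<close>

lemma has_real_derivative_integral:
  fixes f f' :: "real \<Rightarrow> 'y \<Rightarrow> real"
  assumes d: "\<And>m y. ((\<lambda>m. f m y) has_real_derivative f' m y) (at m)"
    and int: "\<And>m. integrable M (f m)"
    and bd: "\<And>m y. \<bar>m - m0\<bar> < 1 \<Longrightarrow> \<bar>f' m y\<bar> \<le> g y" and g: "integrable M g"
    and f'[measurable]: "f' m0 \<in> borel_measurable M"
  shows "((\<lambda>m. \<integral>y. f m y \<partial>M) has_real_derivative (\<integral>y. f' m0 y \<partial>M)) (at m0)"
  unfolding has_field_derivative_iff tendsto_at_iff_sequentially comp_def
proof safe
  fix X :: "nat \<Rightarrow> real" assume X: "\<forall>i. X i \<in> UNIV - {m0}" "X \<longlonglongrightarrow> m0"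
  then obtain N where N: "\<forall>n\<ge>N. \<bar>X n - m0\<bar> < 1"
    using LIMSEQ_D[OF X(2), of 1] by auto
  \<comment> \<open>Dropping an initial segment puts all points within distance 1 of
    \<open>m0\<close>, where \<open>g\<close> dominates.\<close>
  define Y where "Y i = X (i + N)" for i
  have Y: "Y i \<noteq> m0" "\<bar>Y i - m0\<bar> < 1" "Y \<longlonglongrightarrow> m0" for i
    using X N LIMSEQ_ignore_initial_segment[OF X(2), of N] by (auto simp: Y_def[abs_def])
  have [measurable]: "f m \<in> borel_measurable M" for m using int by auto
  have "(\<lambda>i. \<integral>y. (f (Y i) y - f m0 y) / (Y i - m0) \<partial>M) \<longlonglongrightarrow> (\<integral>y. f' m0 y \<partial>M)"
  proof (rule integral_dominated_convergence[where w=g])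
    show "AE y in M. (\<lambda>i. (f (Y i) y - f m0 y) / (Y i - m0)) \<longlonglongrightarrow> f' m0 y"
    proof (rule AE_I2)
      fix y
      have "\<forall>X. (\<forall>i. X i \<in> UNIV - {m0}) \<longrightarrow> X \<longlonglongrightarrow> m0 \<longrightarrow> (\<lambda>i. (f (X i) y - f m0 y) / (X i - m0)) \<longlonglongrightarrow> f' m0 y"
        using d[of y m0] unfolding has_field_derivative_iff tendsto_at_iff_sequentially comp_def .
      then show "(\<lambda>i. (f (Y i) y - f m0 y) / (Y i - m0)) \<longlonglongrightarrow> f' m0 y" using Y by simp
    qed
    show "AE y in M. norm ((f (Y i) y - f m0 y) / (Y i - m0)) \<le> g y" for i
    proof (rule AE_I2)
      fix y
      have "norm (f (Y i) y - f m0 y) \<le> g y * norm (Y i - m0)"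
      proof (rule field_differentiable_bound[where f="\<lambda>m. f m y" and f'="\<lambda>m. f' m y" and S="{m. \<bar>m - m0\<bar> < 1}"])
        have "{m. \<bar>m - m0\<bar> < 1} = ball m0 1" by (auto simp: dist_real_def)
        then show "convex {m. \<bar>m - m0\<bar> < 1}" by simp
      qed (use Y bd in \<open>auto intro: DERIV_subset[OF d]\<close>)
      then show "norm ((f (Y i) y - f m0 y) / (Y i - m0)) \<le> g y"
        using Y(1)[of i] by (simp add: abs_divide field_simps)
    qed
  qed (use g in measurable)
  then have "(\<lambda>i. ((\<integral>y. f (Y i) y \<partial>M) - (\<integral>y. f m0 y \<partial>M)) / (Y i - m0)) \<longlonglongrightarrow> (\<integral>y. f' m0 y \<partial>M)"
    using int by simp
  then show "(\<lambda>i. ((\<integral>y. f (X i) y \<partial>M) - (\<integral>y. f m0 y \<partial>M)) / (X i - m0)) \<longlonglongrightarrow> (\<integral>y. f' m0 y \<partial>M)"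
    unfolding Y_def by (rule LIMSEQ_offset)
qed

lemma continuous_integral_param:
  fixes f :: "'p::real_normed_vector \<Rightarrow> 'y \<Rightarrow> real"
  assumes M: "finite_measure M"
    and cont: "\<And>y. continuous_on UNIV (\<lambda>p. f p y)"
    and meas[measurable]: "\<And>p. f p \<in> borel_measurable M"
    and bd: "\<And>R. \<exists>B. \<forall>p y. norm p \<le> R \<longrightarrow> \<bar>f p y\<bar> \<le> B"
  shows "continuous_on UNIV (\<lambda>p. \<integral>y. f p y \<partial>M)"
  unfolding continuous_on_sequentially comp_def
proof safe
  interpret finite_measure M by fact
  fix X :: "nat \<Rightarrow> 'p" and a assume X: "X \<longlonglongrightarrow> a"
  then obtain R where "\<And>n. norm (X n) \<le> R" using convergent_imp_Bseq[of X] by (auto simp: convergent_def Bseq_def)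
  moreover obtain B where "\<And>p y. norm p \<le> R \<Longrightarrow> \<bar>f p y\<bar> \<le> B" using bd[of R] by blast
  ultimately have "\<bar>f (X n) y\<bar> \<le> B" for n y by blast
  moreover have "(\<lambda>n. f (X n) y) \<longlonglongrightarrow> f a y" for y
    using cont[of y] X by (auto simp: continuous_on_sequentially comp_def)
  ultimately show "(\<lambda>n. \<integral>y. f (X n) y \<partial>M) \<longlonglongrightarrow> (\<integral>y. f a y \<partial>M)"
    by (intro integral_dominated_convergence[where w="\<lambda>_. B"]) auto
qed

section \<open>The characteristic flow\<close>

lemma mean_value_real:
  fixes f f' :: "real \<Rightarrow> real"
  assumes "\<And>x. (f has_real_derivative f' x) (at x)"
  obtains z where "\<bar>z - y\<bar> \<le> \<bar>x - y\<bar>" "f x - f y = f' z * (x - y)"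
proof (cases x y rule: linorder_cases)
  case less
  with MVT2[of x y f f'] assms obtain z where "x < z" "z < y" "f y - f x = (y - x) * f' z" by blast
  then show ?thesis by (intro that[of z]) (auto simp: algebra_simps)
next
  case greater
  with MVT2[of y x f f'] assms obtain z where "y < z" "z < x" "f x - f y = (x - y) * f' z" by blast
  then show ?thesis by (intro that[of z]) (auto simp: algebra_simps)
qed (use that[of y] in simp)

lemma lipschitz_from_deriv:
  fixes f f' :: "real \<Rightarrow> real"
  assumes "\<And>x. (f has_real_derivative f' x) (at x)" "\<And>x. \<bar>f' x\<bar> \<le> C"
  shows "\<bar>f x - f y\<bar> \<le> C * \<bar>x - y\<bar>"
proof -
  obtain z where "f x - f y = f' z * (x - y)" using mean_value_real[OF assms(1)] by blast
  then show ?thesis using mult_right_mono[OF assms(2), of "\<bar>x - y\<bar>" z] by (simp add: abs_mult)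
qed

lemma taylor_lipschitz_deriv:
  fixes f f' :: "real \<Rightarrow> real"
  assumes "\<And>x. (f has_real_derivative f' x) (at x)" "\<And>x y. \<bar>f' x - f' y\<bar> \<le> C * \<bar>x - y\<bar>"
  shows "\<bar>f x - f y - f' y * (x - y)\<bar> \<le> C * (x - y)\<^sup>2"
proof -
  have C: "0 \<le> C" using assms(2)[of 1 0] by simp
  obtain z where z: "\<bar>z - y\<bar> \<le> \<bar>x - y\<bar>" "f x - f y = f' z * (x - y)"
    using mean_value_real[OF assms(1)] by blast
  then have "f x - f y - f' y * (x - y) = (f' z - f' y) * (x - y)" by (simp add: algebra_simps)
  moreover have "\<bar>f' z - f' y\<bar> \<le> C * \<bar>x - y\<bar>"
    using order_trans[OF assms(2) mult_left_mono[OF z(1) C]] .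
  ultimately show ?thesis
    using mult_right_mono[of "\<bar>f' z - f' y\<bar>" "C * \<bar>x - y\<bar>" "\<bar>x - y\<bar>"]
    by (simp add: abs_mult power2_eq_square mult.assoc)
qed

lemma deriv_le_lipschitz:
  fixes f :: "real \<Rightarrow> real"
  assumes d: "(f has_real_derivative d) (at x)" and lip: "\<And>x y. \<bar>f x - f y\<bar> \<le> C * \<bar>x - y\<bar>"
  shows "\<bar>d\<bar> \<le> C"
proof (rule tendsto_upperbound)
  show "((\<lambda>y. \<bar>(f y - f x) / (y - x)\<bar>) \<longlongrightarrow> \<bar>d\<bar>) (at x)"
    using d unfolding has_field_derivative_iff by (rule tendsto_rabs)
  show "\<forall>\<^sub>F y in at x. \<bar>(f y - f x) / (y - x)\<bar> \<le> C"
    using lip[of _ x] by (auto simp: eventually_at_filter abs_divide divide_le_eq)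
qed simp

lemma continuous_by_modulus:
  fixes h :: "'p::real_normed_vector \<Rightarrow> real"
  assumes "\<And>p0. \<exists>e. (e \<longlongrightarrow> 0) (at p0) \<and> (\<forall>p. \<bar>h p - h p0\<bar> \<le> e p)"
  shows "continuous_on UNIV h"
proof (rule continuous_at_imp_continuous_on, safe)
  fix p0
  obtain e where e: "(e \<longlongrightarrow> 0) (at p0)" "\<And>p. \<bar>h p - h p0\<bar> \<le> e p" using assms[of p0] by blast
  have "((\<lambda>p. h p - h p0) \<longlongrightarrow> 0) (at p0)"
    by (rule tendsto_rabs_zero_cancel, rule real_tendsto_sandwich[OF _ _ tendsto_const e(1)])
      (use e(2) in auto)
  then show "isCont h p0" unfolding isCont_def by (simp add: LIM_zero_iff)
qed

lemma continuous_section: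
  fixes f :: "real \<Rightarrow> real \<Rightarrow> real"
  assumes "continuous_on UNIV (\<lambda>p. f (fst p) (snd p))"
  shows "continuous_on UNIV (f r)" "continuous_on UNIV (\<lambda>r. f r x)"
proof -
  have *: "continuous_on UNIV (\<lambda>z. (r, z))" "continuous_on UNIV (\<lambda>r. (r, x))" by (intro continuous_intros)+
  from continuous_on_compose2[OF assms *(1)] show "continuous_on UNIV (f r)" by simp
  from continuous_on_compose2[OF assms *(2)] show "continuous_on UNIV (\<lambda>r. f r x)" by simp
qed

lemma tendsto_at_zero_continuous:
  fixes e :: "'p::real_normed_vector \<Rightarrow> real"
  assumes "continuous_on UNIV e" "e p0 = 0"
  shows "(e \<longlongrightarrow> 0) (at p0)"
  using assms by (metis UNIV_I continuous_on_eq_continuous_at isCont_def open_UNIV)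

text \<open>The coefficient \<open>\<sigma>\<close> with its spatial derivative \<open>a\<close>, its Lions derivative \<open>D\<close> and the linear
  functional derivative \<open>\<delta>\<close> normalised at \<open>0\<close>.\<close>

locale mean_field_coefficient =
  fixes \<sigma> a :: "real \<Rightarrow> real measure \<Rightarrow> real" and D \<delta> :: "real \<Rightarrow> real measure \<Rightarrow> real \<Rightarrow> real"
    and K :: real and \<omega> :: "real \<Rightarrow> real"
  assumes K1: "1 \<le> K"
    and \<omega>_cont: "isCont \<omega> 0" and \<omega>_0: "\<omega> 0 = 0" and \<omega>_nonneg: "0 \<le> \<omega> w"
    and \<sigma>_bdd: "\<mu> \<in> P2 \<Longrightarrow> \<bar>\<sigma> x \<mu>\<bar> \<le> K"
    and \<sigma>_lip: "\<mu> \<in> P2 \<Longrightarrow> \<nu> \<in> P2 \<Longrightarrow> kr_le \<mu> \<nu> w \<Longrightarrow> \<bar>\<sigma> x \<mu> - \<sigma> y \<nu>\<bar> \<le> K * \<bar>x - y\<bar> + K * w"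
    and \<sigma>_deriv: "\<mu> \<in> P2 \<Longrightarrow> ((\<lambda>x. \<sigma> x \<mu>) has_real_derivative a x \<mu>) (at x)"
    and a_mod: "\<mu> \<in> P2 \<Longrightarrow> \<nu> \<in> P2 \<Longrightarrow> kr_le \<mu> \<nu> w \<Longrightarrow> \<bar>a x \<mu> - a y \<nu>\<bar> \<le> K * \<bar>x - y\<bar> + \<omega> w"
    and D_bdd: "\<mu> \<in> P2 \<Longrightarrow> \<bar>D x \<mu> y\<bar> \<le> K"
    and D_mod: "\<mu> \<in> P2 \<Longrightarrow> \<nu> \<in> P2 \<Longrightarrow> kr_le \<mu> \<nu> w \<Longrightarrow>
      \<bar>D x1 \<mu> y1 - D x2 \<nu> y2\<bar> \<le> K * \<bar>x1 - x2\<bar> + K * \<bar>y1 - y2\<bar> + \<omega> w"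
    and \<delta>_deriv: "\<mu> \<in> P2 \<Longrightarrow> (\<delta> x \<mu> has_real_derivative D x \<mu> y) (at y)"
    and \<delta>_0: "\<delta> x \<mu> 0 = 0"
    and \<sigma>_expand: "\<mu> \<in> P2 \<Longrightarrow> \<nu> \<in> P2 \<Longrightarrow> kr_le \<nu> \<mu> w \<Longrightarrow>
      \<bar>\<sigma> x \<nu> - \<sigma> x \<mu> - ((\<integral>y. \<delta> x \<mu> y \<partial>\<nu>) - (\<integral>y. \<delta> x \<mu> y \<partial>\<mu>))\<bar> \<le> \<omega> w * w"
begin

lemma K_pos: "0 < K" and K_nonneg: "0 \<le> K"
  using K1 by auto

lemma a_lip: "\<mu> \<in> P2 \<Longrightarrow> \<bar>a x \<mu> - a y \<mu>\<bar> \<le> K * \<bar>x - y\<bar>"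
  using a_mod[OF _ _ kr_le_refl, of \<mu> x y] \<omega>_0 by simp

lemma a_bdd: "\<mu> \<in> P2 \<Longrightarrow> \<bar>a x \<mu>\<bar> \<le> K"
  using deriv_le_lipschitz[OF \<sigma>_deriv, of \<mu> K x] \<sigma>_lip[OF _ _ kr_le_refl, of \<mu>] by auto

lemma \<sigma>_taylor: "\<mu> \<in> P2 \<Longrightarrow> \<bar>\<sigma> x \<mu> - \<sigma> y \<mu> - a y \<mu> * (x - y)\<bar> \<le> K * (x - y)\<^sup>2"
  using taylor_lipschitz_deriv[of "\<lambda>x. \<sigma> x \<mu>" "\<lambda>x. a x \<mu>" K x y] \<sigma>_deriv a_lip by blast

lemma D_lip: "\<mu> \<in> P2 \<Longrightarrow> \<bar>D x1 \<mu> y1 - D x2 \<mu> y2\<bar> \<le> K * \<bar>x1 - x2\<bar> + K * \<bar>y1 - y2\<bar>"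
  using D_mod[OF _ _ kr_le_refl, of \<mu> x1 y1 x2 y2] \<omega>_0 by simp

lemma \<delta>_lip: "\<mu> \<in> P2 \<Longrightarrow> \<bar>\<delta> x \<mu> y - \<delta> x \<mu> z\<bar> \<le> K * \<bar>y - z\<bar>"
  using lipschitz_from_deriv[OF \<delta>_deriv D_bdd] by blast

lemma \<delta>_taylor: "\<mu> \<in> P2 \<Longrightarrow> \<bar>\<delta> x \<mu> y - \<delta> x \<mu> z - D x \<mu> z * (y - z)\<bar> \<le> K * (y - z)\<^sup>2"
  using taylor_lipschitz_deriv[of "\<delta> x \<mu>" "D x \<mu>" K y z] \<delta>_deriv D_lip[of \<mu> x _ x] by auto

lemma \<delta>_mod:
  assumes "\<mu> \<in> P2" "\<nu> \<in> P2" "kr_le \<mu> \<nu> w"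
  shows "\<bar>\<delta> x1 \<mu> y - \<delta> x2 \<nu> y\<bar> \<le> (K * \<bar>x1 - x2\<bar> + \<omega> w) * \<bar>y\<bar>"
proof -
  have "\<bar>(\<delta> x1 \<mu> y - \<delta> x2 \<nu> y) - (\<delta> x1 \<mu> 0 - \<delta> x2 \<nu> 0)\<bar> \<le> (K * \<bar>x1 - x2\<bar> + \<omega> w) * \<bar>y - 0\<bar>"
  proof (rule lipschitz_from_deriv)
    show "((\<lambda>y. \<delta> x1 \<mu> y - \<delta> x2 \<nu> y) has_real_derivative D x1 \<mu> y - D x2 \<nu> y) (at y)" for y
      by (intro DERIV_diff \<delta>_deriv assms)
    show "\<bar>D x1 \<mu> y - D x2 \<nu> y\<bar> \<le> K * \<bar>x1 - x2\<bar> + \<omega> w" for y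
      using D_mod[OF assms, of x1 y x2 y] by simp
  qed
  then show ?thesis by (simp add: \<delta>_0)
qed

lemma \<omega>_tendsto: "(g \<longlongrightarrow> 0) F \<Longrightarrow> ((\<lambda>p. \<omega> (g p)) \<longlongrightarrow> 0) F"
  using isCont_tendsto_compose[OF \<omega>_cont] \<omega>_0 by simp

section \<open>Existence, uniqueness and semigroup property of the flow\<close>

text \<open>The fixed point is sought for the displacement from the starting point, which is
  bounded, whereas the position is not. Position and law each contribute \<open>K\<close> to the
  Lipschitz constant, hence \<open>2 * K\<close> and the weight \<open>4 * K\<close>.\<close>

lemma flow_exists:
  assumes \<mu>: "\<mu> \<in> P2"
  shows "\<exists>X. continuous_on UNIV (\<lambda>p. X (fst p) (snd p)) \<and> (\<forall>m x. \<bar>X m x - x\<bar> \<le> K * \<bar>m\<bar>) \<and>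
    (\<forall>m x. ((\<lambda>m. X m x) has_real_derivative \<sigma> (X m x) (distr \<mu> borel (X m))) (at m)) \<and>
    (\<forall>x. X 0 x = x)"
proof -
  define G where "G r u x = \<sigma> (x + u x) (distr \<mu> borel (\<lambda>z. z + u z))" for r :: real and u x
  have shift: "distr \<mu> borel (\<lambda>z. z + u z) \<in> P2" "(\<lambda>z. z + u z) \<in> borel_measurable borel"
    if "continuous_on UNIV u" "\<And>z. \<bar>u z\<bar> \<le> B" for u and B :: real
  proof -
    show m: "(\<lambda>z. z + u z) \<in> borel_measurable borel"
      using that by (intro borel_measurable_continuous_onI continuous_intros)
    show "distr \<mu> borel (\<lambda>z. z + u z) \<in> P2"
      using that by (intro distr_P2[OF \<mu> m, of B]) simp
  qed
  have bdE: "\<exists>B. \<forall>z. \<bar>u z\<bar> \<le> B" if "bounded (range u)" for u :: "real \<Rightarrow> real"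
    using that by (auto simp: bounded_iff)
  obtain u where u: "continuous_on UNIV (\<lambda>p. u (fst p) (snd p))"
    "\<And>T. \<exists>B. \<forall>r z. \<bar>r\<bar> \<le> T \<longrightarrow> \<bar>u r z\<bar> \<le> B"
    "\<And>m x. ((\<lambda>m. u m x) has_real_derivative G m (u m) x) (at m)" "\<And>x. u 0 x = 0"
  proof (rule volterra_exists[of "4 * K" "2 * K" G K])
    fix r x c :: real and u v :: "real \<Rightarrow> real"
    assume uv: "continuous_on UNIV u" "continuous_on UNIV v" "bounded (range u)" "bounded (range v)"
      and c: "\<And>z. \<bar>u z - v z\<bar> \<le> c"
    obtain A B where AB: "\<And>z. \<bar>u z\<bar> \<le> A" "\<And>z. \<bar>v z\<bar> \<le> B" using uv(3,4)[THEN bdE] by blast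
    have "kr_le (distr \<mu> borel (\<lambda>z. z + u z)) (distr \<mu> borel (\<lambda>z. z + v z)) c"
      using AB c shift[OF uv(1) AB(1)] shift[OF uv(2) AB(2)]
      by (intro kr_le_distr_uniform[OF \<mu>]) auto
    from \<sigma>_lip[OF shift(1)[OF uv(1) AB(1)] shift(1)[OF uv(2) AB(2)] this, of "x + u x" "x + v x"]
      mult_left_mono[OF c[of x] K_nonneg]
    show "\<bar>G r u x - G r v x\<bar> \<le> 2 * K * c" by (simp add: G_def)
  next
    fix u :: "real \<Rightarrow> real \<Rightarrow> real"
    assume u: "continuous_on UNIV (\<lambda>p. u (fst p) (snd p))"
      and bd: "\<And>T. \<exists>B. \<forall>r z. \<bar>r\<bar> \<le> T \<longrightarrow> \<bar>u r z\<bar> \<le> B"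
    note sec = continuous_section[OF u]
    have bdr: "\<exists>B. \<forall>z. \<bar>u r z\<bar> \<le> B" for r using bd[of "\<bar>r\<bar>"] by auto
    show "continuous_on UNIV (\<lambda>p. G (fst p) (u (fst p)) (snd p))"
    proof (rule continuous_by_modulus)
      fix p0 :: "real \<times> real"
      \<comment> \<open>The displacement is continuous in time only pointwise in z, hence the mean
        distance between the two maps instead of its supremum; it tends to 0 by dominated
        convergence.\<close>
      let ?I = "\<lambda>p :: real \<times> real. \<integral>z. \<bar>(z + u (fst p) z) - (z + u (fst p0) z)\<bar> \<partial>\<mu>"
      let ?e = "\<lambda>p. K * \<bar>(snd p + u (fst p) (snd p)) - (snd p0 + u (fst p0) (snd p0))\<bar> + K * ?I p"
      have "continuous_on UNIV ?I"
      proof (rule continuous_integral_param)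
        show "finite_measure \<mu>" using P2_prob_space[OF \<mu>] by (simp add: prob_space_def)
        have "continuous_on UNIV (\<lambda>p. u (fst p) z)" for z
          using continuous_on_compose2[OF sec(2), of UNIV fst z] by (simp add: continuous_on_fst)
        then show "continuous_on UNIV (\<lambda>p. \<bar>(z + u (fst p) z) - (z + u (fst p0) z)\<bar>)" for z
          by (intro continuous_intros)
        show "(\<lambda>z. \<bar>(z + u (fst p) z) - (z + u (fst p0) z)\<bar>) \<in> borel_measurable \<mu>" for p
          by (intro P2_measurable[OF \<mu>] borel_measurable_continuous_onI continuous_intros sec)
        fix R
        obtain A where A: "\<And>r z. \<bar>r\<bar> \<le> R \<Longrightarrow> \<bar>u r z\<bar> \<le> A" using bd[of R] by blast
        obtain B where B: "\<And>z. \<bar>u (fst p0) z\<bar> \<le> B" using bdr by blast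
        have AB: "\<bar>\<bar>(z + u (fst p) z) - (z + u (fst p0) z)\<bar>\<bar> \<le> A + B" if "norm p \<le> R" for p :: "real \<times> real" and z
        proof -
          have "\<bar>fst p\<bar> \<le> R" using norm_fst_le[of "fst p" "snd p"] that by simp
          from A[OF this, of z] B[of z] show ?thesis by linarith
        qed
        show "\<exists>B. \<forall>(p :: real \<times> real) z. norm p \<le> R \<longrightarrow> \<bar>\<bar>(z + u (fst p) z) - (z + u (fst p0) z)\<bar>\<bar> \<le> B"
          by (intro exI[of _ "A + B"] allI impI AB)
      qed
      then have "(?e \<longlongrightarrow> 0) (at p0)"
        by (intro tendsto_at_zero_continuous continuous_intros u) auto
      moreover have "\<bar>G (fst p) (u (fst p)) (snd p) - G (fst p0) (u (fst p0)) (snd p0)\<bar> \<le> ?e p" for p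
      proof -
        obtain A B where AB: "\<And>z. \<bar>u (fst p) z\<bar> \<le> A" "\<And>z. \<bar>u (fst p0) z\<bar> \<le> B" using bdr by blast
        have "kr_le (distr \<mu> borel (\<lambda>z. z + u (fst p) z)) (distr \<mu> borel (\<lambda>z. z + u (fst p0) z)) (?I p)"
          using AB shift[OF sec(1) AB(1)] shift[OF sec(1) AB(2)] by (intro kr_le_distr[OF \<mu>, where b=A and c=B]) auto
        from \<sigma>_lip[OF shift(1)[OF sec(1) AB(1)] shift(1)[OF sec(1) AB(2)] this]
        show ?thesis by (simp add: G_def)
      qed
      ultimately show "\<exists>e. (e \<longlongrightarrow> 0) (at p0) \<and>
        (\<forall>p. \<bar>G (fst p) (u (fst p)) (snd p) - G (fst p0) (u (fst p0)) (snd p0)\<bar> \<le> e p)" by blast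
    qed
  next
    fix r x :: real
    have "\<bar>G r (\<lambda>_. 0) x\<bar> \<le> K" unfolding G_def by (intro \<sigma>_bdd shift[where B=0]) auto
    also have "\<dots> \<le> K * exp (4 * K * \<bar>r\<bar>)" using K_pos by simp
    finally show "\<bar>G r (\<lambda>_. 0) x\<bar> \<le> K * exp (4 * K * \<bar>r\<bar>)" .
  qed (use K_pos in auto)
  show ?thesis
  proof (intro exI[of _ "\<lambda>m x. x + u m x"] conjI allI)
    show "continuous_on UNIV (\<lambda>p. snd p + u (fst p) (snd p))" by (intro continuous_intros u)
    have P: "distr \<mu> borel (\<lambda>z. z + u m z) \<in> P2" for m
    proof -
      obtain B where "\<And>z. \<bar>u m z\<bar> \<le> B" using u(2)[of "\<bar>m\<bar>"] by auto
      then show ?thesis by (intro shift(1) continuous_section[OF u(1)])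
    qed
    \<comment> \<open>The fixed point is only known to be bounded on time strips; the linear bound
      comes from the bound \<open>K\<close> on the velocity.\<close>
    have "\<bar>u m x - u 0 x\<bar> \<le> K * \<bar>m - 0\<bar>" for m x
      using u(3)[of x] by (rule lipschitz_from_deriv) (auto simp: G_def intro!: \<sigma>_bdd P)
    then show "\<bar>x + u m x - x\<bar> \<le> K * \<bar>m\<bar>" for m x by (simp add: u(4))
    show "((\<lambda>m. x + u m x) has_real_derivative \<sigma> (x + u m x) (distr \<mu> borel (\<lambda>x. x + u m x))) (at m)" for m x
      using u(3)[of x m] by (auto intro!: derivative_eq_intros simp: G_def)
  qed (simp add: u(4))
qed

text \<open>A choice among solutions that are jointly continuous and close to the identity;
  \<open>flow_unique\<close> shows that for a measure in \<open>P2\<close> there is only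
  one.\<close>

definition flow :: "real measure \<Rightarrow> real \<Rightarrow> real \<Rightarrow> real" where
  "flow \<mu> = (SOME X. continuous_on UNIV (\<lambda>p. X (fst p) (snd p)) \<and> (\<forall>m x. \<bar>X m x - x\<bar> \<le> K * \<bar>m\<bar>) \<and>
    (\<forall>m x. ((\<lambda>m. X m x) has_real_derivative \<sigma> (X m x) (distr \<mu> borel (X m))) (at m)) \<and>
    (\<forall>x. X 0 x = x))"

definition law :: "real measure \<Rightarrow> real \<Rightarrow> real measure" where
  "law \<mu> m = distr \<mu> borel (flow \<mu> m)"

lemma
  assumes "\<mu> \<in> P2"
  shows flow_cont: "continuous_on UNIV (\<lambda>p. flow \<mu> (fst p) (snd p))"
    and flow_near: "\<bar>flow \<mu> m x - x\<bar> \<le> K * \<bar>m\<bar>"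
    and flow_deriv: "((\<lambda>m. flow \<mu> m x) has_real_derivative \<sigma> (flow \<mu> m x) (law \<mu> m)) (at m)"
    and flow_0: "flow \<mu> 0 x = x"
  using someI_ex[OF flow_exists[OF assms]] unfolding flow_def[symmetric] law_def by auto

lemma flow_measurable: "\<mu> \<in> P2 \<Longrightarrow> flow \<mu> m \<in> borel_measurable borel"
  by (intro borel_measurable_continuous_onI continuous_section[OF flow_cont])

lemma law_P2:
  assumes \<mu>: "\<mu> \<in> P2"
  shows "law \<mu> m \<in> P2"
  unfolding law_def by (rule distr_P2(1)[OF \<mu> flow_measurable[OF \<mu>] flow_near[OF \<mu>]])

lemma law_0:
  assumes "\<mu> \<in> P2"
  shows "law \<mu> 0 = \<mu>"
proof -
  have "flow \<mu> 0 = (\<lambda>x. x)" using flow_0[OF assms] by auto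
  then show ?thesis
    unfolding law_def using assms by (simp add: distr_id2[OF P2_sets[symmetric]])
qed

lemma integral_law:
  fixes f :: "real \<Rightarrow> real"
  shows "\<mu> \<in> P2 \<Longrightarrow> f \<in> borel_measurable borel \<Longrightarrow> (\<integral>y. f y \<partial>law \<mu> m) = (\<integral>z. f (flow \<mu> m z) \<partial>\<mu>)"
  unfolding law_def by (rule integral_distr) (auto intro: P2_measurable flow_measurable)

lemma flow_time_lip: "\<mu> \<in> P2 \<Longrightarrow> \<bar>flow \<mu> m x - flow \<mu> m' x\<bar> \<le> K * \<bar>m - m'\<bar>"
  by (rule lipschitz_from_deriv[OF flow_deriv]) (auto intro: \<sigma>_bdd law_P2)

lemma law_time_kr:
  assumes \<mu>: "\<mu> \<in> P2"
  shows "kr_le (law \<mu> m) (law \<mu> m') (K * \<bar>m - m'\<bar>)"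
  unfolding law_def
  by (rule kr_le_distr_uniform[OF \<mu> flow_measurable[OF \<mu>] flow_near[OF \<mu>]
        flow_measurable[OF \<mu>] flow_near[OF \<mu>] flow_time_lip[OF \<mu>]])

text \<open>The laws of the two families differ by at most the supremum of \<bar>Z - W\<bar>, so
  Gronwall forces this supremum to be 0. The offset \<open>b\<close> admits families that do not
  start at the identity, as in the semigroup property. Measurability in x is enough, so that every
  solution in the sense of \<open>solves_flow\<close> is covered.\<close>

lemma flow_unique:
  assumes \<mu>: "\<mu> \<in> P2"
    and Z: "\<And>m. Z m \<in> borel_measurable borel" "\<And>m x. \<bar>Z m x - x\<bar> \<le> b + K * \<bar>m\<bar>"
      "\<And>m x. ((\<lambda>m. Z m x) has_real_derivative \<sigma> (Z m x) (distr \<mu> borel (Z m))) (at m)"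
    and W: "\<And>m. W m \<in> borel_measurable borel" "\<And>m x. \<bar>W m x - x\<bar> \<le> b + K * \<bar>m\<bar>"
      "\<And>m x. ((\<lambda>m. W m x) has_real_derivative \<sigma> (W m x) (distr \<mu> borel (W m))) (at m)"
    and init: "\<And>x. Z 0 x = W 0 x"
  shows "Z m x = W m x"
proof -
  have "\<bar>Z m x - W m x\<bar> \<le> 2 * (0 + \<bar>m\<bar> * 0) * exp (2 * (2 * K) * \<bar>m\<bar>)"
  proof (rule gronwall_sup[where w="\<lambda>m x. Z m x - W m x" and K="2 * K"
        and w'="\<lambda>m x. \<sigma> (Z m x) (distr \<mu> borel (Z m)) - \<sigma> (W m x) (distr \<mu> borel (W m))"
        and M="2 * (b + K * \<bar>m\<bar>)"])
    fix r y assume r: "\<bar>r\<bar> \<le> \<bar>m\<bar>"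
    show "\<bar>Z r y - W r y\<bar> \<le> 2 * (b + K * \<bar>m\<bar>)"
    proof -
      have "\<bar>Z r y - W r y\<bar> \<le> \<bar>Z r y - y\<bar> + \<bar>W r y - y\<bar>" by linarith
      also have "\<dots> \<le> (b + K * \<bar>r\<bar>) + (b + K * \<bar>r\<bar>)" by (intro add_mono Z W)
      finally show ?thesis using mult_left_mono[OF r K_nonneg] by simp
    qed
  next
    fix r y c assume c: "\<And>j. \<bar>Z r j - W r j\<bar> \<le> c"
    have "kr_le (distr \<mu> borel (Z r)) (distr \<mu> borel (W r)) c"
      using Z W c by (intro kr_le_distr_uniform[OF \<mu>]) auto
    from \<sigma>_lip[OF distr_P2(1)[OF \<mu> Z(1,2)] distr_P2(1)[OF \<mu> W(1,2)] this, of "Z r y" "W r y"]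
      mult_left_mono[OF c[of y] K_nonneg]
    show "\<bar>\<sigma> (Z r y) (distr \<mu> borel (Z r)) - \<sigma> (W r y) (distr \<mu> borel (W r))\<bar> \<le> 2 * K * c + 0"
      by simp
  qed (use Z W init K_pos in \<open>auto intro: DERIV_diff\<close>)
  then show ?thesis by simp
qed

text \<open>Restarting at time s and continuing past it are two families of maps of the same initial
  point, driven by images of the same \<open>\<mu>\<close> and equal at m = 0; uniqueness identifies
  them.\<close>

lemma flow_semigroup:
  assumes \<mu>: "\<mu> \<in> P2"
  shows "flow (law \<mu> s) m (flow \<mu> s x) = flow \<mu> (s + m) x"
    and "law (law \<mu> s) m = law \<mu> (s + m)"
proof -
  note [measurable] = flow_measurable[OF \<mu>] flow_measurable[OF law_P2[OF \<mu>]]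
  \<comment> \<open>Seen from \<open>\<mu>\<close>, the law of the restarted family is the law of
    the flow started from \<open>law \<mu> s\<close>. Hence the restarted family obeys an equation
    of the form required by \<open>flow_unique\<close>.\<close>
  have dist: "distr \<mu> borel (\<lambda>x. flow (law \<mu> s) m (flow \<mu> s x)) = law (law \<mu> s) m" for m
    unfolding law_def[of \<mu>] law_def[of "distr \<mu> borel (flow \<mu> s)"]
    by (subst distr_distr) (auto simp: comp_def law_def[symmetric] intro: P2_measurable[OF \<mu>])
  have eq: "flow (law \<mu> s) m (flow \<mu> s x) = flow \<mu> (s + m) x" for m x
  proof (rule flow_unique[OF \<mu>, where b="K * \<bar>s\<bar>" and Z="\<lambda>m x. flow (law \<mu> s) m (flow \<mu> s x)"
        and W="\<lambda>m x. flow \<mu> (s + m) x"])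
    fix m x
    show "\<bar>flow (law \<mu> s) m (flow \<mu> s x) - x\<bar> \<le> K * \<bar>s\<bar> + K * \<bar>m\<bar>"
      using flow_near[OF \<mu>, of s x] flow_near[OF law_P2[OF \<mu>], of s m "flow \<mu> s x"] by linarith
    have "K * \<bar>s + m\<bar> \<le> K * \<bar>s\<bar> + K * \<bar>m\<bar>"
      using mult_left_mono[OF abs_triangle_ineq[of s m] K_nonneg] by (simp add: distrib_left)
    then show "\<bar>flow \<mu> (s + m) x - x\<bar> \<le> K * \<bar>s\<bar> + K * \<bar>m\<bar>"
      using flow_near[OF \<mu>, of "s + m" x] by linarith
    show "((\<lambda>m. flow (law \<mu> s) m (flow \<mu> s x)) has_real_derivative
        \<sigma> (flow (law \<mu> s) m (flow \<mu> s x)) (distr \<mu> borel (\<lambda>x. flow (law \<mu> s) m (flow \<mu> s x)))) (at m)"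
      unfolding dist by (rule flow_deriv[OF law_P2[OF \<mu>]])
    show "((\<lambda>m. flow \<mu> (s + m) x) has_real_derivative \<sigma> (flow \<mu> (s + m) x) (distr \<mu> borel (\<lambda>x. flow \<mu> (s + m) x))) (at m)"
      using DERIV_shift[of "\<lambda>r. flow \<mu> r x" _ m s] flow_deriv[OF \<mu>, of x "m + s"]
      by (simp add: law_def add.commute)
  qed (auto simp: flow_0[OF law_P2[OF \<mu>]])
  then show "flow (law \<mu> s) m (flow \<mu> s x) = flow \<mu> (s + m) x" .
  show "law (law \<mu> s) m = law \<mu> (s + m)"
    using dist[of m] eq[of m] by (simp add: law_def[of \<mu> "s + m"])
qed

section \<open>Lipschitz and stability constants of the flow\<close>

definition lip_const :: "real \<Rightarrow> real" where "lip_const T = 2 * exp (2 * K * T)"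

text \<open>The second summand is the Gronwall bound for two flows from the same point; the first is
  the cost of pushing two initial measures by one Lipschitz flow. The sum controls both the flow and
  the law.\<close>

definition stab_const :: "real \<Rightarrow> real" where "stab_const T = lip_const T + 2 * T * (K * lip_const T) * exp (4 * K * T)"

lemma lip_const_pos: "0 < lip_const T" by (simp add: lip_const_def)

lemma flow_lip:
  assumes \<mu>: "\<mu> \<in> P2" and m: "\<bar>m\<bar> \<le> T"
  shows "\<bar>flow \<mu> m x - flow \<mu> m y\<bar> \<le> lip_const T * \<bar>x - y\<bar>"
proof -
  have "\<bar>flow \<mu> m x - flow \<mu> m y\<bar> \<le> 2 * (\<bar>x - y\<bar> + T * 0) * exp (2 * K * T)"
  \<comment> \<open>Both trajectories see the same law, so a single pair of points suffices and the
    index type is \<open>unit\<close>.\<close>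
  proof (rule gronwall_sup[where w="\<lambda>m (_::unit). flow \<mu> m x - flow \<mu> m y"
        and w'="\<lambda>m _. \<sigma> (flow \<mu> m x) (law \<mu> m) - \<sigma> (flow \<mu> m y) (law \<mu> m)"
        and M="\<bar>x - y\<bar> + 2 * (K * T)"])
    fix r :: real assume r: "\<bar>r\<bar> \<le> T"
    show "\<bar>flow \<mu> r x - flow \<mu> r y\<bar> \<le> \<bar>x - y\<bar> + 2 * (K * T)"
      using flow_near[OF \<mu>, of r x] flow_near[OF \<mu>, of r y] mult_left_mono[OF r K_nonneg] by linarith
  next
    fix r c assume "\<And>j::unit. \<bar>flow \<mu> r x - flow \<mu> r y\<bar> \<le> c"
    then have "K * \<bar>flow \<mu> r x - flow \<mu> r y\<bar> \<le> K * c" using K_nonneg by (intro mult_left_mono) auto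
    with \<sigma>_lip[OF law_P2[OF \<mu>] law_P2[OF \<mu>] kr_le_refl, of "flow \<mu> r x" r "flow \<mu> r y"]
    show "\<bar>\<sigma> (flow \<mu> r x) (law \<mu> r) - \<sigma> (flow \<mu> r y) (law \<mu> r)\<bar> \<le> K * c + 0" by simp
  qed (use m K_pos flow_deriv[OF \<mu>] in \<open>auto intro!: DERIV_diff simp: flow_0[OF \<mu>]\<close>)
  then show ?thesis by (simp add: lip_const_def mult_ac)
qed

lemma flow_stab:
  assumes \<mu>: "\<mu> \<in> P2" and \<nu>: "\<nu> \<in> P2" and w: "kr_le \<mu> \<nu> w" and m: "\<bar>m\<bar> \<le> T"
  shows "\<bar>flow \<mu> m x - flow \<nu> m x\<bar> \<le> stab_const T * w"
    and "kr_le (law \<mu> m) (law \<nu> m) (stab_const T * w)"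
proof -
  have w0: "0 \<le> w" using w by (rule kr_le_nonneg)
  \<comment> \<open>Triangle inequality through the image of \<open>\<mu>\<close> under the flow of
    \<open>\<nu>\<close>: first the maps differ, then the initial measures.\<close>
  have kr: "kr_le (law \<mu> r) (law \<nu> r) (c + lip_const T * w)"
    if r: "\<bar>r\<bar> \<le> T" and c: "\<And>j. \<bar>flow \<mu> r j - flow \<nu> r j\<bar> \<le> c" for r c
    unfolding law_def
    by (rule kr_le_trans[OF kr_le_distr_uniform[OF \<mu> flow_measurable[OF \<mu>] flow_near[OF \<mu>]
            flow_measurable[OF \<nu>] flow_near[OF \<nu>] c] kr_le_push[OF w \<mu> \<nu> flow_lip[OF \<nu> r]]])
  have d: "\<bar>flow \<mu> m x - flow \<nu> m x\<bar> \<le> 2 * (0 + T * (K * (lip_const T * w))) * exp (2 * (2 * K) * T)" for x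
  proof (rule gronwall_sup[where w="\<lambda>m x. flow \<mu> m x - flow \<nu> m x"
        and w'="\<lambda>m x. \<sigma> (flow \<mu> m x) (law \<mu> m) - \<sigma> (flow \<nu> m x) (law \<nu> m)"
        and M="2 * (K * T)"])
    fix r y :: real assume r: "\<bar>r\<bar> \<le> T"
    show "\<bar>flow \<mu> r y - flow \<nu> r y\<bar> \<le> 2 * (K * T)"
      using flow_near[OF \<mu>, of r y] flow_near[OF \<nu>, of r y] mult_left_mono[OF r K_nonneg] by linarith
    fix c assume c: "\<And>j. \<bar>flow \<mu> r j - flow \<nu> r j\<bar> \<le> c"
    from \<sigma>_lip[OF law_P2[OF \<mu>] law_P2[OF \<nu>] kr[OF r c], of "flow \<mu> r y" "flow \<nu> r y"]
      mult_left_mono[OF c[of y] K_nonneg]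
    show "\<bar>\<sigma> (flow \<mu> r y) (law \<mu> r) - \<sigma> (flow \<nu> r y) (law \<nu> r)\<bar> \<le> 2 * K * c + K * (lip_const T * w)"
      by (simp add: algebra_simps)
  qed (use m K_pos flow_deriv[OF \<mu>] flow_deriv[OF \<nu>] w0 lip_const_pos[of T] in
      \<open>auto intro!: DERIV_diff simp: flow_0[OF \<mu>] flow_0[OF \<nu>]\<close>)
  have eq: "2 * (0 + T * (K * (lip_const T * w))) * exp (2 * (2 * K) * T) + lip_const T * w = stab_const T * w"
    by (simp add: stab_const_def algebra_simps)
  with kr[OF m d] show "kr_le (law \<mu> m) (law \<nu> m) (stab_const T * w)" by simp
  show "\<bar>flow \<mu> m x - flow \<nu> m x\<bar> \<le> stab_const T * w"
    using d[of x] eq mult_nonneg_nonneg[OF less_imp_le[OF lip_const_pos[of T]] w0] by linarith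
qed

lemma stab_const_nonneg: "0 \<le> T \<Longrightarrow> 0 \<le> stab_const T"
  using lip_const_pos[of T] K_pos by (simp add: stab_const_def)

section \<open>Continuity of the coefficients along the flow\<close>

text \<open>The law moves at speed at most \<open>K\<close>, so a modulus in position and measure
  gives continuity in time. The constant \<open>C\<close> may depend on the base point because the
  modulus of \<open>\<delta>\<close> in the measure is proportional to \<bar>y\<bar>.\<close>

lemma continuous_along_flow:
  fixes F :: "real \<Rightarrow> real measure \<Rightarrow> real \<Rightarrow> real" and \<xi> \<tau> \<eta> :: "'p::real_normed_vector \<Rightarrow> real"
  assumes \<mu>: "\<mu> \<in> P2"
    and F: "\<And>x \<rho> y. \<rho> \<in> P2 \<Longrightarrow> \<exists>C\<ge>0. \<forall>x' \<rho>' y' w. \<rho>' \<in> P2 \<longrightarrow> kr_le \<rho>' \<rho> w \<longrightarrow>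
      \<bar>F x' \<rho>' y' - F x \<rho> y\<bar> \<le> C * (\<bar>x' - x\<bar> + \<bar>y' - y\<bar> + w + \<omega> w)"
    and c: "continuous_on UNIV \<xi>" "continuous_on UNIV \<tau>" "continuous_on UNIV \<eta>"
  shows "continuous_on UNIV (\<lambda>p. F (\<xi> p) (law \<mu> (\<tau> p)) (\<eta> p))"
proof (rule continuous_by_modulus)
  fix p0
  obtain C where C: "\<And>x' \<rho>' y' w. \<rho>' \<in> P2 \<Longrightarrow> kr_le \<rho>' (law \<mu> (\<tau> p0)) w \<Longrightarrow>
      \<bar>F x' \<rho>' y' - F (\<xi> p0) (law \<mu> (\<tau> p0)) (\<eta> p0)\<bar> \<le> C * (\<bar>x' - \<xi> p0\<bar> + \<bar>y' - \<eta> p0\<bar> + w + \<omega> w)"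
    using F[OF law_P2[OF \<mu>], of "\<tau> p0" "\<xi> p0" "\<eta> p0"] by blast
  let ?e = "\<lambda>p. C * (\<bar>\<xi> p - \<xi> p0\<bar> + \<bar>\<eta> p - \<eta> p0\<bar> + K * \<bar>\<tau> p - \<tau> p0\<bar> + \<omega> (K * \<bar>\<tau> p - \<tau> p0\<bar>))"
  have z: "((\<lambda>p. \<bar>f p - f p0\<bar>) \<longlongrightarrow> 0) (at p0)" if "continuous_on UNIV f" for f :: "'p \<Rightarrow> real"
    using that by (intro tendsto_at_zero_continuous continuous_intros) auto
  have "((\<lambda>p. K * \<bar>\<tau> p - \<tau> p0\<bar>) \<longlongrightarrow> K * 0) (at p0)" using z[OF c(2)] by (intro tendsto_intros)
  then have t: "((\<lambda>p. K * \<bar>\<tau> p - \<tau> p0\<bar>) \<longlongrightarrow> 0) (at p0)" by simp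
  have "(?e \<longlongrightarrow> C * (0 + 0 + 0 + 0)) (at p0)"
    by (intro tendsto_intros z c t \<omega>_tendsto)
  then show "\<exists>e. (e \<longlongrightarrow> 0) (at p0) \<and> (\<forall>p. \<bar>F (\<xi> p) (law \<mu> (\<tau> p)) (\<eta> p) - F (\<xi> p0) (law \<mu> (\<tau> p0)) (\<eta> p0)\<bar> \<le> e p)"
    using C[OF law_P2[OF \<mu>] law_time_kr[OF \<mu>]] by (intro exI[of _ ?e]) simp
qed

lemma continuous_a:
  assumes "\<mu> \<in> P2" "continuous_on UNIV \<xi>" "continuous_on UNIV (\<tau> :: 'p::real_normed_vector \<Rightarrow> real)"
  shows "continuous_on UNIV (\<lambda>p. a (\<xi> p) (law \<mu> (\<tau> p)))"
proof (rule continuous_along_flow[where F="\<lambda>x \<rho> y. a x \<rho>" and \<eta>="\<lambda>_. 0", OF assms(1) _ assms(2,3)])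
  fix x \<rho> y assume \<rho>: "\<rho> \<in> P2"
  have "\<bar>a x' \<rho>' - a x \<rho>\<bar> \<le> K * (\<bar>x' - x\<bar> + \<bar>y' - y\<bar> + w + \<omega> w)" if "\<rho>' \<in> P2" "kr_le \<rho>' \<rho> w" for x' \<rho>' y' w
    using a_mod[OF that(1) \<rho> that(2), of x' x] mult_right_mono[OF K1 \<omega>_nonneg[of w]]
      mult_nonneg_nonneg[OF K_nonneg kr_le_nonneg[OF that(2)]]
      mult_nonneg_nonneg[OF K_nonneg abs_ge_zero[of "y' - y"]]
    unfolding distrib_left by linarith
  then show "\<exists>C\<ge>0. \<forall>x' \<rho>' y' w. \<rho>' \<in> P2 \<longrightarrow> kr_le \<rho>' \<rho> w \<longrightarrow>
      \<bar>a x' \<rho>' - a x \<rho>\<bar> \<le> C * (\<bar>x' - x\<bar> + \<bar>y' - y\<bar> + w + \<omega> w)" using K_nonneg by blast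
qed (intro continuous_intros)

lemma continuous_\<sigma>:
  assumes "\<mu> \<in> P2" "continuous_on UNIV \<xi>" "continuous_on UNIV (\<tau> :: 'p::real_normed_vector \<Rightarrow> real)"
  shows "continuous_on UNIV (\<lambda>p. \<sigma> (\<xi> p) (law \<mu> (\<tau> p)))"
proof (rule continuous_along_flow[where F="\<lambda>x \<rho> y. \<sigma> x \<rho>" and \<eta>="\<lambda>_. 0", OF assms(1) _ assms(2,3)])
  fix x \<rho> y assume \<rho>: "\<rho> \<in> P2"
  have "\<bar>\<sigma> x' \<rho>' - \<sigma> x \<rho>\<bar> \<le> K * (\<bar>x' - x\<bar> + \<bar>y' - y\<bar> + w + \<omega> w)" if "\<rho>' \<in> P2" "kr_le \<rho>' \<rho> w" for x' \<rho>' y' w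
    using \<sigma>_lip[OF that(1) \<rho> that(2), of x' x] mult_nonneg_nonneg[OF K_nonneg \<omega>_nonneg[of w]]
      mult_nonneg_nonneg[OF K_nonneg abs_ge_zero[of "y' - y"]]
    unfolding distrib_left by linarith
  then show "\<exists>C\<ge>0. \<forall>x' \<rho>' y' w. \<rho>' \<in> P2 \<longrightarrow> kr_le \<rho>' \<rho> w \<longrightarrow>
      \<bar>\<sigma> x' \<rho>' - \<sigma> x \<rho>\<bar> \<le> C * (\<bar>x' - x\<bar> + \<bar>y' - y\<bar> + w + \<omega> w)" using K_nonneg by blast
qed (intro continuous_intros)

lemma continuous_D:
  assumes "\<mu> \<in> P2" "continuous_on UNIV \<xi>" "continuous_on UNIV (\<tau> :: 'p::real_normed_vector \<Rightarrow> real)"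
    "continuous_on UNIV \<eta>"
  shows "continuous_on UNIV (\<lambda>p. D (\<xi> p) (law \<mu> (\<tau> p)) (\<eta> p))"
proof (rule continuous_along_flow[OF assms(1) _ assms(2,3,4)])
  fix x \<rho> y assume \<rho>: "\<rho> \<in> P2"
  have "\<bar>D x' \<rho>' y' - D x \<rho> y\<bar> \<le> K * (\<bar>x' - x\<bar> + \<bar>y' - y\<bar> + w + \<omega> w)" if "\<rho>' \<in> P2" "kr_le \<rho>' \<rho> w" for x' \<rho>' y' w
    using D_mod[OF that(1) \<rho> that(2), of x' y' x y] mult_right_mono[OF K1 \<omega>_nonneg[of w]]
      mult_nonneg_nonneg[OF K_nonneg kr_le_nonneg[OF that(2)]]
    unfolding distrib_left by linarith
  then show "\<exists>C\<ge>0. \<forall>x' \<rho>' y' w. \<rho>' \<in> P2 \<longrightarrow> kr_le \<rho>' \<rho> w \<longrightarrow>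
      \<bar>D x' \<rho>' y' - D x \<rho> y\<bar> \<le> C * (\<bar>x' - x\<bar> + \<bar>y' - y\<bar> + w + \<omega> w)" using K_nonneg by blast
qed

lemma continuous_\<delta>:
  assumes "\<mu> \<in> P2" "continuous_on UNIV \<xi>" "continuous_on UNIV (\<tau> :: 'p::real_normed_vector \<Rightarrow> real)"
    "continuous_on UNIV \<eta>"
  shows "continuous_on UNIV (\<lambda>p. \<delta> (\<xi> p) (law \<mu> (\<tau> p)) (\<eta> p))"
proof (rule continuous_along_flow[OF assms(1) _ assms(2,3,4)])
  fix x \<rho> y assume \<rho>: "\<rho> \<in> P2"
  have "\<bar>\<delta> x' \<rho>' y' - \<delta> x \<rho> y\<bar> \<le> (K + K * \<bar>y\<bar>) * (\<bar>x' - x\<bar> + \<bar>y' - y\<bar> + w + \<omega> w)"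
    if r: "\<rho>' \<in> P2" "kr_le \<rho>' \<rho> w" for x' \<rho>' y' w
  proof -
    have "(K * \<bar>x' - x\<bar> + \<omega> w) * \<bar>y\<bar> \<le> (K * \<bar>x' - x\<bar> + K * \<omega> w) * \<bar>y\<bar>"
      using mult_right_mono[OF K1 \<omega>_nonneg[of w]] by (intro mult_right_mono) auto
    then have "\<bar>\<delta> x' \<rho>' y' - \<delta> x \<rho> y\<bar> \<le> (K * \<bar>x' - x\<bar> + K * \<omega> w) * \<bar>y\<bar> + K * \<bar>y' - y\<bar>"
      using \<delta>_lip[OF r(1), of x' y' y] \<delta>_mod[OF r(1) \<rho> r(2), of x' y x] by linarith
    also have "\<dots> = K * \<bar>y\<bar> * (\<bar>x' - x\<bar> + \<omega> w) + K * \<bar>y' - y\<bar>"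
      by (simp add: algebra_simps)
    also have "\<dots> \<le> K * \<bar>y\<bar> * (\<bar>x' - x\<bar> + \<bar>y' - y\<bar> + w + \<omega> w) + K * (\<bar>x' - x\<bar> + \<bar>y' - y\<bar> + w + \<omega> w)"
      using K_nonneg kr_le_nonneg[OF r(2)] \<omega>_nonneg[of w] by (intro add_mono mult_left_mono) auto
    finally show ?thesis by (simp add: algebra_simps)
  qed
  then show "\<exists>C\<ge>0. \<forall>x' \<rho>' y' w. \<rho>' \<in> P2 \<longrightarrow> kr_le \<rho>' \<rho> w \<longrightarrow>
      \<bar>\<delta> x' \<rho>' y' - \<delta> x \<rho> y\<bar> \<le> C * (\<bar>x' - x\<bar> + \<bar>y' - y\<bar> + w + \<omega> w)"
    using K_nonneg by (intro exI[of _ "K + K * \<bar>y\<bar>"]) auto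
qed

end

section \<open>The linearized equation\<close>

lemma abs_mult_le:
  fixes p q P Q :: real
  assumes "\<bar>p\<bar> \<le> P" "\<bar>q\<bar> \<le> Q"
  shows "\<bar>p * q\<bar> \<le> P * Q"
  unfolding abs_mult using assms by (intro mult_mono) auto

lemma abs_product_diff_le:
  fixes p q p' q' :: real
  assumes "\<bar>p - p'\<bar> \<le> d" "\<bar>q\<bar> \<le> Q" "\<bar>p'\<bar> \<le> P" "\<bar>q - q'\<bar> \<le> e"
  shows "\<bar>p * q - p' * q'\<bar> \<le> d * Q + P * e"
proof -
  have "p * q - p' * q' = (p - p') * q + p' * (q - q')" by (simp add: algebra_simps)
  then show ?thesis using abs_mult_le[OF assms(1,2)] abs_mult_le[OF assms(3,4)] by linarith
qed

lemma deriv_from_quadratic: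
  fixes f :: "real \<Rightarrow> real"
  assumes "\<And>x. \<bar>f x - f y - d * (x - y)\<bar> \<le> C * (x - y)\<^sup>2"
  shows "(f has_real_derivative d) (at y)"
proof -
  have "((\<lambda>x. (f x - f y) / (x - y) - d) \<longlongrightarrow> 0) (at y)"
  proof (rule Lim_null_comparison)
    show "\<forall>\<^sub>F x in at y. norm ((f x - f y) / (x - y) - d) \<le> C * \<bar>x - y\<bar>"
    proof (rule eventually_at_filter[THEN iffD2], rule always_eventually, safe)
      fix x assume "x \<noteq> y"
      then have "(f x - f y) / (x - y) - d = (f x - f y - d * (x - y)) / (x - y)" by (simp add: field_simps)
      then show "norm ((f x - f y) / (x - y) - d) \<le> C * \<bar>x - y\<bar>"
        using assms[of x] \<open>x \<noteq> y\<close>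
        by (simp add: abs_divide divide_le_eq power2_eq_square mult.assoc flip: abs_mult)
    qed
    have "((\<lambda>x. C * \<bar>x - y\<bar>) \<longlongrightarrow> C * \<bar>y - y\<bar>) (at y)" by (intro tendsto_intros)
    then show "((\<lambda>x. C * \<bar>x - y\<bar>) \<longlongrightarrow> 0) (at y)" by simp
  qed
  then show ?thesis unfolding has_field_derivative_iff by (simp add: LIM_zero_iff)
qed

lemma integral_abs_le_P2:
  fixes f :: "real \<Rightarrow> real"
  assumes "\<mu> \<in> P2" "\<And>z. \<bar>f z\<bar> \<le> c"
  shows "\<bar>\<integral>z. f z \<partial>\<mu>\<bar> \<le> c"
proof -
  interpret prob_space \<mu> using assms by (intro P2_prob_space)
  have c: "0 \<le> c" using order_trans[OF abs_ge_zero assms(2)[of 0]] .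
  have "\<bar>\<integral>z. f z \<partial>\<mu>\<bar> \<le> (\<integral>z. \<bar>f z\<bar> \<partial>\<mu>)" by (rule integral_abs_bound)
  also have "\<dots> \<le> (\<integral>z. c \<partial>\<mu>)" using assms(2) c by (intro integral_mono') auto
  finally show ?thesis by (simp add: prob_space)
qed

lemma integrable_P2_bounded:
  fixes f :: "real \<Rightarrow> real"
  assumes "\<mu> \<in> P2" "f \<in> borel_measurable borel" "\<And>z. \<bar>f z\<bar> \<le> c"
  shows "integrable \<mu> f"
proof (rule integrable_P2[OF assms(1,2)])
  fix z
  have "0 \<le> c" using order_trans[OF abs_ge_zero assms(3)[of 0]] .
  then have "c * 1 \<le> c * (1 + z\<^sup>2)" by (intro mult_left_mono) auto
  then show "\<bar>f z\<bar> \<le> c * (1 + z\<^sup>2)" using assms(3)[of z] by simp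
qed

context mean_field_coefficient
begin

lemma continuous_flow:
  assumes "\<mu> \<in> P2" "continuous_on UNIV \<tau>" "continuous_on UNIV \<xi>"
  shows "continuous_on UNIV (\<lambda>p. flow \<mu> (\<tau> p) (\<xi> p))"
  using continuous_on_compose2[OF flow_cont[OF assms(1)], of UNIV "\<lambda>p. (\<tau> p, \<xi> p)"]
    continuous_on_Pair[OF assms(2,3)] by simp

section \<open>Coefficients of the linearization and their moduli\<close>

definition a_flow :: "real measure \<Rightarrow> real \<Rightarrow> real \<Rightarrow> real" where
  "a_flow \<mu> m x = a (flow \<mu> m x) (law \<mu> m)"

definition D_flow :: "real measure \<Rightarrow> real \<Rightarrow> real \<Rightarrow> real \<Rightarrow> real" where
  "D_flow \<mu> m x z = D (flow \<mu> m x) (law \<mu> m) (flow \<mu> m z)"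

text \<open>One modulus for all coefficients of the linearized equation: changing the initial
  measure by w changes flow and law by \<open>stab_const T * w\<close>, to which
  \<open>\<omega>\<close> is applied; the summand w absorbs the Lipschitz errors.\<close>

definition flow_modulus :: "real \<Rightarrow> real \<Rightarrow> real" where
  "flow_modulus T w = w + \<omega> (stab_const T * w)"

lemma flow_modulus_nonneg: "0 \<le> w \<Longrightarrow> 0 \<le> flow_modulus T w" and le_flow_modulus: "w \<le> flow_modulus T w"
  using \<omega>_nonneg by (auto simp: flow_modulus_def)

lemma flow_modulus_le:
  assumes "0 \<le> T" "0 \<le> w" "0 \<le> c"
  shows "c * (stab_const T * w) + \<omega> (stab_const T * w) \<le> (c * stab_const T + 1) * flow_modulus T w"
  using assms mult_nonneg_nonneg[OF mult_nonneg_nonneg[OF assms(3) stab_const_nonneg[OF assms(1)]] \<omega>_nonneg[of "stab_const T * w"]]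
  by (simp add: flow_modulus_def algebra_simps)

lemma lip_const_mono: "m \<le> T \<Longrightarrow> lip_const m \<le> lip_const T"
  using K_pos by (simp add: lip_const_def)

lemma lip_const_nonneg: "0 \<le> lip_const T"
  using lip_const_pos less_imp_le by blast

lemma a_flow_bdd: "\<mu> \<in> P2 \<Longrightarrow> \<bar>a_flow \<mu> m x\<bar> \<le> K"
  unfolding a_flow_def by (intro a_bdd law_P2)

lemma D_flow_bdd: "\<mu> \<in> P2 \<Longrightarrow> \<bar>D_flow \<mu> m x z\<bar> \<le> K"
  unfolding D_flow_def by (intro D_bdd law_P2)

lemma continuous_a_flow:
  "\<mu> \<in> P2 \<Longrightarrow> continuous_on UNIV \<tau> \<Longrightarrow> continuous_on UNIV (\<xi> :: 'p::real_normed_vector \<Rightarrow> real)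
    \<Longrightarrow> continuous_on UNIV (\<lambda>p. a_flow \<mu> (\<tau> p) (\<xi> p))"
  unfolding a_flow_def by (intro continuous_a continuous_flow)

lemma continuous_D_flow:
  "\<mu> \<in> P2 \<Longrightarrow> continuous_on UNIV \<tau> \<Longrightarrow> continuous_on UNIV (\<xi> :: 'p::real_normed_vector \<Rightarrow> real)
    \<Longrightarrow> continuous_on UNIV \<zeta> \<Longrightarrow> continuous_on UNIV (\<lambda>p. D_flow \<mu> (\<tau> p) (\<xi> p) (\<zeta> p))"
  unfolding D_flow_def by (intro continuous_D continuous_flow)

lemma a_flow_lip: "\<mu> \<in> P2 \<Longrightarrow> \<bar>m\<bar> \<le> T \<Longrightarrow> \<bar>a_flow \<mu> m x - a_flow \<mu> m y\<bar> \<le> K * lip_const T * \<bar>x - y\<bar>"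
  unfolding a_flow_def using order_trans[OF a_lip[OF law_P2] mult_left_mono[OF flow_lip K_nonneg]]
  by (simp add: mult.assoc)

lemma D_flow_lip:
  assumes "\<mu> \<in> P2" "\<bar>m\<bar> \<le> T"
  shows "\<bar>D_flow \<mu> m x z - D_flow \<mu> m x' z'\<bar> \<le> K * lip_const T * (\<bar>x - x'\<bar> + \<bar>z - z'\<bar>)"
  unfolding D_flow_def
  using D_lip[OF law_P2[OF assms(1)], of "flow \<mu> m x" m "flow \<mu> m z" "flow \<mu> m x'" "flow \<mu> m z'"]
    mult_left_mono[OF flow_lip[OF assms, of x x'] K_nonneg] mult_left_mono[OF flow_lip[OF assms, of z z'] K_nonneg]
  by (simp add: algebra_simps)

context
  fixes \<mu> \<nu> :: "real measure" and w m T :: real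
  assumes \<mu>: "\<mu> \<in> P2" and \<nu>: "\<nu> \<in> P2" and w: "kr_le \<mu> \<nu> w" and m: "\<bar>m\<bar> \<le> T"
begin

lemma a_flow_stab: "\<bar>a_flow \<mu> m x - a_flow \<nu> m x\<bar> \<le> (K * stab_const T + 1) * flow_modulus T w"
proof -
  have "\<bar>a_flow \<mu> m x - a_flow \<nu> m x\<bar> \<le> K * \<bar>flow \<mu> m x - flow \<nu> m x\<bar> + \<omega> (stab_const T * w)"
    unfolding a_flow_def by (intro a_mod law_P2 flow_stab(2)[OF _ _ w m] \<mu> \<nu>)
  also have "\<dots> \<le> K * (stab_const T * w) + \<omega> (stab_const T * w)"
    using mult_left_mono[OF flow_stab(1)[OF \<mu> \<nu> w m] K_nonneg] by simp
  also have "\<dots> \<le> (K * stab_const T + 1) * flow_modulus T w"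
    using m by (intro flow_modulus_le kr_le_nonneg[OF w] K_nonneg) simp
  finally show ?thesis .
qed

lemma D_flow_stab: "\<bar>D_flow \<mu> m x z - D_flow \<nu> m x z\<bar> \<le> (2 * K * stab_const T + 1) * flow_modulus T w"
proof -
  have "\<bar>D_flow \<mu> m x z - D_flow \<nu> m x z\<bar>
      \<le> K * \<bar>flow \<mu> m x - flow \<nu> m x\<bar> + K * \<bar>flow \<mu> m z - flow \<nu> m z\<bar> + \<omega> (stab_const T * w)"
    unfolding D_flow_def by (intro D_mod law_P2 flow_stab(2)[OF _ _ w m] \<mu> \<nu>)
  also have "\<dots> \<le> 2 * K * (stab_const T * w) + \<omega> (stab_const T * w)"
    using mult_left_mono[OF flow_stab(1)[OF \<mu> \<nu> w m] K_nonneg, of x]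
      mult_left_mono[OF flow_stab(1)[OF \<mu> \<nu> w m] K_nonneg, of z] by simp
  also have "\<dots> \<le> (2 * K * stab_const T + 1) * flow_modulus T w"
    using m K_nonneg by (intro flow_modulus_le kr_le_nonneg[OF w]) auto
  finally show ?thesis .
qed

end

section \<open>The derivative of the flow in the starting point\<close>

text \<open>Moving only the starting point leaves the law unchanged, so the derivative in x solves a
  scalar linear equation without integral term. \<open>volterra_exists\<close> is used for the joint
  continuity it gives; its solutions start at 0, hence the unknown \<open>1 + u\<close>.\<close>

lemma jacobian_exists:
  assumes \<mu>: "\<mu> \<in> P2"
  shows "\<exists>J. continuous_on UNIV (\<lambda>p. J (fst p) (snd p)) \<and>
    (\<forall>m x. ((\<lambda>m. J m x) has_real_derivative a_flow \<mu> m x * J m x) (at m)) \<and>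
    (\<forall>x. J 0 x = 1) \<and> (\<forall>m x. \<bar>J m x\<bar> \<le> lip_const \<bar>m\<bar>)"
proof -
  obtain u where u: "continuous_on UNIV (\<lambda>p. u (fst p) (snd p))"
    "\<And>T. \<exists>B. \<forall>r z. \<bar>r\<bar> \<le> T \<longrightarrow> \<bar>u r z\<bar> \<le> B"
    "\<And>m x. ((\<lambda>m. u m x) has_real_derivative a_flow \<mu> m x * (1 + u m x)) (at m)" "\<And>x. u 0 x = 0"
  proof (rule volterra_exists[of "4 * K" K "\<lambda>r u x. a_flow \<mu> r x * (1 + u x)" K])
    fix r x c :: real and u v :: "real \<Rightarrow> real" assume "\<And>z. \<bar>u z - v z\<bar> \<le> c"
    from abs_mult_le[OF a_flow_bdd[OF \<mu>] this[of x]]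
    show "\<bar>a_flow \<mu> r x * (1 + u x) - a_flow \<mu> r x * (1 + v x)\<bar> \<le> K * c"
      by (simp flip: right_diff_distrib)
  next
    fix u :: "real \<Rightarrow> real \<Rightarrow> real" assume "continuous_on UNIV (\<lambda>p. u (fst p) (snd p))"
    then show "continuous_on UNIV (\<lambda>p. a_flow \<mu> (fst p) (snd p) * (1 + u (fst p) (snd p)))"
      by (intro continuous_intros continuous_a_flow \<mu>)
  next
    fix r x :: real
    have "K * 1 \<le> K * exp (4 * K * \<bar>r\<bar>)" using K_pos by (intro mult_left_mono) auto
    then show "\<bar>a_flow \<mu> r x * (1 + 0)\<bar> \<le> K * exp (4 * K * \<bar>r\<bar>)" using a_flow_bdd[OF \<mu>, of r x] by simp
  qed (use K_pos in auto)
  have "\<bar>1 + u m x\<bar> \<le> 2 * (1 + \<bar>m\<bar> * 0) * exp (2 * K * \<bar>m\<bar>)" for m x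
  proof -
    obtain B where B: "\<And>r z. \<bar>r\<bar> \<le> \<bar>m\<bar> \<Longrightarrow> \<bar>u r z\<bar> \<le> B" using u(2) by blast
    show ?thesis
    proof (rule gronwall_sup[where w="\<lambda>m (_::unit). 1 + u m x" and w'="\<lambda>m _. a_flow \<mu> m x * (1 + u m x)" and M="1 + B"])
      fix r assume "\<bar>r\<bar> \<le> \<bar>m\<bar>"
      from B[OF this, of x] show "\<bar>1 + u r x\<bar> \<le> 1 + B" by linarith
    next
      fix r c assume "\<And>j::unit. \<bar>1 + u r x\<bar> \<le> c"
      then show "\<bar>a_flow \<mu> r x * (1 + u r x)\<bar> \<le> K * c + 0" using abs_mult_le[OF a_flow_bdd[OF \<mu>]] by simp
    qed (use K_pos u(4) in \<open>auto intro!: derivative_eq_intros u(3)\<close>)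
  qed
  then show ?thesis
    using u by (intro exI[of _ "\<lambda>m x. 1 + u m x"]) (auto intro!: continuous_intros derivative_eq_intros simp: lip_const_def)
qed

definition jacobian :: "real measure \<Rightarrow> real \<Rightarrow> real \<Rightarrow> real" where
  "jacobian \<mu> = (SOME J. continuous_on UNIV (\<lambda>p. J (fst p) (snd p)) \<and>
    (\<forall>m x. ((\<lambda>m. J m x) has_real_derivative a_flow \<mu> m x * J m x) (at m)) \<and>
    (\<forall>x. J 0 x = 1) \<and> (\<forall>m x. \<bar>J m x\<bar> \<le> lip_const \<bar>m\<bar>))"

lemma
  assumes "\<mu> \<in> P2"
  shows jacobian_cont: "continuous_on UNIV (\<lambda>p. jacobian \<mu> (fst p) (snd p))"
    and jacobian_deriv: "((\<lambda>m. jacobian \<mu> m x) has_real_derivative a_flow \<mu> m x * jacobian \<mu> m x) (at m)"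
    and jacobian_0: "jacobian \<mu> 0 x = 1"
    and jacobian_bdd_abs: "\<bar>jacobian \<mu> m x\<bar> \<le> lip_const \<bar>m\<bar>"
  using someI_ex[OF jacobian_exists[OF assms]] unfolding jacobian_def[symmetric] by auto

lemma jacobian_bdd: "\<mu> \<in> P2 \<Longrightarrow> \<bar>m\<bar> \<le> T \<Longrightarrow> \<bar>jacobian \<mu> m x\<bar> \<le> lip_const T"
  using order_trans[OF jacobian_bdd_abs lip_const_mono] .

text \<open>The remainder vanishes at time 0 and solves the equation of \<open>jacobian\<close> with
  a source equal to the Taylor error of \<open>\<sigma>\<close>, which is quadratic in the distance
  of the trajectories. As \<open>lip_const T\<close> is \<open>2 * exp (2 * K * T)\<close>, the
  Gronwall factor supplies its third power.\<close>

lemma flow_expand_x: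
  assumes \<mu>: "\<mu> \<in> P2" and m: "\<bar>m\<bar> \<le> T"
  shows "\<bar>flow \<mu> m x - flow \<mu> m y - jacobian \<mu> m y * (x - y)\<bar> \<le> T * K * (lip_const T) ^ 3 * (x - y)\<^sup>2"
proof -
  have "\<bar>flow \<mu> m x - flow \<mu> m y - jacobian \<mu> m y * (x - y)\<bar>
      \<le> 2 * (0 + T * (K * (lip_const T * \<bar>x - y\<bar>)\<^sup>2)) * exp (2 * K * T)"
  proof (rule gronwall_sup[where w="\<lambda>m (_::unit). flow \<mu> m x - flow \<mu> m y - jacobian \<mu> m y * (x - y)"
        and w'="\<lambda>m _. \<sigma> (flow \<mu> m x) (law \<mu> m) - \<sigma> (flow \<mu> m y) (law \<mu> m) - a_flow \<mu> m y * jacobian \<mu> m y * (x - y)"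
        and M="2 * (lip_const T * \<bar>x - y\<bar>)"])
    fix r :: real assume r: "\<bar>r\<bar> \<le> T"
    show "\<bar>flow \<mu> r x - flow \<mu> r y - jacobian \<mu> r y * (x - y)\<bar> \<le> 2 * (lip_const T * \<bar>x - y\<bar>)"
      using flow_lip[OF \<mu> r, of x y] abs_mult_le[OF jacobian_bdd[OF \<mu> r, of y] order_refl, of "x - y"] by linarith
    fix c assume c: "\<And>j::unit. \<bar>flow \<mu> r x - flow \<mu> r y - jacobian \<mu> r y * (x - y)\<bar> \<le> c"
    let ?X = "flow \<mu> r x" and ?Y = "flow \<mu> r y"
    have "\<bar>\<sigma> ?X (law \<mu> r) - \<sigma> ?Y (law \<mu> r) - a_flow \<mu> r y * (?X - ?Y)\<bar> \<le> K * (?X - ?Y)\<^sup>2"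
      unfolding a_flow_def by (rule \<sigma>_taylor[OF law_P2[OF \<mu>]])
    also have "\<dots> \<le> K * (lip_const T * \<bar>x - y\<bar>)\<^sup>2"
      using flow_lip[OF \<mu> r, of x y] K_nonneg lip_const_nonneg[of T]
      by (intro mult_left_mono abs_le_square_iff[THEN iffD1]) (auto simp: abs_mult)
    finally have 1: "\<bar>\<sigma> ?X (law \<mu> r) - \<sigma> ?Y (law \<mu> r) - a_flow \<mu> r y * (?X - ?Y)\<bar> \<le> K * (lip_const T * \<bar>x - y\<bar>)\<^sup>2" .
    have 2: "\<bar>a_flow \<mu> r y * (?X - ?Y - jacobian \<mu> r y * (x - y))\<bar> \<le> K * c"
      by (rule abs_mult_le[OF a_flow_bdd[OF \<mu>] c])
    have "\<sigma> ?X (law \<mu> r) - \<sigma> ?Y (law \<mu> r) - a_flow \<mu> r y * jacobian \<mu> r y * (x - y)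
      = (\<sigma> ?X (law \<mu> r) - \<sigma> ?Y (law \<mu> r) - a_flow \<mu> r y * (?X - ?Y)) + a_flow \<mu> r y * (?X - ?Y - jacobian \<mu> r y * (x - y))"
      by (simp add: algebra_simps)
    with 1 2 show "\<bar>\<sigma> ?X (law \<mu> r) - \<sigma> ?Y (law \<mu> r) - a_flow \<mu> r y * jacobian \<mu> r y * (x - y)\<bar>
        \<le> K * c + K * (lip_const T * \<bar>x - y\<bar>)\<^sup>2" by linarith
  qed (use m K_pos in \<open>auto intro!: derivative_eq_intros flow_deriv jacobian_deriv \<mu> simp: flow_0[OF \<mu>] jacobian_0[OF \<mu>]\<close>)
  also have "\<dots> = T * K * (lip_const T) ^ 3 * (x - y)\<^sup>2"
    by (simp add: lip_const_def power_mult_distrib power2_eq_square power3_eq_cube)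
  finally show ?thesis .
qed

lemma flow_deriv_x: "\<mu> \<in> P2 \<Longrightarrow> ((\<lambda>x. flow \<mu> m x) has_real_derivative jacobian \<mu> m x) (at x)"
  by (rule deriv_from_quadratic, rule flow_expand_x) auto

lemma jacobian_lip:
  obtains C where "0 \<le> C"
    "\<And>\<mu> m x y. \<mu> \<in> P2 \<Longrightarrow> \<bar>m\<bar> \<le> T \<Longrightarrow> \<bar>jacobian \<mu> m x - jacobian \<mu> m y\<bar> \<le> C * \<bar>x - y\<bar>"
proof
  show "\<bar>jacobian \<mu> m x - jacobian \<mu> m y\<bar> \<le> \<bar>T\<bar> * K * (lip_const T) ^ 3 * \<bar>x - y\<bar>" if \<mu>: "\<mu> \<in> P2" and m: "\<bar>m\<bar> \<le> T" for \<mu> m x y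
  proof -
    have "\<bar>jacobian \<mu> m x - jacobian \<mu> m y\<bar> \<le> 2 * (0 + T * (K * lip_const T * \<bar>x - y\<bar> * lip_const T)) * exp (2 * K * T)"
    proof (rule gronwall_sup[where w="\<lambda>m (_::unit). jacobian \<mu> m x - jacobian \<mu> m y"
          and w'="\<lambda>m _. a_flow \<mu> m x * jacobian \<mu> m x - a_flow \<mu> m y * jacobian \<mu> m y" and M="2 * lip_const T"])
      fix r :: real assume r: "\<bar>r\<bar> \<le> T"
      show "\<bar>jacobian \<mu> r x - jacobian \<mu> r y\<bar> \<le> 2 * lip_const T"
        using jacobian_bdd[OF \<mu> r, of x] jacobian_bdd[OF \<mu> r, of y] by linarith
      fix c assume "\<And>j::unit. \<bar>jacobian \<mu> r x - jacobian \<mu> r y\<bar> \<le> c"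
      from abs_product_diff_le[OF a_flow_lip[OF \<mu> r] jacobian_bdd[OF \<mu> r] a_flow_bdd[OF \<mu>] this, of x y]
      show "\<bar>a_flow \<mu> r x * jacobian \<mu> r x - a_flow \<mu> r y * jacobian \<mu> r y\<bar> \<le> K * c + K * lip_const T * \<bar>x - y\<bar> * lip_const T" by simp
    qed (use m K_pos lip_const_nonneg in \<open>auto intro!: derivative_eq_intros jacobian_deriv \<mu> mult_nonneg_nonneg simp: jacobian_0[OF \<mu>]\<close>)
    also have "\<dots> = \<bar>T\<bar> * K * (lip_const T) ^ 3 * \<bar>x - y\<bar>"
      using m by (simp add: lip_const_def power2_eq_square power3_eq_cube)
    finally show ?thesis .
  qed
qed (use K_nonneg lip_const_nonneg in simp)

lemma jacobian_stab:
  obtains C where "0 \<le> C"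
    "\<And>\<mu> \<nu> w m x. \<mu> \<in> P2 \<Longrightarrow> \<nu> \<in> P2 \<Longrightarrow> kr_le \<mu> \<nu> w \<Longrightarrow> \<bar>m\<bar> \<le> T \<Longrightarrow>
      \<bar>jacobian \<mu> m x - jacobian \<nu> m x\<bar> \<le> C * flow_modulus T w"
proof (cases "0 \<le> T")
  case T: True
  let ?k = "K * stab_const T + 1"
  have k0: "0 \<le> ?k" using K_nonneg stab_const_nonneg[OF T] by simp
  show ?thesis
  proof
    show "0 \<le> T * ?k * (lip_const T)\<^sup>2" using T k0 by simp
    show "\<bar>jacobian \<mu> m x - jacobian \<nu> m x\<bar> \<le> T * ?k * (lip_const T)\<^sup>2 * flow_modulus T w"
      if \<mu>: "\<mu> \<in> P2" and \<nu>: "\<nu> \<in> P2" and w: "kr_le \<mu> \<nu> w" and m: "\<bar>m\<bar> \<le> T" for \<mu> \<nu> w m x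
    proof -
      have "\<bar>jacobian \<mu> m x - jacobian \<nu> m x\<bar> \<le> 2 * (0 + T * (?k * flow_modulus T w * lip_const T)) * exp (2 * K * T)"
      proof (rule gronwall_sup[where w="\<lambda>m (_::unit). jacobian \<mu> m x - jacobian \<nu> m x"
            and w'="\<lambda>m _. a_flow \<mu> m x * jacobian \<mu> m x - a_flow \<nu> m x * jacobian \<nu> m x" and M="2 * lip_const T"])
        fix r :: real assume r: "\<bar>r\<bar> \<le> T"
        show "\<bar>jacobian \<mu> r x - jacobian \<nu> r x\<bar> \<le> 2 * lip_const T"
          using jacobian_bdd[OF \<mu> r, of x] jacobian_bdd[OF \<nu> r, of x] by linarith
        fix c assume "\<And>j::unit. \<bar>jacobian \<mu> r x - jacobian \<nu> r x\<bar> \<le> c"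
        from abs_product_diff_le[OF a_flow_stab[OF \<mu> \<nu> w r] jacobian_bdd[OF \<mu> r] a_flow_bdd[OF \<nu>] this, of x]
        show "\<bar>a_flow \<mu> r x * jacobian \<mu> r x - a_flow \<nu> r x * jacobian \<nu> r x\<bar> \<le> K * c + ?k * flow_modulus T w * lip_const T" by simp
      qed (use m K_pos lip_const_nonneg k0 flow_modulus_nonneg[OF kr_le_nonneg[OF w]] in
          \<open>auto intro!: derivative_eq_intros jacobian_deriv \<mu> \<nu> mult_nonneg_nonneg simp: jacobian_0[OF \<mu>] jacobian_0[OF \<nu>]\<close>)
      also have "\<dots> = T * ?k * (lip_const T)\<^sup>2 * flow_modulus T w"
        by (simp add: lip_const_def power2_eq_square)
      finally show ?thesis .
    qed
  qed
qed (use that[of 0] in auto)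

section \<open>The linearized mean-field equation\<close>

text \<open>The flow equation differentiated with respect to a perturbation of the initial measure.
  The integral term is the response of the law to the displacement of the mass and couples all
  positions. Boundedness on time strips selects the class in which Gronwall applies.\<close>

definition linearized :: "real measure \<Rightarrow> (real \<Rightarrow> real \<Rightarrow> real) \<Rightarrow> (real \<Rightarrow> real \<Rightarrow> real) \<Rightarrow> bool" where
  "linearized \<mu> b v \<longleftrightarrow> continuous_on UNIV (\<lambda>p. v (fst p) (snd p)) \<and>
    (\<forall>T. \<exists>B. \<forall>r z. \<bar>r\<bar> \<le> T \<longrightarrow> \<bar>v r z\<bar> \<le> B) \<and>
    (\<forall>m x. ((\<lambda>m. v m x) has_real_derivative
       a_flow \<mu> m x * v m x + (\<integral>z. D_flow \<mu> m x z * v m z \<partial>\<mu>) + b m x) (at m)) \<and>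
    (\<forall>x. v 0 x = 0)"

lemma D_flow_measurable: "\<mu> \<in> P2 \<Longrightarrow> (\<lambda>z. D_flow \<mu> m x z) \<in> borel_measurable borel"
  by (intro borel_measurable_continuous_onI continuous_D_flow continuous_intros)

lemma integrable_D_flow:
  assumes "\<mu> \<in> P2" "\<nu> \<in> P2" "v \<in> borel_measurable borel" "\<And>z. \<bar>v z\<bar> \<le> B"
  shows "integrable \<nu> (\<lambda>z. D_flow \<mu> m x z * v z)"
  using abs_mult_le[OF D_flow_bdd[OF assms(1)] assms(4)]
  by (intro integrable_P2_bounded[OF assms(2)] borel_measurable_times D_flow_measurable assms)

lemma linearized_exists:
  assumes \<mu>: "\<mu> \<in> P2" and b: "continuous_on UNIV (\<lambda>p. b (fst p) (snd p))"
    and bd: "\<And>m x. \<bar>b m x\<bar> \<le> C * exp (4 * K * \<bar>m\<bar>)"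
  shows "\<exists>v. linearized \<mu> b v"
proof -
  let ?G = "\<lambda>r u x. a_flow \<mu> r x * u x + (\<integral>z. D_flow \<mu> r x z * u z \<partial>\<mu>) + b r x"
  obtain u where "continuous_on UNIV (\<lambda>p. u (fst p) (snd p))"
    "\<And>T. \<exists>B. \<forall>r z. \<bar>r\<bar> \<le> T \<longrightarrow> \<bar>u r z\<bar> \<le> B"
    "\<And>m x. ((\<lambda>m. u m x) has_real_derivative ?G m (u m) x) (at m)" "\<And>x. u 0 x = 0"
  proof (rule volterra_exists[of "4 * K" "2 * K" ?G C])
    fix r x c :: real and u v :: "real \<Rightarrow> real"
    assume uv: "continuous_on UNIV u" "continuous_on UNIV v" "bounded (range u)" "bounded (range v)"
      and c: "\<And>z. \<bar>u z - v z\<bar> \<le> c"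
    obtain B B' where "\<And>z. \<bar>u z\<bar> \<le> B" "\<And>z. \<bar>v z\<bar> \<le> B'" using uv(3,4) by (auto simp: bounded_iff)
    then have "integrable \<mu> (\<lambda>z. D_flow \<mu> r x z * u z)" "integrable \<mu> (\<lambda>z. D_flow \<mu> r x z * v z)"
      using uv by (auto intro!: integrable_D_flow \<mu> borel_measurable_continuous_onI)
    then have "?G r u x - ?G r v x = a_flow \<mu> r x * (u x - v x) + (\<integral>z. D_flow \<mu> r x z * (u z - v z) \<partial>\<mu>)"
      by (simp add: right_diff_distrib)
    moreover have "\<bar>\<integral>z. D_flow \<mu> r x z * (u z - v z) \<partial>\<mu>\<bar> \<le> K * c"
      by (intro integral_abs_le_P2 abs_mult_le D_flow_bdd c \<mu>)
    ultimately show "\<bar>?G r u x - ?G r v x\<bar> \<le> 2 * K * c"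
      using abs_mult_le[OF a_flow_bdd[OF \<mu>] c[of x], of r x] by linarith
  next
    fix u :: "real \<Rightarrow> real \<Rightarrow> real"
    assume u: "continuous_on UNIV (\<lambda>p. u (fst p) (snd p))"
      and bd: "\<And>T. \<exists>B. \<forall>r z. \<bar>r\<bar> \<le> T \<longrightarrow> \<bar>u r z\<bar> \<le> B"
    note sec = continuous_section[OF u]
    have "continuous_on UNIV (\<lambda>p :: real \<times> real. \<integral>z. D_flow \<mu> (fst p) (snd p) z * u (fst p) z \<partial>\<mu>)"
    proof (rule continuous_integral_param)
      show "finite_measure \<mu>" using P2_prob_space[OF \<mu>] by (simp add: prob_space_def)
      have "continuous_on UNIV (\<lambda>p :: real \<times> real. u (fst p) z)" for z
        using continuous_on_compose2[OF sec(2), of UNIV fst z] by (simp add: continuous_on_fst)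
      then show "continuous_on UNIV (\<lambda>p :: real \<times> real. D_flow \<mu> (fst p) (snd p) z * u (fst p) z)" for z
        by (intro continuous_intros continuous_D_flow \<mu>)
      show "(\<lambda>z. D_flow \<mu> (fst p) (snd p) z * u (fst p) z) \<in> borel_measurable \<mu>" for p :: "real \<times> real"
        by (intro P2_measurable[OF \<mu>] borel_measurable_times D_flow_measurable \<mu> borel_measurable_continuous_onI sec)
      fix R
      obtain B where B: "\<And>r z. \<bar>r\<bar> \<le> R \<Longrightarrow> \<bar>u r z\<bar> \<le> B" using bd[of R] by blast
      have KB: "\<bar>D_flow \<mu> (fst p) (snd p) z * u (fst p) z\<bar> \<le> K * B" if "norm p \<le> R" for p :: "real \<times> real" and z
        using norm_fst_le[of "fst p" "snd p"] that by (intro abs_mult_le D_flow_bdd B \<mu>) simp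
      show "\<exists>B. \<forall>p z. norm p \<le> R \<longrightarrow> \<bar>D_flow \<mu> (fst p) (snd p) z * u (fst p) z\<bar> \<le> B"
        by (intro exI[of _ "K * B"] allI impI KB)
    qed
    then show "continuous_on UNIV (\<lambda>p. ?G (fst p) (u (fst p)) (snd p))"
      by (intro continuous_intros continuous_a_flow \<mu> u b)
  qed (use K_pos bd in auto)
  then show ?thesis unfolding linearized_def by blast
qed

text \<open>Phrased for a raw equation with error \<open>e\<close> instead of
  \<open>linearized\<close>, because it is applied to remainders, whose errors are bounded but not
  shown to be continuous.\<close>

lemma linearized_estimate:
  assumes \<mu>: "\<mu> \<in> P2" and m: "\<bar>m\<bar> \<le> T" and \<epsilon>: "0 \<le> \<epsilon>"
    and d: "\<And>m x. ((\<lambda>m. w m x) has_real_derivative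
       a_flow \<mu> m x * w m x + (\<integral>z. D_flow \<mu> m x z * w m z \<partial>\<mu>) + e m x) (at m)"
    and bd: "\<And>m x. \<bar>m\<bar> \<le> T \<Longrightarrow> \<bar>w m x\<bar> \<le> M"
    and e: "\<And>m x. \<bar>m\<bar> \<le> T \<Longrightarrow> \<bar>e m x\<bar> \<le> \<epsilon>"
    and init: "\<And>x. w 0 x = 0"
  shows "\<bar>w m x\<bar> \<le> 2 * T * exp (4 * K * T) * \<epsilon>"
proof -
  have "\<bar>w m x\<bar> \<le> 2 * (0 + T * \<epsilon>) * exp (2 * (2 * K) * T)"
  proof (rule gronwall_sup[OF _ m \<epsilon> d bd])
    fix r y c assume r: "\<bar>r\<bar> \<le> T" and c: "\<And>j. \<bar>w r j\<bar> \<le> c"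
    have "\<bar>\<integral>z. D_flow \<mu> r y z * w r z \<partial>\<mu>\<bar> \<le> K * c"
      by (intro integral_abs_le_P2 abs_mult_le D_flow_bdd c \<mu>)
    then show "\<bar>a_flow \<mu> r y * w r y + (\<integral>z. D_flow \<mu> r y z * w r z \<partial>\<mu>) + e r y\<bar> \<le> 2 * K * c + \<epsilon>"
      using abs_mult_le[OF a_flow_bdd[OF \<mu>] c[of y], of r y] e[OF r, of y] by linarith
  qed (use K_pos init in auto)
  then show ?thesis by (simp add: mult_ac)
qed

text \<open>The source is the derivative in y of \<open>\<delta>\<close> evaluated at the moving
  point \<open>flow \<mu> m y\<close>, by the chain rule.\<close>

definition flow_Lions :: "real measure \<Rightarrow> real \<Rightarrow> real \<Rightarrow> real \<Rightarrow> real" where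
  "flow_Lions \<mu> y = (SOME v. linearized \<mu> (\<lambda>m x. D_flow \<mu> m x y * jacobian \<mu> m y) v)"

text \<open>Formal differentiation of the flow equation in \<open>\<mu>\<close>, in the direction of the point mass at \<open>y\<close>
  minus the one at \<open>0\<close>, leads to the linearized equation with this source. \<open>flow_Lions\<close> is the
  derivative in \<open>y\<close>.\<close>

definition flow_linear :: "real measure \<Rightarrow> real \<Rightarrow> real \<Rightarrow> real \<Rightarrow> real" where
  "flow_linear \<mu> y = (SOME v. linearized \<mu> (\<lambda>m x. \<delta> (flow \<mu> m x) (law \<mu> m) (flow \<mu> m y) -
     \<delta> (flow \<mu> m x) (law \<mu> m) (flow \<mu> m 0)) v)"

lemma continuous_jacobian:
  assumes "\<mu> \<in> P2" "continuous_on UNIV \<tau>" "continuous_on UNIV \<xi>"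
  shows "continuous_on UNIV (\<lambda>p. jacobian \<mu> (\<tau> p) (\<xi> p))"
  using continuous_on_compose2[OF jacobian_cont[OF assms(1)], of UNIV "\<lambda>p. (\<tau> p, \<xi> p)"]
    continuous_on_Pair[OF assms(2,3)] by simp

lemma lip_const_le_exp: "lip_const \<bar>m\<bar> \<le> 2 * exp (4 * K * \<bar>m\<bar>)"
  using K_pos by (simp add: lip_const_def)

lemma flow_Lions_linearized:
  assumes \<mu>: "\<mu> \<in> P2"
  shows "linearized \<mu> (\<lambda>m x. D_flow \<mu> m x y * jacobian \<mu> m y) (flow_Lions \<mu> y)"
  unfolding flow_Lions_def
proof (rule someI_ex[where P="linearized \<mu> (\<lambda>m x. D_flow \<mu> m x y * jacobian \<mu> m y)"],
    rule linearized_exists[OF \<mu>, where C="2 * K"])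
  show "continuous_on UNIV (\<lambda>p. D_flow \<mu> (fst p) (snd p) y * jacobian \<mu> (fst p) y)"
    by (intro continuous_intros continuous_D_flow continuous_jacobian \<mu>)
  have "\<bar>D_flow \<mu> m x y * jacobian \<mu> m y\<bar> \<le> K * (2 * exp (4 * K * \<bar>m\<bar>))" for m x
    by (intro abs_mult_le D_flow_bdd \<mu> order_trans[OF jacobian_bdd_abs lip_const_le_exp])
  then show "\<bar>D_flow \<mu> m x y * jacobian \<mu> m y\<bar> \<le> 2 * K * exp (4 * K * \<bar>m\<bar>)" for m x by (simp add: mult_ac)
qed

lemma flow_linear_linearized:
  assumes \<mu>: "\<mu> \<in> P2"
  shows "linearized \<mu> (\<lambda>m x. \<delta> (flow \<mu> m x) (law \<mu> m) (flow \<mu> m y) -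
     \<delta> (flow \<mu> m x) (law \<mu> m) (flow \<mu> m 0)) (flow_linear \<mu> y)"
  unfolding flow_linear_def
proof (rule someI_ex[where P="linearized \<mu> (\<lambda>m x. \<delta> (flow \<mu> m x) (law \<mu> m) (flow \<mu> m y) -
     \<delta> (flow \<mu> m x) (law \<mu> m) (flow \<mu> m 0))"],
    rule linearized_exists[OF \<mu>, where C="2 * K * \<bar>y\<bar>"])
  show "continuous_on UNIV (\<lambda>p. \<delta> (flow \<mu> (fst p) (snd p)) (law \<mu> (fst p)) (flow \<mu> (fst p) y) -
      \<delta> (flow \<mu> (fst p) (snd p)) (law \<mu> (fst p)) (flow \<mu> (fst p) 0))"
    by (intro continuous_intros continuous_\<delta> continuous_flow \<mu>)
  fix m x
  let ?d = "\<lambda>z. \<delta> (flow \<mu> m x) (law \<mu> m) (flow \<mu> m z)"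
  have "\<bar>?d y - ?d 0\<bar> \<le> K * \<bar>flow \<mu> m y - flow \<mu> m 0\<bar>" by (intro \<delta>_lip law_P2 \<mu>)
  also have "\<dots> \<le> K * (lip_const \<bar>m\<bar> * \<bar>y\<bar>)"
    using flow_lip[OF \<mu> order_refl, of m y 0] K_nonneg by (intro mult_left_mono) auto
  also have "\<dots> \<le> K * (2 * exp (4 * K * \<bar>m\<bar>) * \<bar>y\<bar>)"
    using lip_const_le_exp K_nonneg by (intro mult_left_mono mult_right_mono) auto
  finally show "\<bar>?d y - ?d 0\<bar> \<le> 2 * K * \<bar>y\<bar> * exp (4 * K * \<bar>m\<bar>)" by (simp add: mult_ac)
qed

end

text \<open>The solutions of the linearized equation are chosen separately for each y, so continuity
  in y does not come with their construction. It follows from a Lipschitz bound in y that is locally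
  uniform in p.\<close>

lemma continuous_joint_lipschitz:
  fixes f :: "'p::real_normed_vector \<Rightarrow> real \<Rightarrow> real"
  assumes cont: "\<And>y. continuous_on UNIV (\<lambda>p. f p y)"
    and lip: "\<And>R. \<exists>C. \<forall>p y z. norm p \<le> R \<longrightarrow> \<bar>f p y - f p z\<bar> \<le> C * \<bar>y - z\<bar>"
  shows "continuous_on UNIV (\<lambda>q. f (fst q) (snd q))"
  unfolding continuous_on_sequentially comp_def
proof safe
  fix X :: "nat \<Rightarrow> 'p \<times> real" and p y
  assume X: "X \<longlonglongrightarrow> (p, y)"
  have F: "(\<lambda>n. fst (X n)) \<longlonglongrightarrow> p" and S: "(\<lambda>n. snd (X n)) \<longlonglongrightarrow> y"
    using tendsto_fst[OF X] tendsto_snd[OF X] by simp_all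
  obtain R where R: "\<And>n. norm (fst (X n)) \<le> R"
    using convergent_imp_Bseq[of "\<lambda>n. fst (X n)"] F by (auto simp: convergent_def Bseq_def)
  obtain C where C: "\<And>p y z. norm p \<le> R \<Longrightarrow> \<bar>f p y - f p z\<bar> \<le> C * \<bar>y - z\<bar>" using lip by blast
  have "(\<lambda>n. f (fst (X n)) (snd (X n)) - f (fst (X n)) y) \<longlonglongrightarrow> 0"
  proof (rule Lim_null_comparison)
    show "\<forall>\<^sub>F n in sequentially. norm (f (fst (X n)) (snd (X n)) - f (fst (X n)) y) \<le> C * \<bar>snd (X n) - y\<bar>"
      using C[OF R] by simp
    have "(\<lambda>n. C * \<bar>snd (X n) - y\<bar>) \<longlonglongrightarrow> C * \<bar>y - y\<bar>" by (intro tendsto_intros S)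
    then show "(\<lambda>n. C * \<bar>snd (X n) - y\<bar>) \<longlonglongrightarrow> 0" by simp
  qed
  moreover have "(\<lambda>n. f (fst (X n)) y) \<longlonglongrightarrow> f p y"
    using cont[of y] F by (auto simp: continuous_on_sequentially comp_def)
  ultimately show "(\<lambda>n. f (fst (X n)) (snd (X n))) \<longlonglongrightarrow> f (fst (p, y)) (snd (p, y))"
    using tendsto_add by fastforce
qed

context mean_field_coefficient
begin

lemma
  assumes "linearized \<mu> b v"
  shows linearized_cont: "continuous_on UNIV (\<lambda>p. v (fst p) (snd p))"
    and linearized_deriv: "((\<lambda>m. v m x) has_real_derivative
       a_flow \<mu> m x * v m x + (\<integral>z. D_flow \<mu> m x z * v m z \<partial>\<mu>) + b m x) (at m)"
    and linearized_0: "v 0 x = 0"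
  using assms by (auto simp: linearized_def)

lemma linearized_strip:
  assumes "linearized \<mu> b v"
  obtains B where "\<And>r z. \<bar>r\<bar> \<le> T \<Longrightarrow> \<bar>v r z\<bar> \<le> B"
  using assms unfolding linearized_def by blast

lemma linearized_bound:
  assumes \<mu>: "\<mu> \<in> P2" and v: "linearized \<mu> b v" and m: "\<bar>m\<bar> \<le> T"
    and b: "\<And>m x. \<bar>m\<bar> \<le> T \<Longrightarrow> \<bar>b m x\<bar> \<le> \<epsilon>"
  shows "\<bar>v m x\<bar> \<le> 2 * T * exp (4 * K * T) * \<epsilon>"
proof -
  obtain B where "\<And>r z. \<bar>r\<bar> \<le> T \<Longrightarrow> \<bar>v r z\<bar> \<le> B" using linearized_strip[OF v] by blast
  then show ?thesis
    using order_trans[OF abs_ge_zero b[OF m, of x]]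
    by (intro linearized_estimate[OF \<mu> m _ linearized_deriv[OF v] _ b linearized_0[OF v]]) auto
qed

text \<open>Superposition, used to write a difference or a first-order remainder of solutions as one
  solution whose source is the corresponding combination.\<close>

lemma linearized_add_scaled:
  assumes \<mu>: "\<mu> \<in> P2" and v: "linearized \<mu> b v" and v': "linearized \<mu> b' v'"
  shows "linearized \<mu> (\<lambda>m x. b m x + c * b' m x) (\<lambda>m x. v m x + c * v' m x)"
  unfolding linearized_def
proof (intro conjI allI)
  show "continuous_on UNIV (\<lambda>p. v (fst p) (snd p) + c * v' (fst p) (snd p))"
    by (intro continuous_intros linearized_cont[OF v] linearized_cont[OF v'])
  show "v 0 x + c * v' 0 x = 0" for x using linearized_0[OF v] linearized_0[OF v'] by simp
  have bd: "\<exists>B B'. \<forall>r z. \<bar>r\<bar> \<le> T \<longrightarrow> \<bar>v r z\<bar> \<le> B \<and> \<bar>v' r z\<bar> \<le> B'" for T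
    using linearized_strip[OF v, of T] linearized_strip[OF v', of T] by metis
  fix T
  obtain B B' where B: "\<And>r z. \<bar>r\<bar> \<le> T \<Longrightarrow> \<bar>v r z\<bar> \<le> B" "\<And>r z. \<bar>r\<bar> \<le> T \<Longrightarrow> \<bar>v' r z\<bar> \<le> B'"
    using bd[of T] by blast
  have "\<bar>v r z + c * v' r z\<bar> \<le> B + \<bar>c\<bar> * B'" if "\<bar>r\<bar> \<le> T" for r z
    using B(1)[OF that, of z] abs_mult_le[OF order_refl B(2)[OF that, of z], of c] by linarith
  then show "\<exists>B. \<forall>r z. \<bar>r\<bar> \<le> T \<longrightarrow> \<bar>v r z + c * v' r z\<bar> \<le> B" by blast
next
  fix m x
  obtain B B' where B: "\<And>z. \<bar>v m z\<bar> \<le> B" "\<And>z. \<bar>v' m z\<bar> \<le> B'"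
    using linearized_strip[OF v, of "\<bar>m\<bar>"] linearized_strip[OF v', of "\<bar>m\<bar>"] by (metis order_refl)
  have "integrable \<mu> (\<lambda>z. D_flow \<mu> m x z * v m z)" "integrable \<mu> (\<lambda>z. D_flow \<mu> m x z * v' m z)"
    using B by (auto intro!: integrable_D_flow \<mu> borel_measurable_continuous_onI
        continuous_section(1) linearized_cont[OF v] linearized_cont[OF v'])
  then have "(\<integral>z. D_flow \<mu> m x z * (v m z + c * v' m z) \<partial>\<mu>)
      = (\<integral>z. D_flow \<mu> m x z * v m z \<partial>\<mu>) + c * (\<integral>z. D_flow \<mu> m x z * v' m z \<partial>\<mu>)"
    by (simp add: distrib_left mult.left_commute[of _ c])
  then show "((\<lambda>m. v m x + c * v' m x) has_real_derivative
      a_flow \<mu> m x * (v m x + c * v' m x) + (\<integral>z. D_flow \<mu> m x z * (v m z + c * v' m z) \<partial>\<mu>)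
      + (b m x + c * b' m x)) (at m)"
    by (auto intro!: derivative_eq_intros linearized_deriv[OF v] linearized_deriv[OF v'] simp: algebra_simps)
qed

section \<open>Bounds and stability of the Lions derivative\<close>

lemma flow_Lions_bdd:
  obtains C where "0 \<le> C" "\<And>\<mu> m x y. \<mu> \<in> P2 \<Longrightarrow> \<bar>m\<bar> \<le> T \<Longrightarrow> \<bar>flow_Lions \<mu> y m x\<bar> \<le> C"
proof
  show "\<bar>flow_Lions \<mu> y m x\<bar> \<le> 2 * \<bar>T\<bar> * exp (4 * K * \<bar>T\<bar>) * (K * lip_const \<bar>T\<bar>)" if "\<mu> \<in> P2" "\<bar>m\<bar> \<le> T" for \<mu> m x y
    using that
    by (intro linearized_bound[OF that(1) flow_Lions_linearized[OF that(1)]] abs_mult_le D_flow_bdd jacobian_bdd) auto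
qed (use K_nonneg lip_const_nonneg in auto)

text \<open>In y, the difference of two solutions is estimated by the difference of their sources.
  In x, one solution is compared at two positions: its integral term contains only values already
  bounded by \<open>V\<close>, so it acts as a known source and the Gronwall argument is
  scalar.\<close>

lemma flow_Lions_lip:
  obtains C where "0 \<le> C"
    "\<And>\<mu> m x y x' y'. \<mu> \<in> P2 \<Longrightarrow> \<bar>m\<bar> \<le> T \<Longrightarrow>
      \<bar>flow_Lions \<mu> y m x - flow_Lions \<mu> y' m x'\<bar> \<le> C * (\<bar>x - x'\<bar> + \<bar>y - y'\<bar>)"
proof -
  obtain J where J: "0 \<le> J" "\<And>\<mu> m x y. \<mu> \<in> P2 \<Longrightarrow> \<bar>m\<bar> \<le> T \<Longrightarrow> \<bar>jacobian \<mu> m x - jacobian \<mu> m y\<bar> \<le> J * \<bar>x - y\<bar>"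
    using jacobian_lip[of T] by blast
  obtain V where V: "0 \<le> V" "\<And>\<mu> m x y. \<mu> \<in> P2 \<Longrightarrow> \<bar>m\<bar> \<le> T \<Longrightarrow> \<bar>flow_Lions \<mu> y m x\<bar> \<le> V"
    using flow_Lions_bdd[of T] by blast
  let ?Cy = "2 * \<bar>T\<bar> * exp (4 * K * \<bar>T\<bar>) * (K * lip_const T * lip_const T + K * J)"
  let ?Cx = "2 * \<bar>T\<bar> * exp (2 * K * \<bar>T\<bar>) * (K * lip_const T * V + K * lip_const T * V + K * lip_const T * lip_const T)"
  have ly: "\<bar>flow_Lions \<mu> y m x - flow_Lions \<mu> y' m x\<bar> \<le> ?Cy * \<bar>y - y'\<bar>" if \<mu>: "\<mu> \<in> P2" and m: "\<bar>m\<bar> \<le> T" for \<mu> m x y y'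
  proof -
    have "\<bar>flow_Lions \<mu> y m x + (- 1) * flow_Lions \<mu> y' m x\<bar>
        \<le> 2 * T * exp (4 * K * T) * (K * lip_const T * (\<bar>x - x\<bar> + \<bar>y - y'\<bar>) * lip_const T + K * (J * \<bar>y - y'\<bar>))"
    proof (rule linearized_bound[OF \<mu> linearized_add_scaled[OF \<mu> flow_Lions_linearized[OF \<mu>] flow_Lions_linearized[OF \<mu>]] m])
      fix r z assume r: "\<bar>r\<bar> \<le> T"
      show "\<bar>D_flow \<mu> r z y * jacobian \<mu> r y + - 1 * (D_flow \<mu> r z y' * jacobian \<mu> r y')\<bar>
          \<le> K * lip_const T * (\<bar>x - x\<bar> + \<bar>y - y'\<bar>) * lip_const T + K * (J * \<bar>y - y'\<bar>)"
        using abs_product_diff_le[OF D_flow_lip[OF \<mu> r, of z y z y'] jacobian_bdd[OF \<mu> r, of y] D_flow_bdd[OF \<mu>, of r z y'] J(2)[OF \<mu> r, of y y']]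
        by simp
    qed
    also have "\<dots> = ?Cy * \<bar>y - y'\<bar>" using m by (simp add: algebra_simps)
    finally show ?thesis by simp
  qed
  have lx: "\<bar>flow_Lions \<mu> y m x - flow_Lions \<mu> y m x'\<bar> \<le> ?Cx * \<bar>x - x'\<bar>" if \<mu>: "\<mu> \<in> P2" and m: "\<bar>m\<bar> \<le> T" for \<mu> m x x' y
  proof -
    let ?v = "flow_Lions \<mu> y"
    let ?e = "K * lip_const T * \<bar>x - x'\<bar>"
    have cm: "?v r \<in> borel_measurable borel" for r
      by (intro borel_measurable_continuous_onI continuous_section linearized_cont[OF flow_Lions_linearized[OF \<mu>]])
    have "\<bar>?v m x - ?v m x'\<bar> \<le> 2 * (0 + T * (?e * V + ?e * V + ?e * lip_const T)) * exp (2 * K * T)"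
    proof (rule gronwall_sup[where w="\<lambda>m (_::unit). ?v m x - ?v m x'"
          and w'="\<lambda>m _. (a_flow \<mu> m x * ?v m x + (\<integral>z. D_flow \<mu> m x z * ?v m z \<partial>\<mu>) + D_flow \<mu> m x y * jacobian \<mu> m y)
            - (a_flow \<mu> m x' * ?v m x' + (\<integral>z. D_flow \<mu> m x' z * ?v m z \<partial>\<mu>) + D_flow \<mu> m x' y * jacobian \<mu> m y)"
          and M="2 * V"])
      fix r :: real assume r: "\<bar>r\<bar> \<le> T"
      show "\<bar>?v r x - ?v r x'\<bar> \<le> 2 * V" using V(2)[OF \<mu> r, of y x] V(2)[OF \<mu> r, of y x'] by linarith
      fix c assume c: "\<And>j::unit. \<bar>?v r x - ?v r x'\<bar> \<le> c"
      have kl: "\<bar>D_flow \<mu> r x z - D_flow \<mu> r x' z\<bar> \<le> ?e" for z using D_flow_lip[OF \<mu> r, of x z x' z] by simp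
      have 1: "\<bar>a_flow \<mu> r x * ?v r x - a_flow \<mu> r x' * ?v r x'\<bar> \<le> ?e * V + K * c"
        by (rule abs_product_diff_le[OF a_flow_lip[OF \<mu> r] V(2)[OF \<mu> r] a_flow_bdd[OF \<mu>] c])
      have "integrable \<mu> (\<lambda>z. D_flow \<mu> r x z * ?v r z)" "integrable \<mu> (\<lambda>z. D_flow \<mu> r x' z * ?v r z)"
        by (intro integrable_D_flow[OF \<mu> \<mu> cm V(2)[OF \<mu> r]])+
      then have d: "(\<integral>z. D_flow \<mu> r x z * ?v r z \<partial>\<mu>) - (\<integral>z. D_flow \<mu> r x' z * ?v r z \<partial>\<mu>)
          = (\<integral>z. (D_flow \<mu> r x z - D_flow \<mu> r x' z) * ?v r z \<partial>\<mu>)"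
        by (simp add: left_diff_distrib)
      have 2: "\<bar>(\<integral>z. D_flow \<mu> r x z * ?v r z \<partial>\<mu>) - (\<integral>z. D_flow \<mu> r x' z * ?v r z \<partial>\<mu>)\<bar> \<le> ?e * V"
        unfolding d by (intro integral_abs_le_P2[OF \<mu>] abs_mult_le kl V \<mu> r)
      have 3: "\<bar>D_flow \<mu> r x y * jacobian \<mu> r y - D_flow \<mu> r x' y * jacobian \<mu> r y\<bar> \<le> ?e * lip_const T"
        unfolding left_diff_distrib[symmetric] by (intro abs_mult_le kl jacobian_bdd \<mu> r)
      from 1 2 3 show "\<bar>(a_flow \<mu> r x * ?v r x + (\<integral>z. D_flow \<mu> r x z * ?v r z \<partial>\<mu>) + D_flow \<mu> r x y * jacobian \<mu> r y)
            - (a_flow \<mu> r x' * ?v r x' + (\<integral>z. D_flow \<mu> r x' z * ?v r z \<partial>\<mu>) + D_flow \<mu> r x' y * jacobian \<mu> r y)\<bar>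
          \<le> K * c + (?e * V + ?e * V + ?e * lip_const T)" by linarith
    qed (use m K_pos V(1) lip_const_nonneg[of T] in
        \<open>auto intro!: DERIV_diff linearized_deriv[OF flow_Lions_linearized[OF \<mu>]] add_nonneg_nonneg mult_nonneg_nonneg
          simp: linearized_0[OF flow_Lions_linearized[OF \<mu>]]\<close>)
    also have "\<dots> = ?Cx * \<bar>x - x'\<bar>" using m by (simp add: algebra_simps)
    finally show ?thesis .
  qed
  have C0: "0 \<le> ?Cx" "0 \<le> ?Cy" using K_nonneg lip_const_nonneg[of T] V(1) J(1) by auto
  show thesis
  proof (rule that[of "?Cx + ?Cy"])
    show "\<bar>flow_Lions \<mu> y m x - flow_Lions \<mu> y' m x'\<bar> \<le> (?Cx + ?Cy) * (\<bar>x - x'\<bar> + \<bar>y - y'\<bar>)" if "\<mu> \<in> P2" "\<bar>m\<bar> \<le> T" for \<mu> m x y x' y'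
    proof -
      have "\<bar>flow_Lions \<mu> y m x - flow_Lions \<mu> y' m x'\<bar> \<le> ?Cx * \<bar>x - x'\<bar> + ?Cy * \<bar>y - y'\<bar>"
        using lx[OF that, of y x x'] ly[OF that, of y x' y'] by linarith
      also have "\<dots> \<le> (?Cx + ?Cy) * \<bar>x - x'\<bar> + (?Cx + ?Cy) * \<bar>y - y'\<bar>"
        using C0 by (intro add_mono mult_right_mono) auto
      finally show ?thesis by (simp add: distrib_left)
    qed
  qed (use C0 in linarith)
qed

text \<open>The derivative at \<open>\<mu>\<close> is inserted into the equation of
  \<open>\<nu>\<close>; the defect collects the changes of the local coefficient, of the integrating
  measure, of the kernel and of the source.\<close>

lemma flow_Lions_stab:
  assumes T: "0 \<le> T"
  obtains C where "0 \<le> C"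
    "\<And>\<mu> \<nu> w m x y. \<mu> \<in> P2 \<Longrightarrow> \<nu> \<in> P2 \<Longrightarrow> kr_le \<mu> \<nu> w \<Longrightarrow> \<bar>m\<bar> \<le> T \<Longrightarrow>
      \<bar>flow_Lions \<mu> y m x - flow_Lions \<nu> y m x\<bar> \<le> C * flow_modulus T w"
proof -
  obtain J where J: "0 \<le> J" "\<And>\<mu> \<nu> w m x. \<mu> \<in> P2 \<Longrightarrow> \<nu> \<in> P2 \<Longrightarrow> kr_le \<mu> \<nu> w \<Longrightarrow> \<bar>m\<bar> \<le> T \<Longrightarrow>
      \<bar>jacobian \<mu> m x - jacobian \<nu> m x\<bar> \<le> J * flow_modulus T w"
    using jacobian_stab[of T] by blast
  obtain V where V: "0 \<le> V" "\<And>\<mu> m x y. \<mu> \<in> P2 \<Longrightarrow> \<bar>m\<bar> \<le> T \<Longrightarrow> \<bar>flow_Lions \<mu> y m x\<bar> \<le> V"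
    using flow_Lions_bdd[of T] by blast
  obtain L where L: "0 \<le> L" "\<And>\<mu> m x y x' y'. \<mu> \<in> P2 \<Longrightarrow> \<bar>m\<bar> \<le> T \<Longrightarrow>
      \<bar>flow_Lions \<mu> y m x - flow_Lions \<mu> y' m x'\<bar> \<le> L * (\<bar>x - x'\<bar> + \<bar>y - y'\<bar>)"
    using flow_Lions_lip[of T] by blast
  let ?a = "K * stab_const T + 1" and ?k = "2 * K * stab_const T + 1"
  let ?E = "?a * V + (K * lip_const T * V + K * L) + ?k * V + (?k * lip_const T + K * J)"
  have ak: "0 \<le> ?a" "0 \<le> ?k" using K_nonneg stab_const_nonneg[OF T] by auto
  have E0: "0 \<le> ?E" using ak stab_const_nonneg[OF T] K_nonneg lip_const_nonneg[of T] V(1) J(1) L(1) by (intro add_nonneg_nonneg mult_nonneg_nonneg) auto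
  show thesis
  proof (rule that[of "2 * T * exp (4 * K * T) * ?E"])
    fix \<mu> \<nu> w m x y
    assume \<mu>: "\<mu> \<in> P2" and \<nu>: "\<nu> \<in> P2" and w: "kr_le \<mu> \<nu> w" and m: "\<bar>m\<bar> \<le> T"
    let ?u = "flow_Lions \<mu> y" and ?v = "flow_Lions \<nu> y"
    let ?q = "flow_modulus T w"
    have q: "0 \<le> ?q" "w \<le> ?q" using kr_le_nonneg[OF w] by (auto intro: flow_modulus_nonneg le_flow_modulus)
    have cm: "?u r \<in> borel_measurable borel" "?v r \<in> borel_measurable borel" for r
      by (intro borel_measurable_continuous_onI continuous_section linearized_cont[OF flow_Lions_linearized[OF \<mu>]]
          linearized_cont[OF flow_Lions_linearized[OF \<nu>]])+
    let ?e = "\<lambda>r z. (a_flow \<mu> r z - a_flow \<nu> r z) * ?u r z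
      + ((\<integral>z'. D_flow \<mu> r z z' * ?u r z' \<partial>\<mu>) - (\<integral>z'. D_flow \<nu> r z z' * ?u r z' \<partial>\<nu>))
      + (D_flow \<mu> r z y * jacobian \<mu> r y - D_flow \<nu> r z y * jacobian \<nu> r y)"
    have eb: "\<bar>?e r z\<bar> \<le> ?E * ?q" if r: "\<bar>r\<bar> \<le> T" for r z
    proof -
      have 1: "\<bar>(a_flow \<mu> r z - a_flow \<nu> r z) * ?u r z\<bar> \<le> ?a * ?q * V"
        by (intro abs_mult_le a_flow_stab[OF \<mu> \<nu> w r] V \<mu> r)
      \<comment> \<open>Here only the integrating measure changes, and the integrand is Lipschitz
        because \<open>flow_Lions\<close> is Lipschitz in the position. The kernel is changed
        afterwards, under the integral against \<open>\<nu>\<close>.\<close>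
      have "\<bar>(\<integral>z'. D_flow \<mu> r z z' * ?u r z' \<partial>\<mu>) - (\<integral>z'. D_flow \<mu> r z z' * ?u r z' \<partial>\<nu>)\<bar>
          \<le> (K * lip_const T * V + K * L) * w"
      proof (rule kr_leD[OF w \<mu> \<nu>])
        fix z1 z2
        show "\<bar>D_flow \<mu> r z z1 * ?u r z1 - D_flow \<mu> r z z2 * ?u r z2\<bar> \<le> (K * lip_const T * V + K * L) * \<bar>z1 - z2\<bar>"
          using abs_product_diff_le[OF D_flow_lip[OF \<mu> r, of z z1 z z2] V(2)[OF \<mu> r, of y z1] D_flow_bdd[OF \<mu>, of r z z2] L(2)[OF \<mu> r, of y z1 y z2]]
          by (simp add: algebra_simps)
      qed
      also have "\<dots> \<le> (K * lip_const T * V + K * L) * ?q"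
        using q K_nonneg lip_const_nonneg[of T] V(1) L(1) by (intro mult_left_mono) auto
      finally have 2: "\<bar>(\<integral>z'. D_flow \<mu> r z z' * ?u r z' \<partial>\<mu>) - (\<integral>z'. D_flow \<mu> r z z' * ?u r z' \<partial>\<nu>)\<bar>
          \<le> (K * lip_const T * V + K * L) * ?q" .
      have "integrable \<nu> (\<lambda>z'. D_flow \<mu> r z z' * ?u r z')" "integrable \<nu> (\<lambda>z'. D_flow \<nu> r z z' * ?u r z')"
        by (intro integrable_D_flow[OF \<mu> \<nu> cm(1) V(2)[OF \<mu> r]] integrable_D_flow[OF \<nu> \<nu> cm(1) V(2)[OF \<mu> r]])+
      then have d: "(\<integral>z'. D_flow \<mu> r z z' * ?u r z' \<partial>\<nu>) - (\<integral>z'. D_flow \<nu> r z z' * ?u r z' \<partial>\<nu>)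
          = (\<integral>z'. (D_flow \<mu> r z z' - D_flow \<nu> r z z') * ?u r z' \<partial>\<nu>)"
        by (simp add: left_diff_distrib)
      have 3: "\<bar>(\<integral>z'. D_flow \<mu> r z z' * ?u r z' \<partial>\<nu>) - (\<integral>z'. D_flow \<nu> r z z' * ?u r z' \<partial>\<nu>)\<bar> \<le> ?k * ?q * V"
        unfolding d by (intro integral_abs_le_P2[OF \<nu>] abs_mult_le D_flow_stab[OF \<mu> \<nu> w r] V \<mu> r)
      have 4: "\<bar>D_flow \<mu> r z y * jacobian \<mu> r y - D_flow \<nu> r z y * jacobian \<nu> r y\<bar> \<le> ?k * ?q * lip_const T + K * (J * ?q)"
        by (rule abs_product_diff_le[OF D_flow_stab[OF \<mu> \<nu> w r] jacobian_bdd[OF \<mu> r] D_flow_bdd[OF \<nu>] J(2)[OF \<mu> \<nu> w r]])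
      have "?E * ?q = ?a * ?q * V + (K * lip_const T * V + K * L) * ?q + ?k * ?q * V + (?k * ?q * lip_const T + K * (J * ?q))"
        by (simp add: algebra_simps)
      with 1 2 3 4 show ?thesis by linarith
    qed
    have "\<bar>?u m x - ?v m x\<bar> \<le> 2 * T * exp (4 * K * T) * (?E * ?q)"
    proof (rule linearized_estimate[OF \<nu> m, where w="\<lambda>m x. ?u m x - ?v m x" and e="?e" and M="2 * V"])
      show "0 \<le> ?E * ?q" using E0 q by simp
      show "\<bar>?u r z - ?v r z\<bar> \<le> 2 * V" if "\<bar>r\<bar> \<le> T" for r z
        using V(2)[OF \<mu> that, of y z] V(2)[OF \<nu> that, of y z] by linarith
      show "\<bar>?e r z\<bar> \<le> ?E * ?q" if "\<bar>r\<bar> \<le> T" for r z using eb[OF that] .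
      show "?u 0 z - ?v 0 z = 0" for z
        by (simp add: linearized_0[OF flow_Lions_linearized[OF \<mu>]] linearized_0[OF flow_Lions_linearized[OF \<nu>]])
      show "((\<lambda>m. ?u m x - ?v m x) has_real_derivative a_flow \<nu> m x * (?u m x - ?v m x)
          + (\<integral>z. D_flow \<nu> m x z * (?u m z - ?v m z) \<partial>\<nu>) + ?e m x) (at m)" for m x
      proof -
        obtain B B' where B: "\<And>z. \<bar>?u m z\<bar> \<le> B" "\<And>z. \<bar>?v m z\<bar> \<le> B'"
          using linearized_strip[OF flow_Lions_linearized[OF \<mu>], of "\<bar>m\<bar>"]
            linearized_strip[OF flow_Lions_linearized[OF \<nu>], of "\<bar>m\<bar>"] by (metis order_refl)
        have "integrable \<nu> (\<lambda>z. D_flow \<nu> m x z * ?u m z)" "integrable \<nu> (\<lambda>z. D_flow \<nu> m x z * ?v m z)"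
          using integrable_D_flow[OF \<nu> \<nu> cm(1) B(1)] integrable_D_flow[OF \<nu> \<nu> cm(2) B(2)] by blast+
        then have "(\<integral>z. D_flow \<nu> m x z * (?u m z - ?v m z) \<partial>\<nu>)
            = (\<integral>z. D_flow \<nu> m x z * ?u m z \<partial>\<nu>) - (\<integral>z. D_flow \<nu> m x z * ?v m z \<partial>\<nu>)"
          by (simp add: right_diff_distrib)
        then show ?thesis
          by (auto intro!: derivative_eq_intros linearized_deriv[OF flow_Lions_linearized[OF \<mu>]]
              linearized_deriv[OF flow_Lions_linearized[OF \<nu>]] simp: algebra_simps)
      qed
    qed
    then show "\<bar>?u m x - ?v m x\<bar> \<le> 2 * T * exp (4 * K * T) * ?E * ?q" by (simp add: mult.assoc)
  qed (use T E0 in simp)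
qed

section \<open>The linear functional derivative as a function of the mass point\<close>

text \<open>The combination of three solutions has as source the Taylor remainder of
  \<open>\<delta>\<close> plus \<open>D_flow\<close> times the remainder of the flow in its starting
  point, both quadratic in y - z.\<close>

lemma flow_linear_expand_y:
  assumes \<mu>: "\<mu> \<in> P2" and m: "\<bar>m\<bar> \<le> T"
  shows "\<bar>flow_linear \<mu> y m x - flow_linear \<mu> z m x - flow_Lions \<mu> z m x * (y - z)\<bar>
    \<le> 2 * T * exp (4 * K * T) * (K * (lip_const T)\<^sup>2 + K * (T * K * lip_const T ^ 3)) * (y - z)\<^sup>2"
proof -
  let ?d = "\<lambda>y m x. \<delta> (flow \<mu> m x) (law \<mu> m) (flow \<mu> m y)"
  have "\<bar>flow_linear \<mu> y m x + (- 1) * flow_linear \<mu> z m x + (- (y - z)) * flow_Lions \<mu> z m x\<bar>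
      \<le> 2 * T * exp (4 * K * T) * (K * (lip_const T * \<bar>y - z\<bar>)\<^sup>2 + K * (T * K * lip_const T ^ 3 * (y - z)\<^sup>2))"
  proof (rule linearized_bound[OF \<mu> linearized_add_scaled[OF \<mu>
            linearized_add_scaled[OF \<mu> flow_linear_linearized[OF \<mu>] flow_linear_linearized[OF \<mu>]] flow_Lions_linearized[OF \<mu>]] m])
    fix r x assume r: "\<bar>r\<bar> \<le> T"
    let ?Y = "flow \<mu> r y" and ?Z = "flow \<mu> r z"
    have "\<bar>?d y r x - ?d z r x - D_flow \<mu> r x z * (?Y - ?Z)\<bar> \<le> K * (?Y - ?Z)\<^sup>2"
      unfolding D_flow_def by (intro \<delta>_taylor law_P2 \<mu>)
    also have "\<dots> \<le> K * (lip_const T * \<bar>y - z\<bar>)\<^sup>2"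
      using flow_lip[OF \<mu> r, of y z] K_nonneg lip_const_nonneg[of T]
      by (intro mult_left_mono abs_le_square_iff[THEN iffD1]) (auto simp: abs_mult)
    finally have 1: "\<bar>?d y r x - ?d z r x - D_flow \<mu> r x z * (?Y - ?Z)\<bar> \<le> K * (lip_const T * \<bar>y - z\<bar>)\<^sup>2" .
    have 2: "\<bar>D_flow \<mu> r x z * (?Y - ?Z - jacobian \<mu> r z * (y - z))\<bar> \<le> K * (T * K * lip_const T ^ 3 * (y - z)\<^sup>2)"
      by (intro abs_mult_le D_flow_bdd flow_expand_x \<mu> r)
    have "?d y r x - ?d 0 r x + - 1 * (?d z r x - ?d 0 r x) + - (y - z) * (D_flow \<mu> r x z * jacobian \<mu> r z)
        = (?d y r x - ?d z r x - D_flow \<mu> r x z * (?Y - ?Z)) + D_flow \<mu> r x z * (?Y - ?Z - jacobian \<mu> r z * (y - z))"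
      by (simp add: algebra_simps)
    with 1 2 show "\<bar>?d y r x - ?d 0 r x + - 1 * (?d z r x - ?d 0 r x) + - (y - z) * (D_flow \<mu> r x z * jacobian \<mu> r z)\<bar>
        \<le> K * (lip_const T * \<bar>y - z\<bar>)\<^sup>2 + K * (T * K * lip_const T ^ 3 * (y - z)\<^sup>2)" by linarith
  qed
  also have "\<dots> = 2 * T * exp (4 * K * T) * (K * (lip_const T)\<^sup>2 + K * (T * K * lip_const T ^ 3)) * (y - z)\<^sup>2"
    by (simp add: power_mult_distrib algebra_simps)
  finally show ?thesis by (simp add: algebra_simps)
qed

lemma flow_linear_deriv_y: "\<mu> \<in> P2 \<Longrightarrow> ((\<lambda>y. flow_linear \<mu> y m x) has_real_derivative flow_Lions \<mu> y m x) (at y)"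
  by (rule deriv_from_quadratic, rule flow_linear_expand_y[OF _ order_refl])

text \<open>The source was normalised to vanish at y = 0, and then so does the solution. Bounds on
  the derivative in y thereby become linear growth bounds.\<close>

lemma flow_linear_0:
  assumes \<mu>: "\<mu> \<in> P2"
  shows "flow_linear \<mu> 0 m x = 0"
proof -
  have "\<bar>flow_linear \<mu> 0 m x\<bar> \<le> 2 * \<bar>m\<bar> * exp (4 * K * \<bar>m\<bar>) * 0"
    by (rule linearized_bound[OF \<mu> flow_linear_linearized[OF \<mu>, of 0] order_refl]) simp
  then show ?thesis by simp
qed

lemma flow_linear_lip:
  obtains C where "0 \<le> C"
    "\<And>\<mu> m x y z. \<mu> \<in> P2 \<Longrightarrow> \<bar>m\<bar> \<le> T \<Longrightarrow> \<bar>flow_linear \<mu> y m x - flow_linear \<mu> z m x\<bar> \<le> C * \<bar>y - z\<bar>"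
proof -
  obtain C where C: "0 \<le> C" "\<And>\<mu> m x y. \<mu> \<in> P2 \<Longrightarrow> \<bar>m\<bar> \<le> T \<Longrightarrow> \<bar>flow_Lions \<mu> y m x\<bar> \<le> C"
    using flow_Lions_bdd[of T] by blast
  have "\<bar>flow_linear \<mu> y m x - flow_linear \<mu> z m x\<bar> \<le> C * \<bar>y - z\<bar>" if "\<mu> \<in> P2" "\<bar>m\<bar> \<le> T" for \<mu> m x y z
    by (rule lipschitz_from_deriv[OF flow_linear_deriv_y[OF that(1)] C(2)[OF that]])
  then show ?thesis using C(1) that by blast
qed

lemma continuous_flow_Lions:
  assumes \<mu>: "\<mu> \<in> P2"
  shows "continuous_on UNIV (\<lambda>(x, m, y). flow_Lions \<mu> y m x)"
proof -
  have "continuous_on UNIV (\<lambda>q. flow_Lions \<mu> (snd q) (fst (fst q)) (snd (fst q)))"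
  proof (rule continuous_joint_lipschitz[where f="\<lambda>p y. flow_Lions \<mu> y (fst p) (snd p)"])
    show "continuous_on UNIV (\<lambda>p. flow_Lions \<mu> y (fst p) (snd p))" for y
      by (rule linearized_cont[OF flow_Lions_linearized[OF \<mu>]])
    fix R
    obtain C where C: "0 \<le> C" "\<And>\<mu> m x y x' y'. \<mu> \<in> P2 \<Longrightarrow> \<bar>m\<bar> \<le> R \<Longrightarrow>
      \<bar>flow_Lions \<mu> y m x - flow_Lions \<mu> y' m x'\<bar> \<le> C * (\<bar>x - x'\<bar> + \<bar>y - y'\<bar>)" using flow_Lions_lip[of R] by blast
    have "\<bar>flow_Lions \<mu> y (fst p) (snd p) - flow_Lions \<mu> z (fst p) (snd p)\<bar> \<le> C * \<bar>y - z\<bar>" if "norm p \<le> R" for p y z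
      using C(2)[OF \<mu>, of "fst p" y "snd p" z "snd p"] norm_fst_le[of "fst p" "snd p"] that by simp
    then show "\<exists>C. \<forall>p y z. norm p \<le> R \<longrightarrow>
        \<bar>flow_Lions \<mu> y (fst p) (snd p) - flow_Lions \<mu> z (fst p) (snd p)\<bar> \<le> C * \<bar>y - z\<bar>" by blast
  qed
  moreover have "continuous_on UNIV (\<lambda>q :: real \<times> real \<times> real. ((fst (snd q), fst q), snd (snd q)))"
    by (intro continuous_intros)
  ultimately show ?thesis
    using continuous_on_compose2[of UNIV _ UNIV "\<lambda>q :: real \<times> real \<times> real. ((fst (snd q), fst q), snd (snd q))"]
    by (fastforce simp: case_prod_unfold)
qed

lemma flow_linear_measurable_pair:
  assumes \<mu>: "\<mu> \<in> P2"
  shows "(\<lambda>q. flow_linear \<mu> (snd q) m (fst q)) \<in> borel_measurable borel"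
proof (rule borel_measurable_continuous_onI, rule continuous_joint_lipschitz[where f="\<lambda>p y. flow_linear \<mu> y m p"])
  show "continuous_on UNIV (flow_linear \<mu> y m)" for y
    by (intro continuous_section linearized_cont[OF flow_linear_linearized[OF \<mu>]])
  show "\<exists>C. \<forall>p y z. norm p \<le> R \<longrightarrow> \<bar>flow_linear \<mu> y m p - flow_linear \<mu> z m p\<bar> \<le> C * \<bar>y - z\<bar>" for R
    using flow_linear_lip[of "\<bar>m\<bar>"] \<mu> by (metis order_refl)
qed

end

section \<open>The Lions derivative of the flow\<close>

context mean_field_coefficient
begin

lemma flow_modulus_tendsto: "w \<longlonglongrightarrow> 0 \<Longrightarrow> (\<lambda>n. flow_modulus T (w n)) \<longlonglongrightarrow> 0"
  unfolding flow_modulus_def by (intro tendsto_add_zero \<omega>_tendsto tendsto_mult_right_zero)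

text \<open>Convergence in \<open>W2\<close> forces convergence in the first Wasserstein distance,
  so a modulus in terms of \<open>kr_le\<close> is enough. It may depend on the radius R because
  convergent sequences are bounded.\<close>

lemma continuous_P2I:
  fixes f :: "real measure \<Rightarrow> 'z::real_normed_vector \<Rightarrow> real"
  assumes cont: "\<And>\<mu>. \<mu> \<in> P2 \<Longrightarrow> continuous_on UNIV (f \<mu>)"
    and modulus: "\<And>R. 0 \<le> R \<Longrightarrow> \<exists>C T. \<forall>\<mu>\<in>P2. \<forall>\<nu>\<in>P2. \<forall>w z. kr_le \<mu> \<nu> w \<longrightarrow> norm z \<le> R \<longrightarrow>
      \<bar>f \<mu> z - f \<nu> z\<bar> \<le> C * flow_modulus T w"
  shows "continuous_P2 f"
  unfolding continuous_P2_def
proof safe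
  fix M :: "nat \<Rightarrow> real measure" and \<mu> and Z :: "nat \<Rightarrow> 'z" and z
  assume M: "\<forall>n. M n \<in> P2" and \<mu>: "\<mu> \<in> P2" and W: "(\<lambda>n. W2 (M n) \<mu>) \<longlonglongrightarrow> 0" and Z: "Z \<longlonglongrightarrow> z"
  obtain R where R: "0 < R" "\<And>n. norm (Z n) \<le> R"
    using convergent_imp_Bseq[of Z] Z by (auto simp: convergent_def Bseq_def)
  obtain C T where C: "\<And>\<mu> \<nu> w z. \<mu> \<in> P2 \<Longrightarrow> \<nu> \<in> P2 \<Longrightarrow> kr_le \<mu> \<nu> w \<Longrightarrow> norm z \<le> R \<Longrightarrow>
      \<bar>f \<mu> z - f \<nu> z\<bar> \<le> C * flow_modulus T w"
    using modulus[of R] R(1) by (meson less_imp_le)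
  have "(\<lambda>n. f (M n) (Z n) - f \<mu> (Z n)) \<longlonglongrightarrow> 0"
  proof (rule Lim_null_comparison)
    show "\<forall>\<^sub>F n in sequentially. norm (f (M n) (Z n) - f \<mu> (Z n)) \<le> C * flow_modulus T (W2 (M n) \<mu>)"
      using C M \<mu> kr_le_W2 R by simp
    show "(\<lambda>n. C * flow_modulus T (W2 (M n) \<mu>)) \<longlonglongrightarrow> 0"
      by (intro tendsto_mult_right_zero flow_modulus_tendsto W)
  qed
  moreover have "(\<lambda>n. f \<mu> (Z n)) \<longlonglongrightarrow> f \<mu> z"
    using cont[OF \<mu>] Z by (auto simp: continuous_on_sequentially comp_def)
  ultimately show "(\<lambda>n. f (M n) (Z n)) \<longlonglongrightarrow> f \<mu> z"
    using tendsto_add by fastforce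
qed

section \<open>Averages of the linear derivative over a measure\<close>

lemma flow_linear_growth:
  obtains C where "0 \<le> C" "\<And>\<mu> m x y. \<mu> \<in> P2 \<Longrightarrow> \<bar>m\<bar> \<le> T \<Longrightarrow> \<bar>flow_linear \<mu> y m x\<bar> \<le> C * \<bar>y\<bar>"
proof -
  obtain C where C: "0 \<le> C" "\<And>\<mu> m x y z. \<mu> \<in> P2 \<Longrightarrow> \<bar>m\<bar> \<le> T \<Longrightarrow> \<bar>flow_linear \<mu> y m x - flow_linear \<mu> z m x\<bar> \<le> C * \<bar>y - z\<bar>"
    using flow_linear_lip[of T] by blast
  have "\<bar>flow_linear \<mu> y m x\<bar> \<le> C * \<bar>y\<bar>" if "\<mu> \<in> P2" "\<bar>m\<bar> \<le> T" for \<mu> m x y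
    using C(2)[OF that, of y x 0] by (simp add: flow_linear_0 that)
  with C(1) that show ?thesis by blast
qed

lemma flow_linear_section:
  assumes "\<mu> \<in> P2"
  shows "continuous_on UNIV (flow_linear \<mu> y m)" "flow_linear \<mu> y m \<in> borel_measurable borel"
  by (intro borel_measurable_continuous_onI continuous_section(1) linearized_cont[OF flow_linear_linearized[OF assms]])+

lemma integrable_flow_linear: "\<mu> \<in> P2 \<Longrightarrow> \<rho> \<in> P2 \<Longrightarrow> integrable \<rho> (\<lambda>y. flow_linear \<mu> y m x)"
  using flow_linear_lip[of "\<bar>m\<bar>"] by (metis order_refl integrable_lipschitz)

lemma integral_flow_linear_measurable:
  assumes \<mu>: "\<mu> \<in> P2" and \<rho>: "\<rho> \<in> P2"
  shows "(\<lambda>x. \<integral>y. flow_linear \<mu> y m x \<partial>\<rho>) \<in> borel_measurable borel"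
proof -
  interpret prob_space \<rho> using \<rho> by (rule P2_prob_space)
  have "sets ((borel :: real measure) \<Otimes>\<^sub>M \<rho>) = sets ((borel :: real measure) \<Otimes>\<^sub>M (borel :: real measure))"
    by (intro sets_pair_measure_cong P2_sets \<rho> refl)
  also have "\<dots> = sets (borel :: (real \<times> real) measure)" unfolding borel_prod ..
  finally have "(\<lambda>(x, y). flow_linear \<mu> y m x) \<in> borel_measurable (borel \<Otimes>\<^sub>M \<rho>)"
    using flow_linear_measurable_pair[OF \<mu>, of m] by (simp add: case_prod_unfold cong: measurable_cong_sets)
  then show ?thesis by (rule borel_measurable_lebesgue_integral)
qed

lemma integral_flow_linear_bdd:
  assumes \<rho>: "\<rho> \<in> P2"
  obtains C where "\<And>\<mu> m x. \<mu> \<in> P2 \<Longrightarrow> \<bar>m\<bar> \<le> T \<Longrightarrow> \<bar>\<integral>y. flow_linear \<mu> y m x \<partial>\<rho>\<bar> \<le> C"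
proof -
  obtain C where C: "0 \<le> C" "\<And>\<mu> m x y. \<mu> \<in> P2 \<Longrightarrow> \<bar>m\<bar> \<le> T \<Longrightarrow> \<bar>flow_linear \<mu> y m x\<bar> \<le> C * \<bar>y\<bar>"
    using flow_linear_growth[of T] by blast
  have i: "integrable \<rho> (\<lambda>y. C * \<bar>y\<bar>)"
    using integrable_lipschitz[OF \<rho>, of abs 1] by simp
  have "\<bar>\<integral>y. flow_linear \<mu> y m x \<partial>\<rho>\<bar> \<le> (\<integral>y. C * \<bar>y\<bar> \<partial>\<rho>)" if "\<mu> \<in> P2" "\<bar>m\<bar> \<le> T" for \<mu> m x
  proof -
    have "\<bar>\<integral>y. flow_linear \<mu> y m x \<partial>\<rho>\<bar> \<le> (\<integral>y. \<bar>flow_linear \<mu> y m x\<bar> \<partial>\<rho>)" by (rule integral_abs_bound)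
    also have "\<dots> \<le> (\<integral>y. C * \<bar>y\<bar> \<partial>\<rho>)"
      using C(2)[OF that] integrable_flow_linear[OF that(1) \<rho>] i by (intro integral_mono) auto
    finally show ?thesis .
  qed
  then show ?thesis by (rule that)
qed

text \<open>Averaging over \<open>\<rho>\<close> has to commute with the nonlocal term, an integral
  over \<open>\<mu>\<close>; linear growth in y dominates the integrand.\<close>

lemma fubini_flow_linear:
  assumes \<mu>: "\<mu> \<in> P2" and \<rho>: "\<rho> \<in> P2"
  shows "(\<integral>y. (\<integral>z. D_flow \<mu> m x z * flow_linear \<mu> y m z \<partial>\<mu>) \<partial>\<rho>) = (\<integral>z. D_flow \<mu> m x z * (\<integral>y. flow_linear \<mu> y m z \<partial>\<rho>) \<partial>\<mu>)"
proof -
  interpret m: prob_space \<mu> using \<mu> by (rule P2_prob_space)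
  interpret r: prob_space \<rho> using \<rho> by (rule P2_prob_space)
  interpret pair_sigma_finite \<mu> \<rho> ..
  obtain C where C: "0 \<le> C" "\<And>\<mu> m' x y. \<mu> \<in> P2 \<Longrightarrow> \<bar>m'\<bar> \<le> \<bar>m\<bar> \<Longrightarrow> \<bar>flow_linear \<mu> y m' x\<bar> \<le> C * \<bar>y\<bar>"
    using flow_linear_growth[of "\<bar>m\<bar>"] by blast
  have sets: "sets (\<mu> \<Otimes>\<^sub>M \<rho>) = sets (borel \<Otimes>\<^sub>M borel)"
    by (intro sets_pair_measure_cong P2_sets \<mu> \<rho>)
  have absm: "(\<lambda>q. K * (C * \<bar>snd q\<bar>)) \<in> borel_measurable (\<mu> \<Otimes>\<^sub>M \<rho>)"
    by (subst measurable_cong_sets[OF sets refl]) measurable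
  have "integrable (\<mu> \<Otimes>\<^sub>M \<rho>) (\<lambda>q. K * (C * \<bar>snd q\<bar>))"
  proof (rule Fubini_integrable[OF absm])
    show "integrable \<mu> (\<lambda>x. \<integral>y. norm (K * (C * \<bar>snd (x, y)\<bar>)) \<partial>\<rho>)" by simp
    show "AE x in \<mu>. integrable \<rho> (\<lambda>y. K * (C * \<bar>snd (x, y)\<bar>))"
      using integrable_lipschitz[OF \<rho>, of abs 1] by simp
  qed
  then have int: "integrable (\<mu> \<Otimes>\<^sub>M \<rho>) (\<lambda>(z, y). D_flow \<mu> m x z * flow_linear \<mu> y m z)"
  proof (rule Bochner_Integration.integrable_bound)
    have "(\<lambda>q. flow_linear \<mu> (snd q) m (fst q)) \<in> borel_measurable (borel \<Otimes>\<^sub>M borel)"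
      using flow_linear_measurable_pair[OF \<mu>, of m] by (simp add: borel_prod)
    then show "(\<lambda>(z, y). D_flow \<mu> m x z * flow_linear \<mu> y m z) \<in> borel_measurable (\<mu> \<Otimes>\<^sub>M \<rho>)"
      using D_flow_measurable[OF \<mu>, of m x]
      by (subst measurable_cong_sets[OF sets refl]) (simp add: case_prod_unfold)
    show "AE q in \<mu> \<Otimes>\<^sub>M \<rho>. norm (case q of (z, y) \<Rightarrow> D_flow \<mu> m x z * flow_linear \<mu> y m z) \<le> norm (K * (C * \<bar>snd q\<bar>))"
      using order_trans[OF abs_mult_le[OF D_flow_bdd[OF \<mu>] C(2)[OF \<mu> order_refl]] abs_ge_self]
      by (intro AE_I2) (simp add: case_prod_unfold)
  qed
  show ?thesis using Fubini_integral[OF int] by simp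
qed

text \<open>Averaging the equation of \<open>flow_linear\<close> over \<open>\<rho>\<close> gives
  the linearized equation again, with averaged source. The term at the base point 0 survives here
  and cancels when two such averages are subtracted.\<close>

lemma integral_flow_linear_deriv:
  assumes \<mu>: "\<mu> \<in> P2" and \<rho>: "\<rho> \<in> P2"
  shows "((\<lambda>m. \<integral>y. flow_linear \<mu> y m x \<partial>\<rho>) has_real_derivative
    a_flow \<mu> m x * (\<integral>y. flow_linear \<mu> y m x \<partial>\<rho>) + (\<integral>z. D_flow \<mu> m x z * (\<integral>y. flow_linear \<mu> y m z \<partial>\<rho>) \<partial>\<mu>)
    + ((\<integral>y. \<delta> (flow \<mu> m x) (law \<mu> m) (flow \<mu> m y) \<partial>\<rho>) - \<delta> (flow \<mu> m x) (law \<mu> m) (flow \<mu> m 0))) (at m)"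
proof -
  interpret r: prob_space \<rho> using \<rho> by (rule P2_prob_space)
  \<comment> \<open>Leaves room for the unit neighbourhood of m in which the time derivative has to
    be dominated.\<close>
  let ?T = "\<bar>m\<bar> + 1"
  obtain C where C: "0 \<le> C" "\<And>\<mu> m x y z. \<mu> \<in> P2 \<Longrightarrow> \<bar>m\<bar> \<le> ?T \<Longrightarrow> \<bar>flow_linear \<mu> y m x - flow_linear \<mu> z m x\<bar> \<le> C * \<bar>y - z\<bar>"
    using flow_linear_lip[of ?T] by blast
  have C0: "\<bar>flow_linear \<mu> y r x\<bar> \<le> C * \<bar>y\<bar>" if "\<bar>r\<bar> \<le> ?T" for y r x
    using C(2)[OF \<mu> that, of y x 0] by (simp add: flow_linear_0 \<mu>)
  let ?d = "\<lambda>r y. \<delta> (flow \<mu> r x) (law \<mu> r) (flow \<mu> r y)"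
  let ?k = "\<lambda>r y. \<integral>z. D_flow \<mu> r x z * flow_linear \<mu> y r z \<partial>\<mu>"
  let ?f' = "\<lambda>r y. a_flow \<mu> r x * flow_linear \<mu> y r x + ?k r y + (?d r y - ?d r 0)"
  have lip1: "\<bar>a_flow \<mu> r x * flow_linear \<mu> y r x - a_flow \<mu> r x * flow_linear \<mu> y' r x\<bar> \<le> K * C * \<bar>y - y'\<bar>" if r: "\<bar>r\<bar> \<le> ?T" for r y y'
    using abs_mult_le[OF a_flow_bdd[OF \<mu>] C(2)[OF \<mu> r]] by (simp add: right_diff_distrib mult.assoc)
  have lip2: "\<bar>?k r y - ?k r y'\<bar> \<le> K * C * \<bar>y - y'\<bar>" if r: "\<bar>r\<bar> \<le> ?T" for r y y'
  proof -
    have "integrable \<mu> (\<lambda>z. D_flow \<mu> r x z * flow_linear \<mu> y r z)" for y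
      by (rule integrable_D_flow[OF \<mu> \<mu> flow_linear_section(2)[OF \<mu>] C0[OF r]])
    then have d: "?k r y - ?k r y' = (\<integral>z. D_flow \<mu> r x z * (flow_linear \<mu> y r z - flow_linear \<mu> y' r z) \<partial>\<mu>)"
      by (simp add: right_diff_distrib)
    have "\<bar>\<integral>z. D_flow \<mu> r x z * (flow_linear \<mu> y r z - flow_linear \<mu> y' r z) \<partial>\<mu>\<bar> \<le> K * (C * \<bar>y - y'\<bar>)"
      by (intro integral_abs_le_P2[OF \<mu>] abs_mult_le D_flow_bdd C \<mu> r)
    then show ?thesis unfolding d by (simp add: mult.assoc)
  qed
  have lip3: "\<bar>?d r y - ?d r y'\<bar> \<le> K * lip_const ?T * \<bar>y - y'\<bar>" if r: "\<bar>r\<bar> \<le> ?T" for r y y'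
    using order_trans[OF \<delta>_lip[OF law_P2[OF \<mu>]] mult_left_mono[OF flow_lip[OF \<mu> r] K_nonneg]]
    by (simp add: mult.assoc)
  have lip: "\<bar>?f' r y - ?f' r y'\<bar> \<le> (K * C + K * C + K * lip_const ?T) * \<bar>y - y'\<bar>" if r: "\<bar>r\<bar> \<le> ?T" for r y y'
    using lip1[OF r, of y y'] lip2[OF r, of y y'] lip3[OF r, of y y'] unfolding distrib_right by linarith
  \<comment> \<open>A Lipschitz function of y that vanishes at 0 is dominated by a multiple of
    \<bar>y\<bar>, which is integrable.\<close>
  have f'0: "?f' r 0 = 0" for r by (simp add: flow_linear_0 \<mu>)
  have "((\<lambda>m. \<integral>y. flow_linear \<mu> y m x \<partial>\<rho>) has_real_derivative (\<integral>y. ?f' m y \<partial>\<rho>)) (at m)"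
  proof (rule has_real_derivative_integral)
    show "((\<lambda>m. flow_linear \<mu> y m x) has_real_derivative ?f' r y) (at r)" for r y
      by (rule linearized_deriv[OF flow_linear_linearized[OF \<mu>]])
    show "integrable \<rho> (\<lambda>y. flow_linear \<mu> y r x)" for r by (rule integrable_flow_linear[OF \<mu> \<rho>])
    show "\<bar>?f' r y\<bar> \<le> (K * C + K * C + K * lip_const ?T) * \<bar>y\<bar>" if "\<bar>r - m\<bar> < 1" for r y
      using lip[of r y 0] f'0[of r] that by simp
    show "integrable \<rho> (\<lambda>y. (K * C + K * C + K * lip_const ?T) * \<bar>y\<bar>)"
      using integrable_lipschitz[OF \<rho>, of abs 1] by simp
    show "?f' m \<in> borel_measurable \<rho>"
      by (intro P2_measurable[OF \<rho>] lipschitz_measurable[OF lip]) simp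
  qed
  also have "(\<integral>y. ?f' m y \<partial>\<rho>) = a_flow \<mu> m x * (\<integral>y. flow_linear \<mu> y m x \<partial>\<rho>)
      + (\<integral>z. D_flow \<mu> m x z * (\<integral>y. flow_linear \<mu> y m z \<partial>\<rho>) \<partial>\<mu>) + ((\<integral>y. ?d m y \<partial>\<rho>) - ?d m 0)"
  proof -
    have "integrable \<rho> (\<lambda>y. a_flow \<mu> m x * flow_linear \<mu> y m x)" "integrable \<rho> (?k m)" "integrable \<rho> (?d m)"
      using integrable_lipschitz[OF \<rho> lip1] integrable_lipschitz[OF \<rho> lip2] integrable_lipschitz[OF \<rho> lip3] by auto
    then show ?thesis
      using fubini_flow_linear[OF \<mu> \<rho>, of m x] by (simp add: r.prob_space)
  qed
  finally show ?thesis .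
qed

text \<open>The directional derivative of the flow at \<open>\<mu>\<close> along the signed measure
  m1 - m2, which is the velocity of the segment from \<open>m2\<close> to \<open>m1\<close>.\<close>

definition direction_deriv :: "real measure \<Rightarrow> real measure \<Rightarrow> real measure \<Rightarrow> real \<Rightarrow> real \<Rightarrow> real" where
  "direction_deriv m1 m2 \<mu> m x = (\<integral>y. flow_linear \<mu> y m x \<partial>m1) - (\<integral>y. flow_linear \<mu> y m x \<partial>m2)"

context
  fixes m1 m2 :: "real measure" and w0 :: real
  assumes m1: "m1 \<in> P2" and m2: "m2 \<in> P2" and w0: "kr_le m1 m2 w0"
begin

lemma direction_deriv_measurable: "\<mu> \<in> P2 \<Longrightarrow> direction_deriv m1 m2 \<mu> m \<in> borel_measurable borel"
  unfolding direction_deriv_def[abs_def] by (intro borel_measurable_diff integral_flow_linear_measurable m1 m2)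

lemma direction_deriv_bdd:
  obtains C where "\<And>\<mu> m x. \<mu> \<in> P2 \<Longrightarrow> \<bar>m\<bar> \<le> T \<Longrightarrow> \<bar>direction_deriv m1 m2 \<mu> m x\<bar> \<le> C"
proof -
  obtain C where C: "0 \<le> C" "\<And>\<mu> m x y z. \<mu> \<in> P2 \<Longrightarrow> \<bar>m\<bar> \<le> T \<Longrightarrow> \<bar>flow_linear \<mu> y m x - flow_linear \<mu> z m x\<bar> \<le> C * \<bar>y - z\<bar>"
    using flow_linear_lip[of T] by blast
  have "\<bar>direction_deriv m1 m2 \<mu> m x\<bar> \<le> C * w0" if "\<mu> \<in> P2" "\<bar>m\<bar> \<le> T" for \<mu> m x
    unfolding direction_deriv_def by (rule kr_leD[OF w0 m1 m2 C(2)[OF that]])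
  then show ?thesis by (rule that)
qed

lemma direction_deriv_deriv:
  assumes \<mu>: "\<mu> \<in> P2"
  shows "((\<lambda>m. direction_deriv m1 m2 \<mu> m x) has_real_derivative
    a_flow \<mu> m x * direction_deriv m1 m2 \<mu> m x + (\<integral>z. D_flow \<mu> m x z * direction_deriv m1 m2 \<mu> m z \<partial>\<mu>)
    + ((\<integral>y. \<delta> (flow \<mu> m x) (law \<mu> m) (flow \<mu> m y) \<partial>m1) - (\<integral>y. \<delta> (flow \<mu> m x) (law \<mu> m) (flow \<mu> m y) \<partial>m2))) (at m)"
proof -
  have "integrable \<mu> (\<lambda>z. D_flow \<mu> m x z * (\<integral>y. flow_linear \<mu> y m z \<partial>\<rho>))" if \<rho>: "\<rho> \<in> P2" for \<rho>
  proof -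
    obtain C where "\<And>\<mu> r x. \<mu> \<in> P2 \<Longrightarrow> \<bar>r\<bar> \<le> \<bar>m\<bar> \<Longrightarrow> \<bar>\<integral>y. flow_linear \<mu> y r x \<partial>\<rho>\<bar> \<le> C"
      using integral_flow_linear_bdd[OF \<rho>, of "\<bar>m\<bar>"] by blast
    then show ?thesis
      by (intro integrable_D_flow[OF \<mu> \<mu> integral_flow_linear_measurable[OF \<mu> \<rho>]]) (auto intro: \<mu>)
  qed
  then have e: "(\<integral>z. D_flow \<mu> m x z * direction_deriv m1 m2 \<mu> m z \<partial>\<mu>)
      = (\<integral>z. D_flow \<mu> m x z * (\<integral>y. flow_linear \<mu> y m z \<partial>m1) \<partial>\<mu>) - (\<integral>z. D_flow \<mu> m x z * (\<integral>y. flow_linear \<mu> y m z \<partial>m2) \<partial>\<mu>)"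
    using m1 m2 by (simp add: direction_deriv_def right_diff_distrib)
  let ?E = "\<lambda>\<rho>. a_flow \<mu> m x * (\<integral>y. flow_linear \<mu> y m x \<partial>\<rho>) + (\<integral>z. D_flow \<mu> m x z * (\<integral>y. flow_linear \<mu> y m z \<partial>\<rho>) \<partial>\<mu>)
    + ((\<integral>y. \<delta> (flow \<mu> m x) (law \<mu> m) (flow \<mu> m y) \<partial>\<rho>) - \<delta> (flow \<mu> m x) (law \<mu> m) (flow \<mu> m 0))"
  have "((\<lambda>m. direction_deriv m1 m2 \<mu> m x) has_real_derivative ?E m1 - ?E m2) (at m)"
    unfolding direction_deriv_def by (intro DERIV_diff integral_flow_linear_deriv \<mu> m1 m2)
  then show ?thesis
    by (rule DERIV_cong) (simp add: e direction_deriv_def[of m1 m2 \<mu> m x] algebra_simps)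
qed

text \<open>The derivative in y of a difference of two \<open>flow_linear\<close> is a difference of
  \<open>flow_Lions\<close>, so the stability of the latter is a Lipschitz constant in y; testing
  against m1 - m2 costs the factor \<open>w0\<close>.\<close>

lemma direction_deriv_stab:
  assumes T: "0 \<le> T"
  obtains C where "0 \<le> C" "\<And>\<mu> \<nu> w m x. \<mu> \<in> P2 \<Longrightarrow> \<nu> \<in> P2 \<Longrightarrow> kr_le \<mu> \<nu> w \<Longrightarrow> \<bar>m\<bar> \<le> T \<Longrightarrow>
    \<bar>direction_deriv m1 m2 \<mu> m x - direction_deriv m1 m2 \<nu> m x\<bar> \<le> C * flow_modulus T w"
proof -
  obtain C where C: "0 \<le> C" "\<And>\<mu> \<nu> w m x y. \<mu> \<in> P2 \<Longrightarrow> \<nu> \<in> P2 \<Longrightarrow> kr_le \<mu> \<nu> w \<Longrightarrow> \<bar>m\<bar> \<le> T \<Longrightarrow>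
      \<bar>flow_Lions \<mu> y m x - flow_Lions \<nu> y m x\<bar> \<le> C * flow_modulus T w"
    using flow_Lions_stab[OF T] by blast
  show thesis
  proof (rule that[of "C * w0"])
    fix \<mu> \<nu> w m x assume \<mu>: "\<mu> \<in> P2" and \<nu>: "\<nu> \<in> P2" and w: "kr_le \<mu> \<nu> w" and m: "\<bar>m\<bar> \<le> T"
    have "\<bar>(flow_linear \<mu> y m x - flow_linear \<nu> y m x) - (flow_linear \<mu> z m x - flow_linear \<nu> z m x)\<bar> \<le> C * flow_modulus T w * \<bar>y - z\<bar>" for y z
      by (rule lipschitz_from_deriv[where f="\<lambda>y. flow_linear \<mu> y m x - flow_linear \<nu> y m x" and f'="\<lambda>y. flow_Lions \<mu> y m x - flow_Lions \<nu> y m x"])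
        (intro DERIV_diff flow_linear_deriv_y \<mu> \<nu> C(2)[OF \<mu> \<nu> w m])+
    from kr_leD[OF w0 m1 m2 this]
    show "\<bar>direction_deriv m1 m2 \<mu> m x - direction_deriv m1 m2 \<nu> m x\<bar> \<le> C * w0 * flow_modulus T w"
      using m1 m2 integrable_flow_linear[OF \<mu>] integrable_flow_linear[OF \<nu>] by (simp add: direction_deriv_def algebra_simps)
  qed (use C(1) kr_le_nonneg[OF w0] in simp)
qed

section \<open>Differentiation of the flow along a segment of measures\<close>

text \<open>The first-order remainder solves the linearized equation at the mixture with parameter
  s, up to a defect. Besides quadratic terms the defect contains \<open>\<omega>\<close>, because
  \<open>a\<close> is continuous and \<open>\<sigma>\<close> differentiable in the measure only with
  that modulus; it is still o(s' - s).\<close>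

lemma mixture_flow_expand:
  assumes T: "0 \<le> T"
  obtains C where "0 \<le> C" "\<And>s s' m x. s \<in> {0..1} \<Longrightarrow> s' \<in> {0..1} \<Longrightarrow> \<bar>m\<bar> \<le> T \<Longrightarrow>
    \<bar>flow (mixture s' m1 m2) m x - flow (mixture s m1 m2) m x - (s' - s) * direction_deriv m1 m2 (mixture s m1 m2) m x\<bar>
      \<le> C * \<bar>s' - s\<bar> * (\<bar>s' - s\<bar> + \<omega> (stab_const T * (\<bar>s' - s\<bar> * w0)))"
proof -
  let ?S = "stab_const T"
  have S: "0 \<le> ?S" by (rule stab_const_nonneg[OF T])
  have w00: "0 \<le> w0" by (rule kr_le_nonneg[OF w0])
  \<comment> \<open>Bounds both the coefficient of the square of h and that of \<bar>h\<bar> times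
    \<omega>, as they come out at the end of \<open>eb\<close>.\<close>
  let ?C = "2 * K * ?S\<^sup>2 * w0\<^sup>2 + 2 * ?S * w0 + 2 * K * ?S * w0"
  have C0: "0 \<le> ?C" using S w00 K_nonneg by simp
  show thesis
  proof (rule that[of "2 * T * exp (4 * K * T) * ?C"])
    fix s s' m x :: real assume s: "s \<in> {0..1}" and s': "s' \<in> {0..1}" and m: "\<bar>m\<bar> \<le> T"
    define \<mu> where "\<mu> = mixture s m1 m2"
    define \<nu> where "\<nu> = mixture s' m1 m2"
    define h where "h = s' - s"
    define q where "q = \<bar>h\<bar> * w0"
    have \<mu>: "\<mu> \<in> P2" and \<nu>: "\<nu> \<in> P2" using mixture_P2[OF m1 m2] s s' by (auto simp: \<mu>_def \<nu>_def)
    have q0: "0 \<le> q" using w00 by (simp add: q_def)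
    have kr: "kr_le \<nu> \<mu> q" unfolding \<mu>_def \<nu>_def q_def h_def by (rule kr_le_mixture[OF m1 m2 w0 s' s])
    let ?Y = "direction_deriv m1 m2 \<mu>"
    let ?\<Delta> = "\<lambda>r z. flow \<nu> r z - flow \<mu> r z"
    let ?d = "\<lambda>r z y. \<delta> (flow \<mu> r z) (law \<mu> r) y"
    let ?e = "\<lambda>r z. \<sigma> (flow \<nu> r z) (law \<nu> r) - \<sigma> (flow \<mu> r z) (law \<mu> r) - a_flow \<mu> r z * ?\<Delta> r z
      - (\<integral>y. D_flow \<mu> r z y * ?\<Delta> r y \<partial>\<mu>)
      - h * ((\<integral>y. ?d r z (flow \<mu> r y) \<partial>m1) - (\<integral>y. ?d r z (flow \<mu> r y) \<partial>m2))"
    let ?\<epsilon> = "\<bar>h\<bar> * ?C * (\<bar>h\<bar> + \<omega> (?S * q))"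
    have \<Delta>: "\<bar>?\<Delta> r z\<bar> \<le> ?S * q" if "\<bar>r\<bar> \<le> T" for r z by (rule flow_stab(1)[OF \<nu> \<mu> kr that])
    have \<Delta>m: "?\<Delta> r \<in> borel_measurable borel" for r by (intro borel_measurable_diff flow_measurable \<mu> \<nu>)
    have eb: "\<bar>?e r z\<bar> \<le> ?\<epsilon>" if r: "\<bar>r\<bar> \<le> T" for r z
    proof -
      note P = law_P2[OF \<mu>, of r] law_P2[OF \<nu>, of r]
      note krl = flow_stab(2)[OF \<nu> \<mu> kr r]
      have sq: "(?\<Delta> r y)\<^sup>2 \<le> (?S * q)\<^sup>2" for y
        using \<Delta>[OF r, of y] S q0 by (intro abs_le_square_iff[THEN iffD1]) (simp add: abs_mult)
      have "\<bar>\<sigma> (flow \<nu> r z) (law \<nu> r) - \<sigma> (flow \<mu> r z) (law \<nu> r) - a (flow \<mu> r z) (law \<nu> r) * ?\<Delta> r z\<bar> \<le> K * (?\<Delta> r z)\<^sup>2"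
        by (rule \<sigma>_taylor[OF P(2)])
      then have e1: "\<bar>\<sigma> (flow \<nu> r z) (law \<nu> r) - \<sigma> (flow \<mu> r z) (law \<nu> r) - a (flow \<mu> r z) (law \<nu> r) * ?\<Delta> r z\<bar> \<le> K * (?S * q)\<^sup>2"
        using mult_left_mono[OF sq[of z] K_nonneg] by linarith
      have "\<bar>a (flow \<mu> r z) (law \<nu> r) - a_flow \<mu> r z\<bar> \<le> \<omega> (?S * q)"
        using a_mod[OF P(2) P(1) krl, of "flow \<mu> r z" "flow \<mu> r z"] by (simp add: a_flow_def)
      from abs_mult_le[OF this \<Delta>[OF r, of z]]
      have e2: "\<bar>(a (flow \<mu> r z) (law \<nu> r) - a_flow \<mu> r z) * ?\<Delta> r z\<bar> \<le> \<omega> (?S * q) * (?S * q)" .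
      have e3: "\<bar>\<sigma> (flow \<mu> r z) (law \<nu> r) - \<sigma> (flow \<mu> r z) (law \<mu> r)
          - ((\<integral>y. ?d r z y \<partial>law \<nu> r) - (\<integral>y. ?d r z y \<partial>law \<mu> r))\<bar> \<le> \<omega> (?S * q) * (?S * q)"
        by (rule \<sigma>_expand[OF P krl])
      have dl: "\<bar>?d r z y - ?d r z y'\<bar> \<le> K * \<bar>y - y'\<bar>" for y y' by (rule \<delta>_lip[OF P(1)])
      have dm: "?d r z \<in> borel_measurable borel" by (rule lipschitz_measurable[OF dl])
      have fl: "\<bar>?d r z (flow \<rho> r y) - ?d r z (flow \<rho> r y')\<bar> \<le> K * lip_const T * \<bar>y - y'\<bar>" if "\<rho> \<in> P2" for \<rho> y y'
        using order_trans[OF dl mult_left_mono[OF flow_lip[OF that r] K_nonneg]] by (simp add: mult.assoc)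
      have fi: "integrable \<rho>' (\<lambda>y. ?d r z (flow \<rho> r y))" if "\<rho> \<in> P2" "\<rho>' \<in> P2" for \<rho> \<rho>'
        by (rule integrable_lipschitz[OF that(2) fl[OF that(1)]])
      let ?D = "\<lambda>y. ?d r z (flow \<nu> r y) - ?d r z (flow \<mu> r y)"
      have Di: "integrable \<rho> ?D" if "\<rho> \<in> P2" for \<rho> using fi that \<mu> \<nu> by auto
      have Db: "\<bar>\<integral>y. ?D y \<partial>\<rho>\<bar> \<le> K * (?S * q)" if "\<rho> \<in> P2" for \<rho>
        using order_trans[OF dl mult_left_mono[OF \<Delta>[OF r] K_nonneg]] by (intro integral_abs_le_P2[OF that])
      have mixs: "(\<integral>y. ?d r z (flow \<nu> r y) \<partial>mixture t m1 m2) = t * (\<integral>y. ?d r z (flow \<nu> r y) \<partial>m1)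
          + (1 - t) * (\<integral>y. ?d r z (flow \<nu> r y) \<partial>m2)" if "t \<in> {0..1}" for t
        using that by (intro integral_mixture_lipschitz[OF m1 m2 _ _ fl[OF \<nu>]]) auto
      \<comment> \<open>The measure at s' is the one at s plus h times m1 - m2, tested here on a
        function composed with the flow of \<open>\<nu>\<close>.\<close>
      have mix: "(\<integral>y. ?d r z (flow \<nu> r y) \<partial>\<nu>) = (\<integral>y. ?d r z (flow \<nu> r y) \<partial>\<mu>)
          + h * ((\<integral>y. ?d r z (flow \<nu> r y) \<partial>m1) - (\<integral>y. ?d r z (flow \<nu> r y) \<partial>m2))"
        unfolding mixs[OF s, folded \<mu>_def] mixs[OF s', folded \<nu>_def] by (simp add: h_def algebra_simps)
      have k: "integrable \<mu> (\<lambda>y. D_flow \<mu> r z y * ?\<Delta> r y)" by (rule integrable_D_flow[OF \<mu> \<mu> \<Delta>m \<Delta>[OF r]])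
      have tay: "\<bar>\<integral>y. ?D y - D_flow \<mu> r z y * ?\<Delta> r y \<partial>\<mu>\<bar> \<le> K * (?S * q)\<^sup>2"
      proof (rule integral_abs_le_P2[OF \<mu>])
        fix y
        show "\<bar>?D y - D_flow \<mu> r z y * ?\<Delta> r y\<bar> \<le> K * (?S * q)\<^sup>2"
          unfolding D_flow_def
          using order_trans[OF \<delta>_taylor[OF P(1), of "flow \<mu> r z" "flow \<nu> r y" "flow \<mu> r y"] mult_left_mono[OF sq K_nonneg]] .
      qed
      \<comment> \<open>The law changes for two reasons: the mass moves with the flow, and the
        initial mass changes by h times m1 - m2. The first leaves a Taylor remainder. The second
        should be tested on the flow of \<open>\<mu>\<close>; replacing the flow of
        \<open>\<nu>\<close> there costs a product of two small factors.\<close>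
      have "(\<integral>y. ?d r z y \<partial>law \<nu> r) - (\<integral>y. ?d r z y \<partial>law \<mu> r) - (\<integral>y. D_flow \<mu> r z y * ?\<Delta> r y \<partial>\<mu>)
          - h * ((\<integral>y. ?d r z (flow \<mu> r y) \<partial>m1) - (\<integral>y. ?d r z (flow \<mu> r y) \<partial>m2))
        = (\<integral>y. ?D y - D_flow \<mu> r z y * ?\<Delta> r y \<partial>\<mu>) + h * ((\<integral>y. ?D y \<partial>m1) - (\<integral>y. ?D y \<partial>m2))"
      proof -
        have 1: "(\<integral>y. ?D y - D_flow \<mu> r z y * ?\<Delta> r y \<partial>\<mu>) = (\<integral>y. ?D y \<partial>\<mu>) - (\<integral>y. D_flow \<mu> r z y * ?\<Delta> r y \<partial>\<mu>)"
          by (rule Bochner_Integration.integral_diff[OF Di[OF \<mu>] k])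
        have 2: "(\<integral>y. ?D y \<partial>\<rho>) = (\<integral>y. ?d r z (flow \<nu> r y) \<partial>\<rho>) - (\<integral>y. ?d r z (flow \<mu> r y) \<partial>\<rho>)"
          if "\<rho> \<in> P2" for \<rho>
          by (rule Bochner_Integration.integral_diff[OF fi[OF \<nu> that] fi[OF \<mu> that]])
        show ?thesis
          unfolding 1 2[OF \<mu>] 2[OF m1] 2[OF m2] integral_law[OF \<nu> dm] integral_law[OF \<mu> dm] mix
          by (simp only: right_diff_distrib)
      qed
      moreover have "\<bar>h * ((\<integral>y. ?D y \<partial>m1) - (\<integral>y. ?D y \<partial>m2))\<bar> \<le> \<bar>h\<bar> * (2 * (K * (?S * q)))"
        using Db[OF m1] Db[OF m2] by (intro abs_mult_le) auto
      ultimately have e4: "\<bar>(\<integral>y. ?d r z y \<partial>law \<nu> r) - (\<integral>y. ?d r z y \<partial>law \<mu> r) - (\<integral>y. D_flow \<mu> r z y * ?\<Delta> r y \<partial>\<mu>)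
          - h * ((\<integral>y. ?d r z (flow \<mu> r y) \<partial>m1) - (\<integral>y. ?d r z (flow \<mu> r y) \<partial>m2))\<bar>
          \<le> K * (?S * q)\<^sup>2 + \<bar>h\<bar> * (2 * (K * (?S * q)))"
        using tay by linarith
      \<comment> \<open>Four contributions: Taylor expansion in the position, change of
        \<open>a\<close> with the law, expansion of \<open>\<sigma>\<close> in the law, and the
        comparison of the laws above.\<close>
      have "?e r z = (\<sigma> (flow \<nu> r z) (law \<nu> r) - \<sigma> (flow \<mu> r z) (law \<nu> r) - a (flow \<mu> r z) (law \<nu> r) * ?\<Delta> r z)
          + (a (flow \<mu> r z) (law \<nu> r) - a_flow \<mu> r z) * ?\<Delta> r z
          + (\<sigma> (flow \<mu> r z) (law \<nu> r) - \<sigma> (flow \<mu> r z) (law \<mu> r)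
            - ((\<integral>y. ?d r z y \<partial>law \<nu> r) - (\<integral>y. ?d r z y \<partial>law \<mu> r)))
          + ((\<integral>y. ?d r z y \<partial>law \<nu> r) - (\<integral>y. ?d r z y \<partial>law \<mu> r) - (\<integral>y. D_flow \<mu> r z y * ?\<Delta> r y \<partial>\<mu>)
            - h * ((\<integral>y. ?d r z (flow \<mu> r y) \<partial>m1) - (\<integral>y. ?d r z (flow \<mu> r y) \<partial>m2)))"
        by (simp add: left_diff_distrib)
      then have "\<bar>?e r z\<bar> \<le> 2 * (K * (?S * q)\<^sup>2) + 2 * (\<omega> (?S * q) * (?S * q)) + \<bar>h\<bar> * (2 * (K * (?S * q)))"
        using e1 e2 e3 e4 by linarith
      also have "\<dots> = \<bar>h\<bar> * ((2 * K * ?S\<^sup>2 * w0\<^sup>2 + 2 * K * ?S * w0) * \<bar>h\<bar> + 2 * ?S * w0 * \<omega> (?S * q))"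
        by (simp add: q_def power2_eq_square algebra_simps flip: abs_mult_self_eq[of h])
      also have "\<dots> \<le> \<bar>h\<bar> * (?C * \<bar>h\<bar> + ?C * \<omega> (?S * q))"
        using S w00 K_nonneg \<omega>_nonneg by (intro mult_left_mono add_mono mult_right_mono) auto
      finally show ?thesis by (simp add: algebra_simps)
    qed
    obtain B where B: "\<And>\<mu> r x. \<mu> \<in> P2 \<Longrightarrow> \<bar>r\<bar> \<le> T \<Longrightarrow> \<bar>direction_deriv m1 m2 \<mu> r x\<bar> \<le> B" using direction_deriv_bdd[of T] by blast
    have "\<bar>?\<Delta> m x - h * ?Y m x\<bar> \<le> 2 * T * exp (4 * K * T) * ?\<epsilon>"
    proof (rule linearized_estimate[OF \<mu> m, where w="\<lambda>m x. ?\<Delta> m x - h * ?Y m x" and e="?e" and M="?S * q + \<bar>h\<bar> * B"])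
      show "0 \<le> ?\<epsilon>" using C0 \<omega>_nonneg by simp
      show "\<bar>?\<Delta> r z - h * ?Y r z\<bar> \<le> ?S * q + \<bar>h\<bar> * B" if r: "\<bar>r\<bar> \<le> T" for r z
        using \<Delta>[OF r, of z] abs_mult_le[OF order_refl B[OF \<mu> r, of z], of h] by linarith
      show "\<bar>?e r z\<bar> \<le> ?\<epsilon>" if "\<bar>r\<bar> \<le> T" for r z by (rule eb[OF that])
      show "?\<Delta> 0 z - h * ?Y 0 z = 0" for z
        by (simp add: flow_0 \<mu> \<nu> direction_deriv_def linearized_0[OF flow_linear_linearized[OF \<mu>]])
      show "((\<lambda>r. ?\<Delta> r z - h * ?Y r z) has_real_derivative a_flow \<mu> r z * (?\<Delta> r z - h * ?Y r z)
          + (\<integral>y. D_flow \<mu> r z y * (?\<Delta> r y - h * ?Y r y) \<partial>\<mu>) + ?e r z) (at r)" for r z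
      proof -
        obtain B' where B': "\<And>\<mu> x. \<mu> \<in> P2 \<Longrightarrow> \<bar>direction_deriv m1 m2 \<mu> r x\<bar> \<le> B'" using direction_deriv_bdd[of "\<bar>r\<bar>"] by (metis order_refl)
        have "integrable \<mu> (\<lambda>y. D_flow \<mu> r z y * ?\<Delta> r y)"
          by (rule integrable_D_flow[OF \<mu> \<mu> \<Delta>m flow_stab(1)[OF \<nu> \<mu> kr order_refl]])
        moreover have "integrable \<mu> (\<lambda>y. D_flow \<mu> r z y * ?Y r y)"
          by (rule integrable_D_flow[OF \<mu> \<mu> direction_deriv_measurable[OF \<mu>] B'[OF \<mu>]])
        ultimately have e: "(\<integral>y. D_flow \<mu> r z y * (?\<Delta> r y - h * ?Y r y) \<partial>\<mu>)
            = (\<integral>y. D_flow \<mu> r z y * ?\<Delta> r y \<partial>\<mu>) - h * (\<integral>y. D_flow \<mu> r z y * ?Y r y \<partial>\<mu>)"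
          by (subst right_diff_distrib) (simp add: mult.left_commute[of _ h])
        have "((\<lambda>r. ?\<Delta> r z - h * ?Y r z) has_real_derivative
          \<sigma> (flow \<nu> r z) (law \<nu> r) - \<sigma> (flow \<mu> r z) (law \<mu> r)
          - h * (a_flow \<mu> r z * ?Y r z + (\<integral>y. D_flow \<mu> r z y * ?Y r y \<partial>\<mu>)
            + ((\<integral>y. ?d r z (flow \<mu> r y) \<partial>m1) - (\<integral>y. ?d r z (flow \<mu> r y) \<partial>m2)))) (at r)"
          by (intro DERIV_diff flow_deriv \<mu> \<nu> DERIV_cmult direction_deriv_deriv)
        then show ?thesis unfolding e by (rule DERIV_cong) algebra
      qed
    qed
    then show "\<bar>flow (mixture s' m1 m2) m x - flow (mixture s m1 m2) m x - (s' - s) * direction_deriv m1 m2 (mixture s m1 m2) m x\<bar>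
      \<le> 2 * T * exp (4 * K * T) * ?C * \<bar>s' - s\<bar> * (\<bar>s' - s\<bar> + \<omega> (stab_const T * (\<bar>s' - s\<bar> * w0)))"
      unfolding \<mu>_def[symmetric] \<nu>_def[symmetric] h_def[symmetric] q_def[symmetric] by (simp only: mult_ac)
  qed (use T C0 in simp)
qed

lemma mixture_flow_deriv:
  assumes s: "s \<in> {0..1}"
  shows "((\<lambda>s. flow (mixture s m1 m2) m x) has_real_derivative direction_deriv m1 m2 (mixture s m1 m2) m x) (at s within {0..1})"
proof -
  obtain C where C: "\<And>s s' r x. s \<in> {0..1} \<Longrightarrow> s' \<in> {0..1} \<Longrightarrow> \<bar>r\<bar> \<le> \<bar>m\<bar> \<Longrightarrow>
    \<bar>flow (mixture s' m1 m2) r x - flow (mixture s m1 m2) r x - (s' - s) * direction_deriv m1 m2 (mixture s m1 m2) r x\<bar>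
      \<le> C * \<bar>s' - s\<bar> * (\<bar>s' - s\<bar> + \<omega> (stab_const \<bar>m\<bar> * (\<bar>s' - s\<bar> * w0)))"
    using mixture_flow_expand[of "\<bar>m\<bar>"] by (metis abs_ge_zero)
  let ?f = "\<lambda>s. flow (mixture s m1 m2) m x" and ?d = "direction_deriv m1 m2 (mixture s m1 m2) m x"
  let ?b = "\<lambda>t. C * (\<bar>t - s\<bar> + \<omega> (stab_const \<bar>m\<bar> * (\<bar>t - s\<bar> * w0)))"
  have "((\<lambda>t. (?f t - ?f s) / (t - s) - ?d) \<longlongrightarrow> 0) (at s within {0..1})"
  proof (rule Lim_null_comparison)
    show "\<forall>\<^sub>F t in at s within {0..1}. norm ((?f t - ?f s) / (t - s) - ?d) \<le> ?b t"
    proof (rule eventually_at_filter[THEN iffD2], rule always_eventually, safe)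
      fix t :: real assume t: "t \<noteq> s" "t \<in> {0..1}"
      then have "(?f t - ?f s) / (t - s) - ?d = (?f t - ?f s - (t - s) * ?d) / (t - s)" by (simp add: field_simps)
      moreover have "\<bar>?f t - ?f s - (t - s) * ?d\<bar> \<le> ?b t * \<bar>t - s\<bar>"
        using C[OF s t(2) order_refl, of x] by (simp add: mult_ac)
      ultimately show "norm ((?f t - ?f s) / (t - s) - ?d) \<le> ?b t"
        using t(1) by (simp add: abs_divide pos_divide_le_eq)
    qed
    have z: "((\<lambda>t. \<bar>t - s\<bar>) \<longlongrightarrow> 0) (at s within {0..1})"
      by (rule tendsto_eq_intros | simp)+
    show "(?b \<longlongrightarrow> 0) (at s within {0..1})"
      by (intro tendsto_mult_right_zero tendsto_add_zero z \<omega>_tendsto tendsto_mult_left_zero)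
  qed
  then show ?thesis unfolding has_field_derivative_iff by (simp add: LIM_zero_iff)
qed

lemma mixture_direction_deriv_continuous: "continuous_on {0..1} (\<lambda>s. direction_deriv m1 m2 (mixture s m1 m2) m x)"
  unfolding continuous_on_def
proof safe
  fix s :: real assume s: "s \<in> {0..1}"
  obtain C where C: "\<And>\<mu> \<nu> w r x. \<mu> \<in> P2 \<Longrightarrow> \<nu> \<in> P2 \<Longrightarrow> kr_le \<mu> \<nu> w \<Longrightarrow> \<bar>r\<bar> \<le> \<bar>m\<bar> \<Longrightarrow>
    \<bar>direction_deriv m1 m2 \<mu> r x - direction_deriv m1 m2 \<nu> r x\<bar> \<le> C * flow_modulus \<bar>m\<bar> w"
    using direction_deriv_stab[of "\<bar>m\<bar>"] by (metis abs_ge_zero)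
  let ?f = "\<lambda>s. direction_deriv m1 m2 (mixture s m1 m2) m x"
  have "((\<lambda>t. ?f t - ?f s) \<longlongrightarrow> 0) (at s within {0..1})"
  proof (rule Lim_null_comparison)
    show "\<forall>\<^sub>F t in at s within {0..1}. norm (?f t - ?f s) \<le> C * flow_modulus \<bar>m\<bar> (\<bar>t - s\<bar> * w0)"
    proof (rule eventually_at_filter[THEN iffD2], rule always_eventually, safe)
      fix t :: real assume t: "t \<in> {0..1}"
      show "norm (?f t - ?f s) \<le> C * flow_modulus \<bar>m\<bar> (\<bar>t - s\<bar> * w0)"
        using C[OF mixture_P2[OF m1 m2] mixture_P2[OF m1 m2] kr_le_mixture[OF m1 m2 w0 t s] order_refl] s t by simp
    qed
    have z: "((\<lambda>t. \<bar>t - s\<bar>) \<longlongrightarrow> 0) (at s within {0..1})"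
      by (rule tendsto_eq_intros | simp)+
    show "((\<lambda>t. C * flow_modulus \<bar>m\<bar> (\<bar>t - s\<bar> * w0)) \<longlongrightarrow> 0) (at s within {0..1})"
      unfolding flow_modulus_def
      by (intro tendsto_mult_right_zero tendsto_add_zero z \<omega>_tendsto tendsto_mult_left_zero)
  qed
  then show "(?f \<longlongrightarrow> ?f s) (at s within {0..1})" by (simp add: LIM_zero_iff)
qed

text \<open>Fundamental theorem of calculus along the segment; continuity of the directional
  derivative identifies the gauge integral with the Lebesgue integral of the definition.\<close>

lemma flow_mixture_formula:
  "flow m1 m x - flow m2 m x = (LINT s:{0..1}|lborel. (\<integral>y. flow_linear (mixture s m1 m2) y m x \<partial>m1)
     - (\<integral>y. flow_linear (mixture s m1 m2) y m x \<partial>m2))"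
proof -
  let ?f = "\<lambda>s. direction_deriv m1 m2 (mixture s m1 m2) m x"
  have "(?f has_integral flow (mixture 1 m1 m2) m x - flow (mixture 0 m1 m2) m x) {0..1}"
    using mixture_flow_deriv
    by (intro fundamental_theorem_of_calculus)
      (auto simp: has_real_derivative_iff_has_vector_derivative[symmetric])
  then have "integral {0..1} ?f = flow m1 m x - flow m2 m x"
    by (simp add: integral_unique mixture_0 mixture_1 m1 m2)
  moreover have "(LINT s:{0..1}|lborel. ?f s) = integral {0..1} ?f"
    by (intro set_borel_integral_eq_integral borel_integrable_atLeastAtMost' mixture_direction_deriv_continuous)
  ultimately show ?thesis by (simp add: direction_deriv_def)
qed

end

lemma flow_is_Lions_deriv: "is_Lions_deriv (\<lambda>\<mu>. flow \<mu> m x) (\<lambda>\<mu> y. flow_Lions \<mu> y m x)"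
  unfolding is_Lions_deriv_def
proof (intro exI[of _ "\<lambda>\<mu> y. flow_linear \<mu> y m x"] conjI ballI allI)
  show "((\<lambda>y. flow_linear \<mu> y m x) has_real_derivative flow_Lions \<mu> y m x) (at y)" if "\<mu> \<in> P2" for \<mu> y
    by (rule flow_linear_deriv_y[OF that])
  obtain C where C: "0 \<le> C" "\<And>\<mu> r x y z. \<mu> \<in> P2 \<Longrightarrow> \<bar>r\<bar> \<le> \<bar>m\<bar> \<Longrightarrow> \<bar>flow_linear \<mu> y r x - flow_linear \<mu> z r x\<bar> \<le> C * \<bar>y - z\<bar>"
    using flow_linear_lip[of "\<bar>m\<bar>"] by blast
  obtain C' where C': "0 \<le> C'" "\<And>\<mu> \<nu> w r x y. \<mu> \<in> P2 \<Longrightarrow> \<nu> \<in> P2 \<Longrightarrow> kr_le \<mu> \<nu> w \<Longrightarrow> \<bar>r\<bar> \<le> \<bar>m\<bar> \<Longrightarrow>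
      \<bar>flow_Lions \<mu> y r x - flow_Lions \<nu> y r x\<bar> \<le> C' * flow_modulus \<bar>m\<bar> w"
    using flow_Lions_stab[of "\<bar>m\<bar>"] by (metis abs_ge_zero)
  have Cy: "\<bar>flow_linear \<mu> y m x\<bar> \<le> C * \<bar>y\<bar>" if "\<mu> \<in> P2" for \<mu> y
    using C(2)[OF that order_refl, of y x 0] by (simp add: flow_linear_0 that)
  show "is_linear_deriv (\<lambda>\<mu>. flow \<mu> m x) (\<lambda>\<mu> y. flow_linear \<mu> y m x)"
    unfolding is_linear_deriv_def
  proof (intro conjI allI ballI)
    show "continuous_P2 (\<lambda>\<mu> y. flow_linear \<mu> y m x)"
    proof (rule continuous_P2I)
      show "continuous_on UNIV (\<lambda>y. flow_linear \<mu> y m x)" if "\<mu> \<in> P2" for \<mu>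
        by (rule lipschitz_continuous[OF C(2)[OF that order_refl]])
      fix R :: real assume R: "0 \<le> R"
      have "\<bar>flow_linear \<mu> y m x - flow_linear \<nu> y m x\<bar> \<le> C' * R * flow_modulus \<bar>m\<bar> w"
        if \<mu>: "\<mu> \<in> P2" and \<nu>: "\<nu> \<in> P2" and w: "kr_le \<mu> \<nu> w" and y: "norm y \<le> R" for \<mu> \<nu> w y
      proof -
        have "\<bar>(flow_linear \<mu> y m x - flow_linear \<nu> y m x) - (flow_linear \<mu> 0 m x - flow_linear \<nu> 0 m x)\<bar> \<le> C' * flow_modulus \<bar>m\<bar> w * \<bar>y - 0\<bar>"
          by (rule lipschitz_from_deriv[where f="\<lambda>y. flow_linear \<mu> y m x - flow_linear \<nu> y m x" and f'="\<lambda>y. flow_Lions \<mu> y m x - flow_Lions \<nu> y m x"])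
            (intro DERIV_diff flow_linear_deriv_y \<mu> \<nu> C'(2)[OF \<mu> \<nu> w order_refl])+
        also have "\<dots> \<le> C' * flow_modulus \<bar>m\<bar> w * R"
          using y C'(1) flow_modulus_nonneg[OF kr_le_nonneg[OF w]] by (intro mult_left_mono) auto
        finally show ?thesis by (simp add: flow_linear_0 \<mu> \<nu> mult_ac)
      qed
      then show "\<exists>C T. \<forall>\<mu>\<in>P2. \<forall>\<nu>\<in>P2. \<forall>w z. kr_le \<mu> \<nu> w \<longrightarrow> norm z \<le> R \<longrightarrow>
          \<bar>flow_linear \<mu> z m x - flow_linear \<nu> z m x\<bar> \<le> C * flow_modulus T w"
        by (intro exI[of _ "C' * R"] exI[of _ "\<bar>m\<bar>"]) blast
    qed
    show "\<exists>C. \<forall>\<mu>\<in>P2. second_moment \<mu> \<le> R \<longrightarrow> (\<forall>y. \<bar>flow_linear \<mu> y m x\<bar> \<le> C * (1 + y\<^sup>2))" for R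
      using order_trans[OF Cy mult_left_mono[OF abs_le_one_plus_square C(1)]] by blast
    fix m1 m2 assume m: "m1 \<in> P2" "m2 \<in> P2"
    obtain w0 where "kr_le m1 m2 w0" using kr_le_exists[OF m] by blast
    from flow_mixture_formula[OF m this]
    show "flow m1 m x - flow m2 m x = (LINT s:{0..1}|lborel. (\<integral>y. flow_linear (mixture s m1 m2) y m x \<partial>m1)
       - (\<integral>y. flow_linear (mixture s m1 m2) y m x \<partial>m2))" .
  qed
qed

end

section \<open>The transport equation\<close>

text \<open>Both mixtures are images of \<open>uniform {0..1} \<otimes> \<mu>\<close> under the map that switches from \<open>f y\<close> to \<open>y\<close>
  at the threshold \<open>r\<close>.\<close>

lemma W2_mixture_le:
  assumes \<mu>: "\<mu> \<in> P2" and f: "f \<in> borel_measurable borel" and bd: "\<And>y. \<bar>f y - y\<bar> \<le> c"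
    and r: "r \<in> {0..1}" and r': "r' \<in> {0..1}"
  shows "W2 (mixture r (distr \<mu> borel f) \<mu>) (mixture r' (distr \<mu> borel f) \<mu>) \<le> c * sqrt \<bar>r - r'\<bar>"
proof -
  interpret m: prob_space \<mu> using \<mu> by (rule P2_prob_space)
  define U where "U = uniform_measure lborel {0..1::real}"
  interpret u: prob_space U unfolding U_def by (rule prob_space_uniform_measure) auto
  interpret pair_prob_space U \<mu> ..
  let ?P = "U \<Otimes>\<^sub>M \<mu>"
  have [measurable_cong]: "sets U = sets borel" "sets \<mu> = sets borel" by (auto simp: U_def P2_sets[OF \<mu>])
  have sp: "space \<mu> = UNIV" "space U = UNIV" using P2_space[OF \<mu>] by (auto simp: U_def)
  note [measurable] = f
  have c: "0 \<le> c" using order_trans[OF abs_ge_zero bd[of 0]] .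
  let ?Z = "\<lambda>r (p :: real \<times> real). if fst p < r then f (snd p) else snd p"
  have Zm[measurable]: "?Z r \<in> borel_measurable ?P" for r by measurable
  have Uint: "emeasure U {a..<b} = ennreal (b - a)" if "0 \<le> a" "a \<le> b" "b \<le> 1" for a b
  proof -
    have "{0..1} \<inter> {a..<b} = {a..<b}" using that by auto
    then show ?thesis unfolding U_def using that by (simp add: divide_ennreal_def)
  qed
  have mix: "distr ?P borel (?Z r) = mixture r (distr \<mu> borel f) \<mu>" if r: "r \<in> {0..1}" for r
  proof (rule measure_eqI)
    have dP: "distr \<mu> borel f \<in> P2" by (rule distr_P2(1)[OF \<mu> f bd])
    show "sets (distr ?P borel (?Z r)) = sets (mixture r (distr \<mu> borel f) \<mu>)"
      using r by (simp add: sets_mixture[OF dP \<mu>])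
    fix A :: "real set" assume "A \<in> sets (distr ?P borel (?Z r))"
    then have A[measurable]: "A \<in> sets borel" by simp
    have lo: "{0..1} \<inter> {..<r} = {0..<r}" and hi: "{0..1} \<inter> {r..} = {r..1}" using r by auto
    have Ulo: "emeasure U {..<r} = ennreal r" and Uhi: "emeasure U {r..} = ennreal (1 - r)"
      unfolding U_def using r by (simp_all add: lo hi divide_ennreal_def)
    have [measurable]: "f -` A \<in> sets borel" using measurable_sets[OF f A] by simp
    have "?Z r -` A \<inter> space ?P = ({..<r} \<times> (f -` A)) \<union> ({r..} \<times> A)"
      by (auto simp: space_pair_measure sp split: if_splits)
    then have "emeasure (distr ?P borel (?Z r)) A = emeasure ?P (({..<r} \<times> (f -` A)) \<union> ({r..} \<times> A))"
      by (simp add: emeasure_distr)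
    also have "\<dots> = emeasure ?P ({..<r} \<times> (f -` A)) + emeasure ?P ({r..} \<times> A)"
      by (rule plus_emeasure[symmetric]) auto
    also have "\<dots> = ennreal r * emeasure \<mu> (f -` A) + ennreal (1 - r) * emeasure \<mu> A"
      by (simp add: m.emeasure_pair_measure_Times Ulo Uhi)
    also have "emeasure \<mu> (f -` A) = emeasure (distr \<mu> borel f) A"
      by (simp add: emeasure_distr sp)
    finally show "emeasure (distr ?P borel (?Z r)) A = emeasure (mixture r (distr \<mu> borel f) \<mu>) A"
      using r by (simp add: emeasure_mixture[OF dP \<mu>])
  qed
  \<comment> \<open>The two maps differ only if the threshold variable lies between r and r', an
    event of probability \<bar>r - r'\<bar>, and then by at most \<open>c\<close>. The cost is
    quadratic, whence the square root.\<close>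
  let ?I = "{min r r'..<max r r'} \<times> (UNIV :: real set)"
  have I: "?I \<in> sets ?P" by measurable
  have "(\<integral>p. (?Z r p - ?Z r' p)\<^sup>2 \<partial>?P) \<le> (\<integral>p. c\<^sup>2 * indicator ?I p \<partial>?P)"
  proof (rule integral_mono')
    show "integrable ?P (\<lambda>p. c\<^sup>2 * indicator ?I p)"
      by (intro integrable_mult_right integrable_real_indicator I) (simp add: P.emeasure_eq_measure)
    fix p :: "real \<times> real"
    have "(f (snd p) - snd p)\<^sup>2 \<le> c\<^sup>2" "(snd p - f (snd p))\<^sup>2 \<le> c\<^sup>2"
      using bd[of "snd p"] c by (auto intro!: abs_le_square_iff[THEN iffD1] simp: abs_minus_commute)
    then show "(?Z r p - ?Z r' p)\<^sup>2 \<le> c\<^sup>2 * indicator ?I p"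
      by (cases p) (auto simp: indicator_def)
  qed (simp add: indicator_def)
  also have "\<dots> = c\<^sup>2 * measure ?P ?I" using I by simp
  also have "measure ?P ?I = \<bar>r - r'\<bar>"
  proof -
    have "emeasure ?P ?I = emeasure U {min r r'..<max r r'} * emeasure \<mu> UNIV"
      by (intro m.emeasure_pair_measure_Times) auto
    also have "\<dots> = ennreal \<bar>r - r'\<bar>"
      using r r' m.emeasure_space_1 sp by (subst Uint) (auto simp: min_def max_def)
    finally show ?thesis by (simp add: measure_def)
  qed
  finally have "sqrt (\<integral>p. (?Z r p - ?Z r' p)\<^sup>2 \<partial>?P) \<le> sqrt (c\<^sup>2 * \<bar>r - r'\<bar>)" by simp
  also have "\<dots> = c * sqrt \<bar>r - r'\<bar>" using c by (simp add: real_sqrt_mult)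
  finally have "sqrt (\<integral>p. (?Z r p - ?Z r' p)\<^sup>2 \<partial>?P) \<le> c * sqrt \<bar>r - r'\<bar>" .
  with W2_distr_le[OF P.prob_space_axioms Zm Zm, of r r'] show ?thesis
    using mix[OF r] mix[OF r'] by simp
qed

lemma W2_nonneg: "\<mu> \<in> P2 \<Longrightarrow> \<nu> \<in> P2 \<Longrightarrow> 0 \<le> W2 \<mu> \<nu>"
  by (rule kr_le_nonneg[OF kr_le_W2])

lemma W2_distr_self_le:
  assumes \<mu>: "\<mu> \<in> P2" and f: "f \<in> borel_measurable borel" and bd: "\<And>y. \<bar>f y - y\<bar> \<le> c"
  shows "W2 (distr \<mu> borel f) \<mu> \<le> c"
  using W2_mixture_le[OF \<mu> f bd, of 1 0] distr_P2(1)[OF \<mu> f bd] \<mu> by (simp add: mixture_0 mixture_1)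

lemma W2_self:
  assumes \<mu>: "\<mu> \<in> P2"
  shows "W2 \<mu> \<mu> = 0"
proof -
  have "distr \<mu> borel (\<lambda>y. y) = \<mu>" by (rule distr_id2[OF P2_sets[OF \<mu>, symmetric]])
  then have "W2 \<mu> \<mu> \<le> 0" using W2_distr_self_le[OF \<mu>, of "\<lambda>y. y" 0] by simp
  then show ?thesis using W2_nonneg[OF \<mu> \<mu>] by simp
qed

lemma continuous_P2_section:
  assumes "continuous_P2 f" "\<mu> \<in> P2"
  shows "continuous_on UNIV (f \<mu>)"
  using assms W2_self[OF assms(2)]
  by (auto simp: continuous_on_sequentially comp_def continuous_P2_def)

lemma continuous_P2D:
  assumes "continuous_P2 f" "\<And>n. M n \<in> P2" "\<mu> \<in> P2" "(\<lambda>n. W2 (M n) \<mu>) \<longlonglongrightarrow> 0" "Z \<longlonglongrightarrow> z"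
  shows "(\<lambda>n. f (M n) (Z n)) \<longlonglongrightarrow> f \<mu> z"
  using assms unfolding continuous_P2_def by blast

context mean_field_coefficient
begin

lemma W2_law_le: "\<mu> \<in> P2 \<Longrightarrow> W2 (law \<mu> h) \<mu> \<le> K * \<bar>h\<bar>"
  unfolding law_def by (rule W2_distr_self_le[OF _ flow_measurable flow_near])

text \<open>Continuity of the segment in \<open>W2\<close> itself is needed because the linear
  derivative of an arbitrary solution is known to be continuous only in that metric.\<close>

lemma W2_mixture_law_le:
  assumes \<mu>: "\<mu> \<in> P2" and "r \<in> {0..1}" "r' \<in> {0..1}"
  shows "W2 (mixture r (law \<mu> h) \<mu>) (mixture r' (law \<mu> h) \<mu>) \<le> K * \<bar>h\<bar> * sqrt \<bar>r - r'\<bar>"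
  unfolding law_def by (rule W2_mixture_le[OF \<mu> flow_measurable[OF \<mu>] flow_near[OF \<mu>] assms(2,3)])

lemma second_moment_mixture_law_le:
  assumes \<mu>: "\<mu> \<in> P2" and r: "r \<in> {0..1}" and h: "\<bar>h\<bar> \<le> H"
  shows "second_moment (mixture r (law \<mu> h) \<mu>) \<le> 3 * second_moment \<mu> + 2 * (K * H)\<^sup>2"
proof -
  have 1: "second_moment (law \<mu> h) \<le> 2 * second_moment \<mu> + 2 * (K * \<bar>h\<bar>)\<^sup>2"
    unfolding law_def by (rule distr_P2(2)[OF \<mu> flow_measurable[OF \<mu>] flow_near[OF \<mu>]])
  have "(K * \<bar>h\<bar>)\<^sup>2 \<le> (K * H)\<^sup>2"
    using h K_nonneg by (intro power_mono mult_left_mono) auto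
  with 1 have 2: "second_moment (law \<mu> h) \<le> 2 * second_moment \<mu> + 2 * (K * H)\<^sup>2" by linarith
  have "r * second_moment (law \<mu> h) \<le> 1 * second_moment (law \<mu> h)"
    using r by (intro mult_right_mono second_moment_nonneg) auto
  moreover have "(1 - r) * second_moment \<mu> \<le> 1 * second_moment \<mu>"
    using r by (intro mult_right_mono second_moment_nonneg) auto
  ultimately show ?thesis
    using second_moment_mixture[OF law_P2[OF \<mu>] \<mu>, of r h] r 2 by simp
qed

text \<open>The parameter \<open>t\<close> lets \<open>u\<close> vary with the time step, since position and remaining time change
  along a characteristic too.\<close>

lemma measure_difference_quotient:
  fixes u :: "real measure \<Rightarrow> real \<Rightarrow> real" and D' :: "real measure \<Rightarrow> real \<Rightarrow> real \<Rightarrow> real"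
  assumes \<mu>: "\<mu> \<in> P2"
    and Lions: "\<And>t. is_Lions_deriv (\<lambda>\<mu>. u \<mu> t) (\<lambda>\<mu> y. D' \<mu> t y)"
    and cont: "continuous_P2 (\<lambda>\<mu> (t, y). D' \<mu> t y)"
    and growth: "\<And>R. \<exists>C. \<forall>t y. \<forall>\<mu>\<in>P2. \<bar>t\<bar> \<le> R \<longrightarrow> second_moment \<mu> \<le> R \<longrightarrow> \<bar>D' \<mu> t y\<bar> \<le> C * (1 + y\<^sup>2)"
    and h: "h \<longlonglongrightarrow> 0" "\<And>n. h n \<noteq> (0::real)" and t: "t \<longlonglongrightarrow> t0"
  shows "(\<lambda>n. (u (law \<mu> (h n)) (t n) - u \<mu> (t n)) / h n) \<longlonglongrightarrow> (\<integral>y. D' \<mu> t0 y * \<sigma> y \<mu> \<partial>\<mu>)"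
proof -
  interpret prob_space \<mu> using \<mu> by (rule P2_prob_space)
  obtain H where H: "0 < H" "\<And>n. \<bar>h n\<bar> \<le> H"
    using convergent_imp_Bseq[of h] h(1) by (auto simp: convergent_def Bseq_def)
  obtain T where T: "\<And>n. \<bar>t n\<bar> \<le> T"
    using convergent_imp_Bseq[of t] t by (auto simp: convergent_def Bseq_def)
  obtain dd where dd: "\<And>t. is_linear_deriv (\<lambda>\<mu>. u \<mu> t) (dd t)"
    "\<And>t \<mu> y. \<mu> \<in> P2 \<Longrightarrow> (dd t \<mu> has_real_derivative D' \<mu> t y) (at y)"
    using Lions unfolding is_Lions_deriv_def by metis
  define mx where "mx n r = mixture r (law \<mu> (h n)) \<mu>" for n r
  have mxP: "mx n r \<in> P2" if "r \<in> {0..1}" for n r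
    unfolding mx_def using that by (intro mixture_P2 law_P2 \<mu>) auto
  \<comment> \<open>The growth hypothesis has one radius for both t and the second moment; this one
    covers both.\<close>
  let ?R = "T + (3 * second_moment \<mu> + 2 * (K * H)\<^sup>2)"
  obtain C0 where C0: "\<And>t y \<mu>. \<mu> \<in> P2 \<Longrightarrow> \<bar>t\<bar> \<le> ?R \<Longrightarrow> second_moment \<mu> \<le> ?R \<Longrightarrow> \<bar>D' \<mu> t y\<bar> \<le> C0 * (1 + y\<^sup>2)"
    using growth[of ?R] by blast
  have sm: "0 \<le> second_moment \<mu>" by (rule second_moment_nonneg)
  have T0: "0 \<le> T" using order_trans[OF abs_ge_zero T[of 0]] .
  have C1: "\<bar>D' (mx n r) (t n) y\<bar> \<le> C0 * (1 + y\<^sup>2)" if "r \<in> {0..1}" for n r y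
  proof (rule C0[OF mxP[OF that]])
    show "\<bar>t n\<bar> \<le> ?R" using T[of n] sm zero_le_power2[of "K * H"] by linarith
    show "second_moment (mx n r) \<le> ?R"
      using second_moment_mixture_law_le[OF \<mu> that H(2), of n] T0 by (simp add: mx_def)
  qed
  have C00: "0 \<le> C0" using order_trans[OF abs_ge_zero C1[of 0 0 0]] by simp
  \<comment> \<open>The difference quotient of the linear derivative along the flow. Its mean over
    \<open>\<mu>\<close>, integrated over the segment, is the difference quotient of
    \<open>u\<close> in the measure.\<close>
  define q where "q n r y = (dd (t n) (mx n r) (flow \<mu> (h n) y) - dd (t n) (mx n r) y) / h n" for n r y
  let ?C = "C0 * (2 + 8 * (K * H)\<^sup>2) * K"
  have zeta: "\<exists>z. \<bar>z - y\<bar> \<le> K * \<bar>h n\<bar> \<and> q n r y = D' (mx n r) (t n) z * ((flow \<mu> (h n) y - y) / h n)"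
    if r: "r \<in> {0..1}" for n r y
  proof -
    obtain z where "\<bar>z - y\<bar> \<le> \<bar>flow \<mu> (h n) y - y\<bar>"
      "dd (t n) (mx n r) (flow \<mu> (h n) y) - dd (t n) (mx n r) y = D' (mx n r) (t n) z * (flow \<mu> (h n) y - y)"
      using mean_value_real[OF dd(2)[OF mxP[OF r]]] by blast
    then show ?thesis
      using order_trans[OF _ flow_near[OF \<mu>], of "\<bar>z - y\<bar>" "h n" y] by (intro exI[of _ z]) (simp add: q_def)
  qed
  have qbd: "\<bar>q n r y\<bar> \<le> ?C * (1 + y\<^sup>2)" if r: "r \<in> {0..1}" for n r y
  proof -
    obtain z where z: "\<bar>z - y\<bar> \<le> K * \<bar>h n\<bar>" "q n r y = D' (mx n r) (t n) z * ((flow \<mu> (h n) y - y) / h n)"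
      using zeta[OF r] by blast
    have f: "\<bar>(flow \<mu> (h n) y - y) / h n\<bar> \<le> K"
      using flow_near[OF \<mu>, of "h n" y] h(2)[of n] by (simp add: abs_divide divide_le_eq)
    have "\<bar>z - y\<bar> \<le> K * H" using order_trans[OF z(1) mult_left_mono[OF H(2) K_nonneg]] .
    then have "(z - y)\<^sup>2 \<le> (K * H)\<^sup>2" by (intro abs_le_square_iff[THEN iffD1]) simp
    moreover have "z\<^sup>2 = (y + (z - y))\<^sup>2" by simp
    moreover have "\<dots> \<le> 2 * y\<^sup>2 + 2 * (z - y)\<^sup>2"
      using zero_le_power2[of "y - (z - y)"] by (simp add: power2_eq_square algebra_simps)
    ultimately have "z\<^sup>2 \<le> 2 * y\<^sup>2 + 2 * (K * H)\<^sup>2" by linarith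
    moreover have "0 \<le> (K * H)\<^sup>2 * y\<^sup>2" by simp
    ultimately have "1 + z\<^sup>2 \<le> (2 + 8 * (K * H)\<^sup>2) * (1 + y\<^sup>2)"
      using zero_le_power2[of "K * H"] zero_le_power2[of y] unfolding distrib_right distrib_left by linarith
    then have "C0 * (1 + z\<^sup>2) \<le> C0 * ((2 + 8 * (K * H)\<^sup>2) * (1 + y\<^sup>2))" using C00 by (rule mult_left_mono)
    from abs_mult_le[OF order_trans[OF C1[OF r] this] f] show ?thesis
      unfolding z(2) by (simp add: mult_ac)
  qed
  have qm: "(\<lambda>y. q n r y) \<in> borel_measurable \<mu>" if r: "r \<in> {0..1}" for n r
  proof -
    have "continuous_on UNIV (dd (t n) (mx n r))"
      using dd(2)[OF mxP[OF r]] by (intro continuous_at_imp_continuous_on ballI DERIV_isCont)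
    then have [measurable]: "dd (t n) (mx n r) \<in> borel_measurable borel" by (rule borel_measurable_continuous_onI)
    note [measurable] = flow_measurable[OF \<mu>, of "h n"]
    show ?thesis unfolding q_def by (intro P2_measurable[OF \<mu>]) measurable
  qed
  have wint: "integrable \<mu> (\<lambda>y. ?C * (1 + y\<^sup>2))" using \<mu> by (simp add: P2_def)
  let ?G = "\<lambda>n r. \<integral>y. q n r y \<partial>\<mu>"
  \<comment> \<open>Continuity in r supplies the measurability required for dominated convergence
    over the segment.\<close>
  have Gcont: "continuous_on {0..1} (?G n)" for n
    unfolding continuous_on_sequentially comp_def
  proof safe
    fix x :: "nat \<Rightarrow> real" and r assume r: "r \<in> {0..1}" and x: "\<forall>n. x n \<in> {0..1}" "x \<longlonglongrightarrow> r"
    have W: "(\<lambda>j. W2 (mx n (x j)) (mx n r)) \<longlonglongrightarrow> 0"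
    proof (rule tendsto_sandwich[OF _ _ tendsto_const])
      show "\<forall>\<^sub>F j in sequentially. 0 \<le> W2 (mx n (x j)) (mx n r)" using W2_nonneg mxP x r by simp
      show "\<forall>\<^sub>F j in sequentially. W2 (mx n (x j)) (mx n r) \<le> K * \<bar>h n\<bar> * sqrt \<bar>x j - r\<bar>"
        unfolding mx_def using W2_mixture_law_le[OF \<mu> _ r] x by simp
      have "(\<lambda>j. K * \<bar>h n\<bar> * sqrt \<bar>x j - r\<bar>) \<longlonglongrightarrow> K * \<bar>h n\<bar> * sqrt \<bar>r - r\<bar>" by (intro tendsto_intros x)
      then show "(\<lambda>j. K * \<bar>h n\<bar> * sqrt \<bar>x j - r\<bar>) \<longlonglongrightarrow> 0" by simp
    qed
    have cd: "continuous_P2 (dd (t n))" using dd(1)[of "t n"] by (simp add: is_linear_deriv_def)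
    show "(\<lambda>j. ?G n (x j)) \<longlonglongrightarrow> ?G n r"
    proof (rule integral_dominated_convergence[OF _ _ wint])
      have "(\<lambda>j. dd (t n) (mx n (x j)) y) \<longlonglongrightarrow> dd (t n) (mx n r) y" for y
        using x r mxP by (intro continuous_P2D[OF cd _ _ W]) auto
      then show "AE y in \<mu>. (\<lambda>j. q n (x j) y) \<longlonglongrightarrow> q n r y"
        unfolding q_def by (intro AE_I2 tendsto_intros) (use h in auto)
      show "AE y in \<mu>. norm (q n (x j) y) \<le> ?C * (1 + y\<^sup>2)" for j
        using qbd x by (intro AE_I2) simp
    qed (use qm x r in auto)
  qed
  \<comment> \<open>As the time step shrinks, every mixture tends to \<open>\<mu>\<close> and the
    intermediate point to y, so joint continuity of \<open>D'\<close> identifies the limit.\<close>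
  have Glim: "(\<lambda>n. ?G n r) \<longlonglongrightarrow> (\<integral>y. D' \<mu> t0 y * \<sigma> y \<mu> \<partial>\<mu>)" if r: "r \<in> {0..1}" for r
  proof (rule integral_dominated_convergence[OF _ _ wint])
    have "continuous_on UNIV (\<lambda>y. (\<lambda>(t, y). D' \<mu> t y) (t0, y))"
      by (rule continuous_on_compose2[OF continuous_P2_section[OF cont \<mu>]]) (auto intro!: continuous_intros)
    moreover have "continuous_on UNIV (\<lambda>y. \<sigma> y \<mu>)"
      using \<sigma>_lip[OF \<mu> \<mu> kr_le_refl] by (intro lipschitz_continuous[where C=K]) simp
    ultimately show "(\<lambda>y. D' \<mu> t0 y * \<sigma> y \<mu>) \<in> borel_measurable \<mu>"
      by (intro P2_measurable[OF \<mu>] borel_measurable_continuous_onI continuous_intros) simp_all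
    show "q n r \<in> borel_measurable \<mu>" for n using qm[OF r] .
    show "AE y in \<mu>. norm (q n r y) \<le> ?C * (1 + y\<^sup>2)" for n
      using qbd[OF r] by (intro AE_I2) simp
    show "AE y in \<mu>. (\<lambda>n. q n r y) \<longlonglongrightarrow> D' \<mu> t0 y * \<sigma> y \<mu>"
    proof (rule AE_I2)
      fix y
      obtain z where z: "\<And>n. \<bar>z n - y\<bar> \<le> K * \<bar>h n\<bar>"
        "\<And>n. q n r y = D' (mx n r) (t n) (z n) * ((flow \<mu> (h n) y - y) / h n)"
        using zeta[OF r] by metis
      have hK: "(\<lambda>n. K * \<bar>h n\<bar>) \<longlonglongrightarrow> 0" by (intro tendsto_mult_right_zero tendsto_rabs_zero h)
      have "(\<lambda>n. z n - y) \<longlonglongrightarrow> 0" using z(1) by (intro Lim_null_comparison[OF _ hK]) simp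
      then have zl: "z \<longlonglongrightarrow> y" by (simp add: LIM_zero_iff)
      have W: "(\<lambda>n. W2 (mx n r) \<mu>) \<longlonglongrightarrow> 0"
      proof (rule tendsto_sandwich[OF _ _ tendsto_const])
        show "\<forall>\<^sub>F n in sequentially. 0 \<le> W2 (mx n r) \<mu>" using W2_nonneg mxP r \<mu> by simp
        have "W2 (mx n r) \<mu> \<le> K * \<bar>h n\<bar> * sqrt \<bar>r\<bar>" for n
          using W2_mixture_law_le[OF \<mu> r, of 0 "h n"] by (simp add: mx_def mixture_0 law_P2 \<mu>)
        then show "\<forall>\<^sub>F n in sequentially. W2 (mx n r) \<mu> \<le> K * \<bar>h n\<bar> * sqrt \<bar>r\<bar>" by simp
        show "(\<lambda>n. K * \<bar>h n\<bar> * sqrt \<bar>r\<bar>) \<longlonglongrightarrow> 0" by (intro tendsto_mult_left_zero hK)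
      qed
      have "(\<lambda>n. (\<lambda>(t, y). D' (mx n r) t y) (t n, z n)) \<longlonglongrightarrow> (\<lambda>(t, y). D' \<mu> t y) (t0, y)"
        by (rule continuous_P2D[OF cont mxP[OF r] \<mu> W tendsto_Pair[OF t zl]])
      moreover have "(\<lambda>n. (flow \<mu> (h n) y - y) / h n) \<longlonglongrightarrow> \<sigma> y \<mu>"
        using flow_deriv[OF \<mu>, of y 0] h
        by (simp add: has_field_derivative_iff tendsto_at_iff_sequentially comp_def flow_0 law_0 \<mu>)
      ultimately show "(\<lambda>n. q n r y) \<longlonglongrightarrow> D' \<mu> t0 y * \<sigma> y \<mu>"
        unfolding z(2) by (intro tendsto_mult) simp_all
    qed
  qed
  have eq: "(u (law \<mu> (h n)) (t n) - u \<mu> (t n)) / h n = (LINT r:{0..1}|lborel. ?G n r)" for n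
  proof -
    have cd: "continuous_on UNIV (dd (t n) (mx n r))" if "r \<in> {0..1}" for r
      using dd(2)[OF mxP[OF that]] by (intro continuous_at_imp_continuous_on ballI DERIV_isCont)
    have "u (law \<mu> (h n)) (t n) - u \<mu> (t n) = (LINT r:{0..1}|lborel.
        (\<integral>y. dd (t n) (mx n r) y \<partial>law \<mu> (h n)) - (\<integral>y. dd (t n) (mx n r) y \<partial>\<mu>))"
      using dd(1)[of "t n"] law_P2[OF \<mu>, of "h n"] \<mu> unfolding is_linear_deriv_def mx_def by blast
    also have "\<dots> = (LINT r:{0..1}|lborel. h n * ?G n r)"
    proof (rule set_lebesgue_integral_cong)
      show "\<forall>r. r \<in> {0..1} \<longrightarrow> (\<integral>y. dd (t n) (mx n r) y \<partial>law \<mu> (h n)) - (\<integral>y. dd (t n) (mx n r) y \<partial>\<mu>) = h n * ?G n r"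
      proof safe
        fix r :: real assume r: "r \<in> {0..1}"
        obtain C where "\<forall>\<nu>\<in>P2. second_moment \<nu> \<le> second_moment (mx n r) \<longrightarrow> (\<forall>y. \<bar>dd (t n) \<nu> y\<bar> \<le> C * (1 + y\<^sup>2))"
          using dd(1)[of "t n"] unfolding is_linear_deriv_def by blast
        then have C: "\<bar>dd (t n) (mx n r) y\<bar> \<le> C * (1 + y\<^sup>2)" for y using mxP[OF r, of n] by simp
        have m: "dd (t n) (mx n r) \<in> borel_measurable borel" by (rule borel_measurable_continuous_onI[OF cd[OF r]])
        have i1: "integrable \<mu> (dd (t n) (mx n r))" "integrable (law \<mu> (h n)) (dd (t n) (mx n r))"
          by (intro integrable_P2[OF _ m C] \<mu> law_P2)+
        have i2: "integrable \<mu> (\<lambda>y. dd (t n) (mx n r) (flow \<mu> (h n) y))"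
          using i1(2) m unfolding law_def
          by (subst (asm) integrable_distr_eq) (auto intro: P2_measurable[OF \<mu>] flow_measurable[OF \<mu>])
        have "h n * ?G n r = (\<integral>y. h n * q n r y \<partial>\<mu>)" by simp
        also have "\<dots> = (\<integral>y. dd (t n) (mx n r) (flow \<mu> (h n) y) - dd (t n) (mx n r) y \<partial>\<mu>)"
          using h(2)[of n] by (simp add: q_def)
        also have "\<dots> = (\<integral>y. dd (t n) (mx n r) y \<partial>law \<mu> (h n)) - (\<integral>y. dd (t n) (mx n r) y \<partial>\<mu>)"
          using i1 i2 by (simp add: integral_law[OF \<mu> m])
        finally show "(\<integral>y. dd (t n) (mx n r) y \<partial>law \<mu> (h n)) - (\<integral>y. dd (t n) (mx n r) y \<partial>\<mu>) = h n * ?G n r" by simp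
      qed
    qed simp
    also have "\<dots> = h n * (LINT r:{0..1}|lborel. ?G n r)" by simp
    finally show ?thesis using h(2)[of n] by simp
  qed
  have "(\<lambda>n. LINT r:{0..1}|lborel. ?G n r) \<longlonglongrightarrow> (LINT r:{0..1::real}|lborel. (\<integral>y. D' \<mu> t0 y * \<sigma> y \<mu> \<partial>\<mu>))"
    unfolding set_lebesgue_integral_def
  proof (rule integral_dominated_convergence[where s="\<lambda>n r. indicator {0..1} r *\<^sub>R ?G n r"
        and f="\<lambda>r. indicator {0..1} r *\<^sub>R (\<integral>y. D' \<mu> t0 y * \<sigma> y \<mu> \<partial>\<mu>)"
        and w="\<lambda>r. indicator {0..1} r * (\<integral>y. ?C * (1 + y\<^sup>2) \<partial>\<mu>)"])
    show "(\<lambda>r. indicator {0..1} r *\<^sub>R ?G n r) \<in> borel_measurable lborel" for n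
      using borel_measurable_continuous_on_indicator[OF _ Gcont[of n]] by simp
    show "AE r in lborel. (\<lambda>n. indicator {0..1} r *\<^sub>R ?G n r) \<longlonglongrightarrow> indicator {0..1} r *\<^sub>R (\<integral>y. D' \<mu> t0 y * \<sigma> y \<mu> \<partial>\<mu>)"
      using Glim by (intro AE_I2) (auto simp: indicator_def)
    show "AE r in lborel. norm (indicator {0..1} r *\<^sub>R ?G n r) \<le> indicator {0..1} r * (\<integral>y. ?C * (1 + y\<^sup>2) \<partial>\<mu>)" for n
    proof (rule AE_I2)
      fix r :: real
      have "\<bar>?G n r\<bar> \<le> (\<integral>y. ?C * (1 + y\<^sup>2) \<partial>\<mu>)" if r: "r \<in> {0..1}"
      proof -
        have "\<bar>?G n r\<bar> \<le> (\<integral>y. \<bar>q n r y\<bar> \<partial>\<mu>)" by (rule integral_abs_bound)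
        also have "\<dots> \<le> (\<integral>y. ?C * (1 + y\<^sup>2) \<partial>\<mu>)"
          using wint qbd[OF r] C00 K_nonneg by (intro integral_mono') auto
        finally show ?thesis .
      qed
      then show "norm (indicator {0..1} r *\<^sub>R ?G n r) \<le> indicator {0..1} r * (\<integral>y. ?C * (1 + y\<^sup>2) \<partial>\<mu>)"
        by (simp add: indicator_def)
    qed
    show "integrable lborel (\<lambda>r :: real. indicator {0..1} r * (\<integral>y. ?C * (1 + y\<^sup>2) \<partial>\<mu>))"
      by (intro integrable_mult_left integrable_real_indicator) auto
  qed auto
  then show ?thesis unfolding eq by (simp add: set_lebesgue_integral_def)
qed

section \<open>The chain rule along characteristics and uniqueness\<close>

text \<open>The increment is split into position, measure and time, in this order. The first two are
  evaluated at moving arguments and use joint continuity of \<open>\<phi>x\<close> and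
  \<open>D'\<close>; the last is taken at fixed x and \<open>\<mu>\<close>, where differentiability
  in m suffices. The remaining time decreases, hence the minus sign.\<close>

lemma chain_rule_at_0:
  fixes \<phi> \<phi>x \<phi>m :: "real \<Rightarrow> real measure \<Rightarrow> real \<Rightarrow> real" and D' :: "real \<Rightarrow> real measure \<Rightarrow> real \<Rightarrow> real \<Rightarrow> real"
  assumes dx: "\<And>x m \<mu>. \<mu> \<in> P2 \<Longrightarrow> ((\<lambda>x. \<phi> x \<mu> m) has_real_derivative \<phi>x x \<mu> m) (at x)"
    and dm: "\<And>x m \<mu>. \<mu> \<in> P2 \<Longrightarrow> ((\<lambda>m. \<phi> x \<mu> m) has_real_derivative \<phi>m x \<mu> m) (at m)"
    and Lions: "\<And>x m. is_Lions_deriv (\<lambda>\<mu>. \<phi> x \<mu> m) (\<lambda>\<mu> y. D' x \<mu> m y)"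
    and cx: "continuous_P2 (\<lambda>\<mu> (x, m). \<phi>x x \<mu> m)"
    and cD: "continuous_P2 (\<lambda>\<mu> (x, m, y). D' x \<mu> m y)"
    and growth: "\<And>R. \<exists>C. \<forall>x m y. \<forall>\<mu>\<in>P2. \<bar>x\<bar> \<le> R \<longrightarrow> \<bar>m\<bar> \<le> R \<longrightarrow> second_moment \<mu> \<le> R \<longrightarrow> \<bar>D' x \<mu> m y\<bar> \<le> C * (1 + y\<^sup>2)"
    and \<mu>: "\<mu> \<in> P2"
  shows "((\<lambda>h. \<phi> (flow \<mu> h x) (law \<mu> h) (m - h)) has_real_derivative
    \<phi>x x \<mu> m * \<sigma> x \<mu> + (\<integral>y. D' x \<mu> m y * \<sigma> y \<mu> \<partial>\<mu>) - \<phi>m x \<mu> m) (at 0)"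
  unfolding has_field_derivative_iff tendsto_at_iff_sequentially comp_def
proof safe
  fix h :: "nat \<Rightarrow> real" assume h0: "\<forall>i. h i \<in> UNIV - {0}" and h: "h \<longlonglongrightarrow> 0"
  have hn: "h n \<noteq> 0" for n using h0 by auto
  define t where "t n = m - h n" for n
  have t: "t \<longlonglongrightarrow> m" unfolding t_def using tendsto_diff[OF tendsto_const h, of m] by simp
  have W: "(\<lambda>n. W2 (law \<mu> (h n)) \<mu>) \<longlonglongrightarrow> 0"
  proof (rule tendsto_sandwich[OF _ _ tendsto_const])
    show "\<forall>\<^sub>F n in sequentially. 0 \<le> W2 (law \<mu> (h n)) \<mu>" using W2_nonneg law_P2 \<mu> by simp
    show "\<forall>\<^sub>F n in sequentially. W2 (law \<mu> (h n)) \<mu> \<le> K * \<bar>h n\<bar>" using W2_law_le[OF \<mu>] by simp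
    show "(\<lambda>n. K * \<bar>h n\<bar>) \<longlonglongrightarrow> 0" by (intro tendsto_mult_right_zero tendsto_rabs_zero h)
  qed
  have quot: "(\<lambda>n. (flow \<mu> (h n) x - x) / h n) \<longlonglongrightarrow> \<sigma> x \<mu>"
    using flow_deriv[OF \<mu>, of x 0] h hn
    by (simp add: has_field_derivative_iff tendsto_at_iff_sequentially comp_def flow_0 law_0 \<mu>)
  have 1: "(\<lambda>n. (\<phi> (flow \<mu> (h n) x) (law \<mu> (h n)) (t n) - \<phi> x (law \<mu> (h n)) (t n)) / h n) \<longlonglongrightarrow> \<phi>x x \<mu> m * \<sigma> x \<mu>"
  proof -
    have "\<exists>z. \<bar>z - x\<bar> \<le> \<bar>flow \<mu> (h n) x - x\<bar> \<and> \<phi> (flow \<mu> (h n) x) (law \<mu> (h n)) (t n) - \<phi> x (law \<mu> (h n)) (t n)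
        = \<phi>x z (law \<mu> (h n)) (t n) * (flow \<mu> (h n) x - x)" for n
      using mean_value_real[OF dx[OF law_P2[OF \<mu>]]] by metis
    then obtain z where z: "\<And>n. \<bar>z n - x\<bar> \<le> \<bar>flow \<mu> (h n) x - x\<bar>"
      "\<And>n. \<phi> (flow \<mu> (h n) x) (law \<mu> (h n)) (t n) - \<phi> x (law \<mu> (h n)) (t n)
        = \<phi>x (z n) (law \<mu> (h n)) (t n) * (flow \<mu> (h n) x - x)" by metis
    have "(\<lambda>n. z n - x) \<longlonglongrightarrow> 0"
    proof (rule Lim_null_comparison)
      show "\<forall>\<^sub>F n in sequentially. norm (z n - x) \<le> K * \<bar>h n\<bar>"
        using order_trans[OF z(1) flow_near[OF \<mu>]] by simp
      show "(\<lambda>n. K * \<bar>h n\<bar>) \<longlonglongrightarrow> 0" by (intro tendsto_mult_right_zero tendsto_rabs_zero h)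
    qed
    then have zl: "z \<longlonglongrightarrow> x" by (simp add: LIM_zero_iff)
    have "(\<lambda>n. (\<lambda>(x, m). \<phi>x x (law \<mu> (h n)) m) (z n, t n)) \<longlonglongrightarrow> (\<lambda>(x, m). \<phi>x x \<mu> m) (x, m)"
      by (rule continuous_P2D[OF cx law_P2[OF \<mu>] \<mu> W tendsto_Pair[OF zl t]])
    from tendsto_mult[OF this quot] show ?thesis by (simp add: z(2))
  qed
  have 2: "(\<lambda>n. (\<phi> x (law \<mu> (h n)) (t n) - \<phi> x \<mu> (t n)) / h n) \<longlonglongrightarrow> (\<integral>y. D' x \<mu> m y * \<sigma> y \<mu> \<partial>\<mu>)"
  proof (rule measure_difference_quotient[where u="\<lambda>\<mu> m. \<phi> x \<mu> m" and D'="\<lambda>\<mu> m y. D' x \<mu> m y", OF \<mu> Lions _ _ h hn t])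
    show "continuous_P2 (\<lambda>\<mu> (m, y). D' x \<mu> m y)"
      unfolding continuous_P2_def
    proof safe
      fix M \<nu> and Z :: "nat \<Rightarrow> real \<times> real" and m y
      assume a: "\<forall>n. M n \<in> P2" "\<nu> \<in> P2" "(\<lambda>n. W2 (M n) \<nu>) \<longlonglongrightarrow> 0" "Z \<longlonglongrightarrow> (m, y)"
      have "(\<lambda>n. (x, Z n)) \<longlonglongrightarrow> (x, m, y)" by (intro tendsto_Pair tendsto_const a)
      from continuous_P2D[OF cD _ a(2,3) this] a(1)
      show "(\<lambda>n. case Z n of (m, y) \<Rightarrow> D' x (M n) m y) \<longlonglongrightarrow> D' x \<nu> m y" by simp
    qed
    fix R
    obtain C where C: "\<And>x' m y \<mu>. \<mu> \<in> P2 \<Longrightarrow> \<bar>x'\<bar> \<le> max R \<bar>x\<bar> \<Longrightarrow> \<bar>m\<bar> \<le> max R \<bar>x\<bar> \<Longrightarrow>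
        second_moment \<mu> \<le> max R \<bar>x\<bar> \<Longrightarrow> \<bar>D' x' \<mu> m y\<bar> \<le> C * (1 + y\<^sup>2)"
      using growth[of "max R \<bar>x\<bar>"] by blast
    show "\<exists>C. \<forall>t y. \<forall>\<mu>\<in>P2. \<bar>t\<bar> \<le> R \<longrightarrow> second_moment \<mu> \<le> R \<longrightarrow> \<bar>D' x \<mu> t y\<bar> \<le> C * (1 + y\<^sup>2)"
      by (intro exI[of _ C] allI ballI impI C) auto
  qed
  have 3: "(\<lambda>n. (\<phi> x \<mu> (t n) - \<phi> x \<mu> m) / h n) \<longlonglongrightarrow> - \<phi>m x \<mu> m"
  proof -
    have "((\<lambda>h. \<phi> x \<mu> (m - h)) has_real_derivative \<phi>m x \<mu> (m - 0) * (- 1)) (at 0)"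
      by (rule DERIV_chain2[OF dm[OF \<mu>]]) (auto intro!: derivative_eq_intros)
    then show ?thesis
      using h hn by (simp add: has_field_derivative_iff tendsto_at_iff_sequentially comp_def t_def)
  qed
  have "(\<lambda>n. (\<phi> (flow \<mu> (h n) x) (law \<mu> (h n)) (t n) - \<phi> x (law \<mu> (h n)) (t n)) / h n
      + (\<phi> x (law \<mu> (h n)) (t n) - \<phi> x \<mu> (t n)) / h n + (\<phi> x \<mu> (t n) - \<phi> x \<mu> m) / h n)
    \<longlonglongrightarrow> \<phi>x x \<mu> m * \<sigma> x \<mu> + (\<integral>y. D' x \<mu> m y * \<sigma> y \<mu> \<partial>\<mu>) + - \<phi>m x \<mu> m"
    by (intro tendsto_add 1 2 3)
  moreover have "(\<lambda>n. (\<phi> (flow \<mu> (h n) x) (law \<mu> (h n)) (t n) - \<phi> x (law \<mu> (h n)) (t n)) / h n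
      + (\<phi> x (law \<mu> (h n)) (t n) - \<phi> x \<mu> (t n)) / h n + (\<phi> x \<mu> (t n) - \<phi> x \<mu> m) / h n)
    = (\<lambda>n. (\<phi> (flow \<mu> (h n) x) (law \<mu> (h n)) (m - h n) - \<phi> (flow \<mu> 0 x) (law \<mu> 0) (m - 0)) / (h n - 0))"
    by (simp add: t_def flow_0 law_0 \<mu> flip: add_divide_distrib)
  ultimately show "(\<lambda>n. (\<phi> (flow \<mu> (h n) x) (law \<mu> (h n)) (m - h n) - \<phi> (flow \<mu> 0 x) (law \<mu> 0) (m - 0)) / (h n - 0))
      \<longlonglongrightarrow> \<phi>x x \<mu> m * \<sigma> x \<mu> + (\<integral>y. D' x \<mu> m y * \<sigma> y \<mu> \<partial>\<mu>) - \<phi>m x \<mu> m"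
    by simp
qed

text \<open>A solution of the transport equation is constant along the characteristics
  \<open>s \<mapsto> (flow \<mu> s x, law \<mu> s, m - s)\<close>.\<close>

lemma transport_solution_eq_flow:
  assumes "solves_transport \<sigma> \<phi>" and \<mu>: "\<mu> \<in> P2"
  shows "\<phi> x \<mu> m = flow \<mu> m x"
proof -
  obtain \<phi>x \<phi>m D' where
    dx: "\<And>x m \<mu>. \<mu> \<in> P2 \<Longrightarrow> ((\<lambda>x. \<phi> x \<mu> m) has_real_derivative \<phi>x x \<mu> m) (at x)"
    and dm: "\<And>x m \<mu>. \<mu> \<in> P2 \<Longrightarrow> ((\<lambda>m. \<phi> x \<mu> m) has_real_derivative \<phi>m x \<mu> m) (at m)"
    and Lions: "\<And>x m. is_Lions_deriv (\<lambda>\<mu>. \<phi> x \<mu> m) (\<lambda>\<mu> y. D' x \<mu> m y)"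
    and cx: "continuous_P2 (\<lambda>\<mu> (x, m). \<phi>x x \<mu> m)"
    and cD: "continuous_P2 (\<lambda>\<mu> (x, m, y). D' x \<mu> m y)"
    and growth: "\<And>R. \<exists>C. \<forall>x m y. \<forall>\<mu>\<in>P2. \<bar>x\<bar> \<le> R \<longrightarrow> \<bar>m\<bar> \<le> R \<longrightarrow> second_moment \<mu> \<le> R \<longrightarrow> \<bar>D' x \<mu> m y\<bar> \<le> C * (1 + y\<^sup>2)"
    and pde: "\<And>x m \<mu>. \<mu> \<in> P2 \<Longrightarrow> \<phi>m x \<mu> m = \<phi>x x \<mu> m * \<sigma> x \<mu> + (\<integral>y. D' x \<mu> m y * \<sigma> y \<mu> \<partial>\<mu>)"
    and init: "\<And>x \<mu>. \<mu> \<in> P2 \<Longrightarrow> \<phi> x \<mu> 0 = x"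
    using assms(1) unfolding solves_transport_def
  proof (elim exE conjE, goal_cases)
    case (1 \<psi>x \<psi>m E)
    show ?case by (rule 1(1)[of \<psi>x \<psi>m E]; use 1(2-) in blast)
  qed
  let ?g = "\<lambda>s. \<phi> (flow \<mu> s x) (law \<mu> s) (m - s)"
  have "(?g has_real_derivative 0) (at s)" for s
  proof -
    have "((\<lambda>h. \<phi> (flow (law \<mu> s) h (flow \<mu> s x)) (law (law \<mu> s) h) ((m - s) - h)) has_real_derivative 0) (at 0)"
      using chain_rule_at_0[OF dx dm Lions cx cD growth law_P2[OF \<mu>], of s "flow \<mu> s x" "m - s"] pde[OF law_P2[OF \<mu>]]
      by simp
    \<comment> \<open>The semigroup property turns a derivative at time 0 for the law at s into a
      derivative at time s for \<open>\<mu>\<close>.\<close>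
    then have "((\<lambda>h. ?g (h + s)) has_real_derivative 0) (at 0)"
      by (simp add: flow_semigroup[OF \<mu>] add.commute diff_diff_eq)
    then show ?thesis using DERIV_shift[of ?g 0 0 s] by simp
  qed
  \<comment> \<open>At s = 0 the value is the solution at (x, \<mu>, m); at s = m the remaining time
    is 0 and the initial condition returns the end point of the flow.\<close>
  then have "?g 0 = ?g m" by (rule DERIV_isconst_all[rule_format])
  then show ?thesis by (simp add: flow_0 law_0 law_P2 init \<mu>)
qed

section \<open>The flow as a classical solution of both problems\<close>

lemma continuous_P2_jacobian: "continuous_P2 (\<lambda>\<mu> (x, m). jacobian \<mu> m x)"
proof (rule continuous_P2I)
  show "continuous_on UNIV (\<lambda>(x, m). jacobian \<mu> m x)" if "\<mu> \<in> P2" for \<mu>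
    unfolding case_prod_unfold by (intro continuous_jacobian that continuous_intros)
  fix R :: real
  obtain C where "0 \<le> C" and C: "\<And>\<mu> \<nu> w m x. \<mu> \<in> P2 \<Longrightarrow> \<nu> \<in> P2 \<Longrightarrow> kr_le \<mu> \<nu> w \<Longrightarrow> \<bar>m\<bar> \<le> R \<Longrightarrow>
      \<bar>jacobian \<mu> m x - jacobian \<nu> m x\<bar> \<le> C * flow_modulus R w" using jacobian_stab[of R] by blast
  have "\<bar>(case z of (x, m) \<Rightarrow> jacobian \<mu> m x) - (case z of (x, m) \<Rightarrow> jacobian \<nu> m x)\<bar> \<le> C * flow_modulus R w"
    if "\<mu> \<in> P2" "\<nu> \<in> P2" "kr_le \<mu> \<nu> w" "norm z \<le> R" for \<mu> \<nu> w and z :: "real \<times> real"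
    using C[OF that(1-3), of "snd z"] norm_snd_le[of "snd z" "fst z"] that(4) by (simp add: case_prod_unfold)
  then show "\<exists>C T. \<forall>\<mu>\<in>P2. \<forall>\<nu>\<in>P2. \<forall>w z. kr_le \<mu> \<nu> w \<longrightarrow> norm z \<le> R \<longrightarrow>
      \<bar>(case z of (x, m) \<Rightarrow> jacobian \<mu> m x) - (case z of (x, m) \<Rightarrow> jacobian \<nu> m x)\<bar> \<le> C * flow_modulus T w" by blast
qed

lemma continuous_P2_velocity: "continuous_P2 (\<lambda>\<mu> (x, m). \<sigma> (flow \<mu> m x) (law \<mu> m))"
proof (rule continuous_P2I)
  show "continuous_on UNIV (\<lambda>(x, m). \<sigma> (flow \<mu> m x) (law \<mu> m))" if "\<mu> \<in> P2" for \<mu>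
    unfolding case_prod_unfold by (intro continuous_\<sigma> continuous_flow that continuous_intros)
  fix R :: real assume R: "0 \<le> R"
  have "\<bar>\<sigma> (flow \<mu> m x) (law \<mu> m) - \<sigma> (flow \<nu> m x) (law \<nu> m)\<bar> \<le> 2 * K * stab_const R * flow_modulus R w"
    if a: "\<mu> \<in> P2" "\<nu> \<in> P2" "kr_le \<mu> \<nu> w" "\<bar>m\<bar> \<le> R" for \<mu> \<nu> w m x
  proof -
    have "\<bar>\<sigma> (flow \<mu> m x) (law \<mu> m) - \<sigma> (flow \<nu> m x) (law \<nu> m)\<bar> \<le> K * \<bar>flow \<mu> m x - flow \<nu> m x\<bar> + K * (stab_const R * w)"
      by (intro \<sigma>_lip law_P2 flow_stab(2) a)
    also have "\<dots> \<le> 2 * K * stab_const R * w"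
      using mult_left_mono[OF flow_stab(1)[OF a, of x] K_nonneg] by (simp add: mult_ac)
    also have "\<dots> \<le> 2 * K * stab_const R * flow_modulus R w"
      using stab_const_nonneg[OF R] K_nonneg by (intro mult_left_mono le_flow_modulus) auto
    finally show ?thesis .
  qed
  then have "\<bar>(case z of (x, m) \<Rightarrow> \<sigma> (flow \<mu> m x) (law \<mu> m)) - (case z of (x, m) \<Rightarrow> \<sigma> (flow \<nu> m x) (law \<nu> m))\<bar>
      \<le> 2 * K * stab_const R * flow_modulus R w"
    if "\<mu> \<in> P2" "\<nu> \<in> P2" "kr_le \<mu> \<nu> w" "norm z \<le> R" for \<mu> \<nu> w and z :: "real \<times> real"
    using norm_snd_le[of "snd z" "fst z"] that by (simp add: case_prod_unfold)
  then show "\<exists>C T. \<forall>\<mu>\<in>P2. \<forall>\<nu>\<in>P2. \<forall>w z. kr_le \<mu> \<nu> w \<longrightarrow> norm z \<le> R \<longrightarrow>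
      \<bar>(case z of (x, m) \<Rightarrow> \<sigma> (flow \<mu> m x) (law \<mu> m)) - (case z of (x, m) \<Rightarrow> \<sigma> (flow \<nu> m x) (law \<nu> m))\<bar> \<le> C * flow_modulus T w" by blast
qed

lemma continuous_P2_flow_Lions: "continuous_P2 (\<lambda>\<mu> (x, m, y). flow_Lions \<mu> y m x)"
proof (rule continuous_P2I)
  show "continuous_on UNIV (\<lambda>(x, m, y). flow_Lions \<mu> y m x)" if "\<mu> \<in> P2" for \<mu>
    by (rule continuous_flow_Lions[OF that])
  fix R :: real assume R: "0 \<le> R"
  obtain C where "0 \<le> C" and C: "\<And>\<mu> \<nu> w m x y. \<mu> \<in> P2 \<Longrightarrow> \<nu> \<in> P2 \<Longrightarrow> kr_le \<mu> \<nu> w \<Longrightarrow> \<bar>m\<bar> \<le> R \<Longrightarrow>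
      \<bar>flow_Lions \<mu> y m x - flow_Lions \<nu> y m x\<bar> \<le> C * flow_modulus R w" using flow_Lions_stab[OF R] by blast
  have "\<bar>(case z of (x, m, y) \<Rightarrow> flow_Lions \<mu> y m x) - (case z of (x, m, y) \<Rightarrow> flow_Lions \<nu> y m x)\<bar> \<le> C * flow_modulus R w"
    if "\<mu> \<in> P2" "\<nu> \<in> P2" "kr_le \<mu> \<nu> w" "norm z \<le> R" for \<mu> \<nu> w and z :: "real \<times> real \<times> real"
  proof -
    have "norm (fst (snd z)) \<le> norm (snd z)" using norm_fst_le[of "fst (snd z)" "snd (snd z)"] by simp
    also have "\<dots> \<le> norm z" using norm_snd_le[of "snd z" "fst z"] by simp
    finally show ?thesis using C[OF that(1-3), of "fst (snd z)"] that(4) by (simp add: case_prod_unfold)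
  qed
  then show "\<exists>C T. \<forall>\<mu>\<in>P2. \<forall>\<nu>\<in>P2. \<forall>w z. kr_le \<mu> \<nu> w \<longrightarrow> norm z \<le> R \<longrightarrow>
      \<bar>(case z of (x, m, y) \<Rightarrow> flow_Lions \<mu> y m x) - (case z of (x, m, y) \<Rightarrow> flow_Lions \<nu> y m x)\<bar> \<le> C * flow_modulus T w" by blast
qed

lemma flow_Lions_growth:
  "\<exists>C. \<forall>x m y. \<forall>\<mu>\<in>P2. \<bar>x\<bar> \<le> R \<longrightarrow> \<bar>m\<bar> \<le> R \<longrightarrow> second_moment \<mu> \<le> R \<longrightarrow> \<bar>flow_Lions \<mu> y m x\<bar> \<le> C * (1 + y\<^sup>2)"
proof -
  obtain C where C: "0 \<le> C" "\<And>\<mu> m x y. \<mu> \<in> P2 \<Longrightarrow> \<bar>m\<bar> \<le> R \<Longrightarrow> \<bar>flow_Lions \<mu> y m x\<bar> \<le> C"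
    using flow_Lions_bdd[of R] by blast
  have "C \<le> C * (1 + y\<^sup>2)" for y using C(1) mult_left_mono[of 1 "1 + y\<^sup>2" C] by simp
  then show ?thesis using C(2) order_trans by blast
qed

text \<open>Flowing for time h and then for the remaining time m - h always ends at
  \<open>flow \<mu> m x\<close>. The chain rule computes the derivative of this constant at h = 0,
  and its vanishing is the equation.\<close>

lemma flow_solves_transport: "solves_transport \<sigma> (\<lambda>x \<mu> m. flow \<mu> m x)"
proof -
  have pde: "\<sigma> (flow \<mu> m x) (law \<mu> m) = jacobian \<mu> m x * \<sigma> x \<mu> + (\<integral>y. flow_Lions \<mu> y m x * \<sigma> y \<mu> \<partial>\<mu>)"
    if \<mu>: "\<mu> \<in> P2" for x m \<mu>
  proof -
    have "((\<lambda>h. flow (law \<mu> h) (m - h) (flow \<mu> h x)) has_real_derivative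
        jacobian \<mu> m x * \<sigma> x \<mu> + (\<integral>y. flow_Lions \<mu> y m x * \<sigma> y \<mu> \<partial>\<mu>) - \<sigma> (flow \<mu> m x) (law \<mu> m)) (at 0)"
      by (rule chain_rule_at_0[where \<phi>="\<lambda>x \<mu> m. flow \<mu> m x" and D'="\<lambda>x \<mu> m y. flow_Lions \<mu> y m x"
            and \<phi>x="\<lambda>x \<mu> m. jacobian \<mu> m x" and \<phi>m="\<lambda>x \<mu> m. \<sigma> (flow \<mu> m x) (law \<mu> m)",
            OF flow_deriv_x flow_deriv flow_is_Lions_deriv continuous_P2_jacobian continuous_P2_flow_Lions flow_Lions_growth \<mu>])
    moreover have "(\<lambda>h. flow (law \<mu> h) (m - h) (flow \<mu> h x)) = (\<lambda>h. flow \<mu> m x)"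
      by (simp add: flow_semigroup[OF \<mu>])
    ultimately show ?thesis using DERIV_unique[OF _ DERIV_const] by fastforce
  qed
  show ?thesis
    unfolding solves_transport_def
    by (intro exI[of _ "\<lambda>x \<mu> m. jacobian \<mu> m x"] exI[of _ "\<lambda>x \<mu> m. \<sigma> (flow \<mu> m x) (law \<mu> m)"]
        exI[of _ "\<lambda>x \<mu> m y. flow_Lions \<mu> y m x"] conjI allI ballI flow_deriv_x flow_deriv flow_is_Lions_deriv
        continuous_P2_jacobian continuous_P2_velocity continuous_P2_flow_Lions flow_Lions_growth pde flow_0)
qed

lemma flow_solves_flow: "solves_flow \<sigma> (\<lambda>x \<mu> m. flow \<mu> m x)"
proof -
  have "flow_measure (\<lambda>x \<mu> m. flow \<mu> m x) \<mu> m = law \<mu> m" for \<mu> m by (simp add: flow_measure_def law_def)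
  then show ?thesis
    unfolding solves_flow_def using flow_measurable law_P2 flow_deriv flow_0 by simp
qed

text \<open>The bound on \<open>\<sigma>\<close> keeps a solution within
  \<open>K * \<bar>m\<bar>\<close> of its starting point, which places it in the uniqueness class
  although only measurability in x is given.\<close>

lemma flow_solution_eq_flow:
  assumes "solves_flow \<sigma> \<phi>" and \<mu>: "\<mu> \<in> P2"
  shows "\<phi> x \<mu> m = flow \<mu> m x"
proof -
  have m: "(\<lambda>x. \<phi> x \<mu> m) \<in> borel_measurable borel" and P: "flow_measure \<phi> \<mu> m \<in> P2"
    and d: "((\<lambda>m. \<phi> x \<mu> m) has_real_derivative \<sigma> (\<phi> x \<mu> m) (flow_measure \<phi> \<mu> m)) (at m)"
    and init: "\<phi> x \<mu> 0 = x" for x m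
    using assms unfolding solves_flow_def by auto
  have near: "\<bar>\<phi> x \<mu> m - x\<bar> \<le> 0 + K * \<bar>m\<bar>" for x m
    using lipschitz_from_deriv[OF d \<sigma>_bdd[OF P], of x m 0] by (simp add: init)
  show ?thesis
    by (rule flow_unique[OF \<mu>, where Z="\<lambda>m x. \<phi> x \<mu> m" and W="flow \<mu>" and b=0])
      (use m near d flow_measurable[OF \<mu>] flow_near[OF \<mu>] flow_deriv[OF \<mu>] flow_0[OF \<mu>] init in
        \<open>auto simp: flow_measure_def law_def\<close>)
qed

lemma transport_and_flow_well_posed:
  "\<exists>\<psi>. solves_transport \<sigma> \<psi> \<and> solves_flow \<sigma> \<psi> \<and>
     (\<forall>\<phi>. solves_transport \<sigma> \<phi> \<longrightarrow> agree_P2 \<phi> \<psi>) \<and> (\<forall>\<phi>. solves_flow \<sigma> \<phi> \<longrightarrow> agree_P2 \<phi> \<psi>)"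
  using flow_solves_transport flow_solves_flow transport_solution_eq_flow flow_solution_eq_flow
  unfolding agree_P2_def by blast

end

section \<open>Sobolev functions with a bounded second derivative\<close>

text \<open>The derivatives are existentially quantified order by order, so that sums and products
  are handled by induction; \<open>deriv\<close> enters only in
  \<open>smooth_upto_differentiable\<close>, to match the test functions.\<close>

primrec smooth_upto :: "nat \<Rightarrow> (real \<Rightarrow> real) \<Rightarrow> bool" where
  "smooth_upto 0 f \<longleftrightarrow> True"
| "smooth_upto (Suc n) f \<longleftrightarrow> (\<exists>f'. (\<forall>x. (f has_real_derivative f' x) (at x)) \<and> smooth_upto n f')"

lemma smooth_upto_Suc: "smooth_upto (Suc n) f \<Longrightarrow> smooth_upto n f"
proof (induction n arbitrary: f)
  case (Suc n)
  then obtain f' where "\<And>x. (f has_real_derivative f' x) (at x)" "smooth_upto (Suc n) f'"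
    by (metis smooth_upto.simps(2))
  then show ?case using Suc.IH by auto
qed simp

lemma smooth_upto_const: "smooth_upto n (\<lambda>x. c)"
proof (induction n arbitrary: c)
  case (Suc n)
  then have "(\<forall>x. ((\<lambda>x. c) has_real_derivative 0) (at x)) \<and> smooth_upto n (\<lambda>x. 0)" by simp
  then show ?case unfolding smooth_upto.simps by (rule exI[of _ "\<lambda>_. 0"])
qed simp

lemma smooth_upto_add: "smooth_upto n f \<Longrightarrow> smooth_upto n g \<Longrightarrow> smooth_upto n (\<lambda>x. f x + g x)"
proof (induction n arbitrary: f g)
  case (Suc n)
  then obtain f' g' where "\<And>x. (f has_real_derivative f' x) (at x)" "smooth_upto n f'"
    "\<And>x. (g has_real_derivative g' x) (at x)" "smooth_upto n g'" by auto
  then show ?case using Suc.IH[of f' g']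
    by (auto intro!: exI[of _ "\<lambda>x. f' x + g' x"] derivative_eq_intros)
qed simp

lemma smooth_upto_mult: "smooth_upto n f \<Longrightarrow> smooth_upto n g \<Longrightarrow> smooth_upto n (\<lambda>x. f x * g x)"
proof (induction n arbitrary: f g)
  case (Suc n)
  then obtain f' g' where d: "\<And>x. (f has_real_derivative f' x) (at x)" "\<And>x. (g has_real_derivative g' x) (at x)"
    and s: "smooth_upto n f'" "smooth_upto n g'" by auto
  have "smooth_upto n (\<lambda>x. f' x * g x + g' x * f x)"
    by (intro smooth_upto_add Suc.IH s smooth_upto_Suc[OF Suc.prems(1)] smooth_upto_Suc[OF Suc.prems(2)])
  then show ?case using d
    by (auto intro!: exI[of _ "\<lambda>x. f' x * g x + g' x * f x"] derivative_eq_intros)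
qed simp

lemma smooth_upto_affine: "smooth_upto n f \<Longrightarrow> smooth_upto n (\<lambda>x. f (c * x + d))"
proof (induction n arbitrary: f)
  case (Suc n)
  then obtain f' where d: "\<And>x. (f has_real_derivative f' x) (at x)" and s: "smooth_upto n f'" by auto
  have "smooth_upto n (\<lambda>x. c * f' (c * x + d))"
    by (intro smooth_upto_mult smooth_upto_const Suc.IH s)
  moreover have "((\<lambda>x. f (c * x + d)) has_real_derivative c * f' (c * x + d)) (at x)" for x
  proof -
    have "((\<lambda>x. f (c * x + d)) has_real_derivative f' (c * x + d) * c) (at x)"
      by (rule DERIV_chain2[OF d]) (auto intro!: derivative_eq_intros)
    then show ?thesis by (simp add: mult.commute)
  qed
  ultimately show ?case by (auto intro!: exI[of _ "\<lambda>x. c * f' (c * x + d)"])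
qed simp

lemma deriv_translate:
  fixes s s' :: "real \<Rightarrow> real"
  assumes "\<And>x. (s has_real_derivative s' x) (at x)"
  shows "((\<lambda>t. s (t - u)) has_real_derivative s' (t - u)) (at t)"
proof -
  have "((\<lambda>t. t - u) has_real_derivative 1) (at t)" by (auto intro!: derivative_eq_intros)
  from DERIV_chain2[OF assms this] show ?thesis by simp
qed

lemma smooth_upto_differentiable: "smooth_upto (Suc n) f \<Longrightarrow> (deriv ^^ n) f differentiable_on UNIV"
proof (induction n arbitrary: f)
  case 0
  then show ?case
    by (auto simp: differentiable_on_def real_differentiable_def)
next
  case (Suc n)
  then obtain f' where d: "\<And>x. (f has_real_derivative f' x) (at x)" and s: "smooth_upto (Suc n) f'"
    by (metis smooth_upto.simps(2))
  have "deriv f = f'" using DERIV_imp_deriv[OF d] by auto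
  then show ?case using Suc.IH[OF s] by (simp add: funpow_swap1)
qed

section \<open>Smooth bumps and mollifiers\<close>

text \<open>These functions form a family closed under differentiation, the derivative replacing p
  by X^2 (p - p'). Smoothness then follows by an induction over all polynomials at once.\<close>

definition exp_bump :: "real poly \<Rightarrow> real \<Rightarrow> real" where
  "exp_bump p x = (if x \<le> 0 then 0 else poly p (inverse x) * exp (- inverse x))"

lemma poly_exp_tendsto_0: "((\<lambda>u :: real. poly p u * u ^ k * exp (- u)) \<longlongrightarrow> 0) at_top"
proof (induction p arbitrary: k)
  case 0 then show ?case by simp
next
  case (pCons a p)
  have "((\<lambda>u :: real. a * (u ^ k / exp u)) \<longlongrightarrow> 0) at_top"
    by (intro tendsto_mult_right_zero tendsto_power_div_exp_0)
  from tendsto_add[OF this pCons.IH[of "Suc k"]] show ?case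
    by (simp add: algebra_simps exp_minus divide_inverse)
qed

lemma exp_bump_deriv: "(exp_bump p has_real_derivative exp_bump (monom 1 2 * (p - pderiv p)) x) (at x)"
proof (cases x "0 :: real" rule: linorder_cases)
  case less
  have "((\<lambda>_. 0) has_real_derivative 0) (at x)" by simp
  then have "(exp_bump p has_real_derivative 0) (at x)"
    by (rule has_field_derivative_transform_within_open[where S="{..<0}"]) (use less in \<open>auto simp: exp_bump_def\<close>)
  then show ?thesis using less by (simp add: exp_bump_def)
next
  case greater
  let ?d = "poly p (inverse x) * (exp (- inverse x) * (inverse x)\<^sup>2) - poly (pderiv p) (inverse x) * (inverse x)\<^sup>2 * exp (- inverse x)"
  have "((\<lambda>x. poly p (inverse x) * exp (- inverse x)) has_real_derivative ?d) (at x)"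
  proof -
    have i: "(inverse has_real_derivative - (inverse x)\<^sup>2) (at x)"
      using greater by (auto intro!: derivative_eq_intros simp: power2_eq_square)
    have "((\<lambda>x. poly p (inverse x)) has_real_derivative poly (pderiv p) (inverse x) * - (inverse x)\<^sup>2) (at x)"
      by (rule DERIV_chain2[OF poly_DERIV i])
    moreover have "((\<lambda>x. exp (- inverse x)) has_real_derivative exp (- inverse x) * (inverse x)\<^sup>2) (at x)"
      using DERIV_chain2[OF DERIV_exp DERIV_minus[OF i]] by simp
    ultimately show ?thesis by (rule DERIV_cong[OF DERIV_mult]) (simp add: algebra_simps)
  qed
  then have "(exp_bump p has_real_derivative ?d) (at x)"
    by (rule has_field_derivative_transform_within_open[where S="{0<..}"]) (use greater in \<open>auto simp: exp_bump_def\<close>)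
  then show ?thesis using greater by (simp add: exp_bump_def poly_monom algebra_simps)
next
  case equal
  \<comment> \<open>The quotient is 0 on the left; on the right the substitution u = 1 / h turns it
    into p(u) u exp(-u), which tends to 0 at infinity.\<close>
  have "((\<lambda>h. (exp_bump p h - exp_bump p 0) / (h - 0)) \<longlongrightarrow> 0) (at 0)"
  proof (rule filterlim_split_at)
    have "eventually (\<lambda>h. (exp_bump p h - exp_bump p 0) / (h - 0) = 0) (at_left 0)"
      by (auto simp: eventually_at_filter exp_bump_def)
    then show "((\<lambda>h. (exp_bump p h - exp_bump p 0) / (h - 0)) \<longlongrightarrow> 0) (at_left 0)"
      by (rule tendsto_eventually)
    show "((\<lambda>h. (exp_bump p h - exp_bump p 0) / (h - 0)) \<longlongrightarrow> 0) (at_right 0)"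
      unfolding filterlim_at_right_to_top
    proof (rule Lim_transform_eventually[OF poly_exp_tendsto_0[of p 1]])
      show "\<forall>\<^sub>F u in at_top. poly p u * u ^ 1 * exp (- u) = (exp_bump p (inverse u) - exp_bump p 0) / (inverse u - 0)"
        using eventually_gt_at_top[of 0] by eventually_elim (simp add: exp_bump_def divide_inverse mult_ac)
    qed
  qed
  then show ?thesis using equal by (simp add: has_field_derivative_iff exp_bump_def)
qed

lemma smooth_upto_exp_bump: "smooth_upto n (exp_bump p)"
proof (induction n arbitrary: p)
  case (Suc n)
  then show ?case
    by (auto intro!: exI[of _ "exp_bump (monom 1 2 * (p - pderiv p))"] exp_bump_deriv)
qed simp

lemma linear_where_deriv_const:
  fixes f f' :: "real \<Rightarrow> real"
  assumes d: "\<And>x. (f has_real_derivative f' x) (at x)" and c: "\<And>z. u \<le> z \<Longrightarrow> z \<le> v \<Longrightarrow> f' z = c" and uv: "u \<le> v"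
  shows "f v - f u = c * (v - u)"
proof (cases "u = v")
  case False
  then have "u < v" using uv by simp
  from MVT2[OF this, of f f'] d obtain z where z: "u < z" "z < v" "f v - f u = (v - u) * f' z" by blast
  then show ?thesis using c[of z] by (simp add: mult.commute)
qed simp

text \<open>The three functions are smooth versions of the point mass at 0, the unit step and the
  positive part, each the derivative of the next. The last one is the building block of smoothed hat
  functions.\<close>

lemma mollifier_exists:
  assumes \<epsilon>: "0 < \<epsilon>"
  obtains r r1 r2 :: "real \<Rightarrow> real" where "\<And>n. smooth_upto n r" "\<And>x. (r1 has_real_derivative r x) (at x)"
    "\<And>x. (r2 has_real_derivative r1 x) (at x)" "\<And>x. 0 \<le> r x" "\<And>x. \<epsilon> \<le> \<bar>x\<bar> \<Longrightarrow> r x = 0"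
    "\<And>x. 0 \<le> r1 x" "\<And>x. r1 x \<le> 1" "\<And>x. x \<le> - \<epsilon> \<Longrightarrow> r1 x = 0" "\<And>x. \<epsilon> \<le> x \<Longrightarrow> r1 x = 1"
    "\<And>x. x \<le> - \<epsilon> \<Longrightarrow> r2 x = 0"
proof -
  define b where "b x = exp_bump 1 (\<epsilon> + x) * exp_bump 1 (\<epsilon> - x)" for x
  have bs: "smooth_upto n b" for n
    using smooth_upto_affine[OF smooth_upto_exp_bump[of n 1], of 1 \<epsilon>] smooth_upto_affine[OF smooth_upto_exp_bump[of n 1], of "-1" \<epsilon>]
    unfolding b_def[abs_def] by (intro smooth_upto_mult) (simp_all add: add.commute)
  have b0: "0 \<le> b x" for x by (simp add: b_def exp_bump_def)
  have bz: "b x = 0" if "\<epsilon> \<le> \<bar>x\<bar>" for x using that by (auto simp: b_def exp_bump_def)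
  have bpos: "0 < b 0" using \<epsilon> by (simp add: b_def exp_bump_def)
  have cont: "continuous_on UNIV f" if "smooth_upto 1 f" for f
    using that by (auto intro!: continuous_at_imp_continuous_on intro: DERIV_isCont)
  obtain P where P: "\<And>x. (P has_real_derivative b x) (at x)"
    using continuous_antiderivative[OF cont[OF bs]] by blast
  define Q where "Q x = P x - P (- \<epsilon>)" for x
  have Qd: "(Q has_real_derivative b x) (at x)" for x
    unfolding Q_def[abs_def] by (auto intro!: derivative_eq_intros P)
  have Qmono: "Q x \<le> Q y" if "x \<le> y" for x y
    using DERIV_nonneg_imp_nondecreasing[OF that, of Q] Qd b0 by blast
  have Qlo: "Q x = 0" if "x \<le> - \<epsilon>" for x
    using linear_where_deriv_const[of Q b x "- \<epsilon>" 0, OF Qd _ that] bz \<epsilon> by (simp add: Q_def)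
  have Qhi: "Q x = Q \<epsilon>" if "\<epsilon> \<le> x" for x
    using linear_where_deriv_const[of Q b \<epsilon> x 0, OF Qd _ that] bz \<epsilon> by simp
  \<comment> \<open>If the total mass were not positive, monotonicity would make \<open>Q\<close>
    vanish identically, although its derivative at 0 is positive.\<close>
  have Qpos: "0 < Q \<epsilon>"
  proof (rule ccontr)
    assume "\<not> 0 < Q \<epsilon>"
    moreover have "0 \<le> Q x" for x
      using Qmono[of "- \<epsilon>" x] Qmono[of x "- \<epsilon>"] Qlo[of "- \<epsilon>"] Qlo[of x] by (cases "x \<le> - \<epsilon>") auto
    moreover have "Q x \<le> Q \<epsilon>" for x using Qmono[of x \<epsilon>] Qhi[of x] by (cases "x \<le> \<epsilon>") auto
    ultimately have "Q = (\<lambda>x. 0)" by (intro ext) (meson antisym linorder_not_le order_trans)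
    then have "b 0 = 0" using DERIV_unique[OF Qd[of 0]] by (metis DERIV_const)
    then show False using bpos by simp
  qed
  define r where "r x = 1 / Q \<epsilon> * b x" for x
  define r1 where "r1 x = Q x / Q \<epsilon>" for x
  have r1d: "(r1 has_real_derivative r x) (at x)" for x
    unfolding r1_def[abs_def] r_def using Qpos by (auto intro!: derivative_eq_intros Qd)
  have r1z: "r1 x = 0" if "x \<le> - \<epsilon>" for x by (simp add: r1_def Qlo[OF that])
  have "continuous_on UNIV r1" using r1d by (intro continuous_at_imp_continuous_on ballI DERIV_isCont)
  then obtain P2 where P2: "\<And>x. (P2 has_real_derivative r1 x) (at x)"
    using continuous_antiderivative by blast
  define r2 where "r2 x = P2 x - P2 (- \<epsilon>)" for x
  have r2d: "(r2 has_real_derivative r1 x) (at x)" for x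
    unfolding r2_def[abs_def] by (auto intro!: derivative_eq_intros P2)
  show thesis
  proof
    show "smooth_upto n r" for n unfolding r_def[abs_def] by (intro smooth_upto_mult smooth_upto_const bs)
    show "(r1 has_real_derivative r x) (at x)" "(r2 has_real_derivative r1 x) (at x)" for x by (rule r1d r2d)+
    show "0 \<le> r x" for x using b0 Qpos by (simp add: r_def)
    show "r x = 0" if "\<epsilon> \<le> \<bar>x\<bar>" for x by (simp add: r_def bz[OF that])
    show "0 \<le> r1 x" for x
      using Qmono[of "- \<epsilon>" x] Qlo[of "- \<epsilon>"] Qlo[of x] Qpos by (cases "x \<le> - \<epsilon>") (auto simp: r1_def)
    show "r1 x \<le> 1" for x
      using Qmono[of x \<epsilon>] Qhi[of x] Qpos by (cases "x \<le> \<epsilon>") (auto simp: r1_def)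
    show "r1 x = 0" if "x \<le> - \<epsilon>" for x by (rule r1z[OF that])
    show "r1 x = 1" if "\<epsilon> \<le> x" for x using Qhi[OF that] Qpos by (simp add: r1_def)
    show "r2 x = 0" if "x \<le> - \<epsilon>" for x
      using linear_where_deriv_const[of r2 r1 x "- \<epsilon>" 0, OF r2d _ that] r1z by (simp add: r2_def)
  qed
qed

text \<open>\<open>r\<close> has integral 1, the increment of \<open>r1\<close>, so the integral is
  an average of values of \<open>f\<close> at distance less than \<open>\<epsilon>\<close> from
  x.\<close>

lemma mollified_lipschitz:
  fixes f r r1 :: "real \<Rightarrow> real"
  assumes lip: "\<And>x y. \<bar>f x - f y\<bar> \<le> L * \<bar>x - y\<bar>" and \<epsilon>: "0 < \<epsilon>"
    and r: "continuous_on UNIV r" "\<And>x. 0 \<le> r x" "\<And>x. \<epsilon> \<le> \<bar>x\<bar> \<Longrightarrow> r x = 0"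
    and r1: "\<And>x. (r1 has_real_derivative r x) (at x)" "r1 (- \<epsilon>) = 0" "r1 \<epsilon> = 1"
  shows "integrable lborel (\<lambda>t. f t * r (t - x))" and "\<bar>(\<integral>t. f t * r (t - x) \<partial>lborel) - f x\<bar> \<le> L * \<epsilon>"
proof -
  have [measurable]: "f \<in> borel_measurable borel" "r \<in> borel_measurable borel"
    using lipschitz_measurable[OF lip] borel_measurable_continuous_onI[OF r(1)] by auto
  have L: "0 \<le> L" using lip[of 1 0] by simp
  have "has_bochner_integral lborel (\<lambda>t. r (t - x) * indicator {x - \<epsilon>..x + \<epsilon>} t) (r1 (x + \<epsilon> - x) - r1 (x - \<epsilon> - x))"
  proof (rule has_bochner_integral_FTC_Icc_real)
    show "((\<lambda>t. r1 (t - x)) has_real_derivative r (t - x)) (at t)" for t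
      by (rule deriv_translate[OF r1(1)])
    show "isCont (\<lambda>t. r (t - x)) t" for t
      using r(1) by (intro continuous_intros isCont_o2[of _ "\<lambda>t. t - x" r]) (auto simp: continuous_on_eq_continuous_at)
  qed (use \<epsilon> in auto)
  moreover have "(\<lambda>t. r (t - x) * indicator {x - \<epsilon>..x + \<epsilon>} t) = (\<lambda>t. r (t - x))"
  proof
    fix t
    show "r (t - x) * indicator {x - \<epsilon>..x + \<epsilon>} t = r (t - x)"
    proof (cases "t \<in> {x - \<epsilon>..x + \<epsilon>}")
      case False
      then have "\<epsilon> \<le> \<bar>t - x\<bar>" by auto
      then show ?thesis by (simp add: r(3))
    qed simp
  qed
  ultimately have one: "has_bochner_integral lborel (\<lambda>t. r (t - x)) 1" using r1 by simp
  then have ri: "integrable lborel (\<lambda>t. r (t - x))" and r1': "(\<integral>t. r (t - x) \<partial>lborel) = 1"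
    by (auto simp: has_bochner_integral_iff)
  have near: "\<bar>f t - f x\<bar> * r (t - x) \<le> L * \<epsilon> * r (t - x)" for t
  proof (cases "\<epsilon> \<le> \<bar>t - x\<bar>")
    case False
    then have "L * \<bar>t - x\<bar> \<le> L * \<epsilon>" using L by (intro mult_left_mono) auto
    then show ?thesis using lip[of t x] r(2)[of "t - x"] by (intro mult_right_mono) auto
  qed (simp add: r(3))
  have i1: "integrable lborel (\<lambda>t. (f t - f x) * r (t - x))"
    by (rule Bochner_Integration.integrable_bound[OF integrable_mult_right[OF ri, of "L * \<epsilon>"]])
      (use near r(2) L \<epsilon> in \<open>auto simp: abs_mult\<close>)
  from Bochner_Integration.integrable_add[OF this integrable_mult_right[OF ri, of "f x"]]
  show int: "integrable lborel (\<lambda>t. f t * r (t - x))" by (simp add: algebra_simps)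
  have "(\<integral>t. f t * r (t - x) \<partial>lborel) - f x = (\<integral>t. (f t - f x) * r (t - x) \<partial>lborel)"
    using int ri r1' by (simp add: left_diff_distrib)
  also have "\<bar>\<dots>\<bar> \<le> (\<integral>t. \<bar>(f t - f x) * r (t - x)\<bar> \<partial>lborel)" by (rule integral_abs_bound)
  also have "\<dots> \<le> (\<integral>t. L * \<epsilon> * r (t - x) \<partial>lborel)"
    using ri near r(2) L \<epsilon> by (intro integral_mono') (auto simp: abs_mult)
  also have "\<dots> = L * \<epsilon>" by (simp add: r1')
  finally show "\<bar>(\<integral>t. f t * r (t - x) \<partial>lborel) - f x\<bar> \<le> L * \<epsilon>" .
qed

text \<open>The second divided difference of \<open>f\<close> is tested against the weak second derivative by a smoothed
  hat function, whose second derivative is a combination of three mollifiers.\<close>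

lemma weak_second_deriv_slopes:
  fixes f g :: "real \<Rightarrow> real"
  assumes lip: "\<And>x y. \<bar>f x - f y\<bar> \<le> L * \<bar>x - y\<bar>"
    and weak: "is_weak_deriv 2 f g" and g: "AE x in lborel. \<bar>g x\<bar> \<le> C"
    and abc: "a < b" "b < c"
  shows "\<bar>(f a - f b) / (b - a) - (f b - f c) / (c - b)\<bar> \<le> C * (c - a)"
proof (rule field_le_epsilon)
  fix e :: real assume e: "0 < e"
  have L: "0 \<le> L" using lip[of 1 0] by simp
  \<comment> \<open>The bound on g is given almost everywhere only; since Lebesgue measure is not
    zero it holds at some point, which fixes the sign of \<open>C\<close>.\<close>
  have C: "0 \<le> C"
  proof -
    have "\<exists>x. \<bar>g x\<bar> \<le> C"
    proof (rule ccontr)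
      assume "\<nexists>x. \<bar>g x\<bar> \<le> C"
      then have "AE x in lborel :: real measure. False" using g by simp
      then show False by (simp add: AE_iff_null null_sets_def)
    qed
    then show ?thesis by (meson abs_ge_zero order_trans)
  qed
  \<comment> \<open>The coefficient of \<open>\<epsilon>\<close> in the final error, with 1 added to
    make it positive.\<close>
  let ?M = "2 * C + 2 * L / (b - a) + 2 * L / (c - b) + 1"
  have M: "0 < ?M" using C L abc by (simp add: add_nonneg_pos)
  define \<epsilon> where "\<epsilon> = e / ?M"
  have \<epsilon>: "0 < \<epsilon>" using e M by (simp add: \<epsilon>_def)
  obtain r r1 r2 where sm: "\<And>n. smooth_upto n r" and r1: "\<And>x. (r1 has_real_derivative r x) (at x)"
    and r2: "\<And>x. (r2 has_real_derivative r1 x) (at x)" and r0: "\<And>x. 0 \<le> r x" and rz: "\<And>x. \<epsilon> \<le> \<bar>x\<bar> \<Longrightarrow> r x = 0"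
    and r1n: "\<And>x. 0 \<le> r1 x" "\<And>x. r1 x \<le> 1" and r1lo: "\<And>x. x \<le> - \<epsilon> \<Longrightarrow> r1 x = 0" and r1hi: "\<And>x. \<epsilon> \<le> x \<Longrightarrow> r1 x = 1"
    and r2lo: "\<And>x. x \<le> - \<epsilon> \<Longrightarrow> r2 x = 0"
    using mollifier_exists[OF \<epsilon>] by blast
  have rc: "continuous_on UNIV r"
    using sm[of 1] by (auto intro!: continuous_at_imp_continuous_on intro: DERIV_isCont)
  \<comment> \<open>With the smoothed positive part for \<open>s\<close> this is a hat of height at
    most 1 supported near [a, c]; with the mollifier for \<open>s\<close> it tests \<open>f\<close>
    by its difference of slopes. Differentiation acts on \<open>s\<close> alone.\<close>
  define h where "h s t = (s (t - a) - s (t - b)) * (1 / (b - a)) + (s (t - c) - s (t - b)) * (1 / (c - b))"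
    for s :: "real \<Rightarrow> real" and t
  have hd: "(h s has_real_derivative h s' t) (at t)" if "\<And>x. (s has_real_derivative s' x) (at x)" for s s' t
  proof -
    show ?thesis
      unfolding h_def[abs_def] by (intro DERIV_add DERIV_diff DERIV_cmult_right deriv_translate that)
  qed
  have hs: "smooth_upto n (h r)" for n
  proof -
    have *: "smooth_upto n (\<lambda>t. k * r (t - u))" for k u
      using smooth_upto_mult[OF smooth_upto_const smooth_upto_affine[OF sm, of n 1 "- u"], of k] by simp
    have eq: "h r = (\<lambda>t. (1 / (b - a)) * r (t - a) + (- (1 / (b - a)) - 1 / (c - b)) * r (t - b) + (1 / (c - b)) * r (t - c))"
      by (auto simp: h_def fun_eq_iff algebra_simps)
    show ?thesis unfolding eq by (intro smooth_upto_add *)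
  qed
  have hs2: "smooth_upto n (h r2)" for n
  proof -
    have "smooth_upto (Suc (Suc n)) (h r2)" using hs[of n] hd[OF r2] hd[OF r1] by auto
    then show ?thesis by (rule smooth_upto_Suc[OF smooth_upto_Suc])
  qed
  have der: "(deriv ^^ 2) (h r2) = h r"
  proof -
    have "deriv (h r2) = h r1" "deriv (h r1) = h r"
      using DERIV_imp_deriv[OF hd[OF r2]] DERIV_imp_deriv[OF hd[OF r1]] by auto
    then show ?thesis by (simp add: numeral_2_eq_2)
  qed
  have hlo: "h r2 t = 0" if "t \<le> a - \<epsilon>" for t
    using that abc by (simp add: h_def r2lo)
  have r2inc: "0 \<le> r2 v - r2 u \<and> r2 v - r2 u \<le> v - u" if "u \<le> v" for u v
  proof -
    obtain z where z: "r2 v - r2 u = r1 z * (v - u)" using mean_value_real[OF r2] by blast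
    show ?thesis
      unfolding z using mult_right_mono[OF r1n(2)[of z], of "v - u"] r1n(1)[of z] that by simp
  qed
  have hhi: "h r2 t = 0" if "c + \<epsilon> \<le> t" for t
  proof -
    have s: "r2 v - r2 u = v - u" if "\<epsilon> \<le> u" "u \<le> v" for u v
      using linear_where_deriv_const[of r2 r1 u v 1, OF r2 _ that(2)] r1hi that by simp
    have "r2 (t - a) - r2 (t - b) = b - a" "r2 (t - c) - r2 (t - b) = - (c - b)"
      using s[of "t - b" "t - a"] s[of "t - c" "t - b"] that abc by auto
    moreover have "(b - a) * (1 / (b - a)) = 1" "- (c - b) * (1 / (c - b)) = - 1"
      using abc by (auto simp: field_simps)
    ultimately show ?thesis unfolding h_def by simp
  qed
  have hbd: "\<bar>h r2 t\<bar> \<le> 1" for t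
  proof -
    have u: "0 \<le> (r2 (t - a) - r2 (t - b)) * (1 / (b - a))" "(r2 (t - a) - r2 (t - b)) * (1 / (b - a)) \<le> 1"
      using r2inc[of "t - b" "t - a"] abc by (auto simp: field_simps)
    have v: "0 \<le> (r2 (t - b) - r2 (t - c)) * (1 / (c - b))" "(r2 (t - b) - r2 (t - c)) * (1 / (c - b)) \<le> 1"
      using r2inc[of "t - c" "t - b"] abc by (auto simp: field_simps)
    have "h r2 t = (r2 (t - a) - r2 (t - b)) * (1 / (b - a)) - (r2 (t - b) - r2 (t - c)) * (1 / (c - b))"
      by (simp add: h_def algebra_simps)
    then show ?thesis using u v by linarith
  qed
  have "h r2 \<in> test_functions"
    unfolding test_functions_def
  proof (intro CollectI conjI allI)
    show "(deriv ^^ n) (h r2) differentiable_on UNIV" for n by (rule smooth_upto_differentiable[OF hs2])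
    show "\<exists>R. \<forall>x. R < \<bar>x\<bar> \<longrightarrow> h r2 x = 0"
    proof (intro exI[of _ "\<bar>a\<bar> + \<bar>c\<bar> + \<epsilon>"] allI impI)
      fix x assume "\<bar>a\<bar> + \<bar>c\<bar> + \<epsilon> < \<bar>x\<bar>"
      then have "x \<le> a - \<epsilon> \<or> c + \<epsilon> \<le> x" by linarith
      then show "h r2 x = 0" using hlo hhi by blast
    qed
  qed
  then have weq: "(\<integral>x. f x * h r x \<partial>lborel) = (\<integral>x. g x * h r2 x \<partial>lborel)"
    using weak der unfolding is_weak_deriv_def by fastforce
  define F where "F x = (\<integral>t. f t * r (t - x) \<partial>lborel)" for x
  note moll = mollified_lipschitz[OF lip \<epsilon> rc r0 rz r1 r1lo[OF order_refl] r1hi[OF order_refl]]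
  have Fint: "integrable lborel (\<lambda>t. f t * r (t - x))" for x by (rule moll(1))
  have Fbd: "\<bar>F x - f x\<bar> \<le> L * \<epsilon>" for x unfolding F_def by (rule moll(2))
  have "(\<integral>x. f x * h r x \<partial>lborel) = (F a - F b) * (1 / (b - a)) + (F c - F b) * (1 / (c - b))"
  proof -
    have "(\<lambda>x. f x * h r x) = (\<lambda>t. (f t * r (t - a) - f t * r (t - b)) * (1 / (b - a)) + (f t * r (t - c) - f t * r (t - b)) * (1 / (c - b)))"
      by (auto simp: h_def fun_eq_iff algebra_simps)
    then show ?thesis
      using Fint by (simp add: F_def)
  qed
  moreover have "\<bar>\<integral>x. g x * h r2 x \<partial>lborel\<bar> \<le> C * (c - a + 2 * \<epsilon>)"
  proof -
    have "\<bar>\<integral>x. g x * h r2 x \<partial>lborel\<bar> \<le> (\<integral>x. \<bar>g x * h r2 x\<bar> \<partial>lborel)" by (rule integral_abs_bound)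
    also have "\<dots> \<le> (\<integral>x. C * indicator {a - \<epsilon>..c + \<epsilon>} x \<partial>lborel)"
    proof (rule integral_mono_AE')
      show "AE x in lborel. \<bar>g x * h r2 x\<bar> \<le> C * indicator {a - \<epsilon>..c + \<epsilon>} x"
        using g
      proof eventually_elim
        case (elim x)
        show ?case
        proof (cases "x \<in> {a - \<epsilon>..c + \<epsilon>}")
          case True
          have "\<bar>g x * h r2 x\<bar> \<le> C * 1" by (rule abs_mult_le[OF elim hbd])
          then show ?thesis using True by simp
        next
          case False
          then have "h r2 x = 0" using hlo[of x] hhi[of x] by auto
          then show ?thesis by (simp add: C)
        qed
      qed
      show "integrable lborel (\<lambda>x. C * indicator {a - \<epsilon>..c + \<epsilon>} x)"
        by (intro integrable_mult_right integrable_real_indicator) (simp_all add: emeasure_lborel_Icc_eq)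
    qed (use C in simp)
    also have "\<dots> = C * (c - a + 2 * \<epsilon>)" using abc \<epsilon> by simp
    finally show ?thesis .
  qed
  ultimately have main: "\<bar>(F a - F b) * (1 / (b - a)) + (F c - F b) * (1 / (c - b))\<bar> \<le> C * (c - a + 2 * \<epsilon>)"
    using weq by simp
  have e1: "\<bar>((F a - F b) - (f a - f b)) * (1 / (b - a))\<bar> \<le> 2 * L * \<epsilon> * (1 / (b - a))"
    using Fbd[of a] Fbd[of b] abc by (intro abs_mult_le) auto
  have e2: "\<bar>((F c - F b) - (f c - f b)) * (1 / (c - b))\<bar> \<le> 2 * L * \<epsilon> * (1 / (c - b))"
    using Fbd[of c] Fbd[of b] abc by (intro abs_mult_le) auto
  have "(f a - f b) / (b - a) - (f b - f c) / (c - b)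
      = ((F a - F b) * (1 / (b - a)) + (F c - F b) * (1 / (c - b)))
        - ((F a - F b) - (f a - f b)) * (1 / (b - a)) - ((F c - F b) - (f c - f b)) * (1 / (c - b))"
    by (simp add: divide_inverse algebra_simps)
  then have "\<bar>(f a - f b) / (b - a) - (f b - f c) / (c - b)\<bar>
      \<le> C * (c - a + 2 * \<epsilon>) + 2 * L * \<epsilon> * (1 / (b - a)) + 2 * L * \<epsilon> * (1 / (c - b))"
    using main e1 e2 by linarith
  also have "\<dots> = C * (c - a) + \<epsilon> * (2 * C + 2 * L / (b - a) + 2 * L / (c - b))"
    by (simp add: algebra_simps)
  also have "\<dots> \<le> C * (c - a) + \<epsilon> * ?M" using \<epsilon> by simp
  also have "\<epsilon> * ?M = e" using M by (simp add: \<epsilon>_def)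
  finally show "\<bar>(f a - f b) / (b - a) - (f b - f c) / (c - b)\<bar> \<le> C * (c - a) + e" .
qed

text \<open>Slopes from a common point x differ by at most \<open>C\<close> times the sum of the
  distances of their end points to x, so they have a limit at x. The derivatives at x and at y are
  both compared with the slope between x and y, hence the factor 2.\<close>

lemma differentiable_from_slopes:
  fixes f :: "real \<Rightarrow> real"
  assumes sl: "\<And>a b c. a < b \<Longrightarrow> b < c \<Longrightarrow> \<bar>(f a - f b) / (b - a) - (f b - f c) / (c - b)\<bar> \<le> C * (c - a)"
  shows "\<exists>f'. (\<forall>x. (f has_real_derivative f' x) (at x)) \<and> (\<forall>x y. \<bar>f' x - f' y\<bar> \<le> 2 * C * \<bar>x - y\<bar>)"
proof -
  define S where "S u v = (f v - f u) / (v - u)" for u v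
  have sym: "S u v = S v u" for u v
    unfolding S_def by (metis minus_diff_eq minus_divide_divide)
  have C: "0 \<le> C" using order_trans[OF abs_ge_zero sl[of 0 1 2]] by simp
  have three: "\<bar>S a b - S a c\<bar> \<le> C * (c - a)" "\<bar>S b c - S a c\<bar> \<le> C * (c - a)" "\<bar>S a b - S b c\<bar> \<le> C * (c - a)"
    if abc: "a < b" "b < c" for a b c
  proof -
    have "S a b - S b c = - ((f a - f b) / (b - a) - (f b - f c) / (c - b))"
      by (simp add: S_def diff_divide_distrib)
    then show 1: "\<bar>S a b - S b c\<bar> \<le> C * (c - a)" using sl[OF abc] by simp
    \<comment> \<open>The slope over the long interval is the convex combination of the other two,
      weighted by the lengths.\<close>
    have "S a c * (c - a) = S a b * (b - a) + S b c * (c - b)" using abc by (simp add: S_def)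
    then have "S a b - S a c = (c - b) / (c - a) * (S a b - S b c)" "S b c - S a c = (b - a) / (c - a) * (S b c - S a b)"
      using abc by (simp_all add: field_simps)
    moreover have "\<bar>(c - b) / (c - a)\<bar> \<le> 1" "\<bar>(b - a) / (c - a)\<bar> \<le> 1" using abc by auto
    ultimately show "\<bar>S a b - S a c\<bar> \<le> C * (c - a)" "\<bar>S b c - S a c\<bar> \<le> C * (c - a)"
      using abs_mult_le[of "(c - b) / (c - a)" 1 "S a b - S b c"] abs_mult_le[of "(b - a) / (c - a)" 1 "S b c - S a b"] 1
      by (simp_all add: abs_minus_commute)
  qed
  have two: "\<bar>S x u - S x v\<bar> \<le> C * (\<bar>u - x\<bar> + \<bar>v - x\<bar>)" if uv: "u < v" "u \<noteq> x" "v \<noteq> x" for x u v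
  proof -
    consider "v < x" | "u < x" "x < v" | "x < u" using uv by linarith
    then show ?thesis
    proof cases
      case 1
      have "\<bar>S x u - S x v\<bar> \<le> C * (x - u)"
        using three(2)[OF \<open>u < v\<close> 1] by (simp add: sym[of x] abs_minus_commute)
      also have "\<dots> \<le> C * (\<bar>u - x\<bar> + \<bar>v - x\<bar>)" using C by (intro mult_left_mono) auto
      finally show ?thesis .
    next
      case 2
      have "\<bar>S x u - S x v\<bar> \<le> C * (v - u)"
        using three(3)[OF 2] by (simp add: sym[of x u])
      also have "\<dots> \<le> C * (\<bar>u - x\<bar> + \<bar>v - x\<bar>)" using C by (intro mult_left_mono) auto
      finally show ?thesis .
    next
      case 3
      have "\<bar>S x u - S x v\<bar> \<le> C * (v - x)" using three(1)[OF 3 \<open>u < v\<close>] .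
      also have "\<dots> \<le> C * (\<bar>u - x\<bar> + \<bar>v - x\<bar>)" using C by (intro mult_left_mono) auto
      finally show ?thesis .
    qed
  qed
  have slope: "\<bar>S x u - S x v\<bar> \<le> C * (\<bar>u - x\<bar> + \<bar>v - x\<bar>)" if "u \<noteq> x" "v \<noteq> x" for x u v
    using two[of u v x] two[of v u x] that C by (cases u v rule: linorder_cases) (auto simp: abs_minus_commute add.commute)
  have "\<exists>l. \<forall>y. y \<noteq> x \<longrightarrow> \<bar>S x y - l\<bar> \<le> C * \<bar>y - x\<bar>" for x
  proof -
    define q where "q n = S x (x + inverse (real (Suc n)))" for n
    have qq: "\<bar>q m - q n\<bar> \<le> C * (inverse (real (Suc m)) + inverse (real (Suc n)))" for m n
      using slope[of "x + inverse (real (Suc m))" x "x + inverse (real (Suc n))"] by (simp add: q_def)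
    have "Cauchy q"
    proof (rule metric_CauchyI)
      fix e :: real assume e: "0 < e"
      obtain M where M: "inverse (real (Suc M)) < e / (2 * C + 1)"
        using reals_Archimedean[of "e / (2 * C + 1)"] e C by auto
      have "dist (q m) (q n) < e" if "M \<le> m" "M \<le> n" for m n
      proof -
        have "inverse (real (Suc m)) \<le> inverse (real (Suc M))" "inverse (real (Suc n)) \<le> inverse (real (Suc M))"
          using that by (auto intro!: le_imp_inverse_le)
        then have "inverse (real (Suc m)) + inverse (real (Suc n)) \<le> 2 * inverse (real (Suc M))" by linarith
        then have "C * (inverse (real (Suc m)) + inverse (real (Suc n))) \<le> C * (2 * inverse (real (Suc M)))"
          using C by (rule mult_left_mono)
        also have "\<dots> < (2 * C + 1) * inverse (real (Suc M))" by (simp add: algebra_simps)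
        also have "\<dots> \<le> (2 * C + 1) * (e / (2 * C + 1))" using M C by (intro mult_left_mono) auto
        also have "\<dots> = e" using C by simp
        finally show ?thesis using qq[of m n] by (simp add: dist_real_def)
      qed
      then show "\<exists>M. \<forall>m\<ge>M. \<forall>n\<ge>M. dist (q m) (q n) < e" by blast
    qed
    then obtain l where l: "q \<longlonglongrightarrow> l" using Cauchy_convergent convergent_def by blast
    have "\<bar>S x y - l\<bar> \<le> C * \<bar>y - x\<bar>" if y: "y \<noteq> x" for y
    proof (rule LIMSEQ_le)
      show "(\<lambda>n. \<bar>S x y - q n\<bar>) \<longlonglongrightarrow> \<bar>S x y - l\<bar>" by (intro tendsto_intros l)
      have "(\<lambda>n. C * (\<bar>y - x\<bar> + inverse (real (Suc n)))) \<longlonglongrightarrow> C * (\<bar>y - x\<bar> + 0)"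
        by (intro tendsto_intros LIMSEQ_inverse_real_of_nat)
      then show "(\<lambda>n. C * (\<bar>y - x\<bar> + inverse (real (Suc n)))) \<longlonglongrightarrow> C * \<bar>y - x\<bar>" by simp
      show "\<exists>N. \<forall>n\<ge>N. \<bar>S x y - q n\<bar> \<le> C * (\<bar>y - x\<bar> + inverse (real (Suc n)))"
        using slope[of y x "x + inverse (real (Suc _))"] y by (auto simp: q_def)
    qed
    then show ?thesis by blast
  qed
  then obtain f' where f': "\<And>x y. y \<noteq> x \<Longrightarrow> \<bar>S x y - f' x\<bar> \<le> C * \<bar>y - x\<bar>" by metis
  have "(f has_real_derivative f' x) (at x)" for x
  proof (rule deriv_from_quadratic)
    fix y
    show "\<bar>f y - f x - f' x * (y - x)\<bar> \<le> C * (y - x)\<^sup>2"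
    proof (cases "y = x")
      case False
      then have "S x y * (y - x) = f y - f x" by (simp add: S_def)
      then have "f y - f x - f' x * (y - x) = (S x y - f' x) * (y - x)" by (simp add: left_diff_distrib)
      then show ?thesis
        using abs_mult_le[OF f'[OF False] order_refl, of "y - x"] by (simp add: power2_eq_square mult.assoc)
    qed simp
  qed
  moreover have "\<bar>f' x - f' y\<bar> \<le> 2 * C * \<bar>x - y\<bar>" for x y
  proof (cases "x = y")
    case False
    then have "\<bar>S x y - f' x\<bar> \<le> C * \<bar>x - y\<bar>" "\<bar>S x y - f' y\<bar> \<le> C * \<bar>x - y\<bar>"
      using f'[of y x] f'[of x y] by (auto simp: abs_minus_commute sym[of y])
    then show ?thesis by linarith
  qed simp
  ultimately show ?thesis by blast
qed

section \<open>Essential bounds on weak derivatives\<close>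

lemma Linf_norm_nonneg: "0 \<le> Linf_norm f"
proof (cases "(\<lambda>x. ereal \<bar>f x\<bar>) \<in> borel_measurable lborel")
  case True
  have "(0 :: ereal) = esssup lborel (\<lambda>x :: real. 0)" by (rule esssup_const[symmetric]) simp
  also have "\<dots> \<le> Linf_norm f" unfolding Linf_norm_def by (intro esssup_mono) auto
  finally show ?thesis .
\<comment> \<open>For a non-measurable function the essential supremum is \<infinity> by
  convention.\<close>
qed (simp add: Linf_norm_def esssup_non_measurable)

lemma Linf_norm_AE:
  assumes "Linf_norm f \<le> ereal C"
  shows "AE x in lborel. \<bar>f x\<bar> \<le> C"
proof -
  have "AE x in lborel. ereal \<bar>f x\<bar> \<le> Linf_norm f" unfolding Linf_norm_def by (rule esssup_AE)
  then show ?thesis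
  proof eventually_elim
    case (elim x)
    then have "ereal \<bar>f x\<bar> \<le> ereal C" using assms by (rule order_trans)
    then show ?case by simp
  qed
qed

text \<open>The Sobolev norm is a sum of nonnegative extended reals and dominates its term of order
  2, which is present for every \<open>k\<close>. The representative picked by
  \<open>weak_deriv\<close> is a weak derivative because one exists.\<close>

lemma weak_second_deriv_bound:
  assumes f: "f \<in> sobolev_inf (k + 2)" and C: "sobolev_inf_norm (k + 2) f \<le> ereal C"
  shows "is_weak_deriv 2 f (weak_deriv 2 f)" and "AE x in lborel. \<bar>weak_deriv 2 f x\<bar> \<le> C"
proof -
  have "\<exists>g\<in>Linf. is_weak_deriv 2 f g" using f unfolding sobolev_inf_def by simp
  then show "is_weak_deriv 2 f (weak_deriv 2 f)" unfolding weak_deriv_def by (metis someI_ex)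
  have "sobolev_inf_norm (k + 2) f = Linf_norm (weak_deriv 2 f) + (\<Sum>i\<in>{..k + 2} - {2}. Linf_norm (weak_deriv i f))"
    unfolding sobolev_inf_norm_def by (rule sum.remove) auto
  then have "Linf_norm (weak_deriv 2 f) \<le> sobolev_inf_norm (k + 2) f"
    by (simp add: ereal_le_add_self sum_nonneg Linf_norm_nonneg)
  then show "AE x in lborel. \<bar>weak_deriv 2 f x\<bar> \<le> C" using C by (intro Linf_norm_AE) (rule order_trans)
qed

section \<open>The Fourier distance of negative index\<close>

text \<open>Compared with 1 on [-1, 1] and with the power of exponent -2 lam of \<bar>\<xi>\<bar>
  outside, which is integrable at infinity exactly for lam > 1 / 2.\<close>

lemma integrable_fourier_weight:
  assumes lam: "1 / 2 < lam"
  shows "integrable lborel (\<lambda>\<xi> :: real. 1 / (1 + \<xi>\<^sup>2) powr lam)"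
proof -
  let ?h = "\<lambda>\<xi> :: real. \<xi> powr (- 2 * lam) * indicator {1..} \<xi>"
  have "(\<integral>\<^sup>+\<xi>. ennreal (\<xi> powr (- 2 * lam)) * indicator {1..} \<xi> \<partial>lborel)
      = ennreal (0 - 1 powr (1 - 2 * lam) / (1 - 2 * lam))"
  proof (rule nn_integral_FTC_atLeast[where F="\<lambda>x. x powr (1 - 2 * lam) / (1 - 2 * lam)"])
    show "((\<lambda>x. x powr (1 - 2 * lam) / (1 - 2 * lam)) has_real_derivative x powr (- 2 * lam)) (at x)" if "1 \<le> x" for x
      using DERIV_cdivide[OF has_real_derivative_powr[of x "1 - 2 * lam"], of "1 - 2 * lam"] that lam by simp
    have "((\<lambda>x :: real. x powr (1 - 2 * lam) / (1 - 2 * lam)) \<longlongrightarrow> 0 / (1 - 2 * lam)) at_top"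
      using lam by (intro tendsto_divide tendsto_neg_powr filterlim_ident tendsto_const) auto
    then show "((\<lambda>x :: real. x powr (1 - 2 * lam) / (1 - 2 * lam)) \<longlongrightarrow> 0) at_top" by simp
  qed auto
  moreover have "ennreal (?h \<xi>) = ennreal (\<xi> powr (- 2 * lam)) * indicator {1..} \<xi>" for \<xi>
    by (cases "\<xi> \<in> {1..}") auto
  ultimately have "(\<integral>\<^sup>+\<xi>. ennreal (?h \<xi>) \<partial>lborel) < \<infinity>"
    by (simp only: ennreal_less_top infinity_ennreal_def)
  then have h: "integrable lborel ?h"
    by (intro integrableI_nonneg) simp_all
  have "integrable lborel (\<lambda>\<xi>. ?h (0 + (- 1) * \<xi>))" by (rule lborel_integrable_real_affine[OF h]) simp
  then have h': "integrable lborel (\<lambda>\<xi>. ?h (- \<xi>))" by simp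
  have "integrable lborel (\<lambda>\<xi>. indicator {- 1..1 :: real} \<xi> + ?h \<xi> + ?h (- \<xi>))"
    by (intro Bochner_Integration.integrable_add h h' integrable_real_indicator) auto
  then show ?thesis
  proof (rule Bochner_Integration.integrable_bound)
    have big: "1 / (1 + \<xi>\<^sup>2) powr lam \<le> \<xi> powr (- 2 * lam)" if "1 \<le> \<xi>" for \<xi> :: real
    proof -
      have "\<xi> powr (2 * lam) = (\<xi>\<^sup>2) powr lam" using that by (simp add: powr_powr flip: powr_numeral)
      also have "\<dots> \<le> (1 + \<xi>\<^sup>2) powr lam" using lam by (intro powr_mono2) auto
      finally have "1 / (1 + \<xi>\<^sup>2) powr lam \<le> 1 / \<xi> powr (2 * lam)" 
        using that by (intro divide_left_mono mult_pos_pos) (auto simp: add_nonneg_eq_0_iff)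
      then show ?thesis by (simp add: powr_minus divide_inverse)
    qed
    have "1 / (1 + \<xi>\<^sup>2) powr lam \<le> indicator {- 1..1} \<xi> + ?h \<xi> + ?h (- \<xi>)" for \<xi> :: real
    proof (cases "\<bar>\<xi>\<bar> \<le> 1")
      case True
      have "1 \<le> (1 + \<xi>\<^sup>2) powr lam" using lam by (intro ge_one_powr_ge_zero) auto
      then have "1 / (1 + \<xi>\<^sup>2) powr lam \<le> 1" by (simp add: divide_le_eq)
      moreover have "0 \<le> ?h \<xi>" "0 \<le> ?h (- \<xi>)" by simp_all
      moreover have "indicator {- 1..1} \<xi> = (1 :: real)" using True by (auto simp: indicator_def)
      ultimately show ?thesis by linarith
    next
      case False
      then show ?thesis using big[of \<xi>] big[of "- \<xi>"] by (cases "0 \<le> \<xi>") (auto simp: indicator_def)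
    qed
    then show "AE \<xi> in lborel. norm (1 / (1 + \<xi>\<^sup>2) powr lam) \<le> norm (indicator {- 1..1} \<xi> + ?h \<xi> + ?h (- \<xi>))"
      by (intro AE_I2) (metis abs_ge_self abs_of_nonneg divide_nonneg_nonneg order_trans powr_ge_zero real_norm_def zero_le_one)
  qed measurable
qed

text \<open>Characteristic functions differ by at most 2 and by at most 2 \<bar>\<xi>\<bar> w. The
  second bound alone is square integrable against the weight only for lam > 3 / 2; the minimum works
  for all lam > 1 / 2, without a linear rate in w in general.\<close>

definition fourier_modulus :: "real \<Rightarrow> real \<Rightarrow> real" where
  "fourier_modulus lam w = sqrt (\<integral>\<xi>. min 4 (4 * \<xi>\<^sup>2 * w\<^sup>2) / (1 + \<xi>\<^sup>2) powr lam \<partial>lborel)"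

text \<open>Real and imaginary part are integrals of functions with Lipschitz constant
  \<bar>\<xi>\<bar>; adding the two gives the factor 2 of the second bound.\<close>

lemma char_diff_le:
  assumes \<mu>: "\<mu> \<in> P2" and \<nu>: "\<nu> \<in> P2" and w: "kr_le \<mu> \<nu> w"
  shows "cmod (char \<mu> \<xi> - char \<nu> \<xi>) \<le> 2" and "cmod (char \<mu> \<xi> - char \<nu> \<xi>) \<le> 2 * \<bar>\<xi>\<bar> * w"
proof -
  have rd: "real_distribution \<rho>" if "\<rho> \<in> P2" for \<rho>
    using that P2_prob_space P2_sets by (simp add: real_distribution_def real_distribution_axioms_def)
  show "cmod (char \<mu> \<xi> - char \<nu> \<xi>) \<le> 2"
    using norm_triangle_ineq4[of "char \<mu> \<xi>" "char \<nu> \<xi>"]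
      real_distribution.cmod_char_le_1[OF rd[OF \<mu>], of \<xi>] real_distribution.cmod_char_le_1[OF rd[OF \<nu>], of \<xi>] by linarith
  have int: "integrable \<rho> (\<lambda>x. iexp (\<xi> * x))" if "\<rho> \<in> P2" for \<rho>
  proof -
    interpret real_distribution \<rho> by (rule rd[OF that])
    show ?thesis by (intro integrable_const_bound[where B=1]) auto
  qed
  have re: "Re (char \<rho> \<xi>) = (\<integral>x. cos (\<xi> * x) \<partial>\<rho>)" "Im (char \<rho> \<xi>) = (\<integral>x. sin (\<xi> * x) \<partial>\<rho>)" if "\<rho> \<in> P2" for \<rho>
    unfolding char_def using integral_Re[OF int[OF that]] integral_Im[OF int[OF that]] by (simp_all add: Re_exp Im_exp)
  have "\<bar>cos (\<xi> * x) - cos (\<xi> * y)\<bar> \<le> \<bar>\<xi>\<bar> * \<bar>x - y\<bar>" "\<bar>sin (\<xi> * x) - sin (\<xi> * y)\<bar> \<le> \<bar>\<xi>\<bar> * \<bar>x - y\<bar>" for x y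
    by (rule lipschitz_from_deriv[where f="\<lambda>x. cos (\<xi> * x)" and f'="\<lambda>x. - sin (\<xi> * x) * \<xi>"]
        lipschitz_from_deriv[where f="\<lambda>x. sin (\<xi> * x)" and f'="\<lambda>x. cos (\<xi> * x) * \<xi>"];
      auto intro!: derivative_eq_intros simp: abs_mult mult_left_le_one_le)+
  from kr_leD[OF w \<mu> \<nu> this(1)] kr_leD[OF w \<mu> \<nu> this(2)] cmod_le[of "char \<mu> \<xi> - char \<nu> \<xi>"]
  show "cmod (char \<mu> \<xi> - char \<nu> \<xi>) \<le> 2 * \<bar>\<xi>\<bar> * w" by (simp add: re \<mu> \<nu>)
qed

lemma fourier_integrand_measurable:
  "(\<lambda>\<xi> :: real. min 4 (4 * \<xi>\<^sup>2 * w\<^sup>2) / (1 + \<xi>\<^sup>2) powr lam) \<in> borel_measurable lborel"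
  by measurable

lemma fourier_integrand_le:
  "\<bar>min 4 (4 * \<xi>\<^sup>2 * w\<^sup>2) / (1 + (\<xi> :: real)\<^sup>2) powr lam\<bar> \<le> 4 * (1 / (1 + \<xi>\<^sup>2) powr lam)"
  by (simp add: abs_divide divide_right_mono)

lemma fourier_dist_le_modulus:
  assumes lam: "1 / 2 < lam" and \<mu>: "\<mu> \<in> P2" and \<nu>: "\<nu> \<in> P2" and w: "kr_le \<mu> \<nu> w"
  shows "fourier_dist lam \<mu> \<nu> \<le> fourier_modulus lam w"
  unfolding fourier_dist_def fourier_modulus_def
proof (intro real_sqrt_le_mono integral_mono')
  show "integrable lborel (\<lambda>\<xi>. min 4 (4 * \<xi>\<^sup>2 * w\<^sup>2) / (1 + \<xi>\<^sup>2) powr lam)"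
    by (rule Bochner_Integration.integrable_bound[OF integrable_mult_right[OF integrable_fourier_weight[OF lam], of 4]])
      (use fourier_integrand_measurable fourier_integrand_le in \<open>auto intro: order_trans[OF _ abs_ge_self]\<close>)
  fix \<xi> :: real
  let ?c = "cmod (char \<mu> \<xi> - char \<nu> \<xi>)"
  have "(cmod (fourier_transform_diff \<mu> \<nu> \<xi>))\<^sup>2 = ?c\<^sup>2 / (2 * pi)"
    by (simp add: fourier_transform_diff_def norm_divide power_divide)
  also have "\<dots> \<le> ?c\<^sup>2" 
    using pi_ge_two mult_left_mono[of 1 "2 * pi" "?c\<^sup>2"] by (simp add: divide_le_eq)
  also have "\<dots> \<le> min 4 (4 * \<xi>\<^sup>2 * w\<^sup>2)"
  proof (rule min.boundedI)
    show "?c\<^sup>2 \<le> 4" using power_mono[OF char_diff_le(1)[OF \<mu> \<nu> w, of \<xi>], of 2] by simp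
    show "?c\<^sup>2 \<le> 4 * \<xi>\<^sup>2 * w\<^sup>2"
      using power_mono[OF char_diff_le(2)[OF \<mu> \<nu> w, of \<xi>], of 2] by (simp add: power_mult_distrib)
  qed
  finally show "(cmod (fourier_transform_diff \<mu> \<nu> \<xi>))\<^sup>2 / (1 + \<xi>\<^sup>2) powr lam
      \<le> min 4 (4 * \<xi>\<^sup>2 * w\<^sup>2) / (1 + \<xi>\<^sup>2) powr lam"
    by (rule divide_right_mono) simp
qed simp

lemma fourier_modulus_0: "fourier_modulus lam 0 = 0"
  by (simp add: fourier_modulus_def)

lemma fourier_modulus_nonneg: "0 \<le> fourier_modulus lam w"
  by (simp add: fourier_modulus_def)

lemma fourier_modulus_isCont:
  assumes lam: "1 / 2 < lam"
  shows "isCont (fourier_modulus lam) 0"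
  unfolding continuous_at_sequentially comp_def
proof safe
  fix X :: "nat \<Rightarrow> real" assume X: "X \<longlonglongrightarrow> 0"
  have "(\<lambda>n. \<integral>\<xi>. min 4 (4 * \<xi>\<^sup>2 * (X n)\<^sup>2) / (1 + \<xi>\<^sup>2) powr lam \<partial>lborel) \<longlonglongrightarrow> integral\<^sup>L lborel (\<lambda>\<xi> :: real. 0)"
  proof (rule integral_dominated_convergence[where w="\<lambda>\<xi> :: real. 4 * (1 / (1 + \<xi>\<^sup>2) powr lam)"])
    show "AE \<xi> in lborel. (\<lambda>n. min 4 (4 * \<xi>\<^sup>2 * (X n)\<^sup>2) / (1 + \<xi>\<^sup>2) powr lam) \<longlonglongrightarrow> 0"
    proof (rule AE_I2)
      fix \<xi> :: real
      have "(\<lambda>n. min 4 (4 * \<xi>\<^sup>2 * (X n)\<^sup>2) / (1 + \<xi>\<^sup>2) powr lam) \<longlonglongrightarrow> min 4 (4 * \<xi>\<^sup>2 * 0\<^sup>2) / (1 + \<xi>\<^sup>2) powr lam"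
        by (intro tendsto_intros X) (simp add: add_nonneg_eq_0_iff)
      then show "(\<lambda>n. min 4 (4 * \<xi>\<^sup>2 * (X n)\<^sup>2) / (1 + \<xi>\<^sup>2) powr lam) \<longlonglongrightarrow> 0" by simp
    qed
    show "integrable lborel (\<lambda>\<xi> :: real. 4 * (1 / (1 + \<xi>\<^sup>2) powr lam))"
      by (intro integrable_mult_right integrable_fourier_weight lam)
  qed (use fourier_integrand_measurable fourier_integrand_le in auto)
  then have "(\<lambda>n. fourier_modulus lam (X n)) \<longlonglongrightarrow> sqrt 0"
    unfolding fourier_modulus_def by (intro tendsto_real_sqrt) simp
  then show "(\<lambda>n. fourier_modulus lam (X n)) \<longlonglongrightarrow> fourier_modulus lam 0" by (simp add: fourier_modulus_0)
qed

section \<open>Coefficients satisfying the regularity assumption\<close>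

lemma unit_interval_integral_le:
  fixes G :: "real \<Rightarrow> real"
  assumes "\<And>s. s \<in> {0..1} \<Longrightarrow> \<bar>G s\<bar> \<le> c"
  shows "\<bar>LINT s:{0..1}|lborel. G s\<bar> \<le> c"
proof -
  have c: "0 \<le> c" using assms[of 0] by simp
  have "\<bar>LINT s:{0..1}|lborel. G s\<bar> \<le> (\<integral>s. \<bar>indicator {0..1} s *\<^sub>R G s\<bar> \<partial>lborel)"
    unfolding set_lebesgue_integral_def by (rule integral_abs_bound)
  also have "\<dots> \<le> (\<integral>s. indicator {0..1 :: real} s * c \<partial>lborel)"
  proof (rule integral_mono')
    show "integrable lborel (\<lambda>s. indicator {0..1 :: real} s * c)"
      by (intro integrable_mult_left integrable_real_indicator) simp_all
    show "\<bar>indicator {0..1} s *\<^sub>R G s\<bar> \<le> indicator {0..1} s * c" for s :: real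
      using assms[of s] by (cases "s \<in> {0..1}") auto
    show "0 \<le> indicator {0..1} s * c" for s :: real using c by simp
  qed
  also have "\<dots> = c" by simp
  finally show ?thesis .
qed

text \<open>At every point of the segment the two measures are tested on a function with Lipschitz
  constant \<open>B\<close>. This is the source of the linear rate in w for the coefficient.\<close>

lemma lipschitz_from_linear_deriv:
  assumes lin: "is_linear_deriv u d"
    and D: "\<And>\<mu> y. \<mu> \<in> P2 \<Longrightarrow> (d \<mu> has_real_derivative D \<mu> y) (at y)"
    and bd: "\<And>\<mu> y. \<mu> \<in> P2 \<Longrightarrow> \<bar>D \<mu> y\<bar> \<le> B"
    and m: "\<mu> \<in> P2" "\<nu> \<in> P2" and w: "kr_le \<mu> \<nu> w"
  shows "\<bar>u \<mu> - u \<nu>\<bar> \<le> B * w"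
proof -
  have "u \<mu> - u \<nu> = (LINT s:{0..1}|lborel. (\<integral>y. d (mixture s \<mu> \<nu>) y \<partial>\<mu>) - (\<integral>y. d (mixture s \<mu> \<nu>) y \<partial>\<nu>))"
    using lin m unfolding is_linear_deriv_def by blast
  moreover have "\<bar>(\<integral>y. d (mixture s \<mu> \<nu>) y \<partial>\<mu>) - (\<integral>y. d (mixture s \<mu> \<nu>) y \<partial>\<nu>)\<bar> \<le> B * w"
    if "s \<in> {0..1}" for s
  proof (rule kr_leD[OF w m])
    have "mixture s \<mu> \<nu> \<in> P2" using that m by (intro mixture_P2) auto
    from lipschitz_from_deriv[OF D[OF this] bd[OF this]]
    show "\<bar>d (mixture s \<mu> \<nu>) x - d (mixture s \<mu> \<nu>) y\<bar> \<le> B * \<bar>x - y\<bar>" for x y .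
  qed
  ultimately show ?thesis by (simp only: unit_interval_integral_le)
qed

text \<open>The linear derivative along the segment is compared with the one at the end
  \<open>\<mu>\<close>: the difference has Lipschitz constant \<open>\<eta>\<close> in y, and
  testing it against the difference of the two measures contributes the factor w.\<close>

lemma linear_deriv_expansion:
  assumes lin: "is_linear_deriv u d"
    and D: "\<And>\<mu> y. \<mu> \<in> P2 \<Longrightarrow> (d \<mu> has_real_derivative D \<mu> y) (at y)"
    and bd: "\<And>\<mu> y. \<mu> \<in> P2 \<Longrightarrow> \<bar>D \<mu> y\<bar> \<le> B"
    and modl: "\<And>\<mu> \<nu> y w. \<mu> \<in> P2 \<Longrightarrow> \<nu> \<in> P2 \<Longrightarrow> kr_le \<mu> \<nu> w \<Longrightarrow> \<bar>D \<mu> y - D \<nu> y\<bar> \<le> \<eta> w"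
    and \<eta>: "isCont \<eta> 0" "\<eta> 0 = 0"
    and m: "\<nu> \<in> P2" "\<mu> \<in> P2" and w: "kr_le \<nu> \<mu> w"
  shows "\<bar>u \<nu> - u \<mu> - ((\<integral>y. d \<mu> y \<partial>\<nu>) - (\<integral>y. d \<mu> y \<partial>\<mu>))\<bar> \<le> \<eta> w * w"
proof -
  define I where "I \<rho> = (\<integral>y. d \<rho> y \<partial>\<nu>) - (\<integral>y. d \<rho> y \<partial>\<mu>)" for \<rho>
  have I: "\<bar>I \<rho> - I \<rho>'\<bar> \<le> \<eta> v * w" if r: "\<rho> \<in> P2" "\<rho>' \<in> P2" "kr_le \<rho> \<rho>' v" for \<rho> \<rho>' v
  proof -
    have int: "integrable \<kappa> (d \<tau>)" if "\<kappa> \<in> P2" "\<tau> \<in> P2" for \<kappa> \<tau>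
      by (rule integrable_lipschitz[OF that(1) lipschitz_from_deriv[OF D[OF that(2)] bd[OF that(2)]]])
    have "\<bar>(\<integral>y. d \<rho> y - d \<rho>' y \<partial>\<nu>) - (\<integral>y. d \<rho> y - d \<rho>' y \<partial>\<mu>)\<bar> \<le> \<eta> v * w"
      using DERIV_diff[OF D[OF r(1)] D[OF r(2)]] modl[OF r]
      by (intro kr_leD[OF w m] lipschitz_from_deriv) auto
    moreover have "(\<integral>y. d \<rho> y - d \<rho>' y \<partial>\<kappa>) = (\<integral>y. d \<rho> y \<partial>\<kappa>) - (\<integral>y. d \<rho>' y \<partial>\<kappa>)" if "\<kappa> \<in> P2" for \<kappa>
      by (intro Bochner_Integration.integral_diff int that r)
    ultimately show ?thesis unfolding I_def using m by (simp add: algebra_simps)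
  qed
  define G where "G s = I (mixture s \<nu> \<mu>)" for s
  have G: "\<bar>G s - G t\<bar> \<le> \<eta> (\<bar>s - t\<bar> * w) * w" if "s \<in> {0..1}" "t \<in> {0..1}" for s t
    unfolding G_def using that m by (intro I mixture_P2 kr_le_mixture w) auto
  \<comment> \<open>Gives integrability, so that the integral of \<open>G s - I \<mu>\<close> may be
    split.\<close>
  have "continuous_on {0..1} G"
    unfolding continuous_on_def
  proof
    fix t :: real assume t: "t \<in> {0..1}"
    have "((\<lambda>s. \<bar>s - t\<bar> * w) \<longlongrightarrow> \<bar>t - t\<bar> * w) (at t within {0..1})" by (intro tendsto_intros)
    then have "((\<lambda>s. \<eta> (\<bar>s - t\<bar> * w)) \<longlongrightarrow> \<eta> 0) (at t within {0..1})"
      by (intro isCont_tendsto_compose[OF \<eta>(1)]) simp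
    then have "((\<lambda>s. \<eta> (\<bar>s - t\<bar> * w) * w) \<longlongrightarrow> \<eta> 0 * w) (at t within {0..1})"
      by (intro tendsto_mult tendsto_const)
    then have "((\<lambda>s. \<eta> (\<bar>s - t\<bar> * w) * w) \<longlongrightarrow> 0) (at t within {0..1})" by (simp only: \<eta>(2) mult_zero_left)
    moreover have "\<forall>\<^sub>F s in at t within {0..1}. norm (G s - G t) \<le> \<eta> (\<bar>s - t\<bar> * w) * w"
      unfolding eventually_at_filter using G t by (intro always_eventually) (simp only: real_norm_def, blast)
    ultimately have "((\<lambda>s. G s - G t) \<longlongrightarrow> 0) (at t within {0..1})" by (rule Lim_null_comparison[rotated])
    then show "(G \<longlongrightarrow> G t) (at t within {0..1})" by (simp add: LIM_zero_iff)
  qed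
  then have int: "set_integrable lborel {0..1} G" by (rule borel_integrable_atLeastAtMost')
  have "u \<nu> - u \<mu> = (LINT s:{0..1}|lborel. G s)"
    using lin m unfolding is_linear_deriv_def G_def I_def by blast
  moreover have "(LINT s:{0..1}|lborel. G s - I \<mu>) = (LINT s:{0..1}|lborel. G s) - (LINT s:{0..1::real}|lborel. I \<mu>)"
    by (rule set_integral_diff(2)[OF int borel_integrable_atLeastAtMost']) simp
  moreover have "(LINT s:{0..1::real}|lborel. I \<mu>) = I \<mu>" by (simp add: set_lebesgue_integral_def)
  moreover have "\<bar>LINT s:{0..1}|lborel. G s - I \<mu>\<bar> \<le> \<eta> w * w"
  proof (rule unit_interval_integral_le)
    fix s :: real assume s: "s \<in> {0..1}"
    have "kr_le (mixture s \<nu> \<mu>) (mixture 0 \<nu> \<mu>) (\<bar>s - 0\<bar> * w)" using s by (intro kr_le_mixture m w) auto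
    then have "kr_le (mixture s \<nu> \<mu>) \<mu> (s * w)" using s m by (simp add: mixture_0)
    then have "kr_le (mixture s \<nu> \<mu>) \<mu> w"
      by (rule kr_le_mono) (use s kr_le_nonneg[OF w] in \<open>auto intro: mult_left_le_one_le\<close>)
    then show "\<bar>G s - I \<mu>\<bar> \<le> \<eta> w * w" unfolding G_def using s m by (intro I mixture_P2) auto
  qed
  ultimately show ?thesis unfolding I_def by simp
qed

text \<open>Interpolation of Landau-Kolmogorov type: a Taylor step of length h bounds the derivative
  by \<open>2 * M * w / h + C * h\<close>, and the two terms are balanced by taking h as the square
  root of w.\<close>

lemma deriv_interpolation:
  fixes p p' :: "real \<Rightarrow> real"
  assumes p: "\<And>x. (p has_real_derivative p' x) (at x)"
    and lip: "\<And>x y. \<bar>p' x - p' y\<bar> \<le> C * \<bar>x - y\<bar>"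
    and bd: "\<And>x. \<bar>p x\<bar> \<le> M * w" and w: "0 \<le> w"
  shows "\<bar>p' x\<bar> \<le> (2 * M + C) * sqrt w"
proof (cases "w = 0")
  case True
  then have "p = (\<lambda>x. 0)" using bd by fastforce
  then have "p' x = 0" using DERIV_unique[OF p[of x], of 0] by simp
  then show ?thesis using True by simp
next
  case False
  define h where "h = sqrt w"
  have h: "0 < h" "w = h * h" using False w by (auto simp: h_def)
  have "\<bar>p (x + h) - p x - p' x * h\<bar> \<le> C * (h * h)"
    using taylor_lipschitz_deriv[OF p lip, of "x + h" x] by (simp add: power2_eq_square)
  moreover have "\<bar>p (x + h)\<bar> \<le> M * (h * h)" "\<bar>p x\<bar> \<le> M * (h * h)" using bd h by auto
  ultimately have "\<bar>p' x * h\<bar> \<le> 2 * (M * (h * h)) + C * (h * h)" by linarith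
  then have "\<bar>p' x\<bar> * h \<le> ((2 * M + C) * h) * h" using h by (simp add: abs_mult algebra_simps)
  from mult_right_le_imp_le[OF this h(1)] show ?thesis unfolding h_def .
qed

lemma fourier_dist_self: "fourier_dist lam \<mu> \<mu> = 0"
  by (simp add: fourier_dist_def fourier_transform_diff_def)

section \<open>Verification of the abstract hypotheses\<close>

lemma assumption_R_coefficient:
  assumes lam: "1 / 2 < lam" and R: "assumption_R lam k \<sigma>"
  obtains a D \<delta> K \<omega> where "mean_field_coefficient \<sigma> a D \<delta> K \<omega>"
proof -
  from R obtain D E where Lions: "\<And>x. is_Lions_deriv (\<sigma> x) (D x)"
    and Ra: "assumption_R_a lam \<sigma> D E" and Rb: "assumption_R_b k \<sigma> D E"
    unfolding assumption_R_def by blast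
  from Lions obtain d where lin: "\<And>x. is_linear_deriv (\<sigma> x) (d x)"
    and d: "\<And>x \<mu> y. \<mu> \<in> P2 \<Longrightarrow> (d x \<mu> has_real_derivative D x \<mu> y) (at y)"
    unfolding is_Lions_deriv_def by metis
  note Ra = Ra[unfolded assumption_R_a_def]
  obtain B1 where B1: "\<And>x \<mu>. \<mu> \<in> P2 \<Longrightarrow> \<bar>\<sigma> x \<mu>\<bar> \<le> B1" using conjunct1[OF Ra] by blast
  obtain B2 where B2: "\<And>x \<mu> y. \<mu> \<in> P2 \<Longrightarrow> \<bar>D x \<mu> y\<bar> \<le> B2" using conjunct1[OF conjunct2[OF Ra]] by blast
  from Ra obtain L where L: "0 < L" and RL: "\<forall>x1 x2 y1 y2. \<forall>\<mu>\<in>P2. \<forall>\<nu>\<in>P2.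
        \<bar>\<sigma> x1 \<mu> - \<sigma> x2 \<nu>\<bar> \<le> L * \<bar>x1 - x2\<bar> + L * fourier_dist lam \<mu> \<nu> \<and>
        \<bar>D x1 \<mu> y1 - D x2 \<nu> y2\<bar>
          \<le> L * \<bar>x1 - x2\<bar> + L * \<bar>y1 - y2\<bar> + L * fourier_dist lam \<mu> \<nu> \<and>
        \<bar>E x1 \<mu> y1 - E x2 \<nu> y2\<bar>
          \<le> L * \<bar>x1 - x2\<bar> + L * \<bar>y1 - y2\<bar> + L * fourier_dist lam \<mu> \<nu>"
    by (elim conjE exE) (rule that)
  have \<sigma>L: "\<bar>\<sigma> x1 \<mu> - \<sigma> x2 \<nu>\<bar> \<le> L * \<bar>x1 - x2\<bar> + L * fourier_dist lam \<mu> \<nu>"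
    if "\<mu> \<in> P2" "\<nu> \<in> P2" for x1 x2 \<mu> \<nu>
    by (rule RL[rule_format, THEN conjunct1, OF that])
  have DL: "\<bar>D x1 \<mu> y1 - D x2 \<nu> y2\<bar> \<le> L * \<bar>x1 - x2\<bar> + L * \<bar>y1 - y2\<bar> + L * fourier_dist lam \<mu> \<nu>"
    if "\<mu> \<in> P2" "\<nu> \<in> P2" for x1 x2 y1 y2 \<mu> \<nu>
    by (rule RL[rule_format, THEN conjunct2, THEN conjunct1, OF that])
  obtain C0 where C0: "\<And>\<mu>. \<mu> \<in> P2 \<Longrightarrow> (\<lambda>x. \<sigma> x \<mu>) \<in> sobolev_inf (k + 2)"
      "\<And>\<mu>. \<mu> \<in> P2 \<Longrightarrow> sobolev_inf_norm (k + 2) (\<lambda>x. \<sigma> x \<mu>) \<le> ereal C0"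
    using Rb unfolding assumption_R_b_def by blast
  define C where "C = max 0 C0"
  \<comment> \<open>One constant above all others; in particular \<open>2 * B2 + 4 * C\<close> is at
    most \<open>4 * K\<close>, the factor in \<open>\<omega>\<close>.\<close>
  define K where "K = 1 + max 0 B1 + max 0 B2 + L + 2 * C"
  \<comment> \<open>The Fourier part serves \<open>D\<close> and the expansion of
    \<open>\<sigma>\<close>, the square root serves \<open>a\<close>. The absolute value keeps the
    modulus nonnegative at negative arguments, where \<open>sqrt\<close> is negative.\<close>
  define \<omega> where "\<omega> w = K * fourier_modulus lam w + 4 * K * sqrt \<bar>w\<bar>" for w
  have K: "1 \<le> K" "B1 \<le> K" "B2 \<le> K" "L \<le> K" "2 * C \<le> K" "2 * B2 + 4 * C \<le> 4 * K" and C: "0 \<le> C"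
    using L by (auto simp: K_def C_def)
  have fm: "L * fourier_modulus lam w \<le> K * fourier_modulus lam w" for w
    using K by (intro mult_right_mono fourier_modulus_nonneg) auto
  have \<omega>1: "L * fourier_modulus lam w \<le> \<omega> w" for w using fm[of w] K by (auto simp: \<omega>_def intro: add_increasing2)
  have \<omega>2: "4 * K * sqrt w \<le> \<omega> w" if "0 \<le> w" for w
    using K that by (simp add: \<omega>_def fourier_modulus_nonneg)
  have \<sigma>x: "\<bar>\<sigma> x \<mu> - \<sigma> y \<mu>\<bar> \<le> L * \<bar>x - y\<bar>" if "\<mu> \<in> P2" for x y \<mu>
    using \<sigma>L[OF that that, of x y] by (simp add: fourier_dist_self)
  have \<sigma>\<mu>: "\<bar>\<sigma> x \<mu> - \<sigma> x \<nu>\<bar> \<le> B2 * w" if "\<mu> \<in> P2" "\<nu> \<in> P2" "kr_le \<mu> \<nu> w" for x \<mu> \<nu> w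
    by (rule lipschitz_from_linear_deriv[OF lin d B2 that])
  define a where "a x \<mu> = deriv (\<lambda>x. \<sigma> x \<mu>) x" for x \<mu>
  have a: "((\<lambda>x. \<sigma> x \<mu>) has_real_derivative a x \<mu>) (at x)" "\<bar>a x \<mu> - a y \<mu>\<bar> \<le> 2 * C * \<bar>x - y\<bar>"
    if \<mu>: "\<mu> \<in> P2" for x y \<mu>
  proof -
    have "sobolev_inf_norm (k + 2) (\<lambda>x. \<sigma> x \<mu>) \<le> ereal C"
      by (rule order_trans[OF C0(2)[OF \<mu>]]) (simp add: C_def)
    note weak = weak_second_deriv_bound[OF C0(1)[OF \<mu>] this]
    obtain f' where f': "\<And>x. ((\<lambda>x. \<sigma> x \<mu>) has_real_derivative f' x) (at x)" "\<And>x y. \<bar>f' x - f' y\<bar> \<le> 2 * C * \<bar>x - y\<bar>"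
      using differentiable_from_slopes[OF weak_second_deriv_slopes[OF \<sigma>x[OF \<mu>] weak]] by blast
    moreover have "a x \<mu> = f' x" for x unfolding a_def by (rule DERIV_imp_deriv[OF f'(1)])
    ultimately show "((\<lambda>x. \<sigma> x \<mu>) has_real_derivative a x \<mu>) (at x)" "\<bar>a x \<mu> - a y \<mu>\<bar> \<le> 2 * C * \<bar>x - y\<bar>" by auto
  qed
  define \<delta> where "\<delta> x \<mu> y = d x \<mu> y - d x \<mu> 0" for x \<mu> y
  have "mean_field_coefficient \<sigma> a D \<delta> K \<omega>"
  proof
    show "1 \<le> K" by (rule K)
    show "isCont \<omega> 0" unfolding \<omega>_def by (intro continuous_intros fourier_modulus_isCont lam)
    show "\<omega> 0 = 0" by (simp add: \<omega>_def fourier_modulus_0)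
    show "0 \<le> \<omega> w" for w using K by (simp add: \<omega>_def fourier_modulus_nonneg)
    show "\<bar>\<sigma> x \<mu>\<bar> \<le> K" if "\<mu> \<in> P2" for x \<mu> using B1[OF that, of x] K by simp
    show "\<bar>D x \<mu> y\<bar> \<le> K" if "\<mu> \<in> P2" for x \<mu> y using B2[OF that, of x y] K by simp
    show "((\<lambda>x. \<sigma> x \<mu>) has_real_derivative a x \<mu>) (at x)" if "\<mu> \<in> P2" for x \<mu> by (rule a[OF that])
    show "(\<delta> x \<mu> has_real_derivative D x \<mu> y) (at y)" if "\<mu> \<in> P2" for x \<mu> y
      unfolding \<delta>_def[abs_def] using DERIV_diff[OF d[OF that] DERIV_const] by simp
    show "\<delta> x \<mu> 0 = 0" for x \<mu> by (simp add: \<delta>_def)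
    fix \<mu> \<nu> w assume m: "\<mu> \<in> P2" "\<nu> \<in> P2"
    {
      fix x y assume w: "kr_le \<mu> \<nu> w"
      note w0 = kr_le_nonneg[OF w]
      have "L * \<bar>x - y\<bar> \<le> K * \<bar>x - y\<bar>" "B2 * w \<le> K * w" using K w0 by (auto intro: mult_right_mono)
      then show "\<bar>\<sigma> x \<mu> - \<sigma> y \<nu>\<bar> \<le> K * \<bar>x - y\<bar> + K * w" using \<sigma>\<mu>[OF m w, of x] \<sigma>x[OF m(2), of x y] by linarith
      have "\<bar>a x \<mu> - a x \<nu>\<bar> \<le> (2 * B2 + 4 * C) * sqrt w"
      proof (rule deriv_interpolation[where p="\<lambda>x. \<sigma> x \<mu> - \<sigma> x \<nu>" and p'="\<lambda>x. a x \<mu> - a x \<nu>"])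
        show "((\<lambda>x. \<sigma> x \<mu> - \<sigma> x \<nu>) has_real_derivative a x \<mu> - a x \<nu>) (at x)" for x
          by (intro DERIV_diff a m)
        \<comment> \<open>Each of the two derivatives has Lipschitz constant
          \<open>2 * C\<close>.\<close>
        show "\<bar>a x \<mu> - a x \<nu> - (a y \<mu> - a y \<nu>)\<bar> \<le> 4 * C * \<bar>x - y\<bar>" for x y
          using a(2)[OF m(1), of x y] a(2)[OF m(2), of x y] by linarith
      qed (use \<sigma>\<mu>[OF m w] w0 in auto)
      also have "\<dots> \<le> 4 * K * sqrt w" using K w0 by (intro mult_right_mono) auto
      also have "\<dots> \<le> \<omega> w" by (rule \<omega>2[OF w0])
      finally have "\<bar>a x \<mu> - a x \<nu>\<bar> \<le> \<omega> w" .
      moreover have "2 * C * \<bar>x - y\<bar> \<le> K * \<bar>x - y\<bar>" using K by (intro mult_right_mono) auto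
      ultimately show "\<bar>a x \<mu> - a y \<nu>\<bar> \<le> K * \<bar>x - y\<bar> + \<omega> w" using a(2)[OF m(2), of x y] by linarith
    }
    note fd = fourier_dist_le_modulus[OF lam]
    have D\<omega>: "\<bar>D x \<mu> y - D x \<nu> y\<bar> \<le> L * fourier_modulus lam w" if "\<mu> \<in> P2" "\<nu> \<in> P2" "kr_le \<mu> \<nu> w" for x y \<mu> \<nu> w
      using DL[OF that(1,2), of x y x y] mult_left_mono[OF fd[OF that] less_imp_le[OF L]] by simp
    {
      fix x1 x2 y1 y2 assume w: "kr_le \<mu> \<nu> w"
      have "L * \<bar>x1 - x2\<bar> \<le> K * \<bar>x1 - x2\<bar>" "L * \<bar>y1 - y2\<bar> \<le> K * \<bar>y1 - y2\<bar>"
        using K by (auto intro: mult_right_mono)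
      moreover have "L * fourier_dist lam \<mu> \<nu> \<le> \<omega> w"
        by (rule order_trans[OF mult_left_mono[OF fd[OF m w]] \<omega>1]) (use L in simp)
      ultimately show "\<bar>D x1 \<mu> y1 - D x2 \<nu> y2\<bar> \<le> K * \<bar>x1 - x2\<bar> + K * \<bar>y1 - y2\<bar> + \<omega> w"
        using DL[OF m, of x1 y1 x2 y2] by linarith
    }
    fix x assume w: "kr_le \<nu> \<mu> w"
    have "\<bar>\<sigma> x \<nu> - \<sigma> x \<mu> - ((\<integral>y. d x \<mu> y \<partial>\<nu>) - (\<integral>y. d x \<mu> y \<partial>\<mu>))\<bar> \<le> (L * fourier_modulus lam w) * w"
      by (rule linear_deriv_expansion[OF lin d B2 D\<omega>])
        (auto intro!: continuous_intros fourier_modulus_isCont lam m w simp: fourier_modulus_0)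
    also have "\<dots> \<le> \<omega> w * w" by (intro mult_right_mono \<omega>1 kr_le_nonneg[OF w])
    finally have "\<bar>\<sigma> x \<nu> - \<sigma> x \<mu> - ((\<integral>y. d x \<mu> y \<partial>\<nu>) - (\<integral>y. d x \<mu> y \<partial>\<mu>))\<bar> \<le> \<omega> w * w" .
    \<comment> \<open>Normalising at 0 shifts both integrals by the same constant, as the measures
      have mass 1, so their difference in the expansion is unchanged.\<close>
    moreover have "(\<integral>y. \<delta> x \<mu> y \<partial>\<kappa>) = (\<integral>y. d x \<mu> y \<partial>\<kappa>) - d x \<mu> 0" if \<kappa>: "\<kappa> \<in> P2" for \<kappa>
    proof -
      interpret prob_space \<kappa> using \<kappa> by (rule P2_prob_space)
      have "integrable \<kappa> (d x \<mu>)"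
        by (rule integrable_lipschitz[OF \<kappa> lipschitz_from_deriv[OF d[OF m(1)] B2[OF m(1)]]])
      then show ?thesis unfolding \<delta>_def by (simp add: prob_space)
    qed
    ultimately show "\<bar>\<sigma> x \<nu> - \<sigma> x \<mu> - ((\<integral>y. \<delta> x \<mu> y \<partial>\<nu>) - (\<integral>y. \<delta> x \<mu> y \<partial>\<mu>))\<bar> \<le> \<omega> w * w"
      using m by simp
  qed
  then show thesis by (rule that)
qed

theorem proposition5p1:
  fixes lam :: real and k :: nat and \<sigma>0 :: "real \<Rightarrow> real measure \<Rightarrow> real"
  assumes "lam > 1 / 2"
    and "assumption_R lam k \<sigma>0"
  shows "\<exists>\<psi>. solves_transport \<sigma>0 \<psi> \<and> solves_flow \<sigma>0 \<psi> \<and>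
           (\<forall>\<phi>. solves_transport \<sigma>0 \<phi> \<longrightarrow> agree_P2 \<phi> \<psi>) \<and>
           (\<forall>\<phi>. solves_flow \<sigma>0 \<phi> \<longrightarrow> agree_P2 \<phi> \<psi>)"
proof -
  obtain a D \<delta> K \<omega> where "mean_field_coefficient \<sigma>0 a D \<delta> K \<omega>"
    using assumption_R_coefficient[OF assms] .
  then show ?thesis by (rule mean_field_coefficient.transport_and_flow_well_posed)
qed

end
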